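(* Let $w:\mathbb R^{2d}\to(0,\infty)$ be an admissible TF weight and let $\varphi\in M^1_w(\mathbb R^d)$ with $\|\varphi\|_2=1$. Let $\{\eta_\gamma:\gamma\in\Gamma\}$ be a well-spread family (relative to $w$) of non-negative symbols on $\mathbb R^{2d}$ with $\sum_\gamma\eta_\gamma\approx1$. Let $v$ be a $w$-moderated weight. Then there exist constants $0<c\le C<\infty$ such that for all sufficiently small $\varepsilon>0$ and all $p\in[1,\infty]$, $$c\|f\|_{M^p_v}\le\Big(\sum_\gamma\|H^\varepsilon_{\eta_\gamma}f\|_{L^2}^pv(\gamma)^p\Big)^{1/p}\le C\|f\|_{M^p_v},\qquad f\in M^p_v(\mathbb R^d),$$ with the usual modification for $p=\infty$. The choice of $\varepsilon$ and the constants are uniform over $1\le p\le\infty$ and over any family of weights $v$ having a uniform constant $C_v$.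
   Context: For $z=(x,\xi)$, $\pi(z)f(t)=e^{2\pi i\xi t}f(t-x)$, $V_\varphi f(z)=\langle f,\pi(z)\varphi\rangle$. For $m\in L^\infty(\mathbb R^{2d})$, $H_mf=V_\varphi^*(mV_\varphi f)=\int m(z)V_\varphi f(z)\pi(z)\varphi\,dz$. For non-negative $\eta_\gamma\in L^1\cap L^\infty$, $H_{\eta_\gamma}$ is positive and trace class on $L^2(\mathbb R^d)$, with diagonalization $H_{\eta_\gamma}f=\sum_{k\ge1}\lambda^\gamma_k\langle f,\phi^\gamma_k\rangle\phi^\gamma_k$, $\{\phi^\gamma_k\}$ orthonormal, $(\lambda^\gamma_k)_k$ non-increasing and non-negative; the thresholded operator is $H^\varepsilon_{\eta_\gamma}f=\sum_{k:\lambda^\gamma_k>\varepsilon}\lambda^\gamma_k\langle f,\phi^\gamma_k\rangle\phi^\gamma_k$. An admissible TF weight is a continuous even $w:\mathbb R^{2d}\to(0,\infty)$, submultiplicative, with $w(z)\le C(1+|z|)^N$ and $\lim_nw(nz)^{1/n}=1$. $v$ is $w$-moderated if $v(z+z')\le C_vw(z)v(z')$. $M^p_v(\mathbb R^d)$ is the space of $f\in M^\infty_{1/w}$ with $V_\varphi f\in L^p_v(\mathbb R^{2d})$, normed by $\|V_\varphi f\|_{L^p_v}$; $M^2=L^2$. $W(L^\infty,L^1_w)(\mathbb R^{2d})$: measurable $F$ with $z\mapsto\operatorname{ess\,sup}_{|y|\le1}|F(z+y)|$ in $L^1_w$. Symbols $\{\eta_\gamma:\gamma\in\Gamma\}$ are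 well-spread (relative to $w$) if $\sup_z\#(\Gamma\cap B_1(z))<\infty$ and $|\eta_\gamma(z)|\le g(z-\gamma)$ for some $g\in W(L^\infty,L^1_w)$. $\sum_\gamma\eta_\gamma\approx1$ means $A\le\sum_\gamma\eta_\gamma\le B$ for constants $0<A\le B$. *)

theory Defs
  imports "HOL-Analysis.Analysis" "HOL-Probability.Essential_Supremum"
begin

(* R^d is real^'d, time-frequency plane R^{2d} is real^'d \<times> real^'d, z = (x, xi). *)
type_synonym 'd tf = "(real^('d::finite)) \<times> (real^'d)"
type_synonym 'd fn = "real^('d::finite) \<Rightarrow> complex"

definition L2 :: "('d::finite) fn set" where
  "L2 = {f. f \<in> borel_measurable lebesgue \<and> integrable lebesgue (\<lambda>t. (cmod (f t))^2)}"

definition ip :: "('d::finite) fn \<Rightarrow> ('d::finite) fn \<Rightarrow> complex" where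
  "ip f g = (LINT t|lebesgue. f t * cnj (g t))"

definition L2norm :: "('d::finite) fn \<Rightarrow> real" where
  "L2norm f = sqrt (LINT t|lebesgue. (cmod (f t))^2)"

definition tfshift :: "('d::finite) tf \<Rightarrow> ('d::finite) fn \<Rightarrow> ('d::finite) fn" where
  "tfshift z f = (\<lambda>t. exp (\<i> * of_real (2 * pi * (snd z \<bullet> t))) * f (t - fst z))"

definition stft :: "('d::finite) fn \<Rightarrow> ('d::finite) fn \<Rightarrow> ('d::finite) tf \<Rightarrow> complex" where
  "stft phi f z = ip f (tfshift z phi)"

definition gauss :: "('d::finite) fn" where
  "gauss = (\<lambda>t. of_real (2 powr (real CARD('d) / 4) * exp (- pi * (norm t)^2)))"

definition admissible_weight :: "(('d::finite) tf \<Rightarrow> real) \<Rightarrow> bool" where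
  "admissible_weight w \<longleftrightarrow> continuous_on UNIV w \<and> (\<forall>z. w z > 0) \<and> (\<forall>z. w (- z) = w z)
     \<and> (\<forall>z z'. w (z + z') \<le> w z * w z')
     \<and> (\<exists>C N::nat. \<forall>z. w z \<le> C * (1 + norm z) ^ N)
     \<and> (\<forall>z. (\<lambda>n. w (real n *\<^sub>R z) powr (1 / real n)) \<longlonglongrightarrow> 1)"

definition moderated :: "(('d::finite) tf \<Rightarrow> real) \<Rightarrow> real \<Rightarrow> (('d::finite) tf \<Rightarrow> real) \<Rightarrow> bool" where
  "moderated w Cv v \<longleftrightarrow> v \<in> borel_measurable lborel \<and> (\<forall>z. v z > 0)
     \<and> (\<forall>z z'. v (z + z') \<le> Cv * w z * v z')"

definition M1 :: "(('d::finite) tf \<Rightarrow> real) \<Rightarrow> ('d::finite) fn set" where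
  "M1 w = {f \<in> L2. (\<lambda>z. stft gauss f z) \<in> borel_measurable lborel
       \<and> (\<integral>\<^sup>+ z. ennreal (cmod (stft gauss f z) * w z) \<partial>lborel) < \<infinity>}"

definition M1norm :: "(('d::finite) tf \<Rightarrow> real) \<Rightarrow> ('d::finite) fn \<Rightarrow> real" where
  "M1norm w f = enn2real (\<integral>\<^sup>+ z. ennreal (cmod (stft gauss f z) * w z) \<partial>lborel)"

text \<open>M^\<infinity>_{1/w}, realised as the space of bounded conjugate-linear functionals on M^1_w
  (f \<mapsto> <f, g>); an L^2 function f is identified with the functional g \<mapsto> ip f g.\<close>
definition Minf :: "(('d::finite) tf \<Rightarrow> real) \<Rightarrow> (('d::finite) fn \<Rightarrow> complex) set" where
  "Minf w = {u. (\<forall>f\<in>M1 w. \<forall>g\<in>M1 w. \<forall>a b. u (\<lambda>t. a * f t + b * g t) = cnj a * u f + cnj b * u g)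
               \<and> (\<exists>K. \<forall>f\<in>M1 w. cmod (u f) \<le> K * M1norm w f)}"

definition embL2 :: "('d::finite) fn \<Rightarrow> (('d::finite) fn \<Rightarrow> complex)" where
  "embL2 f = (\<lambda>g. ip f g)"

definition dstft :: "('d::finite) fn \<Rightarrow> (('d::finite) fn \<Rightarrow> complex) \<Rightarrow> ('d::finite) tf \<Rightarrow> complex" where
  "dstft phi u z = u (tfshift z phi)"

definition Lpv_norm :: "ennreal \<Rightarrow> (('d::finite) tf \<Rightarrow> real) \<Rightarrow> (('d::finite) tf \<Rightarrow> complex) \<Rightarrow> ennreal" where
  "Lpv_norm p v F =
     (if p = \<infinity> then esssup lborel (\<lambda>z. ennreal (cmod (F z) * v z))
      else (let I = (\<integral>\<^sup>+ z. ennreal ((cmod (F z) * v z) powr enn2real p) \<partial>lborel)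
            in if I = \<infinity> then \<infinity> else ennreal (enn2real I powr (1 / enn2real p))))"

definition Mpv_norm :: "('d::finite) fn \<Rightarrow> ennreal \<Rightarrow> (('d::finite) tf \<Rightarrow> real) \<Rightarrow> (('d::finite) fn \<Rightarrow> complex) \<Rightarrow> ennreal" where
  "Mpv_norm phi p v u = Lpv_norm p v (dstft phi u)"

definition Mpv :: "(('d::finite) tf \<Rightarrow> real) \<Rightarrow> ('d::finite) fn \<Rightarrow> ennreal \<Rightarrow> (('d::finite) tf \<Rightarrow> real) \<Rightarrow> (('d::finite) fn \<Rightarrow> complex) set" where
  "Mpv w phi p v = {u \<in> Minf w. dstft phi u \<in> borel_measurable lborel \<and> Mpv_norm phi p v u < \<infinity>}"

definition lpv_norm :: "ennreal \<Rightarrow> ('d::finite) tf set \<Rightarrow> (('d::finite) tf \<Rightarrow> real) \<Rightarrow> (('d::finite) tf \<Rightarrow> real) \<Rightarrow> ennreal" where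
  "lpv_norm p \<Gamma> v a =
     (if p = \<infinity> then (SUP \<gamma>\<in>\<Gamma>. ennreal (a \<gamma> * v \<gamma>))
      else (let S = (\<Sum>\<^sub>\<infinity> \<gamma>\<in>\<Gamma>. ennreal ((a \<gamma> * v \<gamma>) powr enn2real p))
            in if S = \<infinity> then \<infinity> else ennreal (enn2real S powr (1 / enn2real p))))"

definition wiener :: "(('d::finite) tf \<Rightarrow> real) \<Rightarrow> (('d::finite) tf \<Rightarrow> real) set" where
  "wiener w = {g. g \<in> borel_measurable lborel \<and>
     (let G = (\<lambda>z. esssup (restrict_space lborel (cball 0 1)) (\<lambda>y. ennreal \<bar>g (z + y)\<bar>))
      in G \<in> borel_measurable lborel \<and> (\<integral>\<^sup>+ z. G z * ennreal (w z) \<partial>lborel) < \<infinity>)}"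

definition well_spread :: "(('d::finite) tf \<Rightarrow> real) \<Rightarrow> ('d::finite) tf set \<Rightarrow> (('d::finite) tf \<Rightarrow> ('d::finite) tf \<Rightarrow> real) \<Rightarrow> bool" where
  "well_spread w \<Gamma> \<eta> \<longleftrightarrow> (\<exists>N::nat. \<forall>z. finite (\<Gamma> \<inter> ball z 1) \<and> card (\<Gamma> \<inter> ball z 1) \<le> N)
     \<and> (\<exists>g \<in> wiener w. \<forall>\<gamma>\<in>\<Gamma>. \<forall>z. \<bar>\<eta> \<gamma> z\<bar> \<le> g (z - \<gamma>))"

text \<open>(lam, e) is a diagonalization of H_m f = V_phi^*(m V_phi f):
  e orthonormal in L^2, lam non-negative non-increasing, and H_m f = \<Sum>_k lam_k <f,e_k> e_k
  (stated weakly: <H_m f, h> = \<integral> m V f conj(V h) for all f, h \<in> L^2).\<close>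
definition diagonalization :: "('d::finite) fn \<Rightarrow> (('d::finite) tf \<Rightarrow> real) \<Rightarrow> (nat \<Rightarrow> real) \<Rightarrow> (nat \<Rightarrow> ('d::finite) fn) \<Rightarrow> bool" where
  "diagonalization phi m lam e \<longleftrightarrow>
     (\<forall>k. e k \<in> L2) \<and> (\<forall>k j. ip (e k) (e j) = (if k = j then 1 else 0))
     \<and> (\<forall>k. 0 \<le> lam k) \<and> decseq lam
     \<and> (\<forall>f\<in>L2. \<forall>h\<in>L2. (\<lambda>k. of_real (lam k) * ip f (e k) * ip (e k) h) sums
            (LINT z|lborel. of_real (m z) * stft phi f z * cnj (stft phi h z)))"

definition Heps :: "real \<Rightarrow> (nat \<Rightarrow> real) \<Rightarrow> (nat \<Rightarrow> ('d::finite) fn) \<Rightarrow> (('d::finite) fn \<Rightarrow> complex) \<Rightarrow> ('d::finite) fn" where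
  "Heps \<epsilon> lam e u = (\<lambda>t. \<Sum>k\<in>{k. lam k > \<epsilon>}. of_real (lam k) * u (e k) * e k t)"

end

theory Submission
  imports Defs "HOL-Probability.Characteristic_Functions"
begin

text \<open>Since the window lies in M1, the transform V u of a functional u reproduces itself through a
  kernel dominated by an even, slowly varying function that is integrable against w.  Upper bounds
  are therefore Schur tests with such kernels, uniformly in p and in all w-moderated weights with
  a given constant.

  For the lower bound let Psi(z) = exp(-|z - x| / L) and let F(x) be the L2 norm of Psi V u.  As the
  symbols sum to at least A, A F(x)^2 is at most the sum over g of the integrals of
  eta_g (Psi |V u|)^2.  Moving Psi^2 across the reproducing kernel costs a commutator that is small
  for large L, and what remains pairs Psi^2 V u with V (H_g u).  This gives
  A F(x) \<le> (sum over g of exp(-|x - g| / L) |H_g u|) + (k * F)(x), where the weighted integral of k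
  tends to 0 as L grows, so the last term is absorbed after taking norms; no inverse-closedness
  (Wiener lemma) is needed.  The part of H_g u lost by thresholding is estimated by splitting the
  symbol at height sqrt epsilon; it is a Schur test with a small constant and is absorbed as well.\<close>

section \<open>Lebesgue norms and the Schur test\<close>

text \<open>Local L2 norms: the eigenfunction expansion yields only square sums, so each symbol is
  handled in L2; p enters afterwards, through kernels with bounded weighted row and column mass, so
  constants do not see p or v. Exponential cut-offs: w grows slower than every exponential, so a
  cut-off at any scale L is integrable against it, and its relative variation is of order 1/L.
  Height sqrt epsilon: for eigenvalues up to epsilon, Bessel gives epsilon times the integral of eta
  |V u|^2. This involves the square root of the symbol, whose envelope need not be integrable
  against w. Where eta > sqrt epsilon, epsilon * eta is at most sqrt epsilon * eta^2; elsewhere eta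
  equals its truncation at sqrt epsilon, and the truncated envelope has small weighted integral.
  Functionals: u acts only on M1, so the coefficients and the transform of H u are written as
  integrals of V u, and u is moved inside integrals by approximation in M1. Absorption: both
  absorbed norms must be finite beforehand; this comes from the finite M^p norm of u.\<close>

definition epow :: "ennreal \<Rightarrow> real \<Rightarrow> ennreal" where
  "epow x r = (if x = \<infinity> then \<infinity> else ennreal (enn2real x powr r))"

lemma epow_ennreal: "0 \<le> x \<Longrightarrow> epow (ennreal x) r = ennreal (x powr r)"
  by (simp add: epow_def)

lemma epow_top [simp]: "epow top r = top"
  by (simp add: epow_def)

lemma epow_zero [simp]: "epow 0 r = 0"
  by (simp add: epow_def)

lemma epow_one: "epow x 1 = x"
  by (cases x) (auto simp: epow_def)

lemma epow_mono: "x \<le> y \<Longrightarrow> 0 \<le> r \<Longrightarrow> epow x r \<le> epow y r"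
  by (cases x; cases y) (auto simp: epow_ennreal powr_mono2 top_unique)

text \<open>Compatible with the convention 0 * top = 0 because \<open>epow\<close> fixes 0 and top
  for every exponent.\<close>

lemma epow_mult: "epow (x * y) r = epow x r * epow y r"
  by (cases x; cases y; cases "x = 0"; cases "y = 0")
    (auto simp: epow_ennreal powr_mult ennreal_mult[symmetric] ennreal_mult_eq_top_iff
      ennreal_mult_top ennreal_top_mult)

lemma epow_epow: "epow (epow x r) s = epow x (r * s)"
  by (cases x) (auto simp: epow_ennreal powr_powr)

lemma epow_add_le:
  assumes "0 \<le> r"
  shows "epow (x + y) r \<le> ennreal (2 powr r) * (epow x r + epow y r)"
proof -
  have "x + y \<le> 2 * max x y"
    unfolding mult_2 by (intro add_mono) auto
  then have "epow (x + y) r \<le> epow (ennreal 2 * max x y) r"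
    using assms by (intro epow_mono) auto
  also have "\<dots> = ennreal (2 powr r) * epow (max x y) r"
    by (simp only: epow_mult epow_ennreal)
  also have "\<dots> \<le> ennreal (2 powr r) * (epow x r + epow y r)"
    by (intro mult_left_mono) (auto simp: max_def add_increasing add_increasing2)
  finally show ?thesis .
qed

lemma measurable_epow [measurable]:
  assumes [measurable]: "f \<in> borel_measurable M"
  shows "(\<lambda>x. epow (f x) r) \<in> borel_measurable M"
  unfolding epow_def by measurable

lemma ennreal_power2_le_cancel: "x ^ 2 \<le> y ^ 2 \<Longrightarrow> x \<le> (y :: ennreal)"
  by (cases x; cases y) (auto simp: ennreal_power top_unique top_power_ennreal intro: power2_le_imp_le)

lemma ennreal_power2_add_le: "(x + y) ^ 2 \<le> 2 * (x ^ 2 + y ^ 2)" for x y :: ennreal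
proof (cases x; cases y)
  fix a b assume *: "0 \<le> a" "0 \<le> b" "x = ennreal a" "y = ennreal b"
  have "(a + b)^2 \<le> 2 * (a^2 + b^2)"
    using sum_squares_ge_zero[of "a - b" 0] by (simp add: power2_eq_square algebra_simps)
  then have "ennreal ((a + b)^2) \<le> ennreal (2 * (a^2 + b^2))"
    by (rule ennreal_leI)
  also have "\<dots> = 2 * ennreal (a^2 + b^2)"
    by (subst ennreal_mult') auto
  finally show "(x + y) ^ 2 \<le> 2 * (x ^ 2 + y ^ 2)" using *
    by (simp add: ennreal_power flip: ennreal_plus)
qed (auto simp: top_power_ennreal ennreal_mult_top)

text \<open>Formulated for an arbitrary measure, so that integrals over the plane and sums over the
  index set are instances of one norm.\<close>

definition lpn :: "ennreal \<Rightarrow> 'a measure \<Rightarrow> ('a \<Rightarrow> ennreal) \<Rightarrow> ennreal" where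
  "lpn p M f = (if p = \<infinity> then esssup M f
     else epow (\<integral>\<^sup>+x. epow (f x) (enn2real p) \<partial>M) (1 / enn2real p))"

lemma enn2real_ge_1: "1 \<le> p \<Longrightarrow> p \<noteq> \<infinity> \<Longrightarrow> 1 \<le> enn2real p"
  by (cases p) (auto simp flip: ennreal_1)

lemma lpn_mono_AE:
  assumes "f \<in> borel_measurable M" "AE x in M. f x \<le> g x"
  shows "lpn p M f \<le> lpn p M g"
  using assms unfolding lpn_def
  by (auto intro!: esssup_AE_mono epow_mono nn_integral_mono_AE elim!: eventually_mono)

lemma lpn_mono:
  assumes "f \<in> borel_measurable M" "\<And>x. x \<in> space M \<Longrightarrow> f x \<le> g x"
  shows "lpn p M f \<le> lpn p M g"
  using assms by (intro lpn_mono_AE) auto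

lemma lpn_cmult_le:
  assumes [measurable]: "f \<in> borel_measurable M" and p: "1 \<le> p"
  shows "lpn p M (\<lambda>x. c * f x) \<le> c * lpn p M f"
proof (cases "p = \<infinity>")
  case True
  have "AE x in M. c * f x \<le> c * esssup M f"
    using esssup_AE[of f M] by eventually_elim (auto intro: mult_left_mono)
  then show ?thesis using True by (auto simp: lpn_def intro!: esssup_I)
next
  case False
  with p have "1 \<le> enn2real p" by (rule enn2real_ge_1)
  then show ?thesis using False
    by (simp add: lpn_def epow_mult nn_integral_cmult epow_epow epow_one)
qed

text \<open>A quasi-triangle inequality in place of Minkowski: one factor 2 comes from
  \<open>epow_add_le\<close> inside the integral, the other bounds 2^(1/r) outside. What matters is
  that 4 is the same for all p.\<close>

lemma lpn_add_le:
  assumes [measurable]: "f \<in> borel_measurable M" "g \<in> borel_measurable M" and p: "1 \<le> p"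
  shows "lpn p M (\<lambda>x. f x + g x) \<le> 4 * (lpn p M f + lpn p M g)"
proof (cases "p = \<infinity>")
  case True
  have "AE x in M. f x + g x \<le> esssup M f + esssup M g"
    using esssup_AE[of f M] esssup_AE[of g M] by eventually_elim (auto intro: add_mono)
  then have "esssup M (\<lambda>x. f x + g x) \<le> 1 * (esssup M f + esssup M g)"
    by (auto intro!: esssup_I)
  also have "\<dots> \<le> 4 * (esssup M f + esssup M g)"
    by (intro mult_right_mono) auto
  finally show ?thesis using True by (auto simp: lpn_def)
next
  case False
  define r where "r = enn2real p"
  have r: "1 \<le> r" unfolding r_def using p False by (rule enn2real_ge_1)
  let ?I = "\<lambda>f. \<integral>\<^sup>+x. epow (f x) r \<partial>M"
  have "?I (\<lambda>x. f x + g x) \<le> (\<integral>\<^sup>+x. ennreal (2 powr r) * (epow (f x) r + epow (g x) r) \<partial>M)"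
    using r by (intro nn_integral_mono epow_add_le) auto
  also have "\<dots> = ennreal (2 powr r) * (?I f + ?I g)"
    by (simp add: nn_integral_cmult nn_integral_add)
  finally have "epow (?I (\<lambda>x. f x + g x)) (1/r) \<le> epow (ennreal (2 powr r) * (?I f + ?I g)) (1/r)"
    using r by (intro epow_mono) auto
  also have "\<dots> = ennreal 2 * epow (?I f + ?I g) (1/r)"
    using r by (simp add: epow_mult epow_ennreal powr_powr)
  also have "\<dots> \<le> ennreal 2 * (ennreal (2 powr (1/r)) * (epow (?I f) (1/r) + epow (?I g) (1/r)))"
    using r by (intro mult_left_mono epow_add_le) auto
  also have "\<dots> \<le> ennreal 2 * (ennreal 2 * (epow (?I f) (1/r) + epow (?I g) (1/r)))"
    using r powr_mono[of "1/r" 1 2]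
    by (intro mult_left_mono mult_right_mono ennreal_leI) auto
  also have "\<dots> = 4 * (epow (?I f) (1/r) + epow (?I g) (1/r))"
    by (simp add: mult.assoc[symmetric] ennreal_mult[symmetric])
  finally show ?thesis using False by (simp add: lpn_def r_def)
qed

text \<open>The tangent to x^r at s lies below the graph; the constant term is moved to the right so
  that only non-negative quantities occur.\<close>

lemma young_tangent:
  assumes "1 \<le> r" "0 \<le> s"
  shows "ennreal (r * s powr (r - 1)) * x \<le> epow x r + ennreal ((r - 1) * s powr r)"
proof (cases x)
  case (real y)
  have "r * s powr (r - 1) * y \<le> y powr r + (r - 1) * s powr r"
  proof (cases "r = 1 \<or> s = 0")
    case True
    then show ?thesis using real assms by (auto simp: field_simps)
  next
    case False
    then have r: "1 < r" and s: "0 < s" using assms by auto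
    have "y * s powr (r - 1) \<le> y powr r / r + (s powr (r - 1)) powr (r / (r - 1)) / (r / (r - 1))"
      using r real by (intro Youngs_inequality) (auto simp: field_simps)
    also have "(s powr (r - 1)) powr (r / (r - 1)) = s powr r"
      using r by (simp add: powr_powr)
    finally show ?thesis using r by (simp add: field_simps)
  qed
  then have "ennreal (r * s powr (r - 1) * y) \<le> ennreal (y powr r + (r - 1) * s powr r)"
    by (rule ennreal_leI)
  then show ?thesis using real assms by (simp add: ennreal_mult epow_ennreal)
qed simp

text \<open>Integrating the tangent inequality against K gives a bound that is linear in the
  integral t of K f, and the best tangent point is the mean value t / C. Using the bound C instead
  of the exact mass of K suits the Schur test, where only bounds on row masses are known.\<close>

lemma jensen_kernel:
  assumes [measurable]: "K \<in> borel_measurable N" "f \<in> borel_measurable N"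
    and K: "(\<integral>\<^sup>+y. K y \<partial>N) \<le> ennreal C" and C: "0 < C" and r: "1 \<le> r"
  shows "epow (\<integral>\<^sup>+y. K y * f y \<partial>N) r
    \<le> ennreal (C powr (r - 1)) * (\<integral>\<^sup>+y. K y * epow (f y) r \<partial>N)"
proof -
  let ?t = "\<integral>\<^sup>+y. K y * f y \<partial>N" and ?J = "\<integral>\<^sup>+y. K y * epow (f y) r \<partial>N"
  have *: "ennreal (r * s powr (r - 1)) * ?t \<le> ?J + ennreal (C * ((r - 1) * s powr r))"
    if s: "0 \<le> s" for s
  proof -
    have "ennreal (r * s powr (r - 1)) * ?t
        = (\<integral>\<^sup>+y. K y * (ennreal (r * s powr (r - 1)) * f y) \<partial>N)"
      by (subst nn_integral_cmult[symmetric]) (auto simp: mult_ac)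
    also have "\<dots> \<le> (\<integral>\<^sup>+y. K y * (epow (f y) r + ennreal ((r - 1) * s powr r)) \<partial>N)"
      using r s by (intro nn_integral_mono mult_left_mono young_tangent) auto
    also have "\<dots> = ?J + (\<integral>\<^sup>+y. K y \<partial>N) * ennreal ((r - 1) * s powr r)"
      by (simp add: distrib_left nn_integral_add nn_integral_multc)
    also have "\<dots> \<le> ?J + ennreal C * ennreal ((r - 1) * s powr r)"
      by (intro add_left_mono mult_right_mono K) auto
    finally show ?thesis using C r by (simp add: ennreal_mult)
  qed
  show ?thesis
  proof (cases "?J = \<infinity>")
    case True
    then show ?thesis using C by (simp add: ennreal_mult_top)
  next
    case J: False
    \<comment> \<open>The tangent at s = 1 bounds t by the finite right side.\<close>
    have "?t \<noteq> \<infinity>"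
    proof
      assume "?t = \<infinity>"
      with *[of 1] r J show False by (auto simp: ennreal_mult_top top_unique)
    qed
    then obtain t where t: "?t = ennreal t" "0 \<le> t" by (cases ?t) auto
    from J obtain j where j: "?J = ennreal j" "0 \<le> j" by (cases ?J) auto
    define s where "s = t / C"
    have s: "0 \<le> s" "t = C * s" using t C by (auto simp: s_def)
    have "ennreal (r * s powr (r - 1) * t) \<le> ennreal (j + C * ((r - 1) * s powr r))"
      using *[OF s(1)] t j r C s(1) by (simp add: ennreal_mult)
    then have "r * s powr (r - 1) * t \<le> j + C * ((r - 1) * s powr r)"
      using j r C by (subst (asm) ennreal_le_iff) auto
    moreover have "s powr (r - 1) * s = s powr r"
      using s(1) r by (cases "s = 0") (auto simp: powr_mult_base[of s "r-1"] mult.commute)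
    ultimately have "C * s powr r \<le> j"
      unfolding s(2) by (auto simp: algebra_simps)
    moreover have "t powr r = C powr (r - 1) * (C * s powr r)"
      using s C powr_mult_base[of C "r - 1"] by (simp add: powr_mult mult.commute mult.left_commute)
    ultimately have "t powr r \<le> C powr (r - 1) * j"
      by (simp add: mult_left_mono)
    then have "ennreal (t powr r) \<le> ennreal (C powr (r - 1) * j)"
      by (rule ennreal_leI)
    then show ?thesis
      unfolding t(1) j(1) using t(2) j(2) by (simp add: epow_ennreal ennreal_mult)
  qed
qed

text \<open>For finite r, Jensen in each row costs C^(r-1), and exchanging the integrals and using
  the column bound costs another C; the r-th root of C^r is C whatever r is.\<close>

lemma schur_test:
  assumes sf: "sigma_finite_measure M" "sigma_finite_measure N"
    and K [measurable]: "(\<lambda>(x, y). K x y) \<in> borel_measurable (M \<Otimes>\<^sub>M N)"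
    and f [measurable]: "f \<in> borel_measurable N" and g [measurable]: "g \<in> borel_measurable M"
    and gK: "AE x in M. g x \<le> (\<integral>\<^sup>+y. K x y * f y \<partial>N)"
    and K1: "\<And>x. x \<in> space M \<Longrightarrow> (\<integral>\<^sup>+y. K x y \<partial>N) \<le> ennreal C"
    and K2: "\<And>y. y \<in> space N \<Longrightarrow> (\<integral>\<^sup>+x. K x y \<partial>M) \<le> ennreal C"
    and C: "0 < C" and p: "1 \<le> p"
  shows "lpn p M g \<le> ennreal C * lpn p N f"
proof (cases "p = \<infinity>")
  case True
  interpret N: sigma_finite_measure N by fact
  have "AE x in M. g x \<le> ennreal C * esssup N f"
    using gK AE_space
  proof eventually_elim
    case (elim x)
    have [measurable]: "K x \<in> borel_measurable N"
      using measurable_Pair2[OF K elim(2)] by simp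
    have "g x \<le> (\<integral>\<^sup>+y. K x y * f y \<partial>N)" by fact
    also have "\<dots> \<le> (\<integral>\<^sup>+y. K x y * esssup N f \<partial>N)"
      using esssup_AE[of f N] by (intro nn_integral_mono_AE) (auto elim!: eventually_mono intro: mult_left_mono)
    also have "\<dots> = (\<integral>\<^sup>+y. K x y \<partial>N) * esssup N f"
      by (rule nn_integral_multc) measurable
    also have "\<dots> \<le> ennreal C * esssup N f"
      using elim by (intro mult_right_mono K1) auto
    finally show ?case .
  qed
  then show ?thesis using True by (auto simp: lpn_def intro!: esssup_I)
next
  case False
  interpret N: sigma_finite_measure N by fact
  interpret M: sigma_finite_measure M by fact
  interpret MN: pair_sigma_finite M N ..
  define r where "r = enn2real p"
  have r: "1 \<le> r" unfolding r_def using p False by (rule enn2real_ge_1)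
  have [measurable]: "K x \<in> borel_measurable N" if "x \<in> space M" for x
    using measurable_Pair2[OF K that] by simp
  have [measurable]: "(\<lambda>x. K x y) \<in> borel_measurable M" if "y \<in> space N" for y
    using measurable_Pair1[OF K that] by simp
  have "(\<integral>\<^sup>+x. epow (g x) r \<partial>M)
      \<le> (\<integral>\<^sup>+x. ennreal (C powr (r - 1)) * (\<integral>\<^sup>+y. K x y * epow (f y) r \<partial>N) \<partial>M)"
  proof (rule nn_integral_mono_AE)
    show "AE x in M. epow (g x) r \<le> ennreal (C powr (r - 1)) * (\<integral>\<^sup>+y. K x y * epow (f y) r \<partial>N)"
      using gK AE_space
    proof eventually_elim
      case (elim x)
      have "epow (g x) r \<le> epow (\<integral>\<^sup>+y. K x y * f y \<partial>N) r"
        using r elim by (intro epow_mono) auto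
      also have "\<dots> \<le> ennreal (C powr (r - 1)) * (\<integral>\<^sup>+y. K x y * epow (f y) r \<partial>N)"
        using elim r C by (intro jensen_kernel K1) auto
      finally show ?case .
    qed
  qed
  also have "\<dots> = ennreal (C powr (r - 1)) * (\<integral>\<^sup>+x. (\<integral>\<^sup>+y. K x y * epow (f y) r \<partial>N) \<partial>M)"
    by (subst nn_integral_cmult) auto
  also have "(\<integral>\<^sup>+x. (\<integral>\<^sup>+y. K x y * epow (f y) r \<partial>N) \<partial>M)
      = (\<integral>\<^sup>+y. (\<integral>\<^sup>+x. K x y * epow (f y) r \<partial>M) \<partial>N)"
    by (subst MN.Fubini') auto
  also have "\<dots> = (\<integral>\<^sup>+y. (\<integral>\<^sup>+x. K x y \<partial>M) * epow (f y) r \<partial>N)"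
    by (intro nn_integral_cong nn_integral_multc) auto
  also have "\<dots> \<le> (\<integral>\<^sup>+y. ennreal C * epow (f y) r \<partial>N)"
    by (intro nn_integral_mono mult_right_mono K2) auto
  also have "\<dots> = ennreal C * (\<integral>\<^sup>+y. epow (f y) r \<partial>N)"
    by (rule nn_integral_cmult) measurable
  finally have "(\<integral>\<^sup>+x. epow (g x) r \<partial>M) \<le> ennreal (C powr (r - 1)) * (ennreal C * (\<integral>\<^sup>+y. epow (f y) r \<partial>N))"
    by (simp add: mult_left_mono)
  also have "\<dots> = ennreal (C powr r) * (\<integral>\<^sup>+y. epow (f y) r \<partial>N)"
    using C powr_mult_base[of C "r - 1"] by (simp add: ennreal_mult[symmetric] mult.assoc[symmetric] mult.commute)
  finally have "epow (\<integral>\<^sup>+x. epow (g x) r \<partial>M) (1/r)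
      \<le> epow (ennreal (C powr r) * (\<integral>\<^sup>+y. epow (f y) r \<partial>N)) (1/r)"
    using r by (intro epow_mono) auto
  also have "\<dots> = ennreal C * epow (\<integral>\<^sup>+y. epow (f y) r \<partial>N) (1/r)"
    using r C by (simp add: epow_mult epow_ennreal powr_powr)
  finally show ?thesis using False by (simp add: lpn_def r_def)
qed

text \<open>Minkowski's integral inequality for exponent 2 without duality: the square of the inner
  integral is a double integral in u and u', and after exchanging integrals Cauchy-Schwarz in z
  bounds its integrand by n u * n u'.\<close>

lemma minkowski_L2:
  assumes sf: "sigma_finite_measure M" "sigma_finite_measure N"
    and f: "(\<lambda>(u, z). f u z) \<in> borel_measurable (N \<Otimes>\<^sub>M M)"
    and n [measurable]: "n \<in> borel_measurable N"
    and le: "\<And>u. u \<in> space N \<Longrightarrow> (\<integral>\<^sup>+z. (f u z)^2 \<partial>M) \<le> (n u)^2"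
  shows "(\<integral>\<^sup>+z. (\<integral>\<^sup>+u. f u z \<partial>N)^2 \<partial>M) \<le> (\<integral>\<^sup>+u. n u \<partial>N)^2"
proof -
  interpret N: sigma_finite_measure N by fact
  interpret M: sigma_finite_measure M by fact
  interpret NM: pair_sigma_finite N M ..
  have [measurable]: "f u \<in> borel_measurable M" if "u \<in> space N" for u
    using measurable_Pair2[OF f that] by simp
  have [measurable]: "(\<lambda>u. f u z) \<in> borel_measurable N" if "z \<in> space M" for z
    using measurable_Pair1[OF f that] by simp
  have f' [measurable]: "(\<lambda>x. f (fst x) (snd x)) \<in> borel_measurable (N \<Otimes>\<^sub>M M)"
    using f by (simp add: split_beta')
  have f1 [measurable]: "(\<lambda>x. f (a x) (b x)) \<in> borel_measurable L"
    if [measurable]: "a \<in> L \<rightarrow>\<^sub>M N" "b \<in> L \<rightarrow>\<^sub>M M" for a b and L :: "'c measure"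
    using measurable_compose[OF measurable_Pair[OF that] f'] by simp
  have f2 [measurable]: "(\<lambda>x. f (a x) (b x)) \<in> borel_measurable L"
    if [measurable]: "a \<in> L \<rightarrow>\<^sub>M N" "b \<in> L \<rightarrow>\<^sub>M M" for a b and L :: "('b \<times> 'a) measure"
    using measurable_compose[OF measurable_Pair[OF that] f'] by simp
  have f3 [measurable]: "(\<lambda>x. f (a x) (b x)) \<in> borel_measurable L"
    if [measurable]: "a \<in> L \<rightarrow>\<^sub>M N" "b \<in> L \<rightarrow>\<^sub>M M" for a b and L :: "('a \<times> 'b) measure"
    using measurable_compose[OF measurable_Pair[OF that] f'] by simp
  have "(\<integral>\<^sup>+z. (\<integral>\<^sup>+u. f u z \<partial>N)^2 \<partial>M) = (\<integral>\<^sup>+z. (\<integral>\<^sup>+u. f u z * (\<integral>\<^sup>+u'. f u' z \<partial>N) \<partial>N) \<partial>M)"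
    by (intro nn_integral_cong) (auto simp: power2_eq_square nn_integral_multc)
  also have "\<dots> = (\<integral>\<^sup>+u. (\<integral>\<^sup>+z. f u z * (\<integral>\<^sup>+u'. f u' z \<partial>N) \<partial>M) \<partial>N)"
    by (subst NM.Fubini') auto
  also have "\<dots> = (\<integral>\<^sup>+u. (\<integral>\<^sup>+z. (\<integral>\<^sup>+u'. f u z * f u' z \<partial>N) \<partial>M) \<partial>N)"
    by (intro nn_integral_cong) (auto simp: nn_integral_cmult)
  also have "\<dots> = (\<integral>\<^sup>+u. (\<integral>\<^sup>+u'. (\<integral>\<^sup>+z. f u z * f u' z \<partial>M) \<partial>N) \<partial>N)"
    by (intro nn_integral_cong, subst NM.Fubini') auto
  also have "\<dots> \<le> (\<integral>\<^sup>+u. (\<integral>\<^sup>+u'. n u * n u' \<partial>N) \<partial>N)"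
  proof (intro nn_integral_mono, rule ennreal_power2_le_cancel)
    fix u u' assume u: "u \<in> space N" "u' \<in> space N"
    have "(\<integral>\<^sup>+z. f u z * f u' z \<partial>M)^2 \<le> (\<integral>\<^sup>+z. (f u z)^2 \<partial>M) * (\<integral>\<^sup>+z. (f u' z)^2 \<partial>M)"
      using u by (intro Cauchy_Schwarz_nn_integral) auto
    also have "\<dots> \<le> (n u)^2 * (n u')^2"
      using u by (intro mult_mono le) auto
    finally show "(\<integral>\<^sup>+z. f u z * f u' z \<partial>M)^2 \<le> (n u * n u')^2"
      by (simp add: power_mult_distrib)
  qed
  also have "\<dots> = (\<integral>\<^sup>+u. n u \<partial>N)^2"
    by (simp add: nn_integral_cmult nn_integral_multc power2_eq_square)
  finally show ?thesis .
qed

text \<open>Turns the unordered sums of the statement into integrals, to which the Schur test and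
  Tonelli apply. For the harder inequality the countable set is exhausted by finite sets and
  monotone convergence is used.\<close>

lemma infsum_eq_nn_integral_count_space:
  fixes f :: "'a \<Rightarrow> ennreal"
  assumes "countable A"
  shows "(\<Sum>\<^sub>\<infinity>x\<in>A. f x) = (\<integral>\<^sup>+x. f x \<partial>count_space A)"
proof (rule antisym)
  have fin: "sum f F = (\<integral>\<^sup>+x. f x * indicator F x \<partial>count_space A)" if "finite F" "F \<subseteq> A" for F
    using that by (subst nn_integral_count_space'[of F]) (auto intro!: sum.cong)
  have le: "sum f F \<le> (\<integral>\<^sup>+x. f x \<partial>count_space A)" if "finite F" "F \<subseteq> A" for F
    unfolding fin[OF that] by (intro nn_integral_mono) (auto simp: indicator_def)
  then show "(\<Sum>\<^sub>\<infinity>x\<in>A. f x) \<le> (\<integral>\<^sup>+x. f x \<partial>count_space A)"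
    by (subst nonneg_infsum_complete) (auto intro!: SUP_least)
  define F where "F n = from_nat_into A ` {..n} \<inter> A" for n
  have F: "finite (F n)" "F n \<subseteq> A" for n by (auto simp: F_def)
  have "(\<integral>\<^sup>+x. f x \<partial>count_space A) = (\<integral>\<^sup>+x. (SUP n. f x * indicator (F n) x) \<partial>count_space A)"
  proof (intro nn_integral_cong antisym)
    fix x assume "x \<in> space (count_space A)"
    then have "x \<in> F (to_nat_on A x)"
      using assms by (force simp: F_def)
    then show "f x \<le> (SUP n. f x * indicator (F n) x)"
      by (intro SUP_upper2[of "to_nat_on A x"]) auto
  qed (auto intro!: SUP_least simp: indicator_def)
  also have "\<dots> = (SUP n. (\<integral>\<^sup>+x. f x * indicator (F n) x \<partial>count_space A))"
    by (intro nn_integral_monotone_convergence_SUP)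
      (auto simp: incseq_def le_fun_def F_def indicator_def dest: le_trans)
  also have "\<dots> \<le> (\<Sum>\<^sub>\<infinity>x\<in>A. f x)"
    unfolding fin[OF F, symmetric] using F
    by (subst nonneg_infsum_complete) (auto intro!: SUP_least SUP_upper)
  finally show "(\<integral>\<^sup>+x. f x \<partial>count_space A) \<le> (\<Sum>\<^sub>\<infinity>x\<in>A. f x)" .
qed

section \<open>Slowly varying functions and submultiplicative weights\<close>

lemma nn_integral_lborel_affine:
  fixes f :: "'a::euclidean_space \<Rightarrow> ennreal"
  assumes [measurable]: "f \<in> borel_measurable borel" and c: "c = 1 \<or> c = -1"
  shows "(\<integral>\<^sup>+x. f (a + c *\<^sub>R x) \<partial>lborel) = (\<integral>\<^sup>+x. f x \<partial>lborel)"
proof -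
  have "lborel = distr lborel borel (\<lambda>x::'a. a + c *\<^sub>R x)"
    using c by (subst lborel_affine[of c a]) (auto simp: density_1)
  then have "(\<integral>\<^sup>+x. f x \<partial>lborel) = (\<integral>\<^sup>+x. f x \<partial>distr lborel borel (\<lambda>x::'a. a + c *\<^sub>R x))"
    by simp
  also have "\<dots> = (\<integral>\<^sup>+x. f (a + c *\<^sub>R x) \<partial>lborel)"
    by (rule nn_integral_distr) auto
  finally show ?thesis by simp
qed

lemma nn_integral_lborel_shift:
  fixes f :: "'a::euclidean_space \<Rightarrow> ennreal"
  assumes "f \<in> borel_measurable borel"
  shows "(\<integral>\<^sup>+x. f (x - a) \<partial>lborel) = (\<integral>\<^sup>+x. f x \<partial>lborel)"
    and "(\<integral>\<^sup>+x. f (x + a) \<partial>lborel) = (\<integral>\<^sup>+x. f x \<partial>lborel)"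
    and "(\<integral>\<^sup>+x. f (a - x) \<partial>lborel) = (\<integral>\<^sup>+x. f x \<partial>lborel)"
    and "(\<integral>\<^sup>+x. f (- x) \<partial>lborel) = (\<integral>\<^sup>+x. f x \<partial>lborel)"
  using nn_integral_lborel_affine[OF assms, of 1 "-a"] nn_integral_lborel_affine[OF assms, of 1 "a"]
    nn_integral_lborel_affine[OF assms, of "-1" a] nn_integral_lborel_affine[OF assms, of "-1" 0]
  by (simp_all add: add.commute)

lemma AE_lborel_shift:
  fixes P :: "'a::euclidean_space \<Rightarrow> bool"
  assumes "AE x in lborel. P x"
  shows "AE x in lborel. P (x - a)"
proof -
  obtain N where N: "{x. \<not> P x} \<subseteq> N" "emeasure lborel N = 0" "N \<in> sets borel"
    using AE_E[OF assms] by auto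
  have [measurable]: "(\<lambda>x. x - a) -` N \<in> sets borel"
    using measurable_sets[of "\<lambda>x. x - a" borel borel N] N by simp
  have "emeasure lborel ((\<lambda>x. x - a) -` N) = (\<integral>\<^sup>+x. indicator N (x - a) \<partial>lborel)"
    by (subst nn_integral_indicator[symmetric]) (auto simp: indicator_def simp del: nn_integral_indicator intro!: nn_integral_cong)
  also have "\<dots> = 0"
    using N by (subst nn_integral_lborel_shift) auto
  finally show ?thesis using N
    by (intro AE_I'[of "(\<lambda>x. x - a) -` N"]) (auto simp: null_sets_def)
qed

text \<open>All sampling and amalgam arguments are reduced to this property.\<close>

definition slow :: "real \<Rightarrow> real \<Rightarrow> ('a::euclidean_space \<Rightarrow> ennreal) \<Rightarrow> bool" where
  "slow D \<kappa> b \<longleftrightarrow> b \<in> borel_measurable borel \<and> 1 \<le> D \<and> 0 \<le> \<kappa>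
     \<and> (\<forall>x y. b x \<le> ennreal (D * exp (\<kappa> * norm (x - y))) * b y)"

lemma slowD:
  assumes "slow D \<kappa> b"
  shows "b \<in> borel_measurable borel" "1 \<le> D" "0 \<le> \<kappa>"
    "b x \<le> ennreal (D * exp (\<kappa> * norm (x - y))) * b y"
  using assms by (auto simp: slow_def)

lemma slow_reflect: "slow D \<kappa> b \<Longrightarrow> slow D \<kappa> (\<lambda>x. b (- x))"
  unfolding slow_def
proof safe
  fix x y assume "\<forall>x y. b x \<le> ennreal (D * exp (\<kappa> * norm (x - y))) * b y"
  from this[rule_format, of "-x" "-y"]
  show "b (- x) \<le> ennreal (D * exp (\<kappa> * norm (x - y))) * b (- y)"
    by (simp add: norm_minus_commute)
qed auto

lemma slow_shift: "slow D \<kappa> b \<Longrightarrow> slow D \<kappa> (\<lambda>x. b (x - a))"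
  unfolding slow_def
proof safe
  fix x y assume "\<forall>x y. b x \<le> ennreal (D * exp (\<kappa> * norm (x - y))) * b y"
  from this[rule_format, of "x - a" "y - a"]
  show "b (x - a) \<le> ennreal (D * exp (\<kappa> * norm (x - y))) * b (y - a)"
    by simp
qed auto

lemma slow_mult:
  fixes b :: "'a::euclidean_space \<Rightarrow> ennreal"
  assumes "slow D \<kappa> b" "slow D' \<kappa>' b'"
  shows "slow (D * D') (\<kappa> + \<kappa>') (\<lambda>x. b x * b' x)"
  unfolding slow_def
proof (intro conjI allI)
  show "1 \<le> D * D'" using assms mult_mono[of 1 D 1 D'] by (auto simp: slow_def)
  fix x y :: 'a
  have "b x * b' x \<le> (ennreal (D * exp (\<kappa> * norm (x - y))) * b y)
      * (ennreal (D' * exp (\<kappa>' * norm (x - y))) * b' y)"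
    using assms by (intro mult_mono slowD) auto
  also have "\<dots> = ennreal (D * D' * exp ((\<kappa> + \<kappa>') * norm (x - y))) * (b y * b' y)"
    using slowD(2)[OF assms(1)] slowD(2)[OF assms(2)]
    by (simp add: ennreal_mult exp_add algebra_simps)
  finally show "b x * b' x \<le> \<dots>" .
qed (use assms in \<open>auto simp: slow_def\<close>)

lemma slow_add:
  assumes "slow D \<kappa> b" "slow D \<kappa> b'"
  shows "slow D \<kappa> (\<lambda>x. b x + b' x)"
  using assms by (auto simp: slow_def distrib_left intro: add_mono)

text \<open>The comparison factor is at least 1, so it dominates the constant level too; this covers
  envelopes of truncated symbols.\<close>

lemma slow_min:
  fixes b :: "'a::euclidean_space \<Rightarrow> ennreal"
  assumes "slow D \<kappa> b"
  shows "slow D \<kappa> (\<lambda>x. min (b x) c)"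
  unfolding slow_def
proof (intro conjI allI)
  fix x y :: 'a
  let ?q = "D * exp (\<kappa> * norm (x - y))"
  have "1 * 1 \<le> ?q" using assms by (intro mult_mono) (auto simp: slow_def)
  then have "ennreal 1 * c \<le> ennreal ?q * c"
    by (intro mult_right_mono ennreal_leI) auto
  then show "min (b x) c \<le> ennreal ?q * min (b y) c"
    using slowD(4)[OF assms, of x y] by (auto simp: min_def intro: order_trans)
qed (use assms in \<open>auto simp: slow_def\<close>)

section \<open>Convolution\<close>

definition conv :: "('a::euclidean_space \<Rightarrow> ennreal) \<Rightarrow> ('a \<Rightarrow> ennreal) \<Rightarrow> 'a \<Rightarrow> ennreal" where
  "conv a b x = (\<integral>\<^sup>+y. a y * b (x - y) \<partial>lborel)"

lemma measurable_conv [measurable]: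
  assumes [measurable]: "a \<in> borel_measurable borel" "b \<in> borel_measurable borel"
  shows "conv a b \<in> borel_measurable borel"
  unfolding conv_def[abs_def] by measurable

text \<open>One slowly varying factor suffices, and its constants survive. This is how functions
  that are merely integrable acquire slowly varying envelopes.\<close>

lemma slow_conv:
  fixes a :: "'a::euclidean_space \<Rightarrow> ennreal"
  assumes [measurable]: "a \<in> borel_measurable borel" and b: "slow D \<kappa> b"
  shows "slow D \<kappa> (conv a b)"
  unfolding slow_def
proof (intro conjI allI)
  have [measurable]: "b \<in> borel_measurable borel" using b by (rule slowD)
  show "conv a b \<in> borel_measurable borel" by measurable
  fix x y :: 'a
  let ?q = "ennreal (D * exp (\<kappa> * norm (x - y)))"
  have "conv a b x \<le> (\<integral>\<^sup>+u. ?q * (a u * b (y - u)) \<partial>lborel)"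
    unfolding conv_def
  proof (intro nn_integral_mono)
    fix u
    show "a u * b (x - u) \<le> ?q * (a u * b (y - u))"
      using mult_left_mono[OF slowD(4)[OF b, of "x - u" "y - u"], of "a u"]
      by (simp add: mult_ac)
  qed
  also have "\<dots> = ?q * conv a b y"
    unfolding conv_def by (rule nn_integral_cmult) measurable
  finally show "conv a b x \<le> ?q * conv a b y" .
qed (use b in \<open>auto simp: slow_def\<close>)

lemma conv_flip:
  assumes [measurable]: "a \<in> borel_measurable borel" "b \<in> borel_measurable borel"
  shows "conv a b x = (\<integral>\<^sup>+y. a (x - y) * b y \<partial>lborel)"
  unfolding conv_def
  by (subst nn_integral_lborel_shift(3)[symmetric, where a = x]) auto

lemma conv_even:
  assumes [measurable]: "a \<in> borel_measurable borel" "b \<in> borel_measurable borel"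
    and "\<And>x. a (- x) = a x" "\<And>x. b (- x) = b x"
  shows "conv a b (- x) = conv a b x"
proof -
  have "conv a b (- x) = (\<integral>\<^sup>+y. a (- y) * b (- x - (- y)) \<partial>lborel)"
    unfolding conv_def
    by (rule nn_integral_lborel_shift(4)[symmetric]) measurable
  also have "\<dots> = (\<integral>\<^sup>+y. a y * b (- (x - y)) \<partial>lborel)"
    by (simp add: assms)
  also have "\<dots> = conv a b x" by (simp only: assms conv_def)
  finally show ?thesis .
qed

section \<open>Local averages and sampling\<close>

lemma unit_ball_measure:
  "\<exists>V>0. \<forall>x::'a::euclidean_space. emeasure lborel (ball x 1) = ennreal V"
  by (intro exI[of _ "unit_ball_vol (real DIM('a))"])
    (auto simp: emeasure_ball)

lemma measurable_indicator_ball [measurable]: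
  "(\<lambda>y. indicator (ball x r) y :: ennreal) \<in> borel_measurable borel"
  by (intro borel_measurable_indicator) auto

text \<open>On a unit ball the function changes by a factor at most D * exp \<kappa>, so its value
  is bounded by its average there. The constant is chosen before the function and depends only on D,
  \<kappa> and the dimension.\<close>

lemma slow_le_integral:
  "\<exists>C>0. \<forall>b::'a::euclidean_space \<Rightarrow> ennreal. slow D \<kappa> b \<longrightarrow>
     (\<forall>x. b x \<le> ennreal C * (\<integral>\<^sup>+y. b y * indicator (ball x 1) y \<partial>lborel))"
proof -
  obtain V where V: "0 < V" "\<And>x::'a. emeasure lborel (ball x 1) = ennreal V"
    using unit_ball_measure by blast
  show ?thesis
  \<comment> \<open>The maxima keep the constant positive for those D and \<kappa> for which no
    slowly varying function exists.\<close>
  proof (intro exI[of _ "max 1 D * exp (max \<kappa> 0) / V"] conjI allI impI)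
    show "0 < max 1 D * exp (max \<kappa> 0) / V" using V by (auto intro!: divide_pos_pos mult_pos_pos)
    fix b :: "'a \<Rightarrow> ennreal" and x assume b: "slow D \<kappa> b"
    note D = slowD(2,3)[OF b]
    have [measurable]: "b \<in> borel_measurable borel" using b by (rule slowD)
    have "b x * ennreal V = (\<integral>\<^sup>+y. b x * indicator (ball x 1) y \<partial>lborel)"
      by (simp add: nn_integral_cmult_indicator V)
    also have "\<dots> \<le> (\<integral>\<^sup>+y. ennreal (D * exp \<kappa>) * (b y * indicator (ball x 1) y) \<partial>lborel)"
    proof (intro nn_integral_mono)
      fix y
      show "b x * indicator (ball x 1) y \<le> ennreal (D * exp \<kappa>) * (b y * indicator (ball x 1) y)"
      proof (cases "y \<in> ball x 1")
        case True
        then have "\<kappa> * norm (x - y) \<le> \<kappa> * 1"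
          using D by (intro mult_left_mono) (auto simp: dist_norm)
        then have "ennreal (D * exp (\<kappa> * norm (x - y))) * b y \<le> ennreal (D * exp \<kappa>) * b y"
          using D by (intro mult_right_mono ennreal_leI mult_left_mono) auto
        then show ?thesis using slowD(4)[OF b, of x y] True by auto
      qed simp
    qed
    also have "\<dots> = ennreal (D * exp \<kappa>) * (\<integral>\<^sup>+y. b y * indicator (ball x 1) y \<partial>lborel)"
      by (rule nn_integral_cmult) measurable
    finally have "ennreal (1/V) * (b x * ennreal V)
        \<le> ennreal (1/V) * (ennreal (D * exp \<kappa>) * (\<integral>\<^sup>+y. b y * indicator (ball x 1) y \<partial>lborel))"
      by (rule mult_left_mono) simp
    also have "ennreal (1/V) * (b x * ennreal V) = b x * ennreal (1/V * V)"
      using V by (subst ennreal_mult) (auto simp: mult_ac)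
    finally show "b x \<le> ennreal (max 1 D * exp (max \<kappa> 0) / V) * (\<integral>\<^sup>+y. b y * indicator (ball x 1) y \<partial>lborel)"
      using V D by (simp add: mult.assoc[symmetric] ennreal_mult[symmetric] max_def)
  qed
qed

text \<open>The supremum is at most C times the L1 norm, and the squared L2 norm is at most the
  supremum times the L1 norm.\<close>

lemma slow_L2_le_L1:
  "\<exists>C>0. \<forall>b::'a::euclidean_space \<Rightarrow> ennreal. slow D \<kappa> b \<longrightarrow>
     (\<integral>\<^sup>+x. (b x)^2 \<partial>lborel) \<le> (ennreal C * (\<integral>\<^sup>+x. b x \<partial>lborel))^2"
proof -
  obtain C where C: "0 < C" "\<And>(b::'a \<Rightarrow> ennreal) x. slow D \<kappa> b \<Longrightarrow>
      b x \<le> ennreal C * (\<integral>\<^sup>+y. b y * indicator (ball x 1) y \<partial>lborel)"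
    using slow_le_integral[of D \<kappa>] by blast
  show ?thesis
  \<comment> \<open>The product argument produces C, the claim needs a square; both are covered by
    max 1 C, since C \<le> (max 1 C)^2.\<close>
  proof (intro exI[of _ "max 1 C"] conjI allI impI)
    fix b :: "'a \<Rightarrow> ennreal" assume b: "slow D \<kappa> b"
    have [measurable]: "b \<in> borel_measurable borel" using b by (rule slowD)
    let ?I = "\<integral>\<^sup>+x. b x \<partial>lborel"
    have le: "b x \<le> ennreal C * ?I" for x
      using C(2)[OF b, of x]
      by (rule order_trans) (intro mult_left_mono nn_integral_mono, auto simp: indicator_def)
    have "(\<integral>\<^sup>+x. (b x)^2 \<partial>lborel) \<le> (\<integral>\<^sup>+x. ennreal C * ?I * b x \<partial>lborel)"
      unfolding power2_eq_square by (intro nn_integral_mono mult_right_mono le) auto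
    also have "\<dots> = ennreal C * ?I * ?I"
      by (rule nn_integral_cmult) measurable
    also have "\<dots> \<le> ennreal ((max 1 C)^2) * ?I * ?I"
    proof (intro mult_right_mono ennreal_leI)
      have "1 * C \<le> max 1 C * max 1 C" using C by (intro mult_mono) auto
      then show "C \<le> (max 1 C)^2" by (simp add: power2_eq_square)
    qed auto
    also have "\<dots> = (ennreal (max 1 C) * ?I)^2"
      by (simp add: power2_eq_square mult_ac ennreal_mult)
    finally show "(\<integral>\<^sup>+x. (b x)^2 \<partial>lborel) \<le> (ennreal (max 1 C) * ?I)^2" .
  qed auto
qed

text \<open>Unit balls around a countable dense set cover everything, and each contains finitely
  many points of the set.\<close>

lemma relatively_separated_countable:
  fixes \<Gamma> :: "'a::euclidean_space set"
  assumes "\<And>z. finite (\<Gamma> \<inter> ball z 1)"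
  shows "countable \<Gamma>"
proof -
  obtain X :: "'a set" where X: "countable X" "\<And>U. open U \<Longrightarrow> U \<noteq> {} \<Longrightarrow> \<exists>d\<in>X. d \<in> U"
    using countable_dense_setE by blast
  have "\<Gamma> \<subseteq> (\<Union>x\<in>X. \<Gamma> \<inter> ball x 1)"
  proof
    fix g assume "g \<in> \<Gamma>"
    obtain d where "d \<in> X" "d \<in> ball g 1" using X(2)[of "ball g 1"] by auto
    then show "g \<in> (\<Union>x\<in>X. \<Gamma> \<inter> ball x 1)"
      using \<open>g \<in> \<Gamma>\<close> by (auto simp: dist_commute)
  qed
  moreover have "countable (\<Union>x\<in>X. \<Gamma> \<inter> ball x 1)"
    by (intro countable_UN X countable_finite assms)
  ultimately show ?thesis by (rule countable_subset)
qed

text \<open>Replace each sample by the integral over the unit ball around it; by the cardinality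
  bound every point of the plane lies in at most N of these balls.\<close>

lemma slow_sum_le_integral:
  assumes fin: "\<And>z. finite (\<Gamma> \<inter> ball z 1)" and card: "\<And>z. card (\<Gamma> \<inter> ball z 1) \<le> N"
  shows "\<exists>C>0. \<forall>b::'a::euclidean_space \<Rightarrow> ennreal. slow D \<kappa> b \<longrightarrow>
    (\<integral>\<^sup>+g. b g \<partial>count_space \<Gamma>) \<le> ennreal C * (\<integral>\<^sup>+x. b x \<partial>lborel)"
proof -
  obtain C where C: "0 < C" "\<And>(b::'a \<Rightarrow> ennreal) x. slow D \<kappa> b \<Longrightarrow>
      b x \<le> ennreal C * (\<integral>\<^sup>+y. b y * indicator (ball x 1) y \<partial>lborel)"
    using slow_le_integral[of D \<kappa>] by blast
  have \<Gamma>: "countable \<Gamma>" using fin by (rule relatively_separated_countable)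
  interpret G: sigma_finite_measure "count_space \<Gamma>"
    using \<Gamma> by (rule sigma_finite_measure_count_space_countable)
  interpret P: pair_sigma_finite "count_space \<Gamma>" "lborel :: 'a measure" ..
  show ?thesis
  \<comment> \<open>N + 1 instead of N gives a positive constant also for N = 0.\<close>
  proof (intro exI[of _ "C * (real N + 1)"] conjI allI impI)
    show "0 < C * (real N + 1)" using C by simp
    fix b :: "'a \<Rightarrow> ennreal" assume b: "slow D \<kappa> b"
    have [measurable]: "b \<in> borel_measurable borel" using b by (rule slowD)
    have m: "(\<lambda>x. b (snd x) * indicator (ball (fst x) 1) (snd x)) \<in> borel_measurable (count_space \<Gamma> \<Otimes>\<^sub>M lborel)"
      by (rule measurable_pair_measure_countable1[OF \<Gamma>])
        (auto intro!: borel_measurable_times_ennreal borel_measurable_indicator)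
    have "(\<integral>\<^sup>+g. b g \<partial>count_space \<Gamma>)
        \<le> (\<integral>\<^sup>+g. ennreal C * (\<integral>\<^sup>+y. b y * indicator (ball g 1) y \<partial>lborel) \<partial>count_space \<Gamma>)"
      by (intro nn_integral_mono C b)
    also have "\<dots> = ennreal C * (\<integral>\<^sup>+g. (\<integral>\<^sup>+y. b y * indicator (ball g 1) y \<partial>lborel) \<partial>count_space \<Gamma>)"
      by (rule nn_integral_cmult) simp
    also have "(\<integral>\<^sup>+g. (\<integral>\<^sup>+y. b y * indicator (ball g 1) y \<partial>lborel) \<partial>count_space \<Gamma>)
        = (\<integral>\<^sup>+y. (\<integral>\<^sup>+g. b y * indicator (ball g 1) y \<partial>count_space \<Gamma>) \<partial>lborel)"
      using P.Fubini[of "\<lambda>x. b (snd x) * indicator (ball (fst x) 1) (snd x)"] m by simp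
    also have "\<dots> \<le> (\<integral>\<^sup>+y. b y * ennreal (real N + 1) \<partial>lborel)"
    proof (intro nn_integral_mono)
      fix y
      have "(\<integral>\<^sup>+g. b y * indicator (ball g 1) y \<partial>count_space \<Gamma>)
          = b y * (\<integral>\<^sup>+g. indicator (\<Gamma> \<inter> ball y 1) g \<partial>count_space \<Gamma>)"
        by (subst nn_integral_cmult)
          (auto intro!: nn_integral_cong arg_cong2[where f="(*)"] simp: indicator_def dist_commute
            simp del: nn_integral_indicator)
      also have "(\<integral>\<^sup>+g. indicator (\<Gamma> \<inter> ball y 1) g \<partial>count_space \<Gamma>) = of_nat (card (\<Gamma> \<inter> ball y 1))"
        using fin by (subst nn_integral_indicator) (auto simp: emeasure_count_space_finite)
      also have "\<dots> \<le> ennreal (real N + 1)"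
      proof -
        have "real (card (\<Gamma> \<inter> ball y 1)) \<le> real N + 1" using card[of y] by linarith
        then show ?thesis by (subst ennreal_of_nat_eq_real_of_nat) (rule ennreal_leI)
      qed
      finally show "(\<integral>\<^sup>+g. b y * indicator (ball g 1) y \<partial>count_space \<Gamma>) \<le> b y * ennreal (real N + 1)"
        by (simp add: mult_left_mono)
    qed
    also have "\<dots> = (\<integral>\<^sup>+y. b y \<partial>lborel) * ennreal (real N + 1)"
      by (rule nn_integral_multc) measurable
    finally show "(\<integral>\<^sup>+g. b g \<partial>count_space \<Gamma>) \<le> ennreal (C * (real N + 1)) * (\<integral>\<^sup>+x. b x \<partial>lborel)"
      using C by (simp add: ennreal_mult mult.assoc mult_left_mono) (simp add: mult_ac)
  qed
qed

section \<open>Exponential cut-offs and their modulus of variation\<close>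

definition edecay :: "real \<Rightarrow> 'a::euclidean_space \<Rightarrow> ennreal" where
  "edecay c x = ennreal (exp (- (c * norm x)))"

text \<open>Bounds the relative variation of the cut-off at scale L over a displacement x; bounded
  by 1 and pointwise tending to 0 as L grows. The summand 1 in the numerator keeps it away from 0 at
  the origin: a slowly varying function that vanishes at one point vanishes everywhere.\<close>

definition rho :: "real \<Rightarrow> 'a::euclidean_space \<Rightarrow> ennreal" where
  "rho L x = ennreal (min 1 ((1 + norm x) / L))"

lemma measurable_edecay [measurable]: "edecay c \<in> borel_measurable borel"
  unfolding edecay_def[abs_def] by measurable

lemma measurable_rho [measurable]: "rho L \<in> borel_measurable borel"
  unfolding rho_def[abs_def] by measurable

lemma edecay_minus [simp]: "edecay c (- x) = edecay c x"
  by (simp add: edecay_def)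

lemma rho_minus [simp]: "rho c (- x) = rho c x"
  by (simp add: rho_def)

lemma slow_edecay: "0 \<le> c \<Longrightarrow> slow 1 c (edecay c)"
  unfolding slow_def
proof (intro conjI allI)
  fix x y :: 'a assume c: "0 \<le> c"
  have "- (c * norm x) \<le> c * norm (x - y) + - (c * norm y)"
    using mult_left_mono[OF norm_triangle_ineq2[of y x] c] by (simp add: algebra_simps norm_minus_commute)
  then show "edecay c x \<le> ennreal (1 * exp (c * norm (x - y))) * edecay c y"
    by (simp add: edecay_def ennreal_mult[symmetric] exp_add[symmetric])
qed auto

lemma slow_rho:
  assumes L: "0 < L"
  shows "slow 1 1 (rho L)"
  unfolding slow_def
proof (intro conjI allI)
  fix x y :: 'a
  let ?e = "exp (norm (x - y))"
  have e: "1 + norm (x - y) \<le> ?e" by (rule exp_ge_add_one_self)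
  have "1 + norm x \<le> (1 + norm (x - y)) * (1 + norm y)"
    using norm_triangle_sub[of x y] mult_nonneg_nonneg[of "norm (x - y)" "norm y"]
    by (simp add: algebra_simps del: mult_nonneg_nonneg)
  also have "\<dots> \<le> ?e * (1 + norm y)" by (intro mult_right_mono e) auto
  finally have "(1 + norm x) / L \<le> ?e * (1 + norm y) / L"
    using L by (intro divide_right_mono) auto
  then have "(1 + norm x) / L \<le> ?e * ((1 + norm y) / L)" by simp
  moreover have "1 \<le> ?e" by simp
  ultimately have "min 1 ((1 + norm x) / L) \<le> ?e * min 1 ((1 + norm y) / L)"
    using mult_mono[of 1 ?e "(1 + norm x) / L" 1] order_trans[of _ 1 ?e]
    by (simp add: min_def)
  then show "rho L x \<le> ennreal (1 * exp (1 * norm (x - y))) * rho L y"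
    using L by (simp add: rho_def ennreal_mult[symmetric])
qed auto

lemma rho_le_1: "rho L x \<le> 1"
  unfolding rho_def by (metis ennreal_1 ennreal_leI min.cobounded1)

text \<open>Compare the exponential of c(1 + t) with the n-th term of its series; the constant
  collects what is left over.\<close>

lemma power_le_exp:
  fixes c :: real
  assumes c: "0 < c"
  shows "\<exists>M>0. \<forall>t\<ge>0. (1 + t) ^ n \<le> M * exp (c * t)"
proof (intro exI[of _ "fact n * exp c / c ^ n"] conjI allI impI)
  fix t :: real assume t: "0 \<le> t"
  let ?y = "c * (1 + t)"
  have "(\<Sum>k\<in>{n}. ?y ^ k /\<^sub>R fact k) \<le> (\<Sum>k. ?y ^ k /\<^sub>R fact k)"
    using t c by (intro sum_le_suminf summable_exp_generic) auto
  then have "?y ^ n / fact n \<le> exp ?y"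
    by (simp add: exp_def divide_inverse mult.commute)
  then have "?y ^ n \<le> fact n * exp ?y"
    by (simp add: divide_le_eq mult.commute)
  also have "exp ?y = exp c * exp (c * t)"
    by (simp add: distrib_left exp_add)
  finally have "c ^ n * (1 + t) ^ n \<le> fact n * (exp c * exp (c * t))"
    by (simp only: power_mult_distrib)
  then show "(1 + t) ^ n \<le> fact n * exp c / c ^ n * exp (c * t)"
    using c by (simp add: field_simps)
qed (use c in auto)

text \<open>Cover the shell where the norm has integer part k by the ball of radius k + 1. Half of
  the decay rate absorbs the polynomial volume growth and the other half leaves a geometric
  series.\<close>

lemma nn_integral_edecay_finite:
  fixes c :: real
  assumes c: "0 < c"
  shows "(\<integral>\<^sup>+x. edecay c (x::'a::euclidean_space) \<partial>lborel) < \<infinity>"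
proof -
  let ?d = "DIM('a)"
  let ?V = "unit_ball_vol (real ?d)"
  obtain M where M: "0 < M" "\<And>t. 0 \<le> t \<Longrightarrow> (1 + t) ^ ?d \<le> M * exp (c / 2 * t)"
    using power_le_exp[of "c/2" ?d] c by auto
  have "(\<integral>\<^sup>+x. edecay c (x::'a) \<partial>lborel)
      \<le> (\<integral>\<^sup>+x. (\<Sum>k. ennreal (exp (- (c * real k))) * indicator (ball (0::'a) (1 + real k)) x) \<partial>lborel)"
  proof (intro nn_integral_mono)
    fix x :: 'a
    define k where "k = nat \<lfloor>norm x\<rfloor>"
    have k: "real k \<le> norm x" "norm x < 1 + real k"
      unfolding k_def by (auto simp: of_nat_floor) linarith
    have "edecay c x \<le> ennreal (exp (- (c * real k))) * indicator (ball (0::'a) (1 + real k)) x"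
      using k c by (auto simp: edecay_def intro!: ennreal_leI)
    also have "\<dots> \<le> (\<Sum>k. ennreal (exp (- (c * real k))) * indicator (ball (0::'a) (1 + real k)) x)"
      using sum_le_suminf[of "\<lambda>k. ennreal (exp (- (c * real k))) * indicator (ball (0::'a) (1 + real k)) x" "{k}"]
      by (simp del: sum_mult_indicator sum_ennreal)
    finally show "edecay c x \<le> \<dots>" .
  qed
  also have "\<dots> = (\<Sum>k. ennreal (exp (- (c * real k))) * emeasure lborel (ball (0::'a) (1 + real k)))"
    by (subst nn_integral_suminf) (auto simp: nn_integral_cmult_indicator intro!: borel_measurable_times_ennreal borel_measurable_indicator)
  also have "\<dots> = (\<Sum>k. ennreal (exp (- (c * real k)) * (?V * (1 + real k) ^ ?d)))"
    by (simp add: emeasure_ball ennreal_mult)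
  also have "\<dots> \<le> (\<Sum>k. ennreal (?V * M * exp (- (c / 2)) ^ k))"
  proof (intro suminf_le ennreal_leI)
    fix k :: nat
    have "exp (- (c * real k)) * (?V * (1 + real k) ^ ?d)
        \<le> exp (- (c * real k)) * (?V * (M * exp (c / 2 * real k)))"
      by (intro mult_left_mono M) auto
    also have "\<dots> = ?V * M * exp (- (c / 2) * real k)"
      by (simp add: exp_add[symmetric] mult.left_commute)
    also have "exp (- (c / 2) * real k) = exp (- (c / 2)) ^ k"
      by (simp add: exp_of_nat_mult[symmetric] mult.commute)
    finally show "exp (- (c * real k)) * (?V * (1 + real k) ^ ?d) \<le> ?V * M * exp (- (c / 2)) ^ k" .
  qed auto
  also have "\<dots> < \<infinity>"
  proof -
    have "summable (\<lambda>k. ?V * M * exp (- (c / 2)) ^ k)"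
      using c by (intro summable_mult summable_geometric) auto
    moreover have "0 \<le> ?V * M * exp (- (c / 2)) ^ k" for k using M by simp
    ultimately show ?thesis
      by (subst suminf_ennreal_eq[OF _ summable_sums]) auto
  qed
  finally show ?thesis .
qed

section \<open>Submultiplicative weights and weighted integrals\<close>

locale submult_weight =
  fixes w :: "'a::euclidean_space \<Rightarrow> real"
  assumes cont: "continuous_on UNIV w"
    and pos: "\<And>z. 0 < w z"
    and even: "\<And>z. w (- z) = w z"
    and submult: "\<And>z z'. w (z + z') \<le> w z * w z'"
    and poly: "\<exists>C N. \<forall>z. w z \<le> C * (1 + norm z) ^ N"
begin

lemma w_measurable [measurable]: "w \<in> borel_measurable borel"
  using cont by (rule borel_measurable_continuous_onI)

text \<open>Submultiplicativity at 0 gives w 0 \<ge> 1, and evenness turns w 0 \<le> w z * w (- z)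
  into w 0 \<le> (w z)^2.\<close>

lemma w_ge_1: "1 \<le> w z"
proof -
  have "1 * w 0 \<le> w 0 * w 0" using submult[of 0 0] by simp
  then have "1 \<le> w 0" using pos[of 0] by (rule mult_right_le_imp_le)
  also have "\<dots> \<le> w z * w (- z)" using submult[of z "- z"] by simp
  finally have "1 \<le> w z * w z" unfolding even .
  then show ?thesis using mult_strict_mono[of "w z" 1 "w z" 1] pos[of z] by linarith
qed

text \<open>The rate c is arbitrary: the cut-offs decay only like exp(-|z| / L) with L large, and
  still have to dominate the weight.\<close>

lemma w_exp_bound:
  assumes "0 < c"
  shows "\<exists>M\<ge>1. \<forall>z. w z \<le> M * exp (c * norm z)"
proof -
  obtain C N where C: "\<And>z. w z \<le> C * (1 + norm z) ^ N" using poly by blast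
  obtain M where M: "0 < M" "\<And>t. 0 \<le> t \<Longrightarrow> (1 + t) ^ N \<le> M * exp (c * t)"
    using power_le_exp[OF assms, of N] by auto
  have C0: "0 < C" using C[of 0] pos[of 0] by simp
  have le: "w z \<le> (C * M) * exp (c * norm z)" for z
  proof -
    have "w z \<le> C * (1 + norm z) ^ N" by (rule C)
    also have "\<dots> \<le> C * (M * exp (c * norm z))"
      using C0 by (intro mult_left_mono M) auto
    finally show ?thesis by simp
  qed
  moreover have "1 \<le> C * M" using le[of 0] w_ge_1[of 0] by simp
  ultimately show ?thesis by blast
qed

lemma slow_w: "\<exists>D. slow D 1 (\<lambda>z. ennreal (w z))"
proof -
  obtain D where D: "1 \<le> D" "\<And>z. w z \<le> D * exp (1 * norm z)"
    using w_exp_bound[of 1] by auto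
  have "w x \<le> D * exp (1 * norm (x - y)) * w y" for x y
  proof -
    have "w x \<le> w (x - y) * w y" using submult[of "x - y" y] by simp
    also have "\<dots> \<le> D * exp (1 * norm (x - y)) * w y"
      using pos[of y] by (intro mult_right_mono D) auto
    finally show ?thesis .
  qed
  then have "slow D 1 (\<lambda>z. ennreal (w z))"
    using D(1) pos unfolding slow_def
    by (auto simp: ennreal_mult[symmetric] less_imp_le intro!: ennreal_leI)
  then show ?thesis ..
qed

definition wint :: "('a \<Rightarrow> ennreal) \<Rightarrow> ennreal" where
  "wint b = (\<integral>\<^sup>+z. b z * ennreal (w z) \<partial>lborel)"

lemma ennreal_w_submult: "ennreal (w (x + y)) \<le> ennreal (w x) * ennreal (w y)"
  using submult[of x y] pos by (simp add: ennreal_mult[symmetric] less_imp_le ennreal_leI)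

lemma nn_integral_le_wint: "(\<integral>\<^sup>+z. b z \<partial>lborel) \<le> wint b"
  unfolding wint_def
proof (intro nn_integral_mono)
  fix z
  have "b z * 1 \<le> b z * ennreal (w z)"
    using w_ge_1[of z] ennreal_leI[of 1 "w z"] by (intro mult_left_mono) auto
  then show "b z \<le> b z * ennreal (w z)" by simp
qed

lemma wint_mono: "(\<And>x. b x \<le> b' x) \<Longrightarrow> wint b \<le> wint b'"
  unfolding wint_def by (intro nn_integral_mono mult_right_mono) auto

lemma wint_cmult: "b \<in> borel_measurable borel \<Longrightarrow> wint (\<lambda>x. c * b x) = c * wint b"
  unfolding wint_def by (subst nn_integral_cmult[symmetric]) (auto simp: mult_ac)

lemma wint_add:
  "b \<in> borel_measurable borel \<Longrightarrow> b' \<in> borel_measurable borel \<Longrightarrow>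
    wint (\<lambda>x. b x + b' x) = wint b + wint b'"
  unfolding wint_def by (subst nn_integral_add[symmetric]) (auto simp: distrib_right)

lemma wint_reflect:
  assumes [measurable]: "b \<in> borel_measurable borel"
  shows "wint (\<lambda>x. b (- x)) = wint b"
proof -
  have "wint (\<lambda>x. b (- x)) = (\<integral>\<^sup>+z. b (- z) * ennreal (w (- z)) \<partial>lborel)"
    unfolding wint_def by (simp only: even)
  also have "\<dots> = wint b"
    unfolding wint_def by (rule nn_integral_lborel_shift) measurable
  finally show ?thesis .
qed

lemma wint_shift_le:
  assumes [measurable]: "b \<in> borel_measurable borel"
  shows "wint (\<lambda>x. b (x - a)) \<le> ennreal (w a) * wint b"
proof -
  have "wint (\<lambda>x. b (x - a)) = (\<integral>\<^sup>+z. b (z + a - a) * ennreal (w (z + a)) \<partial>lborel)"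
    unfolding wint_def by (rule nn_integral_lborel_shift(2)[symmetric]) measurable
  also have "\<dots> \<le> (\<integral>\<^sup>+z. ennreal (w a) * (b z * ennreal (w z)) \<partial>lborel)"
  proof (intro nn_integral_mono)
    fix z
    show "b (z + a - a) * ennreal (w (z + a)) \<le> ennreal (w a) * (b z * ennreal (w z))"
      using mult_left_mono[OF ennreal_w_submult[of z a], of "b z"] by (simp add: mult_ac)
  qed
  also have "\<dots> = ennreal (w a) * wint b"
    unfolding wint_def by (rule nn_integral_cmult) measurable
  finally show ?thesis .
qed

text \<open>Functions integrable against a submultiplicative weight form a convolution algebra,
  because w x \<le> w y * w (x - y).\<close>

lemma wint_conv:
  assumes [measurable]: "a \<in> borel_measurable borel" "b \<in> borel_measurable borel"
  shows "wint (conv a b) \<le> wint a * wint b"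
proof -
  have "wint (conv a b) = (\<integral>\<^sup>+x. \<integral>\<^sup>+y. a y * b (x - y) * ennreal (w x) \<partial>lborel \<partial>lborel)"
    unfolding wint_def conv_def by (intro nn_integral_cong nn_integral_multc[symmetric]) measurable
  also have "\<dots> = (\<integral>\<^sup>+y. \<integral>\<^sup>+x. a y * b (x - y) * ennreal (w x) \<partial>lborel \<partial>lborel)"
    by (rule lborel_pair.Fubini') measurable
  also have "\<dots> = (\<integral>\<^sup>+y. a y * wint (\<lambda>x. b (x - y)) \<partial>lborel)"
    unfolding wint_def by (subst nn_integral_cmult[symmetric]) (auto simp: mult_ac)
  also have "\<dots> \<le> (\<integral>\<^sup>+y. a y * ennreal (w y) * wint b \<partial>lborel)"
    unfolding mult.assoc by (intro nn_integral_mono mult_left_mono wint_shift_le) auto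
  also have "\<dots> = wint a * wint b"
    unfolding wint_def[of a] by (rule nn_integral_multc) measurable
  finally show ?thesis .
qed

lemma wint_edecay_finite:
  assumes "0 < c"
  shows "wint (edecay c) < \<infinity>"
proof -
  obtain M where M: "1 \<le> M" "\<And>z. w z \<le> M * exp (c/2 * norm z)"
    using w_exp_bound[of "c/2"] assms by auto
  have "wint (edecay c) \<le> (\<integral>\<^sup>+z. ennreal M * edecay (c/2) (z::'a) \<partial>lborel)"
    unfolding wint_def
  proof (intro nn_integral_mono)
    fix z
    have "exp (- (c * norm z)) * w z \<le> exp (- (c * norm z)) * (M * exp (c/2 * norm z))"
      by (intro mult_left_mono M) auto
    also have "\<dots> = M * exp (- (c/2 * norm z))"
      by (simp add: exp_add[symmetric] mult.left_commute)
    finally show "edecay c z * ennreal (w z) \<le> ennreal M * edecay (c/2) z"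
      using M(1) pos[of z] by (simp add: edecay_def ennreal_mult[symmetric] ennreal_leI)
  qed
  also have "\<dots> < \<infinity>"
    using nn_integral_edecay_finite[of "c/2"] assms
    by (subst nn_integral_cmult) (auto simp: ennreal_mult_less_top)
  finally show ?thesis .
qed

text \<open>Dominated convergence. The limit is asked for only where b is finite, which is almost
  everywhere since w is positive.\<close>

lemma wint_tendsto_zero:
  assumes [measurable]: "b \<in> borel_measurable borel" and b: "wint b < \<infinity>"
    and [measurable]: "\<And>n. q n \<in> borel_measurable borel" and q: "\<And>n x. q n x \<le> b x"
    and lim: "\<And>x. b x < \<infinity> \<Longrightarrow> (\<lambda>n. q n x) \<longlonglongrightarrow> 0"
  shows "(\<lambda>n. wint (q n)) \<longlonglongrightarrow> 0"
proof -
  have fin: "AE x in lborel. b x * ennreal (w x) \<noteq> \<infinity>"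
    using b unfolding wint_def by (intro nn_integral_PInf_AE) auto
  have "(\<lambda>n. \<integral>\<^sup>+x. q n x * ennreal (w x) \<partial>lborel) \<longlonglongrightarrow> (\<integral>\<^sup>+x. 0 \<partial>(lborel :: 'a measure))"
  proof (rule nn_integral_dominated_convergence[where w = "\<lambda>x. b x * ennreal (w x)"])
    show "AE x in lborel. (\<lambda>n. q n x * ennreal (w x)) \<longlonglongrightarrow> 0"
      using fin
    proof eventually_elim
      case (elim x)
      then have "b x < \<infinity>" using pos[of x] by (auto simp: ennreal_mult_eq_top_iff less_top)
      from ennreal_tendsto_cmult[OF _ lim[OF this], of "ennreal (w x)"] show ?case
        by (simp add: mult.commute)
    qed
  qed (use b in \<open>auto simp: wint_def intro!: mult_right_mono q\<close>)
  then show ?thesis by (simp add: wint_def)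
qed

text \<open>The source of smallness for large L: it makes the commutator and the tails of the
  symbols absorbable.\<close>

lemma wint_rho_small:
  assumes [measurable]: "b \<in> borel_measurable borel" and b: "wint b < \<infinity>" and "0 < \<delta>"
  shows "\<exists>N. \<forall>n\<ge>N. wint (\<lambda>x. rho (real (Suc n)) x * b x) \<le> ennreal \<delta>"
proof -
  have "(\<lambda>n. wint (\<lambda>x. rho (real (Suc n)) x * b x)) \<longlonglongrightarrow> 0"
  proof (rule wint_tendsto_zero[OF _ b])
    fix x assume fin: "b x < \<infinity>"
    have "(\<lambda>n. min 1 ((1 + norm x) / real (Suc n))) \<longlonglongrightarrow> min 1 0"
      by (intro tendsto_min tendsto_const LIMSEQ_Suc[OF lim_const_over_n])
    then have "(\<lambda>n. rho (real (Suc n)) x) \<longlonglongrightarrow> 0"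
      unfolding rho_def using tendsto_ennrealI by fastforce
    from ennreal_tendsto_cmult[OF fin[simplified] this]
    show "(\<lambda>n. rho (real (Suc n)) x * b x) \<longlonglongrightarrow> 0" by (simp add: mult.commute)
  next
    fix n x show "rho (real (Suc n)) x * b x \<le> b x"
      using mult_right_mono[OF rho_le_1, of "b x" "real (Suc n)" x] by simp
  qed auto
  then have "eventually (\<lambda>n. wint (\<lambda>x. rho (real (Suc n)) x * b x) < ennreal \<delta>) sequentially"
    using assms by (intro order_tendstoD) auto
  then show ?thesis by (auto simp: eventually_sequentially intro: less_imp_le)
qed

text \<open>The source of smallness for small epsilon on the part of the symbol below the splitting
  height.\<close>

lemma wint_min_small:
  assumes [measurable]: "b \<in> borel_measurable borel" and b: "wint b < \<infinity>" and "0 < \<delta>"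
  shows "\<exists>\<tau>>0. wint (\<lambda>x. min (b x) (ennreal \<tau>)) \<le> ennreal \<delta>"
proof -
  have "(\<lambda>n. wint (\<lambda>x. min (b x) (ennreal (1 / real (Suc n))))) \<longlonglongrightarrow> 0"
  proof (rule wint_tendsto_zero[OF _ b])
    fix x
    have "(\<lambda>n. ennreal (1 / real (Suc n))) \<longlonglongrightarrow> ennreal 0"
      by (intro tendsto_ennrealI LIMSEQ_Suc[OF lim_const_over_n])
    then have "(\<lambda>n. min (b x) (ennreal (1 / real (Suc n)))) \<longlonglongrightarrow> min (b x) (ennreal 0)"
      by (intro tendsto_min tendsto_const)
    then show "(\<lambda>n. min (b x) (ennreal (1 / real (Suc n)))) \<longlonglongrightarrow> 0" by simp
  qed auto
  then have "eventually (\<lambda>n. wint (\<lambda>x. min (b x) (ennreal (1 / real (Suc n)))) < ennreal \<delta>) sequentially"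
    using assms by (intro order_tendstoD) auto
  then obtain n where "wint (\<lambda>x. min (b x) (ennreal (1 / real (Suc n)))) < ennreal \<delta>"
    by (auto simp: eventually_sequentially)
  then show ?thesis by (intro exI[of _ "1 / real (Suc n)"]) (auto intro: less_imp_le)
qed

end

section \<open>The Plancherel formula\<close>

lemma measurable_cnj [measurable (raw)]:
  "f \<in> borel_measurable M \<Longrightarrow> (\<lambda>x. cnj (f x)) \<in> borel_measurable M"
  by (rule borel_measurable_continuous_on[where f = cnj]) (auto intro!: continuous_intros)

lemma borel_measurable_fst_snd [measurable (raw)]:
  fixes f :: "'a \<Rightarrow> 'b::second_countable_topology \<times> 'c::second_countable_topology"
  assumes "f \<in> borel_measurable M"
  shows "(\<lambda>x. fst (f x)) \<in> borel_measurable M" "(\<lambda>x. snd (f x)) \<in> borel_measurable M"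
  using assms by (auto intro!: borel_measurable_continuous_on[where f = fst] borel_measurable_continuous_on[where f = snd] continuous_intros)

lemma lborel_integral_affine:
  fixes f :: "'a::euclidean_space \<Rightarrow> 'b::{banach, second_countable_topology}"
  assumes [measurable]: "f \<in> borel_measurable borel" and c: "c \<noteq> 0"
  shows "(LINT x|lborel. f x) = \<bar>c\<bar> ^ DIM('a) *\<^sub>R (LINT x|lborel. f (a + c *\<^sub>R x))"
  using c by (subst lborel_affine[OF c, of a])
    (simp add: integral_density integral_distr ennreal_power)

lemma integrable_pairI:
  fixes F :: "'a::euclidean_space \<times> 'b::euclidean_space \<Rightarrow> 'c::{banach, second_countable_topology}"
  assumes [measurable]: "F \<in> borel_measurable borel"
    and "(\<integral>\<^sup>+x. \<integral>\<^sup>+y. ennreal (norm (F (x, y))) \<partial>lborel \<partial>lborel) < \<infinity>"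
  shows "integrable (lborel \<Otimes>\<^sub>M lborel) F"
proof (rule integrableI_bounded)
  show m [measurable]: "F \<in> borel_measurable (lborel \<Otimes>\<^sub>M lborel)"
    by (simp add: lborel_prod)
  show "(\<integral>\<^sup>+p. ennreal (norm (F p)) \<partial>(lborel \<Otimes>\<^sub>M lborel)) < \<infinity>"
    using assms(2) by (subst lborel.nn_integral_fst[symmetric]) auto
qed

lemma measurable_cis [measurable]: "cis \<in> borel_measurable borel"
  by (intro borel_measurable_continuous_onI continuous_intros)

section \<open>Fourier transforms of Gaussians\<close>

lemma gauss_fourier_1d:
  fixes a s :: real
  assumes a: "0 < a"
  shows "integrable lborel (\<lambda>x. complex_of_real (exp (- pi * a * x^2)) * cis (2 * pi * (x * s)))"
    and "(LINT x|lborel. complex_of_real (exp (- pi * a * x^2)) * cis (2 * pi * (x * s)))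
      = complex_of_real (exp (- pi * s^2 / a) / sqrt a)"
proof -
  \<comment> \<open>Scaling by c turns the Gaussian into the standard normal density, and r is the
    frequency that s becomes; the value is then read off the characteristic function of the normal
    distribution.\<close>
  define c where "c = sqrt (2 * pi * a)"
  have c: "0 < c" "c^2 = 2 * pi * a" using a by (auto simp: c_def)
  define r where "r = 2 * pi * s / c"
  let ?h = "\<lambda>x. complex_of_real (std_normal_density x) * cis (r * x)"
  have sc: "sqrt (2 * pi) * sqrt a = c" by (simp add: c_def real_sqrt_mult)
  have eq: "?h (0 + c * x) = complex_of_real (1 / sqrt (2 * pi)) * (complex_of_real (exp (- pi * a * x^2)) * cis (2 * pi * (x * s)))" for x
  proof -
    have 1: "- (0 + c * x)\<^sup>2 / 2 = - pi * a * x^2" by (simp add: power_mult_distrib c)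
    have 2: "r * (0 + c * x) = 2 * pi * (x * s)" using c by (simp add: r_def)
    show ?thesis
      unfolding std_normal_density_def 1 2 of_real_mult mult.assoc ..
  qed
  have int: "integrable lborel ?h"
  proof (rule Bochner_Integration.integrable_bound)
    show "integrable lborel std_normal_density" by (rule integrable_normal_density) simp
  qed (auto simp: norm_mult)
  then have int': "integrable lborel (\<lambda>x. ?h (0 + c * x))"
    by (rule lborel_integrable_real_affine) (use c in auto)
  then show "integrable lborel (\<lambda>x. complex_of_real (exp (- pi * a * x^2)) * cis (2 * pi * (x * s)))"
  proof -
    assume "integrable lborel (\<lambda>x. ?h (0 + c * x))"
    then have "integrable lborel (\<lambda>x. complex_of_real (sqrt (2 * pi)) * ?h (0 + c * x))"
      by (rule integrable_mult_right)
    moreover have "complex_of_real (sqrt (2 * pi)) * (complex_of_real (1 / sqrt (2 * pi)) * y) = y" for y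
      by (simp flip: mult.assoc of_real_mult)
    ultimately show ?thesis unfolding eq by simp
  qed
  have "complex_of_real (exp (- (r^2) / 2)) = char std_normal_distribution r"
    by (simp add: char_std_normal_distribution)
  also have "\<dots> = (LINT x|lborel. ?h x)"
    unfolding char_def by (subst integral_density) (auto simp: cis_conv_exp scaleR_conv_of_real)
  also have "\<dots> = c *\<^sub>R (LINT x|lborel. ?h (0 + c * x))"
    using c by (subst lborel_integral_real_affine[of c _ 0]) auto
  also have "\<dots> = of_real (c / sqrt (2 * pi)) * (LINT x|lborel. complex_of_real (exp (- pi * a * x^2)) * cis (2 * pi * (x * s)))"
    unfolding eq by (simp add: scaleR_conv_of_real)
  also have "c / sqrt (2 * pi) = sqrt a" using sc by (simp add: field_simps)
  also have "- (r^2) / 2 = - pi * s^2 / a"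
    unfolding r_def by (simp add: power_divide power_mult_distrib c) (simp add: power2_eq_square)
  finally show "(LINT x|lborel. complex_of_real (exp (- pi * a * x^2)) * cis (2 * pi * (x * s)))
      = complex_of_real (exp (- pi * s^2 / a) / sqrt a)"
    using a by (simp add: field_simps)
qed

lemma cis_sum: "finite A \<Longrightarrow> cis (\<Sum>i\<in>A. f i) = (\<Prod>i\<in>A. cis (f i))"
  by (induction A rule: finite_induct) (auto simp: cis_mult[symmetric])

interpretation lborel_product: product_sigma_finite "\<lambda>_. lborel :: real measure" ..

text \<open>Lebesgue measure is the image of the product measure under orthonormal coordinates, in
  which both the Gaussian and the character split into one-dimensional factors.\<close>

lemma gauss_fourier:
  fixes s :: "'a::euclidean_space"
  assumes a: "0 < a"
  shows "integrable lborel (\<lambda>x::'a. exp (- pi * a * (norm x)^2))"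
    and "(LINT x|lborel. complex_of_real (exp (- pi * a * (norm x)^2)) * cis (2 * pi * (x \<bullet> s)))
      = complex_of_real (exp (- pi * (norm s)^2 / a) / (sqrt a) ^ DIM('a))"
proof -
  let ?P = "\<Pi>\<^sub>M b\<in>(Basis::'a set). (lborel :: real measure)"
  let ?T = "\<lambda>f. \<Sum>b\<in>(Basis::'a set). f b *\<^sub>R b"
  have T [measurable]: "?T \<in> ?P \<rightarrow>\<^sub>M borel" by measurable
  have eq: "complex_of_real (exp (- pi * a * (norm (?T f))^2)) * cis (2 * pi * (?T f \<bullet> s))
      = (\<Prod>b\<in>Basis. complex_of_real (exp (- pi * a * (f b)^2)) * cis (2 * pi * (f b * (b \<bullet> s))))"
    for f and s :: 'a
  proof -
    have "(norm (?T f))^2 = (\<Sum>b\<in>Basis. (f b)^2)"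
      unfolding power2_norm_eq_inner
      by (subst euclidean_inner, intro sum.cong) (auto simp: inner_sum_left_Basis power2_eq_square)
    then have 1: "exp (- pi * a * (norm (?T f))^2) = (\<Prod>b\<in>Basis. exp (- pi * a * (f b)^2))"
      by (simp add: sum_distrib_left exp_sum)
    have "2 * pi * (?T f \<bullet> s) = (\<Sum>b\<in>Basis. 2 * pi * (f b * (b \<bullet> s)))"
      by (simp add: inner_sum_left sum_distrib_left)
    then have 2: "cis (2 * pi * (?T f \<bullet> s)) = (\<Prod>b\<in>Basis. cis (2 * pi * (f b * (b \<bullet> s))))"
      by (simp add: cis_sum)
    show ?thesis unfolding 1 2 by (simp add: prod.distrib)
  qed
  let ?g = "\<lambda>s b x. complex_of_real (exp (- pi * a * x^2)) * cis (2 * pi * (x * (b \<bullet> (s::'a))))"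
  have "integrable ?P (\<lambda>f. \<Prod>b\<in>Basis. ?g s b (f b))" for s
    by (rule lborel_product.product_integrable_prod[OF finite_Basis gauss_fourier_1d(1)[OF a]])
  then have "integrable lborel (\<lambda>x::'a. complex_of_real (exp (- pi * a * (norm x)^2)) * cis (2 * pi * (x \<bullet> s)))" for s
    by (subst lborel_eq, subst integrable_distr_eq) (measurable, simp only: eq)
  from this[of 0] show "integrable lborel (\<lambda>x::'a. exp (- pi * a * (norm x)^2))"
    by (simp add: complex_of_real_integrable_eq del: of_real_exp)
  have "(LINT x|lborel. complex_of_real (exp (- pi * a * (norm x)^2)) * cis (2 * pi * (x \<bullet> s)))
      = (LINT f|?P. (\<Prod>b\<in>Basis. ?g s b (f b)))"
    by (subst lborel_eq, subst integral_distr) (measurable, simp only: eq)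
  also have "\<dots> = (\<Prod>b\<in>Basis. LINT x|lborel. ?g s b x)"
    by (rule lborel_product.product_integral_prod[OF finite_Basis gauss_fourier_1d(1)[OF a]])
  also have "\<dots> = (\<Prod>b\<in>Basis. complex_of_real (exp (- pi * (b \<bullet> s)^2 / a) / sqrt a))"
    by (simp only: gauss_fourier_1d(2)[OF a])
  also have "\<dots> = complex_of_real (\<Prod>b\<in>Basis. exp (- pi * (b \<bullet> s)^2 / a) / sqrt a)"
    by simp
  also have "(\<Prod>b\<in>Basis. exp (- pi * (b \<bullet> s)^2 / a) / sqrt a) = (\<Prod>b\<in>(Basis::'a set). exp (- pi * (b \<bullet> s)^2 / a)) / (sqrt a) ^ DIM('a)"
    by (simp add: prod_dividef)
  also have "(\<Prod>b\<in>(Basis::'a set). exp (- pi * (b \<bullet> s)^2 / a)) = exp (\<Sum>b\<in>(Basis::'a set). - pi * (b \<bullet> s)^2 / a)"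
    by (simp add: exp_sum)
  also have "(\<Sum>b\<in>(Basis::'a set). - pi * (b \<bullet> s)^2 / a) = - pi * (norm s)^2 / a"
    unfolding power2_norm_eq_inner
    by (subst euclidean_inner) (simp add: inner_commute power2_eq_square sum_distrib_left sum_divide_distrib)
  finally show "(LINT x|lborel. complex_of_real (exp (- pi * a * (norm x)^2)) * cis (2 * pi * (x \<bullet> s)))
      = complex_of_real (exp (- pi * (norm s)^2 / a) / (sqrt a) ^ DIM('a))" .
qed

section \<open>Continuity of translations in L1 and L2\<close>

definition translation_continuous :: "nat \<Rightarrow> ('a::euclidean_space \<Rightarrow> 'b::real_normed_vector) \<Rightarrow> bool" where
  "translation_continuous r f \<longleftrightarrow> (\<forall>u. u \<longlonglongrightarrow> 0 \<longrightarrow>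
    (\<lambda>n. \<integral>\<^sup>+t. ennreal (norm (f (t - u n) - f t) ^ r) \<partial>lborel) \<longlonglongrightarrow> 0)"

lemma power_add3_le:
  fixes x y z :: real
  assumes "0 \<le> x" "0 \<le> y" "0 \<le> z"
  shows "(x + y + z) ^ r \<le> 3 ^ r * (x ^ r + y ^ r + z ^ r)"
proof -
  define m where "m = max x (max y z)"
  have "(x + y + z) ^ r \<le> (3 * m) ^ r" using assms by (intro power_mono) (auto simp: m_def)
  also have "m ^ r \<le> x ^ r + y ^ r + z ^ r"
    using assms by (auto simp: m_def max_def)
  then have "(3 * m) ^ r \<le> 3 ^ r * (x ^ r + y ^ r + z ^ r)"
    by (simp add: power_mult_distrib)
  finally show ?thesis .
qed

text \<open>A three-term estimate: f is compared with g before and after the shift, and translation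
  invariance makes these two errors equal.\<close>

lemma translation_continuous_approx:
  fixes f :: "'a::euclidean_space \<Rightarrow> 'b::{banach, second_countable_topology}"
  assumes [measurable]: "f \<in> borel_measurable borel"
    and approx: "\<And>\<epsilon>. 0 < \<epsilon> \<Longrightarrow> \<exists>g. g \<in> borel_measurable borel \<and> translation_continuous r g
      \<and> (\<integral>\<^sup>+t. ennreal (norm (f t - g t) ^ r) \<partial>lborel) \<le> ennreal \<epsilon>"
  shows "translation_continuous r f"
  unfolding translation_continuous_def
proof (intro allI impI)
  fix u :: "nat \<Rightarrow> 'a" assume u: "u \<longlonglongrightarrow> 0"
  let ?I = "\<lambda>f n. \<integral>\<^sup>+t. ennreal (norm (f (t - u n) - f t) ^ r) \<partial>lborel"
  show "?I f \<longlonglongrightarrow> 0"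
    unfolding order_tendsto_iff
  proof safe
    fix e :: ennreal assume "0 < e"
    then obtain \<epsilon> where \<epsilon>: "0 < \<epsilon>" "ennreal \<epsilon> < e" by (metis ennreal_0 dense ennreal_less_zero_iff ennreal_cases less_le_trans top_greatest order.strict_trans less_top)
    \<comment> \<open>Three errors of size d, multiplied by the factor 3^r of
      \<open>power_add3_le\<close>, add up to \<epsilon>.\<close>
    define d where "d = \<epsilon> / (3 * 3 ^ r)"
    have d: "0 < d" using \<epsilon> by (simp add: d_def)
    obtain g where [measurable]: "g \<in> borel_measurable borel" and g: "translation_continuous r g"
      and fg: "(\<integral>\<^sup>+t. ennreal (norm (f t - g t) ^ r) \<partial>lborel) \<le> ennreal d"
      using approx[OF d] by blast
    have "eventually (\<lambda>n. ?I g n < ennreal d) sequentially"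
      using g u d by (intro order_tendstoD) (auto simp: translation_continuous_def)
    then show "eventually (\<lambda>n. ?I f n < e) sequentially"
    proof eventually_elim
      case (elim n)
      have "?I f n \<le> (\<integral>\<^sup>+t. ennreal (3 ^ r) * (ennreal (norm (f (t - u n) - g (t - u n)) ^ r)
          + ennreal (norm (g (t - u n) - g t) ^ r) + ennreal (norm (f t - g t) ^ r)) \<partial>lborel)"
      proof (intro nn_integral_mono)
        fix t
        have "norm (f (t - u n) - f t)
            = norm ((f (t - u n) - g (t - u n)) + (g (t - u n) - g t) + (g t - f t))"
          by simp
        also have "\<dots> \<le> norm (f (t - u n) - g (t - u n)) + norm (g (t - u n) - g t) + norm (f t - g t)"
          by (metis norm_triangle_mono norm_triangle_ineq norm_minus_commute order_refl)
        finally have "norm (f (t - u n) - f t) ^ r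
          \<le> (norm (f (t - u n) - g (t - u n)) + norm (g (t - u n) - g t) + norm (f t - g t)) ^ r"
          by (intro power_mono) auto
        also have "\<dots> \<le> 3 ^ r * (norm (f (t - u n) - g (t - u n)) ^ r + norm (g (t - u n) - g t) ^ r + norm (f t - g t) ^ r)"
          by (intro power_add3_le) auto
        finally show "ennreal (norm (f (t - u n) - f t) ^ r) \<le> ennreal (3 ^ r) * (ennreal (norm (f (t - u n) - g (t - u n)) ^ r)
          + ennreal (norm (g (t - u n) - g t) ^ r) + ennreal (norm (f t - g t) ^ r))"
          by (simp add: ennreal_mult[symmetric] ennreal_plus[symmetric] ennreal_leI del: ennreal_plus)
      qed
      also have "\<dots> = ennreal (3 ^ r) * ((\<integral>\<^sup>+t. ennreal (norm (f (t - u n) - g (t - u n)) ^ r) \<partial>lborel)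
          + ?I g n + (\<integral>\<^sup>+t. ennreal (norm (f t - g t) ^ r) \<partial>lborel))"
        by (simp add: nn_integral_cmult nn_integral_add)
      also have "(\<integral>\<^sup>+t. ennreal (norm (f (t - u n) - g (t - u n)) ^ r) \<partial>lborel)
          = (\<integral>\<^sup>+t. ennreal (norm (f t - g t) ^ r) \<partial>lborel)"
        by (rule nn_integral_lborel_shift) measurable
      also have "ennreal (3 ^ r) * (\<dots> + ?I g n + \<dots>) \<le> ennreal (3 ^ r) * (ennreal d + ennreal d + ennreal d)"
        using fg elim by (intro mult_left_mono add_mono) auto
      also have "\<dots> = ennreal \<epsilon>"
        using d by (simp add: ennreal_mult[symmetric] ennreal_plus[symmetric] del: ennreal_plus) (simp add: d_def)
      also have "\<dots> < e" by fact
      finally show ?case .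
    qed
  qed simp
qed

text \<open>A point of an open set stays in it under small shifts, so the part of S that a shift
  leaves uncovered has vanishing measure. The other half of the symmetric difference becomes the
  same quantity for - u after a translation.\<close>

lemma translation_continuous_open:
  fixes S :: "'a::euclidean_space set"
  assumes S: "open S" and fin: "emeasure lborel S < \<infinity>"
  shows "translation_continuous 1 (\<lambda>t. indicator S t *\<^sub>R (c::'b::{banach, second_countable_topology}))"
  unfolding translation_continuous_def
proof (intro allI impI)
  fix u :: "nat \<Rightarrow> 'a" assume u: "u \<longlonglongrightarrow> 0"
  have [measurable]: "S \<in> sets borel" using S by simp
  let ?f = "\<lambda>t. indicator S t *\<^sub>R c"
  let ?J = "\<lambda>u. \<integral>\<^sup>+t. indicator S t * indicator (- S) (t - u) * ennreal (norm c) \<partial>lborel"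
  have J: "(\<lambda>n. ?J (u n)) \<longlonglongrightarrow> 0" if u: "u \<longlonglongrightarrow> 0" for u :: "nat \<Rightarrow> 'a"
  proof -
    have "(\<lambda>n. ?J (u n)) \<longlonglongrightarrow> (\<integral>\<^sup>+t. 0 \<partial>(lborel :: 'a measure))"
    proof (rule nn_integral_dominated_convergence[where w = "\<lambda>t. indicator S t * ennreal (norm c)"])
      show "AE t in lborel. (\<lambda>n. indicator S t * indicator (- S) (t - u n) * ennreal (norm c)) \<longlonglongrightarrow> 0"
      proof (intro AE_I2)
        fix t
        show "(\<lambda>n. indicator S t * indicator (- S) (t - u n) * ennreal (norm c)) \<longlonglongrightarrow> 0"
        proof (cases "t \<in> S")
          case True
          have "(\<lambda>n. t - u n) \<longlonglongrightarrow> t - 0" using u by (intro tendsto_intros)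
          then have "eventually (\<lambda>n. t - u n \<in> S) sequentially"
            using topological_tendstoD[of "\<lambda>n. t - u n" t sequentially S] True S by simp
          then have "eventually (\<lambda>n. indicator S t * indicator (- S) (t - u n) * ennreal (norm c) = 0) sequentially"
            by eventually_elim auto
          then show ?thesis by (rule tendsto_eventually)
        qed auto
      qed
      show "(\<integral>\<^sup>+t. indicator S t * ennreal (norm c) \<partial>lborel) < \<infinity>"
        using fin by (simp add: nn_integral_multc ennreal_mult_less_top)
    qed (auto simp: indicator_def)
    then show ?thesis by simp
  qed
  have "(\<lambda>n. ?J (u n) + ?J (- u n)) \<longlonglongrightarrow> 0 + 0"
    using u tendsto_minus[OF u] by (intro tendsto_add J) auto
  moreover have "(\<integral>\<^sup>+t. ennreal (norm (?f (t - v) - ?f t) ^ 1) \<partial>lborel) = ?J v + ?J (- v)" for v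
  proof -
    have "?J (- v) = (\<integral>\<^sup>+t. indicator S (t - v) * indicator (- S) (t - v - (- v)) * ennreal (norm c) \<partial>lborel)"
      by (rule nn_integral_lborel_shift(1)[symmetric]) measurable
    then have "?J v + ?J (- v) = (\<integral>\<^sup>+t. indicator S t * indicator (- S) (t - v) * ennreal (norm c)
        + indicator S (t - v) * indicator (- S) t * ennreal (norm c) \<partial>lborel)"
      by (simp add: nn_integral_add)
    also have "\<dots> = (\<integral>\<^sup>+t. ennreal (norm (?f (t - v) - ?f t) ^ 1) \<partial>lborel)"
      by (intro nn_integral_cong) (auto simp: indicator_def)
    finally show ?thesis by simp
  qed
  ultimately show "(\<lambda>n. \<integral>\<^sup>+t. ennreal (norm (?f (t - u n) - ?f t) ^ 1) \<partial>lborel) \<longlonglongrightarrow> 0"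
    by simp
qed

text \<open>Induction over integrable functions: indicators reduce to open sets by outer regularity,
  and a sequence dominated by 2|f| that converges pointwise to f also converges in L1, so the
  approximation lemma applies again.\<close>

lemma translation_continuous_L1:
  fixes f :: "'a::euclidean_space \<Rightarrow> 'b::{banach, second_countable_topology}"
  assumes "integrable lborel f"
  shows "translation_continuous 1 f"
  using assms
proof (induction f rule: integrable_induct)
  case (base A c)
  then have A [measurable]: "A \<in> sets borel" by simp
  show ?case
  proof (rule translation_continuous_approx)
    fix \<epsilon> :: real assume \<epsilon>: "0 < \<epsilon>"
    \<comment> \<open>The added 1 avoids a zero denominator when c = 0.\<close>
    define d where "d = \<epsilon> / (norm c + 1)"
    have d: "0 < d" using \<epsilon> by (simp add: d_def add_nonneg_pos)
    have "A \<in> sets lebesgue" using A by (simp add: sets_completionI_sets)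
    from sets_lebesgue_outer_open[OF this d]
    obtain T where T: "open T" "A \<subseteq> T" "emeasure lebesgue (T - A) < ennreal d" by metis
    have [measurable]: "T \<in> sets borel" using T by simp
    have TA: "emeasure lborel (T - A) < ennreal d" using T by (simp add: emeasure_completion)
    have "emeasure lborel T \<le> emeasure lborel A + emeasure lborel (T - A)"
      using emeasure_subadditive[of A lborel "T - A"] T by (simp add: Un_absorb1)
    also have "\<dots> < \<infinity>" using base TA by (auto simp: less_top[symmetric])
    finally have "emeasure lborel T < \<infinity>" .
    then have "translation_continuous 1 (\<lambda>t. indicator T t *\<^sub>R c)"
      using T by (intro translation_continuous_open)
    moreover have "(\<integral>\<^sup>+t. ennreal (norm (indicator A t *\<^sub>R c - indicator T t *\<^sub>R c) ^ 1) \<partial>lborel)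
        = (\<integral>\<^sup>+t. indicator (T - A) t * ennreal (norm c) \<partial>lborel)"
      using T by (intro nn_integral_cong) (auto simp: indicator_def)
    moreover have "\<dots> \<le> ennreal d * ennreal (norm c)"
      using TA by (simp add: nn_integral_multc mult_right_mono)
    moreover have "ennreal d * ennreal (norm c) \<le> ennreal \<epsilon>"
      using d \<epsilon> by (simp add: ennreal_mult[symmetric]) (simp add: d_def divide_le_eq add_nonneg_pos)
    ultimately show "\<exists>g. g \<in> borel_measurable borel \<and> translation_continuous 1 g
      \<and> (\<integral>\<^sup>+t. ennreal (norm (indicator A t *\<^sub>R c - g t) ^ 1) \<partial>lborel) \<le> ennreal \<epsilon>"
      by (intro exI[of _ "\<lambda>t. indicator T t *\<^sub>R c"]) auto
  qed measurable
next
  case (add f g)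
  have [measurable]: "f \<in> borel_measurable borel" "g \<in> borel_measurable borel" using add by auto
  show ?case unfolding translation_continuous_def
  proof (intro allI impI)
    fix u :: "nat \<Rightarrow> 'a" assume u: "u \<longlonglongrightarrow> 0"
    let ?I = "\<lambda>f n. \<integral>\<^sup>+t. ennreal (norm (f (t - u n) - f t) ^ 1) \<partial>lborel"
    have "(\<lambda>n. ?I f n + ?I g n) \<longlonglongrightarrow> 0 + 0"
      using add u by (intro tendsto_add) (auto simp: translation_continuous_def)
    then have lim: "(\<lambda>n. ?I f n + ?I g n) \<longlonglongrightarrow> 0" by simp
    show "?I (\<lambda>x. f x + g x) \<longlonglongrightarrow> 0"
    proof (rule tendsto_sandwich[OF _ _ tendsto_const lim])
      show "eventually (\<lambda>n. ?I (\<lambda>x. f x + g x) n \<le> ?I f n + ?I g n) sequentially"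
      proof (intro always_eventually allI)
        fix n
        have "?I (\<lambda>x. f x + g x) n \<le> (\<integral>\<^sup>+t. ennreal (norm (f (t - u n) - f t) ^ 1) + ennreal (norm (g (t - u n) - g t) ^ 1) \<partial>lborel)"
        proof (intro nn_integral_mono)
          fix t
          have "norm ((f (t - u n) + g (t - u n)) - (f t + g t)) \<le> norm (f (t - u n) - f t) + norm (g (t - u n) - g t)"
            by (metis norm_diff_triangle_ineq)
          then show "ennreal (norm (f (t - u n) + g (t - u n) - (f t + g t)) ^ 1) \<le> ennreal (norm (f (t - u n) - f t) ^ 1) + ennreal (norm (g (t - u n) - g t) ^ 1)"
            by (simp add: ennreal_plus[symmetric] ennreal_leI del: ennreal_plus)
        qed
        also have "\<dots> = ?I f n + ?I g n" by (rule nn_integral_add) measurable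
        finally show "?I (\<lambda>x. f x + g x) n \<le> ?I f n + ?I g n" .
      qed
    qed auto
  qed
next
  case (lim f s)
  have [measurable]: "f \<in> borel_measurable borel" "\<And>i. s i \<in> borel_measurable borel" using lim by auto
  have lim_pt: "(\<lambda>i. s i t) \<longlonglongrightarrow> f t" and lim_bd: "norm (s i t) \<le> 2 * norm (f t)" for i t
    using lim.hyps by auto
  have f1: "integrable lborel f" by fact
  show ?case
  proof (rule translation_continuous_approx)
    fix \<epsilon> :: real assume \<epsilon>: "0 < \<epsilon>"
    have "(\<lambda>i. \<integral>\<^sup>+t. ennreal (norm (f t - s i t) ^ 1) \<partial>lborel) \<longlonglongrightarrow> (\<integral>\<^sup>+t. 0 \<partial>(lborel :: 'a measure))"
    proof (rule nn_integral_dominated_convergence[where w = "\<lambda>t. ennreal (3 * norm (f t))"])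
      show "AE t in lborel. ennreal (norm (f t - s i t) ^ 1) \<le> ennreal (3 * norm (f t))" for i
      proof (intro AE_I2 ennreal_leI)
        fix t show "norm (f t - s i t) ^ 1 \<le> 3 * norm (f t)"
          using lim_bd[of i t] norm_triangle_ineq4[of "f t" "s i t"] by simp
      qed
      show "(\<integral>\<^sup>+t. ennreal (3 * norm (f t)) \<partial>lborel) < \<infinity>"
        using f1 by (simp add: integrable_iff_bounded ennreal_mult nn_integral_cmult ennreal_mult_less_top)
      show "AE t in lborel. (\<lambda>i. ennreal (norm (f t - s i t) ^ 1)) \<longlonglongrightarrow> 0"
      proof (intro AE_I2)
        fix t
        have "(\<lambda>i. norm (f t - s i t)) \<longlonglongrightarrow> norm (f t - f t)"
          by (intro tendsto_intros lim_pt)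
        then show "(\<lambda>i. ennreal (norm (f t - s i t) ^ 1)) \<longlonglongrightarrow> 0"
          using tendsto_ennrealI by fastforce
      qed
    qed auto
    then have "eventually (\<lambda>i. (\<integral>\<^sup>+t. ennreal (norm (f t - s i t) ^ 1) \<partial>lborel) < ennreal \<epsilon>) sequentially"
      using \<epsilon> by (intro order_tendstoD) auto
    then obtain i where "(\<integral>\<^sup>+t. ennreal (norm (f t - s i t) ^ 1) \<partial>lborel) < ennreal \<epsilon>"
      by (auto simp: eventually_sequentially)
    then show "\<exists>g. g \<in> borel_measurable borel \<and> translation_continuous 1 g
      \<and> (\<integral>\<^sup>+t. ennreal (norm (f t - g t) ^ 1) \<partial>lborel) \<le> ennreal \<epsilon>"
      using lim.IH[of i] by (intro exI[of _ "s i"]) auto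
  qed measurable
qed

section \<open>Square integrals, autocorrelation and the Fourier transform\<close>

definition sqint :: "('a::euclidean_space \<Rightarrow> complex) \<Rightarrow> ennreal" where
  "sqint f = (\<integral>\<^sup>+t. ennreal ((cmod (f t))^2) \<partial>lborel)"

text \<open>Reduction to L1 by keeping only values of modulus between 1/n and n. Such a piece is
  integrable, since its modulus is at most n|f|^2 there, and bounded by n, so squared differences
  are at most 2n times differences.\<close>

lemma translation_continuous_L2:
  fixes f :: "'a::euclidean_space \<Rightarrow> complex"
  assumes [measurable]: "f \<in> borel_measurable borel" and fin: "sqint f < \<infinity>"
  shows "translation_continuous 2 f"
proof (rule translation_continuous_approx)
  fix \<epsilon> :: real assume \<epsilon>: "0 < \<epsilon>"
  define s where "s n t = (if cmod (f t) \<le> real n \<and> 1 \<le> real n * cmod (f t) then f t else 0)" for n t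
  have [measurable]: "s n \<in> borel_measurable borel" for n unfolding s_def by measurable
  have "(\<lambda>i. \<integral>\<^sup>+t. ennreal (norm (f t - s i t) ^ 2) \<partial>lborel) \<longlonglongrightarrow> (\<integral>\<^sup>+t. 0 \<partial>(lborel :: 'a measure))"
  proof (rule nn_integral_dominated_convergence[where w = "\<lambda>t. ennreal (norm (f t) ^ 2)"])
    show "AE t in lborel. (\<lambda>i. ennreal (norm (f t - s i t) ^ 2)) \<longlonglongrightarrow> 0"
    proof (intro AE_I2 tendsto_eventually)
      fix t
      show "eventually (\<lambda>i. ennreal (norm (f t - s i t) ^ 2) = 0) sequentially"
      proof (cases "f t = 0")
        case False
        have "eventually (\<lambda>n. cmod (f t) \<le> real n) sequentially"
          using filterlim_real_sequentially by (auto simp: filterlim_at_top)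
        moreover have "eventually (\<lambda>n. 1 / cmod (f t) \<le> real n) sequentially"
          using filterlim_real_sequentially by (auto simp: filterlim_at_top)
        ultimately show ?thesis
          by eventually_elim (use False in \<open>auto simp: s_def field_simps\<close>)
      qed (auto simp: s_def)
    qed
  qed (use fin in \<open>auto simp: s_def sqint_def\<close>)
  then have "eventually (\<lambda>i. (\<integral>\<^sup>+t. ennreal (norm (f t - s i t) ^ 2) \<partial>lborel) < ennreal \<epsilon>) sequentially"
    using \<epsilon> by (intro order_tendstoD) auto
  then obtain i where i: "(\<integral>\<^sup>+t. ennreal (norm (f t - s i t) ^ 2) \<partial>lborel) < ennreal \<epsilon>"
    by (auto simp: eventually_sequentially)
  have "(\<integral>\<^sup>+t. ennreal (norm (s i t)) \<partial>lborel) \<le> (\<integral>\<^sup>+t. ennreal (real i) * ennreal ((cmod (f t))^2) \<partial>lborel)"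
  proof (intro nn_integral_mono)
    fix t
    have "norm (s i t) \<le> real i * (cmod (f t))^2"
      using mult_right_mono[of 1 "real i * cmod (f t)" "cmod (f t)"]
      by (auto simp: s_def power2_eq_square mult.assoc)
    then show "ennreal (norm (s i t)) \<le> ennreal (real i) * ennreal ((cmod (f t))^2)"
      by (simp add: ennreal_mult[symmetric] ennreal_leI)
  qed
  also have "\<dots> < \<infinity>" using fin by (simp add: nn_integral_cmult sqint_def ennreal_mult_less_top)
  finally have "integrable lborel (s i)" by (simp add: integrable_iff_bounded)
  then have tc: "translation_continuous 1 (s i)" by (rule translation_continuous_L1)
  have "translation_continuous 2 (s i)"
    unfolding translation_continuous_def
  proof (intro allI impI)
    fix u :: "nat \<Rightarrow> 'a" assume "u \<longlonglongrightarrow> 0"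
    with tc have "(\<lambda>n. ennreal (2 * real i) * (\<integral>\<^sup>+t. ennreal (norm (s i (t - u n) - s i t) ^ 1) \<partial>lborel)) \<longlonglongrightarrow> ennreal (2 * real i) * 0"
      by (intro ennreal_tendsto_cmult) (auto simp: translation_continuous_def)
    then have lim: "(\<lambda>n. ennreal (2 * real i) * (\<integral>\<^sup>+t. ennreal (norm (s i (t - u n) - s i t) ^ 1) \<partial>lborel)) \<longlonglongrightarrow> 0"
      by simp
    show "(\<lambda>n. \<integral>\<^sup>+t. ennreal (norm (s i (t - u n) - s i t) ^ 2) \<partial>lborel) \<longlonglongrightarrow> 0"
    proof (rule tendsto_sandwich[OF _ _ tendsto_const lim])
      show "eventually (\<lambda>n. (\<integral>\<^sup>+t. ennreal (norm (s i (t - u n) - s i t) ^ 2) \<partial>lborel) \<le>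
         ennreal (2 * real i) * (\<integral>\<^sup>+t. ennreal (norm (s i (t - u n) - s i t) ^ 1) \<partial>lborel)) sequentially"
      proof (intro always_eventually allI)
        fix n
        have "(\<integral>\<^sup>+t. ennreal (norm (s i (t - u n) - s i t) ^ 2) \<partial>lborel)
          \<le> (\<integral>\<^sup>+t. ennreal (2 * real i) * ennreal (norm (s i (t - u n) - s i t) ^ 1) \<partial>lborel)"
        proof (intro nn_integral_mono)
          fix t
          have "cmod (s i v) \<le> real i" for v by (simp add: s_def)
          then have "norm (s i (t - u n) - s i t) \<le> 2 * real i"
            using norm_triangle_ineq4[of "s i (t - u n)" "s i t"] by (smt (verit))
          then have "norm (s i (t - u n) - s i t) ^ 2 \<le> 2 * real i * norm (s i (t - u n) - s i t)"
            unfolding power2_eq_square by (rule mult_right_mono) simp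
          then show "ennreal (norm (s i (t - u n) - s i t) ^ 2) \<le> ennreal (2 * real i) * ennreal (norm (s i (t - u n) - s i t) ^ 1)"
            by (subst ennreal_mult[symmetric]) (auto intro!: ennreal_leI)
        qed
        then show "(\<integral>\<^sup>+t. ennreal (norm (s i (t - u n) - s i t) ^ 2) \<partial>lborel) \<le>
         ennreal (2 * real i) * (\<integral>\<^sup>+t. ennreal (norm (s i (t - u n) - s i t) ^ 1) \<partial>lborel)"
          by (subst (asm) nn_integral_cmult) auto
      qed
    qed auto
  qed
  then show "\<exists>g. g \<in> borel_measurable borel \<and> translation_continuous 2 g
      \<and> (\<integral>\<^sup>+t. ennreal (norm (f t - g t) ^ 2) \<partial>lborel) \<le> ennreal \<epsilon>"
    using i by (intro exI[of _ "s i"]) auto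
qed measurable


lemma power2_tendsto_zero_iff_ennreal:
  fixes f :: "nat \<Rightarrow> real"
  assumes "\<And>n. 0 \<le> f n" and "(\<lambda>n. ennreal (f n)) \<longlonglongrightarrow> 0"
  shows "f \<longlonglongrightarrow> 0"
  using assms tendsto_ennreal_iff[of f sequentially 0] by simp

text \<open>Bilinear form; inner products arise by inserting a conjugate, which leaves
  \<open>sqint\<close> unchanged.\<close>

lemma cauchy_schwarz_sqint:
  fixes f g :: "'a::euclidean_space \<Rightarrow> complex"
  assumes [measurable]: "f \<in> borel_measurable borel" "g \<in> borel_measurable borel"
    and fin: "sqint f < \<infinity>" "sqint g < \<infinity>"
  shows "integrable lborel (\<lambda>t. f t * g t)"
    and "cmod (LINT t|lborel. f t * g t) ^ 2 \<le> enn2real (sqint f) * enn2real (sqint g)"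
proof -
  let ?I = "\<integral>\<^sup>+t. ennreal (cmod (f t * g t)) \<partial>lborel"
  have "?I ^ 2 = (\<integral>\<^sup>+t. ennreal (cmod (f t)) * ennreal (cmod (g t)) \<partial>lborel) ^ 2"
    by (simp add: norm_mult ennreal_mult)
  also have "\<dots> \<le> sqint f * sqint g"
    using Cauchy_Schwarz_nn_integral[of "\<lambda>t. ennreal (cmod (f t))" lborel "\<lambda>t. ennreal (cmod (g t))"]
    by (simp add: sqint_def ennreal_power)
  finally have le: "?I ^ 2 \<le> sqint f * sqint g" .
  also have "\<dots> < \<infinity>" using fin by (simp add: ennreal_mult_less_top)
  finally have "?I < \<infinity>" by (simp add: power_less_top_ennreal)
  then show int: "integrable lborel (\<lambda>t. f t * g t)"
    by (simp add: integrable_iff_bounded)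
  have "ennreal (cmod (LINT t|lborel. f t * g t)) \<le> ?I"
    using int by (rule integral_norm_bound_ennreal)
  then have "ennreal (cmod (LINT t|lborel. f t * g t)) ^ 2 \<le> ?I ^ 2"
    by (intro power_mono) auto
  also note le
  also have "sqint f * sqint g = ennreal (enn2real (sqint f) * enn2real (sqint g))"
    using fin by (simp add: ennreal_mult)
  finally show "cmod (LINT t|lborel. f t * g t) ^ 2 \<le> enn2real (sqint f) * enn2real (sqint g)"
    by (simp add: ennreal_power ennreal_le_iff)
qed

definition fourier :: "('a::euclidean_space \<Rightarrow> complex) \<Rightarrow> 'a \<Rightarrow> complex" where
  "fourier q \<xi> = (LINT t|lborel. q t * cis (- (2 * pi * (\<xi> \<bullet> t))))"

lemma measurable_fourier [measurable]:
  assumes [measurable]: "q \<in> borel_measurable borel"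
  shows "fourier q \<in> borel_measurable borel"
  unfolding fourier_def[abs_def] by measurable

definition autocor :: "('a::euclidean_space \<Rightarrow> complex) \<Rightarrow> 'a \<Rightarrow> complex" where
  "autocor q u = (LINT t|lborel. q t * cnj (q (t - u)))"

lemma measurable_autocor [measurable]:
  assumes [measurable]: "q \<in> borel_measurable borel"
  shows "autocor q \<in> borel_measurable borel"
  unfolding autocor_def[abs_def] by measurable

lemma sqint_shift:
  assumes [measurable]: "f \<in> borel_measurable borel"
  shows "sqint (\<lambda>t. f (t - u)) = sqint f"
  unfolding sqint_def by (rule nn_integral_lborel_shift) measurable

lemma sqint_cnj: "sqint (\<lambda>t. cnj (f t)) = sqint f"
  by (simp add: sqint_def)

lemma autocor_bound:
  assumes [measurable]: "q \<in> borel_measurable borel" and fin: "sqint q < \<infinity>"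
  shows "cmod (autocor q u) \<le> enn2real (sqint q)"
proof -
  have "cmod (autocor q u) ^ 2 \<le> enn2real (sqint q) * enn2real (sqint (\<lambda>t. cnj (q (t - u))))"
    unfolding autocor_def using fin
    by (intro cauchy_schwarz_sqint) (auto simp: sqint_cnj sqint_shift)
  then show ?thesis
    using power2_le_imp_le[of "cmod (autocor q u)" "enn2real (sqint q)"]
    by (simp add: sqint_cnj sqint_shift power2_eq_square)
qed

lemma autocor_0:
  assumes [measurable]: "q \<in> borel_measurable borel" and fin: "sqint q < \<infinity>"
  shows "autocor q 0 = of_real (enn2real (sqint q))"
proof -
  have "autocor q 0 = (LINT t|lborel. complex_of_real ((cmod (q t))^2))"
    unfolding autocor_def by (simp only: complex_norm_square diff_0_right)
  also have "\<dots> = of_real (LINT t|lborel. (cmod (q t))^2)" by (rule integral_complex_of_real)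
  also have "(LINT t|lborel. (cmod (q t))^2) = enn2real (sqint q)"
    unfolding sqint_def by (rule integral_eq_nn_integral) auto
  finally show ?thesis .
qed

text \<open>The difference of two autocorrelations is the inner product of q with the difference of
  two translates, so Cauchy-Schwarz and continuity of translations in L2 suffice.\<close>

lemma autocor_tendsto:
  assumes [measurable]: "q \<in> borel_measurable borel" and fin: "sqint q < \<infinity>" and u: "u \<longlonglongrightarrow> 0"
  shows "(\<lambda>n. autocor q (u n)) \<longlonglongrightarrow> autocor q 0"
proof -
  let ?d = "\<lambda>n t. q (t - u n) - q t"
  have lim: "(\<lambda>n. sqint (?d n)) \<longlonglongrightarrow> 0"
    using translation_continuous_L2[OF assms(1,2)] u
    unfolding translation_continuous_def sqint_def by simp
  have bound: "sqint (?d n) \<le> 2 * (sqint q + sqint q)" for n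
  proof -
    have "sqint (?d n) \<le> (\<integral>\<^sup>+t. 2 * (ennreal ((cmod (q (t - u n)))^2) + ennreal ((cmod (q t))^2)) \<partial>lborel)"
      unfolding sqint_def
    proof (intro nn_integral_mono)
      fix t
      have "ennreal (cmod (?d n t)) ^ 2 \<le> (ennreal (cmod (q (t - u n))) + ennreal (cmod (q t))) ^ 2"
        by (intro power_mono) (auto simp: ennreal_plus[symmetric] simp del: ennreal_plus intro!: ennreal_leI norm_triangle_ineq4)
      also have "\<dots> \<le> 2 * (ennreal (cmod (q (t - u n))) ^ 2 + ennreal (cmod (q t)) ^ 2)"
        by (rule ennreal_power2_add_le)
      finally show "ennreal ((cmod (?d n t))^2) \<le> 2 * (ennreal ((cmod (q (t - u n)))^2) + ennreal ((cmod (q t))^2))"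
        by (simp add: ennreal_power)
    qed
    also have "\<dots> = 2 * (sqint (\<lambda>t. q (t - u n)) + sqint q)"
      unfolding sqint_def by (simp add: nn_integral_cmult nn_integral_add)
    finally show ?thesis by (simp add: sqint_shift)
  qed
  have fin_d: "sqint (?d n) < \<infinity>" for n
    using fin by (intro le_less_trans[OF bound]) (auto simp: ennreal_mult_less_top)
  have "(\<lambda>n. ennreal (enn2real (sqint (?d n)))) \<longlonglongrightarrow> 0"
    using lim fin_d by simp
  then have lim': "(\<lambda>n. enn2real (sqint (?d n))) \<longlonglongrightarrow> 0"
    by (rule power2_tendsto_zero_iff_ennreal[rotated]) simp
  have lim2: "(\<lambda>n. enn2real (sqint q) * enn2real (sqint (?d n))) \<longlonglongrightarrow> 0"
    using tendsto_mult_left[OF lim', of "enn2real (sqint q)"] by simp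
  have bd: "cmod (autocor q (u n) - autocor q 0) ^ 2 \<le> enn2real (sqint q) * enn2real (sqint (?d n))" for n
  proof -
    have "integrable lborel (\<lambda>t. q t * cnj (q (t - v)))" for v
    proof (rule cauchy_schwarz_sqint)
      show "sqint (\<lambda>t. cnj (q (t - v))) < \<infinity>"
        by (simp only: sqint_cnj sqint_shift[OF assms(1)] fin)
    qed (use fin in auto)
    from this[of "u n"] this[of 0] have "autocor q (u n) - autocor q 0 = (LINT t|lborel. q t * cnj (?d n t))"
      unfolding autocor_def by (subst Bochner_Integration.integral_diff[symmetric]) (auto simp: algebra_simps)
    also have "cmod \<dots> ^ 2 \<le> enn2real (sqint q) * enn2real (sqint (\<lambda>t. cnj (?d n t)))"
    proof (rule cauchy_schwarz_sqint)
      show "sqint (\<lambda>t. cnj (?d n t)) < \<infinity>" by (simp only: sqint_cnj fin_d)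
    qed (use fin in auto)
    finally show ?thesis by (simp only: sqint_cnj)
  qed
  have "(\<lambda>n. cmod (autocor q (u n) - autocor q 0) ^ 2) \<longlonglongrightarrow> 0"
    by (rule tendsto_sandwich[OF _ _ tendsto_const lim2]) (auto intro!: always_eventually bd)
  then have "(\<lambda>n. sqrt (cmod (autocor q (u n) - autocor q 0) ^ 2)) \<longlonglongrightarrow> sqrt 0"
    by (intro tendsto_real_sqrt)
  then have "(\<lambda>n. autocor q (u n) - autocor q 0) \<longlonglongrightarrow> 0"
    by (simp add: tendsto_norm_zero_iff)
  then show ?thesis by (simp add: LIM_zero_iff)
qed

lemma integrable_mult_pair:
  fixes f :: "'a::euclidean_space \<Rightarrow> complex" and g :: "'b::euclidean_space \<Rightarrow> complex"
  assumes f: "integrable lborel f" and g: "integrable lborel g"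
  shows "integrable (lborel \<Otimes>\<^sub>M lborel) (\<lambda>(x, y). f x * g y)"
proof (rule lborel_pair.Fubini_integrable)
  have [measurable]: "f \<in> borel_measurable borel" "g \<in> borel_measurable borel" using f g by auto
  show "(\<lambda>(x, y). f x * g y) \<in> borel_measurable (lborel \<Otimes>\<^sub>M lborel)" by measurable
qed (use f g in \<open>auto simp: norm_mult\<close>)

text \<open>Regularise with a Gaussian: the Gaussian Fourier transform turns the regularised energy of
  the transform into an average of the autocorrelation, which is continuous at the origin.\<close>

lemma fourier_regularised:
  fixes q :: "'a::euclidean_space \<Rightarrow> complex"
  assumes [measurable]: "q \<in> borel_measurable borel" and q1: "integrable lborel q" and a: "0 < a"
  shows "(LINT \<xi>|lborel. complex_of_real (exp (- pi * a^2 * (norm \<xi>)^2) * (cmod (fourier q \<xi>))^2))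
    = (LINT y|lborel. complex_of_real (exp (- pi * (norm y)^2)) * autocor q (a *\<^sub>R y))"
proof -
  let ?G = "\<lambda>\<xi>::'a. complex_of_real (exp (- pi * a^2 * (norm \<xi>)^2))"
  let ?e = "\<lambda>\<xi> v::'a. cis (2 * pi * (\<xi> \<bullet> v))"
  let ?F = "\<lambda>\<xi> (t, s). ?G \<xi> * (q t * cnj (q s)) * ?e \<xi> (s - t)"
  have G: "integrable lborel ?G" using gauss_fourier(1)[of "a^2"] a
    by (simp add: complex_of_real_integrable_eq del: of_real_exp)
  have q1c: "integrable lborel (\<lambda>t. cnj (q t))" using q1 by simp
  have qq: "integrable lborel (\<lambda>(t, s). q t * cnj (q s))"
    using integrable_mult_pair[OF q1 q1c] by (simp add: lborel_prod)
  have intF: "integrable (lborel \<Otimes>\<^sub>M lborel) (case_prod ?F)"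
  proof (rule Bochner_Integration.integrable_bound[OF integrable_mult_pair[OF G qq]])
    show "case_prod ?F \<in> borel_measurable (lborel \<Otimes>\<^sub>M lborel)"
      by (simp add: split_beta') measurable
  qed (auto simp: norm_mult split_beta')
  \<comment> \<open>Integrating out t and s first: the double integral factors into the transform
    and its conjugate.\<close>
  have four: "(LINT p|lborel. ?F \<xi> p) = complex_of_real (exp (- pi * a^2 * (norm \<xi>)^2) * (cmod (fourier q \<xi>))^2)" for \<xi>
  proof -
    let ?f = "\<lambda>t. q t * cis (- (2 * pi * (\<xi> \<bullet> t)))"
    have f: "integrable lborel ?f"
      by (rule Bochner_Integration.integrable_bound[OF q1]) (auto simp: norm_mult)
    then have fc: "integrable lborel (\<lambda>t. cnj (?f t))" by (simp only: integrable_cnj)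
    have "(LINT p|lborel. ?F \<xi> p) = (LINT p|(lborel \<Otimes>\<^sub>M lborel). ?G \<xi> * (case p of (t, s) \<Rightarrow> ?f t * cnj (?f s)))"
      unfolding lborel_prod
      by (intro Bochner_Integration.integral_cong)
        (auto simp: cis_cnj cis_mult inner_diff_right algebra_simps)
    also have "\<dots> = ?G \<xi> * (LINT p|(lborel \<Otimes>\<^sub>M lborel). (case p of (t, s) \<Rightarrow> ?f t * cnj (?f s)))"
      by simp
    also have "(LINT p|(lborel \<Otimes>\<^sub>M lborel). (case p of (t, s) \<Rightarrow> ?f t * cnj (?f s)))
        = (LINT t|lborel. LINT s|lborel. ?f t * cnj (?f s))"
      using lborel_pair.integral_fst'[OF integrable_mult_pair[OF f fc]] by simp
    also have "\<dots> = fourier q \<xi> * cnj (fourier q \<xi>)"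
      unfolding fourier_def by (simp del: complex_cnj_mult)
    also have "\<dots> = complex_of_real ((cmod (fourier q \<xi>))^2)"
      by (simp only: complex_norm_square)
    finally show ?thesis by simp
  qed
  let ?K = "\<lambda>v::'a. complex_of_real (exp (- pi * (norm v)^2 / a^2) / a ^ DIM('a))"
  \<comment> \<open>Integrating out the frequency first: the Gaussian transforms into the Gaussian
    \<open>?K\<close> in s - t.\<close>
  have gauss: "(LINT \<xi>|lborel. ?F \<xi> p) = (case p of (t, s) \<Rightarrow> q t * cnj (q s) * ?K (s - t))" for p
  proof (cases p)
    case (Pair t s)
    have "(LINT \<xi>|lborel. ?F \<xi> p) = (LINT \<xi>|lborel. (q t * cnj (q s)) * (?G \<xi> * ?e \<xi> (s - t)))"
      by (simp add: Pair mult_ac)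
    also have "\<dots> = (q t * cnj (q s)) * (LINT \<xi>|lborel. (?G \<xi> * ?e \<xi> (s - t)))"
      by simp
    also have "(LINT \<xi>|lborel. (?G \<xi> * ?e \<xi> (s - t))) = ?K (s - t)"
      using gauss_fourier(2)[of "a^2" "s - t"] a by simp
    finally show ?thesis by (simp add: Pair)
  qed
  have K0: "integrable lborel ?K"
  proof -
    have "integrable lborel (\<lambda>x::'a. exp (- pi * (1/a^2) * (norm x)^2) / a ^ DIM('a))"
      using gauss_fourier(1)[of "1/a^2"] a by (intro integrable_divide_zero) auto
    then show ?thesis by (simp add: complex_of_real_integrable_eq del: of_real_exp of_real_divide)
  qed
  have Kbound: "cmod (?K v) \<le> 1 / a ^ DIM('a)" for v
    using a by (simp add: norm_divide norm_power divide_right_mono)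
  have [measurable]: "?K \<in> borel_measurable borel" by measurable
  have n1: "(\<integral>\<^sup>+t. ennreal (cmod (q t)) \<partial>lborel) < \<infinity>"
    using q1 by (simp add: integrable_iff_bounded)
  \<comment> \<open>The function q' t s stands for q s or for q (t - s), the two forms of the
    integrand before and after the substitution; one estimate serves both applications of
    Fubini.\<close>
  have bnd: "(\<integral>\<^sup>+t. \<integral>\<^sup>+s. ennreal (cmod (q t * cnj (q' t s) * ?K (k t s))) \<partial>lborel \<partial>lborel) < \<infinity>"
    if q': "\<And>t. (\<integral>\<^sup>+s. ennreal (cmod (q' t s)) \<partial>lborel) = (\<integral>\<^sup>+t. ennreal (cmod (q t)) \<partial>lborel)"
      and [measurable]: "\<And>t. q' t \<in> borel_measurable borel" for q' k
  proof -
    have "(\<integral>\<^sup>+t. \<integral>\<^sup>+s. ennreal (cmod (q t * cnj (q' t s) * ?K (k t s))) \<partial>lborel \<partial>lborel)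
      \<le> (\<integral>\<^sup>+t. \<integral>\<^sup>+s. ennreal (1 / a ^ DIM('a)) * (ennreal (cmod (q t)) * ennreal (cmod (q' t s))) \<partial>lborel \<partial>lborel)"
    proof (intro nn_integral_mono)
      fix t s
      have "cmod (q t) * cmod (q' t s) * cmod (?K (k t s)) \<le> cmod (q t) * cmod (q' t s) * (1 / a ^ DIM('a))"
        by (intro mult_left_mono Kbound) auto
      then show "ennreal (cmod (q t * cnj (q' t s) * ?K (k t s)))
          \<le> ennreal (1 / a ^ DIM('a)) * (ennreal (cmod (q t)) * ennreal (cmod (q' t s)))"
        using a by (simp add: norm_mult ennreal_mult[symmetric] mult.commute ennreal_leI del: of_real_divide)
    qed
    also have "\<dots> = ennreal (1 / a ^ DIM('a)) * ((\<integral>\<^sup>+t. ennreal (cmod (q t)) \<partial>lborel) * (\<integral>\<^sup>+t. ennreal (cmod (q t)) \<partial>lborel))"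
      by (simp add: nn_integral_cmult nn_integral_multc q')
    also have "\<dots> < \<infinity>" using n1 by (simp add: ennreal_mult_less_top)
    finally show ?thesis .
  qed
  have H1: "integrable (lborel \<Otimes>\<^sub>M lborel) (\<lambda>(t, s). q t * cnj (q s) * ?K (s - t))"
    by (rule integrable_pairI, measurable) (use bnd[of "\<lambda>t. q" "\<lambda>t s. s - t"] in simp)
  have H2: "integrable (lborel \<Otimes>\<^sub>M lborel) (\<lambda>(t, u). q t * cnj (q (t - u)) * ?K u)"
    by (rule integrable_pairI, measurable)
      (use bnd[of "\<lambda>t u. q (t - u)" "\<lambda>t u. u"] nn_integral_lborel_shift(3)[of "\<lambda>t. ennreal (cmod (q t))"] in simp)
  have "(LINT \<xi>|lborel. LINT p|lborel. ?F \<xi> p) = (LINT p|lborel. LINT \<xi>|lborel. ?F \<xi> p)"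
    by (rule lborel_pair.Fubini_integral[OF intF, symmetric])
  also have "\<dots> = (LINT p|(lborel \<Otimes>\<^sub>M lborel). (case p of (t, s) \<Rightarrow> q t * cnj (q s) * ?K (s - t)))"
    unfolding gauss lborel_prod ..
  also have "\<dots> = (LINT t|lborel. LINT s|lborel. q t * cnj (q s) * ?K (s - t))"
    using lborel_pair.integral_fst'[OF H1] by simp
  also have "\<dots> = (LINT t|lborel. LINT u|lborel. q t * cnj (q (t - u)) * ?K u)"
  proof (rule Bochner_Integration.integral_cong[OF refl])
    fix t
    have "(LINT s|lborel. q t * cnj (q s) * ?K (s - t))
        = \<bar>-1\<bar> ^ DIM('a) *\<^sub>R (LINT u|lborel. q t * cnj (q (t + (-1) *\<^sub>R u)) * ?K ((t + (-1) *\<^sub>R u) - t))"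
      by (rule lborel_integral_affine) auto
    then show "(LINT s|lborel. q t * cnj (q s) * ?K (s - t)) = (LINT u|lborel. q t * cnj (q (t - u)) * ?K u)"
      by simp
  qed
  also have "\<dots> = (LINT u|lborel. LINT t|lborel. q t * cnj (q (t - u)) * ?K u)"
    by (rule lborel_pair.Fubini_integral[OF H2, symmetric])
  also have "\<dots> = (LINT u|lborel. autocor q u * ?K u)"
    unfolding autocor_def by simp
  \<comment> \<open>Substituting u = a y cancels the normalisation of \<open>?K\<close> and leaves a
    Gaussian independent of a, so that a enters only through the autocorrelation.\<close>
  also have "\<dots> = \<bar>a\<bar> ^ DIM('a) *\<^sub>R (LINT y|lborel. autocor q (0 + a *\<^sub>R y) * ?K (0 + a *\<^sub>R y))"
    using a by (intro lborel_integral_affine) auto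
  also have "\<dots> = (LINT y|lborel. of_real (a ^ DIM('a)) * (autocor q (a *\<^sub>R y) * ?K (a *\<^sub>R y)))"
    using a by (simp add: scaleR_conv_of_real)
  also have "\<dots> = (LINT y|lborel. complex_of_real (exp (- pi * (norm y)^2)) * autocor q (a *\<^sub>R y))"
    using a by (intro Bochner_Integration.integral_cong) (auto simp: power_mult_distrib)
  finally show ?thesis unfolding four .
qed

text \<open>Along a = 1 / (n + 1) the regularised energies increase to the energy of the transform,
  while the averages of the autocorrelation converge, by dominated convergence, to its value at 0,
  which is the energy of q.\<close>

lemma plancherel:
  fixes q :: "'a::euclidean_space \<Rightarrow> complex"
  assumes [measurable]: "q \<in> borel_measurable borel" and q1: "integrable lborel q" and q2: "sqint q < \<infinity>"
  shows "sqint (fourier q) = sqint q"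
proof -
  let ?a = "\<lambda>n. 1 / real (Suc n)"
  let ?G = "\<lambda>n \<xi>. exp (- pi * (?a n)^2 * (norm (\<xi>::'a))^2)"
  let ?g = "\<lambda>y::'a. complex_of_real (exp (- pi * (norm y)^2))"
  have g1: "integrable lborel ?g"
    using gauss_fourier(1)[of 1] by (simp add: complex_of_real_integrable_eq del: of_real_exp)
  have "(\<lambda>n. LINT y|lborel. ?g y * autocor q (?a n *\<^sub>R y)) \<longlonglongrightarrow> (LINT y|lborel. ?g y * autocor q 0)"
  proof (rule integral_dominated_convergence[where w = "\<lambda>y. cmod (?g y) * enn2real (sqint q)"])
    show "integrable lborel (\<lambda>y. cmod (?g y) * enn2real (sqint q))"
      using integrable_norm[OF g1] by (rule integrable_mult_left)
    show "AE y in lborel. (\<lambda>n. ?g y * autocor q (?a n *\<^sub>R y)) \<longlonglongrightarrow> ?g y * autocor q 0"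
    proof (intro AE_I2 tendsto_mult_left autocor_tendsto q2)
      fix y :: 'a
      have "(\<lambda>n. ?a n *\<^sub>R y) \<longlonglongrightarrow> 0 *\<^sub>R y"
        by (intro tendsto_scaleR tendsto_const LIMSEQ_Suc[OF lim_const_over_n])
      then show "(\<lambda>n. ?a n *\<^sub>R y) \<longlonglongrightarrow> 0" by simp
    qed measurable
    show "AE y in lborel. norm (?g y * autocor q (?a n *\<^sub>R y)) \<le> cmod (?g y) * enn2real (sqint q)" for n
      by (auto simp: norm_mult intro!: mult_left_mono autocor_bound q2)
  qed measurable
  also have "(LINT y|lborel. ?g y * autocor q 0) = autocor q 0"
    using gauss_fourier(2)[of 1 "0::'a"] by simp
  also have "\<dots> = of_real (enn2real (sqint q))" using q2 by (intro autocor_0) auto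
  finally have lim: "(\<lambda>n. LINT y|lborel. ?g y * autocor q (?a n *\<^sub>R y)) \<longlonglongrightarrow> of_real (enn2real (sqint q))" .
  have fb: "cmod (fourier q \<xi>) \<le> (LINT t|lborel. cmod (q t))" for \<xi>
    unfolding fourier_def by (rule order_trans[OF integral_norm_bound]) (simp add: norm_mult)
  have intG: "integrable lborel (\<lambda>\<xi>. ?G n \<xi> * (cmod (fourier q \<xi>))^2)" for n
  proof (rule Bochner_Integration.integrable_bound)
    show "integrable lborel (\<lambda>\<xi>. ?G n \<xi> * (LINT t|lborel. cmod (q t))^2)"
      using gauss_fourier(1)[of "(?a n)^2"] by (intro integrable_mult_left) auto
    show "AE \<xi> in lborel. norm (?G n \<xi> * (cmod (fourier q \<xi>))^2) \<le> norm (?G n \<xi> * (LINT t|lborel. cmod (q t))^2)"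
      by (auto simp: norm_mult intro!: mult_left_mono power_mono fb)
  qed measurable
  have "(\<lambda>n. complex_of_real (LINT \<xi>|lborel. ?G n \<xi> * (cmod (fourier q \<xi>))^2)) \<longlonglongrightarrow> of_real (enn2real (sqint q))"
    using lim fourier_regularised[OF assms(1) q1, of "?a n" for n, symmetric]
    by (simp only: integral_complex_of_real divide_pos_pos zero_less_one of_nat_0_less_iff zero_less_Suc)
  then have "(\<lambda>n. (LINT \<xi>|lborel. ?G n \<xi> * (cmod (fourier q \<xi>))^2)) \<longlonglongrightarrow> enn2real (sqint q)"
    by (simp only: tendsto_of_real_iff)
  then have "(\<lambda>n. ennreal (LINT \<xi>|lborel. ?G n \<xi> * (cmod (fourier q \<xi>))^2)) \<longlonglongrightarrow> ennreal (enn2real (sqint q))"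
    by (rule tendsto_ennrealI)
  moreover have "ennreal (enn2real (sqint q)) = sqint q" using q2 by simp
  ultimately have l1: "(\<lambda>n. \<integral>\<^sup>+\<xi>. ennreal (?G n \<xi> * (cmod (fourier q \<xi>))^2) \<partial>lborel) \<longlonglongrightarrow> sqint q"
    by (subst nn_integral_eq_integral[OF intG]) (simp_all only: AE_I2 mult_nonneg_nonneg exp_ge_zero zero_le_power2 always_eventually)
  have "(\<lambda>n. \<integral>\<^sup>+\<xi>. ennreal (?G n \<xi> * (cmod (fourier q \<xi>))^2) \<partial>lborel) \<longlonglongrightarrow> (\<integral>\<^sup>+\<xi>. ennreal ((cmod (fourier q \<xi>))^2) \<partial>lborel)"
  proof (rule nn_integral_LIMSEQ)
    show "incseq (\<lambda>n (\<xi>::'a). ennreal (?G n \<xi> * (cmod (fourier q \<xi>))^2))"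
    proof (intro incseq_SucI le_funI ennreal_leI mult_right_mono)
      fix n and \<xi> :: 'a
      have "(?a (Suc n))^2 \<le> (?a n)^2" by (intro power_mono divide_left_mono) auto
      then have "pi * (?a (Suc n))^2 * (norm \<xi>)^2 \<le> pi * (?a n)^2 * (norm \<xi>)^2"
        by (intro mult_right_mono mult_left_mono) auto
      then show "?G n \<xi> \<le> ?G (Suc n) \<xi>" by simp
    qed auto
    fix \<xi> :: 'a
    have "(\<lambda>n. ?G n \<xi> * (cmod (fourier q \<xi>))^2) \<longlonglongrightarrow> exp (- pi * 0^2 * (norm \<xi>)^2) * (cmod (fourier q \<xi>))^2"
      by (intro tendsto_mult_right tendsto_exp tendsto_mult_left tendsto_power LIMSEQ_Suc[OF lim_const_over_n])
    then have "(\<lambda>n. ?G n \<xi> * (cmod (fourier q \<xi>))^2) \<longlonglongrightarrow> (cmod (fourier q \<xi>))^2" by simp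
    then show "(\<lambda>n. ennreal (?G n \<xi> * (cmod (fourier q \<xi>))^2)) \<longlonglongrightarrow> ennreal ((cmod (fourier q \<xi>))^2)"
      by (rule tendsto_ennrealI)
  qed measurable
  from LIMSEQ_unique[OF this l1] show ?thesis by (simp add: sqint_def)
qed

section \<open>Orthogonality relations of the short-time Fourier transform\<close>

text \<open>The statement uses Lebesgue measurable functions, for which products and Fubini on the
  Borel sigma-algebra are not directly available. A Borel function of finite energy that agrees
  almost everywhere replaces them in all integrals.\<close>

definition rep :: "('d::finite) fn \<Rightarrow> ('d::finite) fn \<Rightarrow> bool" where
  "rep f f' \<longleftrightarrow> f' \<in> borel_measurable borel \<and> sqint f' < \<infinity> \<and> (AE t in lborel. f t = f' t)"

lemma rep_self: "f \<in> borel_measurable borel \<Longrightarrow> sqint f < \<infinity> \<Longrightarrow> rep f f"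
  by (simp add: rep_def)

lemma completion_ex_borel_complex:
  fixes f :: "'a::euclidean_space \<Rightarrow> complex"
  assumes "f \<in> borel_measurable lebesgue"
  shows "\<exists>f'\<in>borel_measurable borel. AE t in lborel. f t = f' t"
proof -
  have "(\<lambda>t. Re (f t)) \<in> borel_measurable lebesgue" "(\<lambda>t. Im (f t)) \<in> borel_measurable lebesgue"
    using assms by auto
  from this[THEN completion_ex_borel_measurable_real]
  obtain r i where [measurable]: "r \<in> borel_measurable borel" "i \<in> borel_measurable borel"
    and "AE t in lborel. Re (f t) = r t" "AE t in lborel. Im (f t) = i t"
    by auto
  then have "AE t in lborel. f t = Complex (r t) (i t)"
    by (auto simp: complex_eq_iff)
  moreover have "(\<lambda>t. Complex (r t) (i t)) \<in> borel_measurable borel"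
    unfolding Complex_eq by measurable
  ultimately show ?thesis by (rule bexI)
qed

lemma rep_lebesgue_measurable: "rep f f' \<Longrightarrow> f \<in> borel_measurable lebesgue"
proof (rule borel_measurable_AE[of f'])
  assume "rep f f'"
  then show "f' \<in> borel_measurable lebesgue" "AE t in lebesgue. f' t = f t"
    by (auto simp: rep_def measurable_completion intro!: AE_completion elim: eventually_mono)
qed

lemma rep_sqint:
  assumes "rep f f'"
  shows "(\<integral>\<^sup>+t. ennreal ((cmod (f t))^2) \<partial>lebesgue) = sqint f'"
  unfolding sqint_def nn_integral_completion
  using assms by (intro nn_integral_cong_AE) (auto simp: rep_def)

lemma L2_iff_rep: "f \<in> L2 \<longleftrightarrow> (\<exists>f'. rep f f')"
proof
  assume f: "f \<in> L2"
  then obtain f' where [measurable]: "f' \<in> borel_measurable borel" and eq: "AE t in lborel. f t = f' t"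
    using completion_ex_borel_complex[of f] by (auto simp: L2_def)
  have "sqint f' = (\<integral>\<^sup>+t. ennreal ((cmod (f t))^2) \<partial>lebesgue)"
    unfolding sqint_def nn_integral_completion using eq by (intro nn_integral_cong_AE) auto
  also have "\<dots> < \<infinity>" using f by (auto simp: L2_def integrable_iff_bounded)
  finally have "rep f f'" using eq by (simp add: rep_def)
  then show "\<exists>f'. rep f f'" by blast
next
  assume "\<exists>f'. rep f f'"
  then obtain f' where f: "rep f f'" ..
  note m = rep_lebesgue_measurable[OF f]
  have "(\<integral>\<^sup>+t. ennreal ((cmod (f t))^2) \<partial>lebesgue) < \<infinity>"
    unfolding rep_sqint[OF f] using f by (simp add: rep_def)
  then show "f \<in> L2" using m by (auto simp: L2_def integrable_iff_bounded)
qed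

lemma L2_repE:
  assumes "f \<in> L2"
  obtains f' where "rep f f'"
  using assms by (auto simp: L2_iff_rep)

lemma rep_L2norm:
  assumes "rep f f'"
  shows "L2norm f = sqrt (enn2real (sqint f'))"
proof -
  have "(LINT t|lebesgue. (cmod (f t))^2) = enn2real (\<integral>\<^sup>+t. ennreal ((cmod (f t))^2) \<partial>lebesgue)"
    using rep_lebesgue_measurable[OF assms] by (intro integral_eq_nn_integral) auto
  then show ?thesis unfolding L2norm_def rep_sqint[OF assms] by simp
qed

lemma rep_L2norm_sq:
  assumes "rep f f'"
  shows "sqint f' = ennreal ((L2norm f)^2)"
  using assms by (simp add: rep_L2norm rep_def)

lemma rep_ip:
  assumes f: "rep f f'" and g: "rep g g'"
  shows "ip f g = (LINT t|lborel. f' t * cnj (g' t))"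
proof -
  have [measurable]: "f' \<in> borel_measurable borel" "g' \<in> borel_measurable borel"
    using f g by (auto simp: rep_def)
  have "AE t in lborel. f t * cnj (g t) = f' t * cnj (g' t)"
    using f g by (auto simp: rep_def)
  then have "ip f g = (LINT t|lebesgue. f' t * cnj (g' t))"
    unfolding ip_def using rep_lebesgue_measurable[OF f] rep_lebesgue_measurable[OF g]
    by (intro integral_cong_AE) (auto intro!: AE_completion measurable_completion)
  then show ?thesis by (simp add: integral_completion)
qed

lemma sqint_add_finite:
  assumes [measurable]: "f \<in> borel_measurable borel" "g \<in> borel_measurable borel"
    and fin: "sqint f < \<infinity>" "sqint g < \<infinity>"
  shows "sqint (\<lambda>t. a * f t + b * g t) < \<infinity>"
proof -
  have "sqint (\<lambda>t. a * f t + b * g t)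
      \<le> (\<integral>\<^sup>+t. 2 * (ennreal ((cmod a)^2) * ennreal ((cmod (f t))^2) + ennreal ((cmod b)^2) * ennreal ((cmod (g t))^2)) \<partial>lborel)"
    unfolding sqint_def
  proof (intro nn_integral_mono)
    fix t
    have "ennreal (cmod (a * f t + b * g t)) ^ 2 \<le> (ennreal (cmod (a * f t)) + ennreal (cmod (b * g t))) ^ 2"
      by (intro power_mono) (auto simp: ennreal_plus[symmetric] simp del: ennreal_plus intro!: ennreal_leI norm_triangle_ineq)
    also have "\<dots> \<le> 2 * (ennreal (cmod (a * f t)) ^ 2 + ennreal (cmod (b * g t)) ^ 2)"
      by (rule ennreal_power2_add_le)
    finally show "ennreal ((cmod (a * f t + b * g t))^2)
        \<le> 2 * (ennreal ((cmod a)^2) * ennreal ((cmod (f t))^2) + ennreal ((cmod b)^2) * ennreal ((cmod (g t))^2))"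
      by (simp add: ennreal_power norm_mult power_mult_distrib ennreal_mult)
  qed
  also have "\<dots> = 2 * (ennreal ((cmod a)^2) * sqint f + ennreal ((cmod b)^2) * sqint g)"
    unfolding sqint_def by (simp add: nn_integral_cmult nn_integral_add)
  also have "\<dots> < \<infinity>" using fin by (simp add: ennreal_mult_less_top)
  finally show ?thesis .
qed

lemma rep_lin: "rep f f' \<Longrightarrow> rep g g' \<Longrightarrow> rep (\<lambda>t. a * f t + b * g t) (\<lambda>t. a * f' t + b * g' t)"
  unfolding rep_def using sqint_add_finite[of f' g' a b] by auto

lemma cmod_tfshift: "cmod (tfshift z f t) = cmod (f (t - fst z))"
  unfolding tfshift_def norm_mult by (metis cis_conv_exp mult_1 norm_cis)

lemma tfshift_cis: "tfshift z f t = cis (2 * pi * (snd z \<bullet> t)) * f (t - fst z)"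
  by (simp add: tfshift_def cis_conv_exp)

lemma rep_tfshift:
  assumes f: "rep f f'"
  shows "rep (tfshift z f) (tfshift z f')"
proof -
  have [measurable]: "f' \<in> borel_measurable borel" using f by (auto simp: rep_def)
  have "sqint (tfshift z f') = sqint f'"
    unfolding sqint_def cmod_tfshift by (rule nn_integral_lborel_shift) measurable
  moreover have "AE t in lborel. tfshift z f t = tfshift z f' t"
    using AE_lborel_shift[of "\<lambda>t. f t = f' t" "fst z"] f by (auto simp: rep_def tfshift_def)
  moreover have "tfshift z f' \<in> borel_measurable borel"
    unfolding tfshift_cis[abs_def] by measurable
  ultimately show ?thesis using f by (simp add: rep_def)
qed

text \<open>For a fixed time shift the short-time transform is an ordinary Fourier transform in the
  frequency variable, which is where Plancherel enters.\<close>

lemma rep_stft: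
  assumes f: "rep f f'" and p: "rep p p'"
  shows "stft p f z = fourier (\<lambda>t. f' t * cnj (p' (t - fst z))) (snd z)"
  unfolding stft_def rep_ip[OF f rep_tfshift[OF p]] fourier_def
  by (intro Bochner_Integration.integral_cong) (auto simp: tfshift_cis cis_cnj mult_ac)

lemma L2_lin: "f \<in> L2 \<Longrightarrow> g \<in> L2 \<Longrightarrow> (\<lambda>t. a * f t + b * g t) \<in> L2"
  using rep_lin L2_iff_rep by metis

lemma L2_scale: "f \<in> L2 \<Longrightarrow> (\<lambda>t. a * f t) \<in> L2"
  using L2_lin[of f f a 0] by simp

lemma L2_tfshift: "f \<in> L2 \<Longrightarrow> tfshift z f \<in> L2"
  by (meson L2_iff_rep rep_tfshift)

lemma L2norm_tfshift:
  assumes "f \<in> L2"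
  shows "L2norm (tfshift z f) = L2norm f"
proof -
  obtain f' where f: "rep f f'" using assms by (rule L2_repE)
  then have [measurable]: "f' \<in> borel_measurable borel" by (auto simp: rep_def)
  have "sqint (tfshift z f') = sqint f'"
    unfolding sqint_def cmod_tfshift by (rule nn_integral_lborel_shift) measurable
  then show ?thesis by (simp add: rep_L2norm[OF f] rep_L2norm[OF rep_tfshift[OF f]])
qed

lemma ip_integrable:
  assumes "rep f f'" "rep g g'"
  shows "integrable lborel (\<lambda>t. f' t * cnj (g' t))"
  using assms by (intro cauchy_schwarz_sqint(1)) (auto simp: rep_def sqint_cnj)

lemma ip_cauchy_schwarz:
  assumes "f \<in> L2" "g \<in> L2"
  shows "cmod (ip f g) \<le> L2norm f * L2norm g"
proof -
  obtain f' g' where f: "rep f f'" and g: "rep g g'" using assms by (meson L2_repE)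
  have "cmod (ip f g) ^ 2 \<le> enn2real (sqint f') * enn2real (sqint (\<lambda>t. cnj (g' t)))"
    unfolding rep_ip[OF f g] using f g by (intro cauchy_schwarz_sqint(2)) (auto simp: rep_def sqint_cnj)
  then have "cmod (ip f g) ^ 2 \<le> (L2norm f * L2norm g)^2"
    using f g by (simp add: rep_L2norm_sq sqint_cnj power_mult_distrib)
  then show ?thesis
    by (rule power2_le_imp_le) (simp add: L2norm_def)
qed

lemma ip_lin_left:
  assumes "f \<in> L2" "g \<in> L2" "h \<in> L2"
  shows "ip (\<lambda>t. a * f t + b * g t) h = a * ip f h + b * ip g h"
proof -
  obtain f' g' h' where r: "rep f f'" "rep g g'" "rep h h'" using assms by (meson L2_repE)
  have "ip (\<lambda>t. a * f t + b * g t) h = (LINT t|lborel. a * (f' t * cnj (h' t)) + b * (g' t * cnj (h' t)))"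
    unfolding rep_ip[OF rep_lin[OF r(1,2)] r(3)] by (simp add: algebra_simps)
  also have "\<dots> = a * ip f h + b * ip g h"
    unfolding rep_ip[OF r(1,3)] rep_ip[OF r(2,3)] using ip_integrable[OF r(1,3)] ip_integrable[OF r(2,3)]
    by (subst Bochner_Integration.integral_add) auto
  finally show ?thesis .
qed

lemma ip_cnj:
  assumes "f \<in> L2" "g \<in> L2"
  shows "ip g f = cnj (ip f g)"
proof -
  obtain f' g' where r: "rep f f'" "rep g g'" using assms by (meson L2_repE)
  show ?thesis
    using Bochner_Integration.integral_cnj[of lborel "\<lambda>t. f' t * cnj (g' t)"]
    unfolding rep_ip[OF r] rep_ip[OF r(2,1)] by (simp add: mult.commute)
qed

lemma ip_self:
  assumes "f \<in> L2"
  shows "ip f f = of_real ((L2norm f)^2)"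
proof -
  obtain f' where r: "rep f f'" using assms by (meson L2_repE)
  show ?thesis
    using autocor_0[of f'] r unfolding rep_ip[OF r r] autocor_def by (simp add: rep_def rep_L2norm[OF r])
qed

lemma stft_bound: "f \<in> L2 \<Longrightarrow> p \<in> L2 \<Longrightarrow> cmod (stft p f z) \<le> L2norm f * L2norm p"
  unfolding stft_def using ip_cauchy_schwarz[of f "tfshift z p"] by (simp add: L2_tfshift L2norm_tfshift)

lemma measurable_stft:
  assumes "f \<in> L2" "p \<in> L2"
  shows "stft p f \<in> borel_measurable borel"
proof -
  obtain f' p' where r: "rep f f'" "rep p p'" using assms by (meson L2_repE)
  then have [measurable]: "f' \<in> borel_measurable borel" "p' \<in> borel_measurable borel"
    by (auto simp: rep_def)
  show ?thesis
    unfolding rep_stft[OF r, abs_def] fourier_def by measurable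
qed

text \<open>Plancherel in the frequency for each time shift x, then Tonelli in x.\<close>

lemma sqint_stft:
  assumes "f \<in> L2" "p \<in> L2"
  shows "sqint (stft p f) = ennreal ((L2norm f)^2) * ennreal ((L2norm p)^2)"
proof -
  obtain f' p' where r: "rep f f'" "rep p p'" using assms by (meson L2_repE)
  then have [measurable]: "f' \<in> borel_measurable borel" "p' \<in> borel_measurable borel"
    and fin: "sqint f' < \<infinity>" "sqint p' < \<infinity>"
    by (auto simp: rep_def)
  have [measurable]: "stft p f \<in> borel_measurable borel" using assms by (rule measurable_stft)
  let ?q = "\<lambda>x t. f' t * cnj (p' (t - x))"
  have prod: "(\<integral>\<^sup>+x. sqint (?q x) \<partial>lborel) = sqint f' * sqint p'"
  proof -
    have "(\<integral>\<^sup>+x. sqint (?q x) \<partial>lborel)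
        = (\<integral>\<^sup>+x. \<integral>\<^sup>+t. ennreal ((cmod (f' t))^2) * ennreal ((cmod (p' (t - x)))^2) \<partial>lborel \<partial>lborel)"
      by (simp add: sqint_def norm_mult power_mult_distrib ennreal_mult)
    also have "\<dots> = (\<integral>\<^sup>+t. \<integral>\<^sup>+x. ennreal ((cmod (f' t))^2) * ennreal ((cmod (p' (t - x)))^2) \<partial>lborel \<partial>lborel)"
      by (rule lborel_pair.Fubini') measurable
    also have "\<dots> = (\<integral>\<^sup>+t. ennreal ((cmod (f' t))^2) * sqint p' \<partial>lborel)"
      using nn_integral_lborel_shift(3)[of "\<lambda>t. ennreal ((cmod (p' t))^2)"]
      by (simp add: nn_integral_cmult sqint_def)
    also have "\<dots> = sqint f' * sqint p'"
      unfolding sqint_def[of f'] by (rule nn_integral_multc) measurable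
    finally show ?thesis .
  qed
  \<comment> \<open>The product of f' with a shifted window is integrable for every x but square
    integrable only for almost every x, because its energies have a finite integral.\<close>
  have ae: "AE x in lborel. sqint (?q x) < \<infinity>"
  proof -
    have "(\<integral>\<^sup>+x. sqint (?q x) \<partial>lborel) \<noteq> \<infinity>"
      unfolding prod using fin by (auto simp: ennreal_mult_eq_top_iff)
    then have "AE x in lborel. sqint (?q x) \<noteq> \<infinity>"
      by (intro nn_integral_PInf_AE) (auto simp: sqint_def)
    then show ?thesis by (simp add: less_top)
  qed
  have int: "integrable lborel (?q x)" for x
  proof (rule cauchy_schwarz_sqint(1))
    show "sqint (\<lambda>t. cnj (p' (t - x))) < \<infinity>"
      by (simp only: sqint_cnj sqint_shift[OF \<open>p' \<in> borel_measurable borel\<close>] fin)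
  qed (use fin in auto)
  have "sqint (stft p f) = (\<integral>\<^sup>+z. ennreal ((cmod (stft p f z))^2) \<partial>(lborel \<Otimes>\<^sub>M lborel))"
    by (simp add: sqint_def lborel_prod)
  also have "\<dots> = (\<integral>\<^sup>+x. \<integral>\<^sup>+\<xi>. ennreal ((cmod (stft p f (x, \<xi>)))^2) \<partial>lborel \<partial>lborel)"
    by (rule lborel.nn_integral_fst[symmetric]) (simp add: lborel_prod)
  also have "\<dots> = (\<integral>\<^sup>+x. sqint (fourier (?q x)) \<partial>lborel)"
    unfolding sqint_def rep_stft[OF r] by simp
  also have "\<dots> = (\<integral>\<^sup>+x. sqint (?q x) \<partial>lborel)"
    using ae by (intro nn_integral_cong_AE) (auto intro!: plancherel int elim!: eventually_mono)
  also have "\<dots> = sqint f' * sqint p'" by (rule prod)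
  finally show ?thesis using r by (simp add: rep_L2norm_sq)
qed

text \<open>The coefficients -1 and -\<i> are written as factors so that every term has the form a +
  c * b, for which one energy formula is proved.\<close>

lemma complex_polarization:
  "4 * (a * cnj b) = of_real ((cmod (a + b))^2 - (cmod (a + (-1) * b))^2)
    + \<i> * of_real ((cmod (a + \<i> * b))^2 - (cmod (a + (-\<i>) * b))^2)"
  by (simp add: complex_eq_iff cmod_power2) (simp add: power2_eq_square algebra_simps)

lemma sqint_polarization:
  fixes f g :: "'a::euclidean_space \<Rightarrow> complex"
  assumes [measurable]: "f \<in> borel_measurable borel" "g \<in> borel_measurable borel"
    and fin: "sqint f < \<infinity>" "sqint g < \<infinity>"
  shows "4 * (LINT t|lborel. f t * cnj (g t))
    = of_real (enn2real (sqint (\<lambda>t. f t + 1 * g t)) - enn2real (sqint (\<lambda>t. f t + (-1) * g t)))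
    + \<i> * of_real (enn2real (sqint (\<lambda>t. f t + \<i> * g t)) - enn2real (sqint (\<lambda>t. f t + (-\<i>) * g t)))"
proof -
  have int: "integrable lborel (\<lambda>t. (cmod (f t + c * g t))^2)" for c
    using sqint_add_finite[OF assms, of 1 c] by (simp add: integrable_iff_bounded sqint_def)
  have eq: "enn2real (sqint (\<lambda>t. f t + c * g t)) = (LINT t|lborel. (cmod (f t + c * g t))^2)" for c
    unfolding sqint_def by (rule integral_eq_nn_integral[symmetric]) auto
  have "4 * (LINT t|lborel. f t * cnj (g t)) = (LINT t|lborel. 4 * (f t * cnj (g t)))" by simp
  also have "\<dots> = (LINT t|lborel. of_real ((cmod (f t + 1 * g t))^2 - (cmod (f t + (-1) * g t))^2)
    + \<i> * of_real ((cmod (f t + \<i> * g t))^2 - (cmod (f t + (-\<i>) * g t))^2))"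
    unfolding complex_polarization by simp
  also have "\<dots> = (LINT t|lborel. of_real ((cmod (f t + 1 * g t))^2 - (cmod (f t + (-1) * g t))^2))
    + (LINT t|lborel. \<i> * of_real ((cmod (f t + \<i> * g t))^2 - (cmod (f t + (-\<i>) * g t))^2))"
    by (rule Bochner_Integration.integral_add)
      (intro integrable_mult_right integrable_of_real Bochner_Integration.integrable_diff int)+
  also have "\<dots> = of_real (LINT t|lborel. ((cmod (f t + 1 * g t))^2 - (cmod (f t + (-1) * g t))^2))
    + \<i> * of_real (LINT t|lborel. ((cmod (f t + \<i> * g t))^2 - (cmod (f t + (-\<i>) * g t))^2))"
    by (simp only: integral_mult_right_zero integral_complex_of_real)
  finally show ?thesis unfolding eq Bochner_Integration.integral_diff[OF int int] .
qed

lemma stft_lin: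
  assumes "f \<in> L2" "g \<in> L2" "p \<in> L2"
  shows "stft p (\<lambda>t. a * f t + b * g t) z = a * stft p f z + b * stft p g z"
  unfolding stft_def using assms by (intro ip_lin_left L2_tfshift)

text \<open>Polarization of the energy identity: both inner products are the same combination of
  four energies, and each energy scales by the squared norm of the window.\<close>

lemma stft_moyal:
  assumes L: "f \<in> L2" "h \<in> L2" "p \<in> L2"
  shows "integrable lborel (\<lambda>z. stft p f z * cnj (stft p h z))"
    and "(LINT z|lborel. stft p f z * cnj (stft p h z)) = of_real ((L2norm p)^2) * ip f h"
proof -
  have [measurable]: "stft p f \<in> borel_measurable borel" "stft p h \<in> borel_measurable borel"
    using L by (auto intro: measurable_stft)
  have fin: "sqint (stft p f) < \<infinity>" "sqint (stft p h) < \<infinity>"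
    using L by (auto simp: sqint_stft ennreal_mult_less_top)
  then show "integrable lborel (\<lambda>z. stft p f z * cnj (stft p h z))"
    by (intro cauchy_schwarz_sqint(1)) (auto simp: sqint_cnj)
  obtain f' h' where r: "rep f f'" "rep h h'" using L by (meson L2_repE)
  have eq: "enn2real (sqint (\<lambda>z. stft p f z + c * stft p h z))
      = (L2norm p)^2 * enn2real (sqint (\<lambda>t. f' t + c * h' t))" for c
  proof -
    have "(\<lambda>z. stft p f z + c * stft p h z) = stft p (\<lambda>t. 1 * f t + c * h t)"
      using stft_lin[OF L, of 1 c] by (auto simp: fun_eq_iff)
    then have "enn2real (sqint (\<lambda>z. stft p f z + c * stft p h z)) = (L2norm p)^2 * (L2norm (\<lambda>t. 1 * f t + c * h t))^2"
      by (simp only: sqint_stft[OF L2_lin[OF L(1,2)] L(3)] enn2real_mult enn2real_ennreal zero_le_power2 mult.commute)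
    also have "(L2norm (\<lambda>t. 1 * f t + c * h t))^2 = enn2real (sqint (\<lambda>t. f' t + c * h' t))"
      unfolding rep_L2norm[OF rep_lin[OF r]] by simp
    finally show ?thesis .
  qed
  have "4 * (LINT z|lborel. stft p f z * cnj (stft p h z)) = of_real ((L2norm p)^2) * (4 * ip f h)"
  proof -
    have r': "f' \<in> borel_measurable borel" "h' \<in> borel_measurable borel" "sqint f' < \<infinity>" "sqint h' < \<infinity>"
      using r by (auto simp: rep_def)
    have "4 * ip f h = 4 * (LINT t|lborel. f' t * cnj (h' t))" by (simp only: rep_ip[OF r])
    note this[unfolded sqint_polarization[OF r']]
    then show ?thesis
      unfolding sqint_polarization[OF \<open>stft p f \<in> _\<close> \<open>stft p h \<in> _\<close> fin] eq
      by (simp only: of_real_mult of_real_diff) (simp only: algebra_simps)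
  qed
  then show "(LINT z|lborel. stft p f z * cnj (stft p h z)) = of_real ((L2norm p)^2) * ip f h"
    by simp
qed

lemma L2norm_nonneg [simp]: "0 \<le> L2norm f"
  by (simp add: L2norm_def)

text \<open>Strong continuity of time-frequency shifts. The difference splits into a translation
  part \<open>?A\<close>, small by continuity of translations, and a modulation part
  \<open>?B\<close>, which tends to 0 pointwise under the bound 4|p'|^2.\<close>

lemma tendsto_L2norm_tfshift:
  assumes p: "p \<in> L2" and z: "zs \<longlonglongrightarrow> z"
  shows "(\<lambda>n. L2norm (\<lambda>t. 1 * tfshift (zs n) p t + (-1) * tfshift z p t)) \<longlonglongrightarrow> 0"
proof -
  obtain p' where r: "rep p p'" using p by (rule L2_repE)
  then have [measurable]: "p' \<in> borel_measurable borel" and fin: "sqint p' < \<infinity>" by (auto simp: rep_def)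
  let ?x = "fst z" and ?u = "\<lambda>n. fst (zs n) - fst z"
  have u: "?u \<longlonglongrightarrow> 0" using tendsto_diff[OF tendsto_fst[OF z] tendsto_const[of "fst z"]] by simp
  let ?A = "\<lambda>n. \<integral>\<^sup>+t. ennreal (norm (p' (t - ?u n) - p' t) ^ 2) \<partial>lborel"
  let ?c = "\<lambda>n t. cis (2 * pi * (snd (zs n) \<bullet> t)) - cis (2 * pi * (snd z \<bullet> t))"
  let ?B = "\<lambda>n. \<integral>\<^sup>+t. ennreal ((cmod (?c n t * p' (t - ?x)))^2) \<partial>lborel"
  have A: "?A \<longlonglongrightarrow> 0"
    using translation_continuous_L2[of p'] fin u by (auto simp: translation_continuous_def)
  have "?B \<longlonglongrightarrow> (\<integral>\<^sup>+t. 0 \<partial>(lborel :: (real^'a) measure))"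
  proof (rule nn_integral_dominated_convergence[where w = "\<lambda>t. ennreal (4 * (cmod (p' (t - ?x)))^2)"])
    show "AE t in lborel. ennreal ((cmod (?c n t * p' (t - ?x)))^2) \<le> ennreal (4 * (cmod (p' (t - ?x)))^2)" for n
    proof (intro AE_I2 ennreal_leI)
      fix t
      have "cmod (?c n t) \<le> 2" using norm_triangle_ineq4[of "cis (2 * pi * (snd (zs n) \<bullet> t))" "cis (2 * pi * (snd z \<bullet> t))"] by simp
      then have "(cmod (?c n t))^2 \<le> 2^2" by (intro power_mono) auto
      then show "(cmod (?c n t * p' (t - ?x)))^2 \<le> 4 * (cmod (p' (t - ?x)))^2"
        by (simp add: norm_mult power_mult_distrib mult_right_mono)
    qed
    have "(\<integral>\<^sup>+t. ennreal (4 * (cmod (p' (t - ?x)))^2) \<partial>lborel) = 4 * sqint (\<lambda>t. p' (t - ?x))"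
      unfolding sqint_def by (subst nn_integral_cmult[symmetric]) (auto simp: ennreal_mult)
    also have "\<dots> < \<infinity>" using fin by (simp add: sqint_shift ennreal_mult_less_top)
    finally show "(\<integral>\<^sup>+t. ennreal (4 * (cmod (p' (t - ?x)))^2) \<partial>lborel) < \<infinity>" .
    show "AE t in lborel. (\<lambda>n. ennreal ((cmod (?c n t * p' (t - ?x)))^2)) \<longlonglongrightarrow> 0"
    proof (intro AE_I2)
      fix t
      have "isCont (\<lambda>\<xi>. cis (2 * pi * (\<xi> \<bullet> t))) (snd z)"
        unfolding cis_conv_exp by (intro continuous_intros)
      then have "(\<lambda>n. cis (2 * pi * (snd (zs n) \<bullet> t))) \<longlonglongrightarrow> cis (2 * pi * (snd z \<bullet> t))"
        by (rule isCont_tendsto_compose[OF _ tendsto_snd[OF z]])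
      then have "(\<lambda>n. (cmod (?c n t * p' (t - ?x)))^2) \<longlonglongrightarrow> (cmod ((cis (2 * pi * (snd z \<bullet> t)) - cis (2 * pi * (snd z \<bullet> t))) * p' (t - ?x)))^2"
        by (intro tendsto_power tendsto_norm tendsto_mult tendsto_diff tendsto_const)
      then show "(\<lambda>n. ennreal ((cmod (?c n t * p' (t - ?x)))^2)) \<longlonglongrightarrow> 0"
        using tendsto_ennrealI by fastforce
    qed
  qed measurable
  then have B: "?B \<longlonglongrightarrow> 0" by simp
  have lim: "(\<lambda>n. 2 * (?A n + ?B n)) \<longlonglongrightarrow> 0"
    using ennreal_tendsto_cmult[OF _ tendsto_add[OF A B], of 2] by simp
  let ?D = "\<lambda>n t. 1 * tfshift (zs n) p' t + (-1) * tfshift z p' t"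
  have le: "sqint (?D n) \<le> 2 * (?A n + ?B n)" for n
  proof -
    have "sqint (?D n) \<le> (\<integral>\<^sup>+t. 2 * (ennreal (norm (p' (t - ?x - ?u n) - p' (t - ?x)) ^ 2) + ennreal ((cmod (?c n t * p' (t - ?x)))^2)) \<partial>lborel)"
      unfolding sqint_def
    proof (intro nn_integral_mono)
      fix t
      let ?a = "cis (2 * pi * (snd (zs n) \<bullet> t)) * (p' (t - ?x - ?u n) - p' (t - ?x))"
      have "?D n t = ?a + ?c n t * p' (t - ?x)"
        by (simp add: tfshift_cis algebra_simps)
      then have "ennreal (cmod (?D n t)) ^ 2 \<le> (ennreal (cmod ?a) + ennreal (cmod (?c n t * p' (t - ?x)))) ^ 2"
        by (intro power_mono) (auto simp: ennreal_plus[symmetric] simp del: ennreal_plus intro!: ennreal_leI norm_triangle_ineq)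
      also have "\<dots> \<le> 2 * (ennreal (cmod ?a) ^ 2 + ennreal (cmod (?c n t * p' (t - ?x))) ^ 2)"
        by (rule ennreal_power2_add_le)
      also have "cmod ?a = norm (p' (t - ?x - ?u n) - p' (t - ?x))" by (simp add: norm_mult)
      finally show "ennreal ((cmod (?D n t))^2) \<le> 2 * (ennreal (norm (p' (t - ?x - ?u n) - p' (t - ?x)) ^ 2) + ennreal ((cmod (?c n t * p' (t - ?x)))^2))"
        by (simp only: ennreal_power norm_ge_zero)
    qed
    also have "\<dots> = 2 * ((\<integral>\<^sup>+t. ennreal (norm (p' (t - ?x - ?u n) - p' (t - ?x)) ^ 2) \<partial>lborel) + ?B n)"
      by (subst nn_integral_cmult) (measurable, subst nn_integral_add, auto)
    also have "(\<integral>\<^sup>+t. ennreal (norm (p' (t - ?x - ?u n) - p' (t - ?x)) ^ 2) \<partial>lborel) = ?A n"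
      by (rule nn_integral_lborel_shift(1)[where f = "\<lambda>t. ennreal (norm (p' (t - ?u n) - p' t) ^ 2)"]) measurable
    finally show ?thesis .
  qed
  have "(\<lambda>n. sqint (?D n)) \<longlonglongrightarrow> 0"
    by (rule tendsto_sandwich[OF _ _ tendsto_const lim]) (rule always_eventually, simp, rule always_eventually, rule allI, rule le)
  then have "(\<lambda>n. ennreal ((L2norm (\<lambda>t. 1 * tfshift (zs n) p t + (-1) * tfshift z p t))^2)) \<longlonglongrightarrow> 0"
    using rep_L2norm_sq[OF rep_lin[OF rep_tfshift[OF r] rep_tfshift[OF r]], of 1 _ "-1" z] by simp
  then have "(\<lambda>n. (L2norm (\<lambda>t. 1 * tfshift (zs n) p t + (-1) * tfshift z p t))^2) \<longlonglongrightarrow> 0"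
    by (rule power2_tendsto_zero_iff_ennreal[rotated]) simp
  then have "(\<lambda>n. sqrt ((L2norm (\<lambda>t. 1 * tfshift (zs n) p t + (-1) * tfshift z p t))^2)) \<longlonglongrightarrow> sqrt 0"
    by (rule tendsto_real_sqrt)
  then show ?thesis by simp
qed

lemma stft_tendsto:
  assumes f: "f \<in> L2" and p: "p \<in> L2" and z: "zs \<longlonglongrightarrow> z"
  shows "(\<lambda>n. stft p f (zs n)) \<longlonglongrightarrow> stft p f z"
proof -
  let ?D = "\<lambda>n t. 1 * tfshift (zs n) p t + (-1) * tfshift z p t"
  have D: "?D n \<in> L2" for n using p by (intro L2_lin L2_tfshift)
  have "(\<lambda>n. L2norm f * L2norm (?D n)) \<longlonglongrightarrow> 0"
    using tendsto_mult_left[OF tendsto_L2norm_tfshift[OF p z], of "L2norm f"] by simp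
  then have lim: "(\<lambda>n. L2norm f * L2norm (?D n)) \<longlonglongrightarrow> 0" .
  have "cmod (stft p f (zs n) - stft p f z) \<le> L2norm f * L2norm (?D n)" for n
  proof -
    have "ip (?D n) f = 1 * ip (tfshift (zs n) p) f + (-1) * ip (tfshift z p) f"
      using p f by (intro ip_lin_left L2_tfshift)
    then have "cnj (ip (?D n) f) = stft p f (zs n) - stft p f z"
      unfolding stft_def using ip_cnj[OF L2_tfshift[OF p] f] by simp
    then have "cmod (stft p f (zs n) - stft p f z) = cmod (ip (?D n) f)"
      by (metis complex_mod_cnj)
    also have "\<dots> \<le> L2norm (?D n) * L2norm f" by (rule ip_cauchy_schwarz[OF D f])
    finally show ?thesis by (simp add: mult.commute)
  qed
  then have "(\<lambda>n. cmod (stft p f (zs n) - stft p f z)) \<longlonglongrightarrow> 0"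
    by - (rule tendsto_sandwich[OF _ _ tendsto_const lim], auto intro: always_eventually)
  then show ?thesis by (simp only: tendsto_norm_zero_iff LIM_zero_iff)
qed

text \<open>Covariance of the transform: translating the variable of integration turns a shift of f
  into a shift of the argument, up to a phase that the modulus removes.\<close>

lemma cmod_stft_tfshift:
  assumes f: "f \<in> L2" and p: "p \<in> L2"
  shows "cmod (stft p (tfshift z f) y) = cmod (stft p f (y - z))"
proof -
  obtain f' p' where r: "rep f f'" "rep p p'" using f p by (meson L2_repE)
  then have [measurable]: "f' \<in> borel_measurable borel" "p' \<in> borel_measurable borel" by (auto simp: rep_def)
  let ?h = "\<lambda>t. tfshift z f' t * cnj (p' (t - fst y)) * cis (- (2 * pi * (snd y \<bullet> t)))"
  have [measurable]: "tfshift z f' \<in> borel_measurable borel" using rep_tfshift[OF r(1), of z] by (simp add: rep_def)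
  have "stft p (tfshift z f) y = (LINT t|lborel. ?h t)"
    unfolding rep_stft[OF rep_tfshift[OF r(1)] r(2)] fourier_def ..
  also have "\<dots> = \<bar>1\<bar> ^ DIM(real^'a) *\<^sub>R (LINT t|lborel. ?h (fst z + 1 *\<^sub>R t))"
    by (rule lborel_integral_affine) auto
  also have "\<dots> = (LINT t|lborel. cis (2 * pi * ((snd z - snd y) \<bullet> fst z)) *
      (f' t * cnj (p' (t - fst (y - z))) * cis (- (2 * pi * (snd (y - z) \<bullet> t)))))"
    by (auto simp: tfshift_cis cis_mult mult_ac inner_simps algebra_simps
        intro!: Bochner_Integration.integral_cong)
  also have "\<dots> = cis (2 * pi * ((snd z - snd y) \<bullet> fst z)) * stft p f (y - z)"
    unfolding rep_stft[OF r] fourier_def by simp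
  finally show ?thesis by (simp add: norm_mult)
qed

section \<open>Windows in weighted modulation spaces\<close>

lemma slow_cmult: "slow D \<kappa> b \<Longrightarrow> slow D \<kappa> (\<lambda>x. c * b x)"
  unfolding slow_def
proof safe
  fix x y assume *: "\<forall>x y. b x \<le> ennreal (D * exp (\<kappa> * norm (x - y))) * b y"
  show "c * b x \<le> ennreal (D * exp (\<kappa> * norm (x - y))) * (c * b y)"
    using mult_left_mono[OF *[rule_format, of x y], of c] by (simp add: mult_ac)
qed auto

section \<open>The Gaussian window\<close>

lemma gauss_measurable [measurable]: "gauss \<in> borel_measurable borel"
  unfolding gauss_def by measurable

lemma gauss_sq: "2 powr (real CARD('d) / 4) * 2 powr (real CARD('d) / 4) / (sqrt 2) ^ CARD('d::finite) = 1"
  by (simp add: powr_add[symmetric] powr_half_sqrt[symmetric] powr_realpow[symmetric] powr_powr)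

lemma gauss_rep: "rep (gauss :: ('d::finite) fn) gauss" and L2norm_gauss: "L2norm (gauss :: ('d::finite) fn) = 1"
proof -
  let ?c = "2 powr (real CARD('d) / 4)"
  have eq: "(cmod (gauss t))^2 = ?c * ?c * exp (- pi * 2 * (norm t)^2)" for t :: "real^'d"
  proof -
    have "cmod (gauss t) = ?c * exp (- pi * (norm t)^2)" unfolding gauss_def norm_of_real by simp
    then have "(cmod (gauss t))^2 = ?c * ?c * (exp (- pi * (norm t)^2) * exp (- pi * (norm t)^2))"
      by (simp add: power2_eq_square mult_ac)
    then show ?thesis unfolding exp_add[symmetric] by simp
  qed
  have int: "integrable lborel (\<lambda>t::real^'d. ?c * ?c * exp (- pi * 2 * (norm t)^2))"
    using gauss_fourier(1)[of 2] by simp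
  have "complex_of_real (LINT t|lborel. exp (- pi * 2 * (norm (t::real^'d))^2)) = 1 / complex_of_real (sqrt 2 ^ CARD('d))"
    using gauss_fourier(2)[of 2 "0::real^'d"] by (simp del: of_real_exp)
  then have "(LINT t|lborel. exp (- pi * 2 * (norm (t::real^'d))^2)) = 1 / sqrt 2 ^ CARD('d)"
    by (metis of_real_1 of_real_divide of_real_eq_iff)
  then have "(LINT t|lborel. ?c * ?c * exp (- pi * 2 * (norm (t::real^'d))^2)) = 1"
    using gauss_sq by (simp only: integral_mult_right_zero) simp
  then have *: "sqint (gauss :: 'd fn) = 1"
    unfolding sqint_def eq by (subst nn_integral_eq_integral[OF int]) auto
  then show r: "rep (gauss :: 'd fn) gauss"
    by (intro rep_self) auto
  show "L2norm (gauss :: 'd fn) = 1"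
    unfolding rep_L2norm[OF r] * by simp
qed

lemma L2_gauss: "gauss \<in> L2"
  using gauss_rep L2_iff_rep by blast

lemma norm_prod_sq: "(norm (z :: 'a::real_inner \<times> 'b::real_inner))^2 = (norm (fst z))^2 + (norm (snd z))^2"
  by (simp add: norm_prod_def)

lemma stft_gauss_gauss:
  fixes z :: "('d::finite) tf"
  shows "cmod (stft gauss gauss z) = exp (- pi * (norm z)^2 / 2)"
proof -
  obtain x \<xi> where z: "z = (x, \<xi>)" by (cases z)
  let ?c = "2 powr (real CARD('d) / 4)"
  let ?h = "\<lambda>t. gauss t * cnj (gauss (t - x)) * cis (- (2 * pi * (\<xi> \<bullet> t)))"
  have ms [measurable]: "?h \<in> borel_measurable borel" by measurable
  have "stft gauss gauss z = (LINT t|lborel. ?h t)"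
    unfolding rep_stft[OF gauss_rep gauss_rep] fourier_def z by simp
  \<comment> \<open>Recentring at x / 2 separates the product of the two Gaussians into a constant
    and one Gaussian centred at 0, by the parallelogram identity.\<close>
  also have "\<dots> = \<bar>1\<bar> ^ DIM(real^'d) *\<^sub>R (LINT t|lborel. ?h ((1/2) *\<^sub>R x + 1 *\<^sub>R t))"
    by (rule lborel_integral_affine) auto
  also have "\<dots> = (LINT t|lborel. complex_of_real (?c * ?c * exp (- pi * (norm x)^2 / 2)) * cis (- (pi * (\<xi> \<bullet> x))) *
      (complex_of_real (exp (- pi * 2 * (norm t)^2)) * cis (2 * pi * (t \<bullet> (- \<xi>)))))"
  proof -
    have "?h ((1/2) *\<^sub>R x + 1 *\<^sub>R t) = complex_of_real (?c * ?c * exp (- pi * (norm x)^2 / 2)) * cis (- (pi * (\<xi> \<bullet> x))) *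
      (complex_of_real (exp (- pi * 2 * (norm t)^2)) * cis (2 * pi * (t \<bullet> (- \<xi>))))" for t
    proof -
      let ?s = "(1/2) *\<^sub>R x + 1 *\<^sub>R t"
      have "(norm ?s)^2 + (norm (?s - x))^2 = (norm x)^2 / 2 + 2 * (norm t)^2"
        unfolding power2_norm_eq_inner by (simp add: inner_simps inner_commute algebra_simps)
      then have e: "- pi * (norm ?s)^2 + - pi * (norm (?s - x))^2 = - pi * (norm x)^2 / 2 + - pi * 2 * (norm t)^2"
        by (simp add: algebra_simps flip: distrib_left)
      have g: "gauss ?s * cnj (gauss (?s - x)) = complex_of_real (?c * ?c * exp (- pi * (norm ?s)^2 + - pi * (norm (?s - x))^2))"
        unfolding gauss_def exp_add by simp
      have c: "- (2 * pi * (\<xi> \<bullet> ?s)) = - (pi * (\<xi> \<bullet> x)) + 2 * pi * (t \<bullet> (- \<xi>))"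
        by (simp add: inner_simps inner_commute algebra_simps)
      show ?thesis unfolding g e c cis_mult[symmetric] exp_add by simp
    qed
    then show ?thesis by simp
  qed
  also have "\<dots> = complex_of_real (?c * ?c * exp (- pi * (norm x)^2 / 2)) * cis (- (pi * (\<xi> \<bullet> x))) *
      complex_of_real (exp (- pi * (norm \<xi>)^2 / 2) / (sqrt 2) ^ CARD('d))"
    using gauss_fourier(2)[of 2 "- \<xi>"] by (subst integral_mult_right_zero) simp
  finally have "cmod (stft gauss gauss z) = ?c * ?c * exp (- pi * (norm x)^2 / 2) * (exp (- pi * (norm \<xi>)^2 / 2) / (sqrt 2) ^ CARD('d))"
    by (simp only: norm_mult norm_of_real norm_cis) (simp add: abs_mult)
  also have "\<dots> = (?c * ?c / (sqrt 2) ^ CARD('d)) * exp (- pi * (norm x)^2 / 2 + - pi * (norm \<xi>)^2 / 2)"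
    unfolding exp_add by simp
  also have "\<dots> = exp (- pi * (norm x)^2 / 2 + - pi * (norm \<xi>)^2 / 2)" unfolding gauss_sq by simp
  also have "- pi * (norm x)^2 / 2 + - pi * (norm \<xi>)^2 / 2 = - pi * (norm z)^2 / 2"
    unfolding norm_prod_sq z by (simp add: field_simps)
  finally show ?thesis .
qed

text \<open>The exponential is preferred to the exact Gaussian because it is slowly varying and the
  Gaussian is not.\<close>

lemma stft_gauss_gauss_le: "ennreal (cmod (stft gauss gauss z)) \<le> ennreal (exp 1) * edecay 1 z"
proof -
  let ?r = "norm z"
  have "0 \<le> (?r - 1)^2" by simp
  then have "2 * ?r \<le> ?r^2 + 1" by (simp add: power2_eq_square algebra_simps)
  moreover have "?r^2 \<le> pi * ?r^2" using pi_ge_two mult_right_mono[of 1 pi "?r^2"] by simp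
  ultimately have "- pi * ?r^2 / 2 \<le> 1 + - (1 * ?r)" by linarith
  then have "exp (- pi * ?r^2 / 2) \<le> exp (1 + - (1 * ?r))" by simp
  then show ?thesis
    unfolding stft_gauss_gauss edecay_def by (subst ennreal_mult[symmetric]) (auto simp: exp_add[symmetric] intro: ennreal_leI)
qed

text \<open>Moyal's identity for a unit window. Combined with covariance it bounds inner products of
  shifted functions by convolutions of transform moduli.\<close>

lemma ip_le_stft:
  assumes L: "f \<in> L2" "h \<in> L2" "p \<in> L2" and p: "L2norm p = 1"
  shows "ennreal (cmod (ip f h)) \<le> (\<integral>\<^sup>+y. ennreal (cmod (stft p f y)) * ennreal (cmod (stft p h y)) \<partial>lborel)"
proof -
  have "ip f h = (LINT z|lborel. stft p f z * cnj (stft p h z))"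
    using stft_moyal(2)[OF L] p by simp
  then have "ennreal (cmod (ip f h)) \<le> (\<integral>\<^sup>+z. ennreal (norm (stft p f z * cnj (stft p h z))) \<partial>lborel)"
    using integral_norm_bound_ennreal[OF stft_moyal(1)[OF L]] by simp
  then show ?thesis by (simp add: norm_mult ennreal_mult)
qed

section \<open>The window, its reproducing kernel and their envelopes\<close>

locale tf_frame = submult_weight w for w :: "('d::finite) tf \<Rightarrow> real" +
  fixes phi :: "'d fn"
  assumes phi_M1: "phi \<in> M1 w" and phi_norm: "L2norm phi = 1"
begin

text \<open>The norm of M1 as an extended number: membership becomes finiteness, and estimates can
  precede any proof of membership.\<close>

definition N1 :: "'d fn \<Rightarrow> ennreal" where
  "N1 f = wint (\<lambda>z. ennreal (cmod (stft gauss f z)))"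

lemma M1_iff: "f \<in> M1 w \<longleftrightarrow> f \<in> L2 \<and> N1 f < \<infinity>"
  unfolding M1_def N1_def wint_def using measurable_stft[OF _ L2_gauss, of f] less_imp_le[OF pos]
  by (auto simp: ennreal_mult)

lemma M1norm_eq: "M1norm w f = enn2real (N1 f)"
  unfolding M1norm_def N1_def wint_def using less_imp_le[OF pos] by (simp add: ennreal_mult)

lemma phi_L2: "phi \<in> L2" and phi_N1: "N1 phi < \<infinity>"
  using phi_M1 by (auto simp: M1_iff)

lemma M1_L2: "f \<in> M1 w \<Longrightarrow> f \<in> L2" by (simp add: M1_iff)

lemma measurable_stft_gauss [measurable]: "f \<in> L2 \<Longrightarrow> stft gauss f \<in> borel_measurable borel"
  using measurable_stft L2_gauss by blast

lemma N1_lin: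
  assumes "f \<in> L2" "g \<in> L2"
  shows "N1 (\<lambda>t. a * f t + b * g t) \<le> ennreal (cmod a) * N1 f + ennreal (cmod b) * N1 g"
proof -
  have [measurable]: "stft gauss f \<in> borel_measurable borel" "stft gauss g \<in> borel_measurable borel"
    using assms by auto
  have "N1 (\<lambda>t. a * f t + b * g t)
      \<le> wint (\<lambda>z. ennreal (cmod a) * ennreal (cmod (stft gauss f z)) + ennreal (cmod b) * ennreal (cmod (stft gauss g z)))"
    unfolding N1_def
  proof (rule wint_mono)
    fix z
    have "cmod (a * stft gauss f z + b * stft gauss g z) \<le> cmod a * cmod (stft gauss f z) + cmod b * cmod (stft gauss g z)"
      by (metis norm_mult norm_triangle_ineq)
    then show "ennreal (cmod (stft gauss (\<lambda>t. a * f t + b * g t) z))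
      \<le> ennreal (cmod a) * ennreal (cmod (stft gauss f z)) + ennreal (cmod b) * ennreal (cmod (stft gauss g z))"
      unfolding stft_lin[OF assms L2_gauss]
      by (simp add: ennreal_mult[symmetric] ennreal_plus[symmetric] ennreal_leI del: ennreal_plus)
  qed
  also have "\<dots> = ennreal (cmod a) * N1 f + ennreal (cmod b) * N1 g"
    unfolding N1_def by (subst wint_add) (auto simp: wint_cmult)
  finally show ?thesis .
qed

lemma M1_lin: "f \<in> M1 w \<Longrightarrow> g \<in> M1 w \<Longrightarrow> (\<lambda>t. a * f t + b * g t) \<in> M1 w"
  using N1_lin[of f g a b] by (auto simp: M1_iff ennreal_mult_less_top L2_lin intro: le_less_trans)

lemma M1_scale: "f \<in> M1 w \<Longrightarrow> (\<lambda>t. a * f t) \<in> M1 w"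
  using M1_lin[of f f a 0] by simp

lemma M1_sum: "finite I \<Longrightarrow> (\<And>i. i \<in> I \<Longrightarrow> f i \<in> M1 w) \<Longrightarrow> (\<lambda>t. \<Sum>i\<in>I. c i * f i t) \<in> M1 w"
proof (induction I rule: finite_induct)
  case empty
  then show ?case using M1_scale[OF phi_M1, of 0] by simp
next
  case (insert i I)
  then show ?case using M1_lin[of "f i" "\<lambda>t. \<Sum>i\<in>I. c i * f i t" "c i" 1] by simp
qed

lemma N1_tfshift:
  assumes f: "f \<in> L2"
  shows "N1 (tfshift z f) \<le> ennreal (w z) * N1 f"
proof -
  have [measurable]: "stft gauss f \<in> borel_measurable borel" using f by auto
  show ?thesis unfolding N1_def cmod_stft_tfshift[OF f L2_gauss] by (rule wint_shift_le) measurable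
qed

lemma M1_tfshift: "f \<in> M1 w \<Longrightarrow> tfshift z f \<in> M1 w"
  using N1_tfshift[of f z] by (auto simp: M1_iff L2_tfshift ennreal_mult_less_top intro: le_less_trans)

definition A :: "'d tf \<Rightarrow> ennreal" where "A z = ennreal (cmod (stft gauss phi z))"

lemma A_measurable [measurable]: "A \<in> borel_measurable borel"
  unfolding A_def[abs_def] using measurable_stft_gauss[OF phi_L2] by measurable

lemma wint_A: "wint A < \<infinity>"
  using phi_N1 unfolding N1_def A_def[abs_def] .

text \<open>Slowly varying envelope of the window's transform A. The transform is reproduced by the
  Gaussian window, so A is at most its convolution with the envelope of the Gaussian's own
  transform.\<close>

definition b0 :: "'d tf \<Rightarrow> ennreal" where "b0 z = ennreal (exp 1) * conv A (edecay 1) z"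

lemma slow_b0: "slow 1 1 b0"
  unfolding b0_def[abs_def] by (intro slow_cmult slow_conv slow_edecay) auto

lemma b0_measurable [measurable]: "b0 \<in> borel_measurable borel"
  using slow_b0 by (rule slowD)

lemma wint_b0: "wint b0 < \<infinity>"
proof -
  have "wint b0 = ennreal (exp 1) * wint (conv A (edecay 1))"
    unfolding b0_def[abs_def] by (rule wint_cmult) measurable
  also have "\<dots> \<le> ennreal (exp 1) * (wint A * wint (edecay 1))"
    by (intro mult_left_mono wint_conv) auto
  also have "\<dots> < \<infinity>" using wint_A wint_edecay_finite[of 1] by (simp add: ennreal_mult_less_top)
  finally show ?thesis .
qed

lemma A_le_b0: "A z \<le> b0 z"
proof -
  have "A z \<le> (\<integral>\<^sup>+y. ennreal (cmod (stft gauss phi y)) * ennreal (cmod (stft gauss (tfshift z gauss) y)) \<partial>lborel)"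
    unfolding A_def stft_def[of gauss phi z]
    by (intro ip_le_stft phi_L2 L2_tfshift L2_gauss L2norm_gauss)
  also have "\<dots> \<le> (\<integral>\<^sup>+y. ennreal (exp 1) * (A y * edecay 1 (z - y)) \<partial>lborel)"
  proof (intro nn_integral_mono)
    fix y
    have "ennreal (cmod (stft gauss (tfshift z gauss) y)) \<le> ennreal (exp 1) * edecay 1 (z - y)"
      using stft_gauss_gauss_le[of "y - z"] edecay_minus[of 1 "y - z"]
      by (simp add: cmod_stft_tfshift[OF L2_gauss L2_gauss])
    from mult_left_mono[OF this, of "A y"]
    show "ennreal (cmod (stft gauss phi y)) * ennreal (cmod (stft gauss (tfshift z gauss) y))
        \<le> ennreal (exp 1) * (A y * edecay 1 (z - y))"
      by (simp add: A_def mult_ac)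
  qed
  also have "\<dots> = b0 z" unfolding b0_def conv_def by (rule nn_integral_cmult) measurable
  finally show ?thesis .
qed

text \<open>Envelope of the reproducing kernel: the transform of phi with window phi is at most the
  convolution of A with the reflected \<open>b0\<close>. Adding the reflection makes the envelope
  even, so that it bounds the kernel in either order of its arguments.\<close>

definition b1 :: "'d tf \<Rightarrow> ennreal" where
  "b1 z = conv A (\<lambda>u. b0 (- u)) z + conv A (\<lambda>u. b0 (- u)) (- z)"

lemma slow_b1: "slow 1 1 b1"
  unfolding b1_def[abs_def]
  by (intro slow_add slow_reflect[of 1 1 "conv A (\<lambda>u. b0 (- u))"] slow_conv slow_reflect slow_b0) auto

lemma b1_measurable [measurable]: "b1 \<in> borel_measurable borel"
  using slow_b1 by (rule slowD)

lemma b1_even: "b1 (- z) = b1 z"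
  by (simp add: b1_def add.commute)

lemma wint_b1: "wint b1 < \<infinity>"
proof -
  let ?c = "conv A (\<lambda>u. b0 (- u))"
  have [measurable]: "?c \<in> borel_measurable borel" by measurable
  have "wint ?c \<le> wint A * wint (\<lambda>u. b0 (- u))" by (rule wint_conv) measurable
  also have "\<dots> < \<infinity>" using wint_A wint_b0 by (simp add: wint_reflect ennreal_mult_less_top)
  finally have c: "wint ?c < \<infinity>" .
  have "wint b1 = wint ?c + wint (\<lambda>z. ?c (- z))"
    unfolding b1_def[abs_def] by (rule wint_add) measurable
  then show ?thesis using c by (simp add: wint_reflect)
qed

definition ker :: "'d tf \<Rightarrow> 'd tf \<Rightarrow> complex" where
  "ker z y = ip (tfshift y phi) (tfshift z phi)"

lemma ker_cnj: "cnj (ker z y) = ker y z"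
  unfolding ker_def by (rule ip_cnj[symmetric]) (intro L2_tfshift phi_L2)+

lemma ker_bound: "ennreal (cmod (ker z y)) \<le> b1 (z - y)"
proof -
  have "ennreal (cmod (ker z y)) = ennreal (cmod (stft phi phi (z - y)))"
    unfolding ker_def stft_def[symmetric] cmod_stft_tfshift[OF phi_L2 phi_L2] ..
  also have "\<dots> \<le> (\<integral>\<^sup>+x. ennreal (cmod (stft gauss phi x)) * ennreal (cmod (stft gauss (tfshift (z - y) phi) x)) \<partial>lborel)"
    unfolding stft_def[of phi phi]
    by (intro ip_le_stft phi_L2 L2_tfshift L2_gauss L2norm_gauss)
  also have "\<dots> \<le> conv A (\<lambda>u. b0 (- u)) (z - y)"
    unfolding conv_def cmod_stft_tfshift[OF phi_L2 L2_gauss] A_def[symmetric]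
    by (intro nn_integral_mono mult_left_mono) (auto intro: order_trans[OF A_le_b0])
  also have "\<dots> \<le> b1 (z - y)" unfolding b1_def by simp
  finally show ?thesis .
qed

definition V :: "'d tf \<Rightarrow> 'd tf \<Rightarrow> complex" where
  "V z y = stft gauss (tfshift z phi) y"

lemma V_measurable: "(\<lambda>(z, y). V z y) \<in> borel_measurable (borel \<Otimes>\<^sub>M borel)"
proof -
  obtain p where r: "rep phi p" using phi_L2 by (rule L2_repE)
  then have [measurable]: "p \<in> borel_measurable borel" by (auto simp: rep_def)
  show ?thesis
    unfolding V_def rep_stft[OF rep_tfshift[OF r] gauss_rep] fourier_def tfshift_cis by measurable
qed

lemma V_measurable' [measurable]: "f \<in> borel_measurable M \<Longrightarrow> g \<in> borel_measurable M \<Longrightarrow> (\<lambda>x. V (f x) (g x)) \<in> borel_measurable M"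
  using measurable_compose[OF measurable_Pair V_measurable] by simp

lemma V_le: "ennreal (cmod (V z y)) \<le> b0 (y - z)"
  unfolding V_def cmod_stft_tfshift[OF phi_L2 L2_gauss] using A_le_b0 by (simp add: A_def)

lemma V_tendsto: "zs \<longlonglongrightarrow> z \<Longrightarrow> (\<lambda>n. V (zs n) y) \<longlonglongrightarrow> V z y"
proof -
  assume z: "zs \<longlonglongrightarrow> z"
  have eq: "V z y = cnj (stft phi (tfshift y gauss) z)" for z
    unfolding V_def stft_def by (rule ip_cnj) (intro L2_tfshift phi_L2 L2_gauss)+
  show ?thesis unfolding eq by (intro tendsto_cnj stft_tendsto[OF _ phi_L2 z] L2_tfshift L2_gauss)
qed

text \<open>Shifts of the window depend continuously on z in the norm of M1. Pointwise convergence
  is upgraded by a dominating function: slow variation of \<open>b0\<close> absorbs the bounded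
  displacement of zs n from z.\<close>

lemma N1_tfshift_tendsto:
  assumes z: "zs \<longlonglongrightarrow> z"
  shows "(\<lambda>n. wint (\<lambda>y. ennreal (cmod (V (zs n) y - V z y)))) \<longlonglongrightarrow> 0"
proof -
  have "Bseq (\<lambda>n. zs n - z)" using z by (intro convergent_imp_Bseq convergentI[of _ "z - z"] tendsto_intros)
  then obtain R where R: "\<And>n. norm (zs n - z) \<le> R" by (auto simp: Bseq_def)
  let ?M = "ennreal (exp R) + 1"
  show ?thesis
  proof (rule wint_tendsto_zero[where b = "\<lambda>y. ?M * b0 (y - z)"])
    have "wint (\<lambda>y. ?M * b0 (y - z)) = ?M * wint (\<lambda>y. b0 (y - z))" by (rule wint_cmult) measurable
    also have "\<dots> \<le> ?M * (ennreal (w z) * wint b0)" by (intro mult_left_mono wint_shift_le) auto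
    also have "\<dots> < \<infinity>" using wint_b0 by (simp add: ennreal_mult_less_top)
    finally show "wint (\<lambda>y. ?M * b0 (y - z)) < \<infinity>" .
    fix n y
    have "ennreal (cmod (V (zs n) y - V z y)) \<le> ennreal (cmod (V (zs n) y)) + ennreal (cmod (V z y))"
      by (simp add: ennreal_plus[symmetric] ennreal_leI norm_triangle_ineq4 del: ennreal_plus)
    also have "\<dots> \<le> b0 (y - zs n) + b0 (y - z)" by (intro add_mono V_le)
    also have "b0 (y - zs n) \<le> ennreal (1 * exp (1 * norm ((y - zs n) - (y - z)))) * b0 (y - z)"
      by (rule slowD(4)[OF slow_b0])
    also have "\<dots> \<le> ennreal (exp R) * b0 (y - z)"
      using R[of n] by (intro mult_right_mono ennreal_leI) (auto simp: norm_minus_commute)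
    finally show "ennreal (cmod (V (zs n) y - V z y)) \<le> ?M * b0 (y - z)"
      by (simp add: distrib_right)
  next
    fix y
    have "(\<lambda>n. cmod (V (zs n) y - V z y)) \<longlonglongrightarrow> cmod (V z y - V z y)"
      by (intro tendsto_norm tendsto_diff tendsto_const V_tendsto z)
    then show "(\<lambda>n. ennreal (cmod (V (zs n) y - V z y))) \<longlonglongrightarrow> 0"
      using tendsto_ennrealI by fastforce
  qed measurable
qed


lemma V_le_1: "cmod (V z y) \<le> 1"
  unfolding V_def using stft_bound[OF L2_tfshift[OF phi_L2, of z] L2_gauss, of y]
  by (simp add: L2norm_tfshift phi_L2 phi_norm L2norm_gauss)

lemma stft_sum:
  fixes g :: "'d fn"
  assumes "finite I" "\<And>i. i \<in> I \<Longrightarrow> f i \<in> L2" "g \<in> L2"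
  shows "(\<lambda>t. \<Sum>i\<in>I. c i * f i t) \<in> L2 \<and> stft g (\<lambda>t. \<Sum>i\<in>I. c i * f i t) y = (\<Sum>i\<in>I. c i * stft g (f i) y)"
  using assms
proof (induction I rule: finite_induct)
  case empty
  then show ?case using L2_scale[OF phi_L2, of 0] stft_lin[OF phi_L2 phi_L2, of g 0 0 y] by simp
next
  case (insert i I)
  then show ?case
    using L2_lin[of "f i" "\<lambda>t. \<Sum>i\<in>I. c i * f i t" "c i" 1]
      stft_lin[of "f i" "\<lambda>t. \<Sum>i\<in>I. c i * f i t" g "c i" 1 y] by simp
qed

text \<open>By \<open>N1_diff\<close> this is the distance in M1 between the windows shifted to z
  and to a.\<close>

definition dV :: "'d tf \<Rightarrow> 'd tf \<Rightarrow> ennreal" where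
  "dV z a = wint (\<lambda>y. ennreal (cmod (V z y - V a y)))"

lemma N1_diff: "N1 (\<lambda>t. 1 * tfshift z phi t + (-1) * tfshift a phi t) = dV z a"
  unfolding N1_def dV_def V_def by (simp add: stft_lin[OF L2_tfshift[OF phi_L2] L2_tfshift[OF phi_L2] L2_gauss, of 1 _ "-1", simplified])

lemma dV_small_near:
  assumes "0 < \<epsilon>"
  shows "\<exists>\<delta>>0. \<forall>z\<in>ball a \<delta>. dV z a \<le> ennreal \<epsilon>"
proof (rule ccontr)
  assume "\<not> ?thesis"
  then have "\<forall>n. \<exists>z. z \<in> ball a (1 / real (Suc n)) \<and> ennreal \<epsilon> < dV z a"
    by (metis not_le of_nat_0_less_iff zero_less_Suc zero_less_divide_1_iff)
  then obtain zs where zs: "\<And>n. zs n \<in> ball a (1 / real (Suc n))" "\<And>n. ennreal \<epsilon> < dV (zs n) a"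
    by metis
  have "(\<lambda>n. dist (zs n) a) \<longlonglongrightarrow> 0"
    by (rule tendsto_sandwich[OF _ _ tendsto_const LIMSEQ_Suc[OF lim_const_over_n[of 1]]])
      (use zs(1) in \<open>auto simp: dist_commute intro!: always_eventually less_imp_le\<close>)
  then have "zs \<longlonglongrightarrow> a" by (rule tendsto_dist_iff[THEN iffD2])
  then have "(\<lambda>n. dV (zs n) a) \<longlonglongrightarrow> 0"
    unfolding dV_def by (rule N1_tfshift_tendsto)
  then have "eventually (\<lambda>n. dV (zs n) a < ennreal \<epsilon>) sequentially"
    using assms by (intro order_tendstoD) auto
  then show False using zs(2) by (auto simp: eventually_sequentially dest: less_asym)
qed

section \<open>Bounded functionals on M1 and their transforms\<close>

definition ubound :: "('d fn \<Rightarrow> complex) \<Rightarrow> real \<Rightarrow> bool" where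
  "ubound u K \<longleftrightarrow> 0 \<le> K \<and> (\<forall>f\<in>M1 w. ennreal (cmod (u f)) \<le> ennreal K * N1 f)"

lemma Minf_ubound:
  assumes "u \<in> Minf w"
  shows "\<exists>K. ubound u K"
proof -
  obtain K where K: "\<And>f. f \<in> M1 w \<Longrightarrow> cmod (u f) \<le> K * M1norm w f" using assms unfolding Minf_def by blast
  have "ennreal (cmod (u f)) \<le> ennreal (max 0 K) * N1 f" if f: "f \<in> M1 w" for f
  proof -
    have "cmod (u f) \<le> max 0 K * M1norm w f"
      using K[OF f] by (rule order_trans) (auto intro!: mult_right_mono simp: M1norm_eq)
    then have "ennreal (cmod (u f)) \<le> ennreal (max 0 K * enn2real (N1 f))"
      unfolding M1norm_eq by (rule ennreal_leI)
    also have "\<dots> = ennreal (max 0 K) * N1 f" using f by (subst ennreal_mult) (auto simp: M1_iff)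
    finally show ?thesis .
  qed
  then show ?thesis by (intro exI[of _ "max 0 K"]) (simp add: ubound_def)
qed

lemma Minf_lin: "u \<in> Minf w \<Longrightarrow> f \<in> M1 w \<Longrightarrow> g \<in> M1 w \<Longrightarrow>
    u (\<lambda>t. a * f t + b * g t) = cnj a * u f + cnj b * u g"
  by (simp add: Minf_def)

lemma Minf_sum:
  assumes u: "u \<in> Minf w" and "finite I" "\<And>i. i \<in> I \<Longrightarrow> f i \<in> M1 w"
  shows "u (\<lambda>t. \<Sum>i\<in>I. c i * f i t) = (\<Sum>i\<in>I. cnj (c i) * u (f i))"
  using assms(2,3)
proof (induction I rule: finite_induct)
  case empty
  then show ?case using Minf_lin[OF u phi_M1 phi_M1, of 0 0] by simp
next
  case (insert i I)
  then show ?case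
    using Minf_lin[OF u, of "f i" "\<lambda>t. \<Sum>i\<in>I. c i * f i t" "c i" 1] M1_sum[of I f c] by simp
qed

lemma dstft_lipschitz:
  assumes u: "u \<in> Minf w" "ubound u K"
  shows "ennreal (cmod (dstft phi u z - dstft phi u a)) \<le> ennreal K * dV z a"
proof -
  have M: "tfshift z phi \<in> M1 w" for z by (intro M1_tfshift phi_M1)
  have "dstft phi u z - dstft phi u a = u (\<lambda>t. 1 * tfshift z phi t + (-1) * tfshift a phi t)"
    unfolding dstft_def Minf_lin[OF u(1) M M] by simp
  then show ?thesis
    using u(2) M1_lin[OF M M, of 1 z "-1" a] unfolding ubound_def N1_diff[symmetric] by metis
qed

lemma dstft_bound:
  assumes u: "u \<in> Minf w" "ubound u K"
  shows "ennreal (cmod (dstft phi u z)) \<le> ennreal K * (ennreal (w z) * N1 phi)"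
proof -
  have "ennreal (cmod (dstft phi u z)) \<le> ennreal K * N1 (tfshift z phi)"
    using u(2) M1_tfshift[OF phi_M1, of z] by (simp add: ubound_def dstft_def)
  also have "\<dots> \<le> ennreal K * (ennreal (w z) * N1 phi)"
    by (intro mult_left_mono N1_tfshift phi_L2) auto
  finally show ?thesis .
qed

text \<open>The transform is continuous, as a bounded functional evaluated along a norm-continuous
  family of windows.\<close>

lemma dstft_measurable:
  assumes u: "u \<in> Minf w"
  shows "dstft phi u \<in> borel_measurable borel"
proof -
  obtain K where K: "ubound u K" using Minf_ubound[OF u] by blast
  have "continuous_on UNIV (dstft phi u)"
    unfolding continuous_on_sequentially
  proof (intro allI ballI impI)
    fix zs :: "nat \<Rightarrow> 'd tf" and z assume "(\<forall>n. zs n \<in> UNIV) \<and> zs \<longlonglongrightarrow> z"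
    then have "(\<lambda>n. dV (zs n) z) \<longlonglongrightarrow> 0" unfolding dV_def by (intro N1_tfshift_tendsto) auto
    from ennreal_tendsto_cmult[OF _ this, of "ennreal K"]
    have lim: "(\<lambda>n. ennreal K * dV (zs n) z) \<longlonglongrightarrow> 0" by simp
    have "(\<lambda>n. ennreal (cmod (dstft phi u (zs n) - dstft phi u z))) \<longlonglongrightarrow> 0"
      by (rule tendsto_sandwich[OF _ _ tendsto_const lim])
        (rule always_eventually, simp, rule always_eventually, rule allI, rule dstft_lipschitz[OF u K])
    then have "(\<lambda>n. cmod (dstft phi u (zs n) - dstft phi u z)) \<longlonglongrightarrow> 0"
      by (rule power2_tendsto_zero_iff_ennreal[rotated]) simp
    then show "(dstft phi u \<circ> zs) \<longlonglongrightarrow> dstft phi u z"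
      unfolding comp_def by (simp only: tendsto_norm_zero_iff LIM_zero_iff)
  qed
  then show ?thesis by (rule borel_measurable_continuous_onI)
qed

text \<open>A bounded functional on M1 commutes with weak superpositions of time-frequency shifts:
  on a large ball the shifts are replaced by finitely many nearby ones, the rest is small.\<close>

lemma functional_superposition:
  assumes u: "u \<in> Minf w" and m [measurable]: "m \<in> borel_measurable borel"
    and mfin: "wint (\<lambda>z. ennreal (cmod (m z))) < \<infinity>"
    and h: "h \<in> M1 w" and hV: "\<And>y. stft gauss h y = (LINT z|lborel. m z * V z y)"
  shows "u h = (LINT z|lborel. cnj (m z) * dstft phi u z)"
proof -
  obtain K where K: "ubound u K" using Minf_ubound[OF u] by blast
  have K0: "0 \<le> K" using K by (simp add: ubound_def)
  let ?U = "dstft phi u"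
  have [measurable]: "?U \<in> borel_measurable borel" using u by (rule dstft_measurable)
  let ?m = "\<lambda>z. ennreal (cmod (m z))"
  let ?J = "LINT z|lborel. cnj (m z) * ?U z"
  have M: "tfshift z phi \<in> M1 w" for z by (intro M1_tfshift phi_M1)
  have m1: "integrable lborel m"
    using le_less_trans[OF nn_integral_le_wint mfin] by (simp add: integrable_iff_bounded)
  have Jint: "integrable lborel (\<lambda>z. cnj (m z) * ?U z)"
    unfolding integrable_iff_bounded
  proof
    have "(\<integral>\<^sup>+z. ennreal (norm (cnj (m z) * ?U z)) \<partial>lborel)
        \<le> (\<integral>\<^sup>+z. (ennreal K * N1 phi) * (?m z * ennreal (w z)) \<partial>lborel)"
    proof (intro nn_integral_mono)
      fix z
      show "ennreal (norm (cnj (m z) * ?U z)) \<le> (ennreal K * N1 phi) * (?m z * ennreal (w z))"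
        using mult_left_mono[OF dstft_bound[OF u K, of z], of "?m z"]
        by (simp add: norm_mult ennreal_mult mult_ac)
    qed
    also have "\<dots> = (ennreal K * N1 phi) * wint ?m"
      unfolding wint_def by (rule nn_integral_cmult) measurable
    also have "\<dots> < \<infinity>" using phi_N1 mfin by (simp add: ennreal_mult_less_top)
    finally show "(\<integral>\<^sup>+z. ennreal (norm (cnj (m z) * ?U z)) \<partial>lborel) < \<infinity>" .
  qed measurable
  let ?X = "wint ?m + N1 phi"
  have main: "ennreal (cmod (u h - ?J)) \<le> ennreal (2 * K * \<epsilon>) * ?X" if \<epsilon>: "0 < \<epsilon>" for \<epsilon>
  proof -
    \<comment> \<open>Choice of the ball: outside it m has weighted mass below \<epsilon>.\<close>
    have "(\<lambda>n. wint (\<lambda>z. ?m z * indicator (- cball 0 (real n)) z)) \<longlonglongrightarrow> 0"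
    proof (rule wint_tendsto_zero[OF _ mfin])
      fix z :: "'d tf"
      obtain n0 where n0: "norm z \<le> real n0" using real_arch_simple by blast
      have "eventually (\<lambda>n. ?m z * indicator (- cball 0 (real n)) z = 0) sequentially"
        using eventually_ge_at_top[of n0] by eventually_elim (use n0 in auto)
      then show "(\<lambda>n. ?m z * indicator (- cball 0 (real n)) z) \<longlonglongrightarrow> 0" by (rule tendsto_eventually)
    qed (auto simp: indicator_def)
    then have "eventually (\<lambda>n. wint (\<lambda>z. ?m z * indicator (- cball 0 (real n)) z) < ennreal \<epsilon>) sequentially"
      using \<epsilon> by (intro order_tendstoD) auto
    then obtain R where R: "wint (\<lambda>z. ?m z * indicator (- cball 0 (real R)) z) < ennreal \<epsilon>"
      by (auto simp: eventually_sequentially)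
    define C where "C = cball (0::'d tf) (real R)"
    have C [measurable]: "C \<in> sets borel" and cC: "compact C" by (auto simp: C_def)
    obtain \<delta> where \<delta>: "\<And>a. 0 < \<delta> a" "\<And>a z. z \<in> ball a (\<delta> a) \<Longrightarrow> dV z a \<le> ennreal \<epsilon>"
      using dV_small_near[OF \<epsilon>] by metis
    have "C \<subseteq> (\<Union>a\<in>C. ball a (\<delta> a))" using \<delta>(1) by force
    then obtain D where D: "D \<subseteq> C" "finite D" "C \<subseteq> (\<Union>a\<in>D. ball a (\<delta> a))"
      using compactE_image[OF cC, of C "\<lambda>a. ball a (\<delta> a)"] open_ball by blast
    obtain e where e: "bij_betw e {0..<card D} D" using ex_bij_betw_nat_finite[OF D(2)] by blast
    define N where "N = card D"
    define B where "B i = ball (e i) (\<delta> (e i))" for i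
    \<comment> \<open>Disjoint pieces of the cover: a point of C belongs to the piece of the first
      ball that contains it, so a sum over the pieces picks out a single nearby centre.\<close>
    define S where "S i = (B i - (\<Union>j<i. B j)) \<inter> C" for i
    have [measurable]: "B i \<in> sets borel" for i by (simp add: B_def)
    have [measurable]: "S i \<in> sets borel" for i unfolding S_def by measurable
    let ?ind = "\<lambda>i z. indicator (S i) z :: complex"
    have cover: "\<exists>i<N. z \<in> B i \<and> (\<forall>x :: nat \<Rightarrow> complex. (\<Sum>j<N. ?ind j z * x j) = x i)" if z: "z \<in> C" for z
    proof -
      have "\<exists>i<N. z \<in> B i"
        using D(3) z e unfolding bij_betw_def B_def N_def by force
      then obtain i0 where i0: "i0 < N" "z \<in> B i0" by blast
      define i where "i = (LEAST i. z \<in> B i)"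
      have i: "z \<in> B i" "i < N" "\<And>j. j < i \<Longrightarrow> z \<notin> B j"
        using LeastI[of "\<lambda>i. z \<in> B i", OF i0(2)] Least_le[of "\<lambda>i. z \<in> B i", OF i0(2)] i0(1)
        by (auto simp: i_def dest: not_less_Least)
      have "z \<in> S j \<longleftrightarrow> j = i" for j
        using i z unfolding S_def by (metis Diff_iff IntE IntI UN_E UN_I lessThan_iff linorder_neqE_nat)
      then have "(\<Sum>j<N. ?ind j z * x j) = (\<Sum>j<N. if j = i then x j else 0)" for x :: "nat \<Rightarrow> complex"
        by (intro sum.cong) (auto simp: indicator_def)
      then show ?thesis using i by auto
    qed
    have nocover: "(\<Sum>j<N. ?ind j z * x j) = 0" if "z \<notin> C" for z and x :: "nat \<Rightarrow> complex"
      using that by (intro sum.neutral) (auto simp: S_def)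
    define c where "c i = (LINT z|lborel. m z * ?ind i z)" for i
    have cint: "integrable lborel (\<lambda>z. m z * ?ind i z)" for i
      by (rule Bochner_Integration.integrable_bound[OF m1]) (auto simp: indicator_def)
    define s where "s = (\<lambda>t. \<Sum>i<N. c i * tfshift (e i) phi t)"
    have sM: "s \<in> M1 w" unfolding s_def by (intro M1_sum M) auto
    \<comment> \<open>Common error of replacing the shift at z by its centre: \<epsilon> on C, the
      full size of the shifted window off C. Integrated against |m| this is at most \<epsilon> times
      \<open>?X\<close>, both for the window in M1 and, up to K, for the functional.\<close>
    let ?bd = "\<lambda>z. ennreal \<epsilon> + indicator (- C) z * (ennreal (w z) * N1 phi)"
    have bd: "(\<integral>\<^sup>+z. ?m z * ?bd z \<partial>lborel) \<le> ennreal \<epsilon> * ?X"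
    proof -
      have "(\<integral>\<^sup>+z. ?m z * ?bd z \<partial>lborel)
          = (\<integral>\<^sup>+z. ennreal \<epsilon> * ?m z + N1 phi * (?m z * indicator (- C) z * ennreal (w z)) \<partial>lborel)"
        by (intro nn_integral_cong) (simp add: distrib_left mult_ac)
      also have "\<dots> = ennreal \<epsilon> * (\<integral>\<^sup>+z. ?m z \<partial>lborel) + N1 phi * wint (\<lambda>z. ?m z * indicator (- C) z)"
        unfolding wint_def by (subst nn_integral_add) (auto simp: nn_integral_cmult)
      also have "\<dots> \<le> ennreal \<epsilon> * wint ?m + N1 phi * ennreal \<epsilon>"
        using R by (intro add_mono mult_left_mono nn_integral_le_wint) (auto simp: C_def)
      finally show ?thesis by (simp add: distrib_left mult.commute)
    qed
    have Vbd: "wint (\<lambda>y. ennreal (cmod (V z y - (\<Sum>i<N. ?ind i z * V (e i) y)))) \<le> ?bd z" for z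
    proof (cases "z \<in> C")
      case True
      then obtain i where i: "z \<in> B i" "\<And>x :: nat \<Rightarrow> complex. (\<Sum>j<N. ?ind j z * x j) = x i" using cover by blast
      have "wint (\<lambda>y. ennreal (cmod (V z y - (\<Sum>i<N. ?ind i z * V (e i) y)))) = dV z (e i)"
        unfolding i(2) dV_def ..
      also have "\<dots> \<le> ennreal \<epsilon>" using i(1) \<delta>(2) by (simp add: B_def)
      finally show ?thesis using True by simp
    next
      case False
      have "wint (\<lambda>y. ennreal (cmod (V z y - (\<Sum>i<N. ?ind i z * V (e i) y)))) = N1 (tfshift z phi)"
        unfolding nocover[OF False] N1_def V_def by simp
      also have "\<dots> \<le> ennreal (w z) * N1 phi" by (rule N1_tfshift[OF phi_L2])
      finally show ?thesis using False by (simp add: add_increasing)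
    qed
    have Ubd: "ennreal (cmod (?U z - (\<Sum>i<N. ?ind i z * ?U (e i)))) \<le> ennreal K * ?bd z" for z
    proof (cases "z \<in> C")
      case True
      then obtain i where i: "z \<in> B i" "\<And>x :: nat \<Rightarrow> complex. (\<Sum>j<N. ?ind j z * x j) = x i" using cover by blast
      have "ennreal (cmod (?U z - ?U (e i))) \<le> ennreal K * dV z (e i)" by (rule dstft_lipschitz[OF u K])
      also have "\<dots> \<le> ennreal K * ennreal \<epsilon>" using i(1) \<delta>(2) by (intro mult_left_mono) (auto simp: B_def)
      finally show ?thesis using True unfolding i(2) by simp
    next
      case False
      then show ?thesis unfolding nocover[OF False]
        using dstft_bound[OF u K, of z] by (simp add: distrib_left add_increasing)
    qed
    let ?g = "\<lambda>t. 1 * h t + (-1) * s t"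
    have gM: "?g \<in> M1 w" by (intro M1_lin h sM)
    have "N1 ?g \<le> ennreal \<epsilon> * ?X"
    proof -
      have eq: "stft gauss ?g y = (LINT z|lborel. m z * (V z y - (\<Sum>i<N. ?ind i z * V (e i) y)))" for y
      proof -
        have int1: "integrable lborel (\<lambda>z. m z * V z y)"
          by (rule Bochner_Integration.integrable_bound[OF m1])
            (auto simp: norm_mult intro!: mult_left_le V_le_1)
        have int2: "integrable lborel (\<lambda>z. m z * ?ind i z * V (e i) y)" for i
          using cint by (rule integrable_mult_left)
        have ss: "stft gauss s y = (\<Sum>i<N. c i * V (e i) y)"
          unfolding s_def V_def using stft_sum[of "{..<N}" "\<lambda>i. tfshift (e i) phi" gauss c y]
          by (simp add: L2_tfshift phi_L2 L2_gauss)
        have "stft gauss ?g y = (LINT z|lborel. m z * V z y) - (\<Sum>i<N. c i * V (e i) y)"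
          unfolding stft_lin[OF M1_L2[OF h] M1_L2[OF sM] L2_gauss] hV ss by simp
        also have "(\<Sum>i<N. c i * V (e i) y) = (LINT z|lborel. (\<Sum>i<N. m z * ?ind i z * V (e i) y))"
          unfolding c_def using int2 by (subst Bochner_Integration.integral_sum) auto
        also have "(LINT z|lborel. m z * V z y) - \<dots> = (LINT z|lborel. (m z * V z y - (\<Sum>i<N. m z * ?ind i z * V (e i) y)))"
          using int1 int2 by (subst Bochner_Integration.integral_diff) auto
        finally show ?thesis by (simp only: right_diff_distrib sum_distrib_left mult.assoc)
      qed
      have "N1 ?g \<le> wint (\<lambda>y. \<integral>\<^sup>+z. ?m z * ennreal (cmod (V z y - (\<Sum>i<N. ?ind i z * V (e i) y))) \<partial>lborel)"
        unfolding N1_def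
      proof (rule wint_mono)
        fix y
        \<comment> \<open>A Bochner integral that does not exist has the value 0, so the bound by
          the integral of the modulus holds in that case too.\<close>
        show "ennreal (cmod (stft gauss ?g y)) \<le> (\<integral>\<^sup>+z. ?m z * ennreal (cmod (V z y - (\<Sum>i<N. ?ind i z * V (e i) y))) \<partial>lborel)"
          unfolding eq
          by (cases "integrable lborel (\<lambda>z. m z * (V z y - (\<Sum>i<N. ?ind i z * V (e i) y)))")
            (use integral_norm_bound_ennreal in \<open>auto simp: norm_mult ennreal_mult not_integrable_integral_eq dest!: integral_norm_bound_ennreal\<close>)
      qed
      also have "\<dots> = (\<integral>\<^sup>+y. \<integral>\<^sup>+z. ?m z * ennreal (cmod (V z y - (\<Sum>i<N. ?ind i z * V (e i) y))) * ennreal (w y) \<partial>lborel \<partial>lborel)"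
        unfolding wint_def by (intro nn_integral_cong nn_integral_multc[symmetric]) measurable
      also have "\<dots> = (\<integral>\<^sup>+z. \<integral>\<^sup>+y. ?m z * ennreal (cmod (V z y - (\<Sum>i<N. ?ind i z * V (e i) y))) * ennreal (w y) \<partial>lborel \<partial>lborel)"
        by (rule lborel_pair.Fubini') measurable
      also have "\<dots> = (\<integral>\<^sup>+z. ?m z * wint (\<lambda>y. ennreal (cmod (V z y - (\<Sum>i<N. ?ind i z * V (e i) y)))) \<partial>lborel)"
        unfolding wint_def mult.assoc by (intro nn_integral_cong nn_integral_cmult) measurable
      also have "\<dots> \<le> (\<integral>\<^sup>+z. ?m z * ?bd z \<partial>lborel)"
        by (intro nn_integral_mono mult_left_mono Vbd) auto
      also note bd
      finally show ?thesis .
    qed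
    then have "ennreal K * N1 ?g \<le> ennreal K * (ennreal \<epsilon> * ?X)" by (intro mult_left_mono) auto
    with K gM have ug: "ennreal (cmod (u ?g)) \<le> ennreal K * (ennreal \<epsilon> * ?X)"
      unfolding ubound_def by (blast intro: order_trans)
    let ?Us = "\<Sum>i<N. cnj (c i) * ?U (e i)"
    have us: "u ?g = u h - ?Us"
      unfolding Minf_lin[OF u h sM] unfolding s_def dstft_def by (subst Minf_sum[OF u]) (auto intro: M)
    have "?J - ?Us = (LINT z|lborel. cnj (m z) * (?U z - (\<Sum>i<N. ?ind i z * ?U (e i))))"
    proof -
      have cc: "cnj (c i) = (LINT z|lborel. cnj (m z) * ?ind i z)" for i
        unfolding c_def Bochner_Integration.integral_cnj[symmetric] by (intro Bochner_Integration.integral_cong) (auto simp: indicator_def)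
      have ci: "integrable lborel (\<lambda>z. cnj (m z) * ?ind i z * ?U (e i))" for i
        by (rule integrable_mult_left, rule Bochner_Integration.integrable_bound[OF m1]) (auto simp: indicator_def)
      have "?Us = (LINT z|lborel. (\<Sum>i<N. cnj (m z) * ?ind i z * ?U (e i)))"
        unfolding cc using ci by (subst Bochner_Integration.integral_sum) auto
      then have "?J - ?Us = (LINT z|lborel. cnj (m z) * ?U z - (\<Sum>i<N. cnj (m z) * ?ind i z * ?U (e i)))"
        using Jint ci by (subst Bochner_Integration.integral_diff) auto
      then show ?thesis by (simp only: right_diff_distrib sum_distrib_left mult.assoc)
    qed
    then have "ennreal (cmod (?J - ?Us)) \<le> (\<integral>\<^sup>+z. ?m z * ennreal (cmod (?U z - (\<Sum>i<N. ?ind i z * ?U (e i)))) \<partial>lborel)"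
      by (cases "integrable lborel (\<lambda>z. cnj (m z) * (?U z - (\<Sum>i<N. ?ind i z * ?U (e i))))")
        (auto simp: norm_mult ennreal_mult not_integrable_integral_eq dest!: integral_norm_bound_ennreal)
    also have "\<dots> \<le> (\<integral>\<^sup>+z. ennreal K * (?m z * ?bd z) \<partial>lborel)"
    proof (intro nn_integral_mono)
      fix z show "?m z * ennreal (cmod (?U z - (\<Sum>i<N. ?ind i z * ?U (e i)))) \<le> ennreal K * (?m z * ?bd z)"
        using mult_left_mono[OF Ubd[of z] zero_le, of "?m z"] by (simp only: mult_ac)
    qed
    also have "\<dots> = ennreal K * (\<integral>\<^sup>+z. ?m z * ?bd z \<partial>lborel)" by (rule nn_integral_cmult) measurable
    also have "\<dots> \<le> ennreal K * (ennreal \<epsilon> * ?X)" by (intro mult_left_mono bd) auto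
    finally have Js: "ennreal (cmod (?J - ?Us)) \<le> ennreal K * (ennreal \<epsilon> * ?X)" .
    have "cmod (u h - ?J) \<le> cmod (u ?g) + cmod (?J - ?Us)"
      unfolding us using norm_triangle_ineq4[of "u h - ?Us" "?J - ?Us"] by simp
    then have "ennreal (cmod (u h - ?J)) \<le> ennreal (cmod (u ?g)) + ennreal (cmod (?J - ?Us))"
      by (simp add: ennreal_plus[symmetric] ennreal_leI del: ennreal_plus)
    also have "\<dots> \<le> ennreal K * (ennreal \<epsilon> * ?X) + ennreal K * (ennreal \<epsilon> * ?X)"
      by (intro add_mono ug Js)
    also have "\<dots> = ennreal (2 * K * \<epsilon>) * ?X"
      unfolding mult_2[symmetric] using K0 \<epsilon> by (simp add: ennreal_mult mult.assoc)
    finally show ?thesis .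
  qed
  have X: "?X < \<infinity>" using mfin phi_N1 by simp
  then obtain x where x: "?X = ennreal x" "0 \<le> x" by (cases ?X) auto
  \<comment> \<open>The estimate \<open>main\<close> holds for every \<epsilon> and
    \<open>?X\<close> is finite. The 1 added in the denominator below covers 2 * K * x = 0.\<close>
  have "cmod (u h - ?J) \<le> 0"
  proof (rule field_le_epsilon)
    fix d :: real assume d: "0 < d"
    have p: "0 < 2 * K * x + 1" using K0 x by (simp add: add_nonneg_pos)
    have "ennreal (cmod (u h - ?J)) \<le> ennreal (2 * K * (d / (2 * K * x + 1)) * x)"
      using main[of "d / (2 * K * x + 1)"] d p K0 x by (subst ennreal_mult''[OF x(2)]) (simp only: divide_pos_pos)
    then have "cmod (u h - ?J) \<le> 2 * K * (d / (2 * K * x + 1)) * x"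
      using K0 x d p by (subst (asm) ennreal_le_iff) auto
    also have "\<dots> = d * (2 * K * x / (2 * K * x + 1))" by simp
    also have "\<dots> \<le> d * 1" using d p K0 x by (intro mult_left_mono) (auto simp: divide_le_eq)
    finally show "cmod (u h - ?J) \<le> 0 + d" by simp
  qed
  then show ?thesis by simp
qed


text \<open>Moving the norm inside the superposition leaves the integral of |m| times the norm of a
  shifted window, and that norm grows at most like w.\<close>

lemma superposition_M1:
  assumes m [measurable]: "m \<in> borel_measurable borel"
    and mfin: "wint (\<lambda>z. ennreal (cmod (m z))) < \<infinity>"
    and h: "h \<in> L2" and hV: "\<And>y. stft gauss h y = (LINT z|lborel. m z * V z y)"
  shows "h \<in> M1 w"
proof -
  let ?m = "\<lambda>z. ennreal (cmod (m z))"
  have "N1 h \<le> wint (\<lambda>y. \<integral>\<^sup>+z. ?m z * ennreal (cmod (V z y)) \<partial>lborel)"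
    unfolding N1_def
  proof (rule wint_mono)
    fix y
    show "ennreal (cmod (stft gauss h y)) \<le> (\<integral>\<^sup>+z. ?m z * ennreal (cmod (V z y)) \<partial>lborel)"
      unfolding hV by (cases "integrable lborel (\<lambda>z. m z * V z y)")
        (auto simp: norm_mult ennreal_mult not_integrable_integral_eq dest!: integral_norm_bound_ennreal)
  qed
  also have "\<dots> = (\<integral>\<^sup>+y. \<integral>\<^sup>+z. ?m z * ennreal (cmod (V z y)) * ennreal (w y) \<partial>lborel \<partial>lborel)"
    unfolding wint_def by (intro nn_integral_cong nn_integral_multc[symmetric]) measurable
  also have "\<dots> = (\<integral>\<^sup>+z. \<integral>\<^sup>+y. ?m z * ennreal (cmod (V z y)) * ennreal (w y) \<partial>lborel \<partial>lborel)"
    by (rule lborel_pair.Fubini') measurable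
  also have "\<dots> = (\<integral>\<^sup>+z. ?m z * N1 (tfshift z phi) \<partial>lborel)"
    unfolding N1_def wint_def mult.assoc V_def[symmetric] by (intro nn_integral_cong nn_integral_cmult) measurable
  also have "\<dots> \<le> (\<integral>\<^sup>+z. ?m z * (ennreal (w z) * N1 phi) \<partial>lborel)"
    by (intro nn_integral_mono mult_left_mono N1_tfshift phi_L2) auto
  also have "\<dots> = wint ?m * N1 phi"
    unfolding wint_def mult.assoc[symmetric] by (rule nn_integral_multc) measurable
  also have "\<dots> < \<infinity>" using mfin phi_N1 by (simp add: ennreal_mult_less_top)
  finally show ?thesis using h by (simp add: M1_iff)
qed

lemma measurable_stft_phi [measurable]: "f \<in> L2 \<Longrightarrow> stft phi f \<in> borel_measurable borel"
  using measurable_stft phi_L2 by blast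

lemma ker_eq: "ker z y = stft phi (tfshift y phi) z" "ker z y = cnj (stft phi (tfshift z phi) y)"
  by (simp add: ker_def stft_def) (metis ker_cnj ker_def stft_def)

lemma V_eq: "V z y = cnj (stft phi (tfshift y gauss) z)"
  unfolding V_def stft_def by (rule ip_cnj) (intro L2_tfshift phi_L2 L2_gauss)+

text \<open>By Moyal, a shifted window is a superposition of shifted windows whose coefficients are
  bounded by a shift of \<open>b1\<close>, hence integrable against w. Then u may be applied under
  the integral.\<close>

lemma reproducing:
  assumes u: "u \<in> Minf w"
  shows "dstft phi u y = (LINT z|lborel. ker y z * dstft phi u z)"
proof -
  have L: "tfshift y phi \<in> L2" by (intro L2_tfshift phi_L2)
  have "dstft phi u y = (LINT z|lborel. cnj (stft phi (tfshift y phi) z) * dstft phi u z)"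
    unfolding dstft_def[of phi u y]
  proof (rule functional_superposition[OF u])
    show "stft phi (tfshift y phi) \<in> borel_measurable borel" using L by measurable
    have "wint (\<lambda>z. ennreal (cmod (stft phi (tfshift y phi) z))) \<le> wint (\<lambda>z. b1 (z - y))"
      unfolding ker_eq(1)[symmetric] by (intro wint_mono ker_bound)
    also have "\<dots> \<le> ennreal (w y) * wint b1" by (rule wint_shift_le) measurable
    also have "\<dots> < \<infinity>" using wint_b1 by (simp add: ennreal_mult_less_top)
    finally show "wint (\<lambda>z. ennreal (cmod (stft phi (tfshift y phi) z))) < \<infinity>" .
    show "tfshift y phi \<in> M1 w" by (intro M1_tfshift phi_M1)
    fix y'
    show "stft gauss (tfshift y phi) y' = (LINT z|lborel. stft phi (tfshift y phi) z * V z y')"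
      unfolding V_eq using stft_moyal(2)[OF L L2_tfshift[OF L2_gauss, of y'] phi_L2]
      by (simp add: stft_def[of gauss] phi_norm)
  qed
  then show ?thesis unfolding ker_eq(2) .
qed

lemma dstft_le_conv:
  assumes u: "u \<in> Minf w"
  shows "ennreal (cmod (dstft phi u y)) \<le> (\<integral>\<^sup>+z. b1 (y - z) * ennreal (cmod (dstft phi u z)) \<partial>lborel)"
proof -
  have "ennreal (cmod (dstft phi u y)) \<le> (\<integral>\<^sup>+z. ennreal (cmod (ker y z)) * ennreal (cmod (dstft phi u z)) \<partial>lborel)"
    unfolding reproducing[OF u, of y]
    by (cases "integrable lborel (\<lambda>z. ker y z * dstft phi u z)")
      (auto simp: norm_mult ennreal_mult not_integrable_integral_eq dest!: integral_norm_bound_ennreal)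
  also have "\<dots> \<le> (\<integral>\<^sup>+z. b1 (y - z) * ennreal (cmod (dstft phi u z)) \<partial>lborel)"
    by (intro nn_integral_mono mult_right_mono ker_bound) auto
  finally show ?thesis .
qed

end

section \<open>Localization operators and thresholding\<close>

text \<open>Pythagoras with general squared norms \<mu>, because the eigenfunction transforms
  weighted by sqrt eta have the eigenvalues as squared norms.\<close>

lemma sqint_orthogonal_sum:
  fixes g :: "'k \<Rightarrow> 'a::euclidean_space \<Rightarrow> complex"
  assumes F: "finite F" and g [measurable]: "\<And>k. g k \<in> borel_measurable borel"
    and fin: "\<And>k. k \<in> F \<Longrightarrow> sqint (g k) < \<infinity>"
    and orth: "\<And>j k. j \<in> F \<Longrightarrow> k \<in> F \<Longrightarrow> (LINT t|lborel. g j t * cnj (g k t)) = (if j = k then of_real (\<mu> k) else 0)"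
  shows "sqint (\<lambda>t. \<Sum>k\<in>F. a k * g k t) = ennreal (\<Sum>k\<in>F. (cmod (a k))^2 * \<mu> k)"
proof -
  let ?s = "\<lambda>t. \<Sum>k\<in>F. a k * g k t"
  have int: "integrable lborel (\<lambda>t. g j t * cnj (g k t))" if "j \<in> F" "k \<in> F" for j k
    using that fin by (intro cauchy_schwarz_sqint(1)) (auto simp: sqint_cnj)
  have eq: "complex_of_real ((cmod (?s t))^2) = (\<Sum>j\<in>F. \<Sum>k\<in>F. a j * cnj (a k) * (g j t * cnj (g k t)))" for t
    unfolding complex_norm_square by (simp add: sum_product cnj_sum mult_ac)
  have cint: "integrable lborel (\<lambda>t. complex_of_real ((cmod (?s t))^2))"
    unfolding eq by (intro Bochner_Integration.integrable_sum integrable_mult_right int)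
  then have rint: "integrable lborel (\<lambda>t. (cmod (?s t))^2)"
    by (simp only: complex_of_real_integrable_eq)
  have "complex_of_real (LINT t|lborel. (cmod (?s t))^2) = (LINT t|lborel. (\<Sum>j\<in>F. \<Sum>k\<in>F. a j * cnj (a k) * (g j t * cnj (g k t))))"
    by (simp only: integral_complex_of_real[symmetric] eq)
  also have "\<dots> = (\<Sum>j\<in>F. LINT t|lborel. (\<Sum>k\<in>F. a j * cnj (a k) * (g j t * cnj (g k t))))"
    by (rule Bochner_Integration.integral_sum) (intro Bochner_Integration.integrable_sum integrable_mult_right int)
  also have "\<dots> = (\<Sum>j\<in>F. \<Sum>k\<in>F. LINT t|lborel. a j * cnj (a k) * (g j t * cnj (g k t)))"
    by (rule sum.cong[OF refl], rule Bochner_Integration.integral_sum) (intro integrable_mult_right int)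
  also have "\<dots> = (\<Sum>j\<in>F. \<Sum>k\<in>F. a j * cnj (a k) * (LINT t|lborel. g j t * cnj (g k t)))"
    by simp
  also have "\<dots> = (\<Sum>j\<in>F. \<Sum>k\<in>F. if j = k then of_real ((cmod (a k))^2 * \<mu> k) else 0)"
  proof (intro sum.cong refl)
    fix j k assume jk: "j \<in> F" "k \<in> F"
    show "a j * cnj (a k) * (LINT t|lborel. g j t * cnj (g k t)) = (if j = k then of_real ((cmod (a k))^2 * \<mu> k) else 0)"
      unfolding orth[OF jk] of_real_mult complex_norm_square by simp
  qed
  also have "\<dots> = of_real (\<Sum>k\<in>F. (cmod (a k))^2 * \<mu> k)"
    using F by (simp add: sum.delta)
  finally have "(LINT t|lborel. (cmod (?s t))^2) = (\<Sum>k\<in>F. (cmod (a k))^2 * \<mu> k)"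
    by (simp only: of_real_eq_iff)
  then show ?thesis unfolding sqint_def by (subst nn_integral_eq_integral[OF rint]) auto
qed

text \<open>Let S be the sum of the |a_k|^2. Pairing G with the sum of the a_k g_k gives S, while
  that sum has energy at most M * S; Cauchy-Schwarz gives S^2 \<le> |G|^2 * M * S, and S
  cancels.\<close>

lemma bessel:
  fixes g :: "'k \<Rightarrow> 'a::euclidean_space \<Rightarrow> complex"
  assumes F: "finite F" and g [measurable]: "\<And>k. g k \<in> borel_measurable borel"
    and fin: "\<And>k. k \<in> F \<Longrightarrow> sqint (g k) < \<infinity>"
    and orth: "\<And>j k. j \<in> F \<Longrightarrow> k \<in> F \<Longrightarrow> (LINT t|lborel. g j t * cnj (g k t)) = (if j = k then of_real (\<mu> k) else 0)"
    and \<mu>: "\<And>k. k \<in> F \<Longrightarrow> \<mu> k \<le> M" and M: "0 \<le> M"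
    and G [measurable]: "G \<in> borel_measurable borel" and Gfin: "sqint G < \<infinity>"
  shows "ennreal (\<Sum>k\<in>F. (cmod (LINT t|lborel. G t * cnj (g k t)))^2) \<le> ennreal M * sqint G"
proof -
  define a where "a k = (LINT t|lborel. G t * cnj (g k t))" for k
  define S where "S = (\<Sum>k\<in>F. (cmod (a k))^2)"
  let ?s = "\<lambda>t. \<Sum>k\<in>F. a k * g k t"
  have S0: "0 \<le> S" unfolding S_def by (intro sum_nonneg) auto
  have ps: "sqint ?s = ennreal (\<Sum>k\<in>F. (cmod (a k))^2 * \<mu> k)"
    by (rule sqint_orthogonal_sum[OF F g fin orth])
  have le: "(\<Sum>k\<in>F. (cmod (a k))^2 * \<mu> k) \<le> M * S"
    unfolding S_def sum_distrib_left by (intro sum_mono) (auto simp: mult.commute[of M] intro: mult_left_mono \<mu>)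
  have int: "integrable lborel (\<lambda>t. G t * cnj (g k t))" if "k \<in> F" for k
    using that fin Gfin by (intro cauchy_schwarz_sqint(1)) (auto simp: sqint_cnj)
  have "(LINT t|lborel. G t * cnj (?s t)) = (LINT t|lborel. (\<Sum>k\<in>F. cnj (a k) * (G t * cnj (g k t))))"
    by (simp add: cnj_sum sum_distrib_left mult_ac)
  also have "\<dots> = (\<Sum>k\<in>F. cnj (a k) * a k)"
    unfolding a_def using int by (subst Bochner_Integration.integral_sum) auto
  also have "\<dots> = of_real S"
    unfolding S_def of_real_sum by (intro sum.cong refl) (simp only: complex_norm_square mult.commute)
  finally have "S^2 = cmod (LINT t|lborel. G t * cnj (?s t)) ^ 2"
    using S0 by (simp add: norm_of_real)
  also have "\<dots> \<le> enn2real (sqint G) * enn2real (sqint (\<lambda>t. cnj (?s t)))"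
  proof (rule cauchy_schwarz_sqint(2)[OF G _ Gfin])
    show "sqint (\<lambda>t. cnj (?s t)) < \<infinity>" unfolding sqint_cnj ps by simp
  qed measurable
  also have "\<dots> \<le> enn2real (sqint G) * (M * S)"
    unfolding sqint_cnj ps using le M S0 by (intro mult_left_mono) (auto simp: enn2real_leI)
  finally have "S * S \<le> (M * enn2real (sqint G)) * S" by (simp add: power2_eq_square mult_ac)
  then have "S \<le> M * enn2real (sqint G)"
    using S0 M by (cases "S = 0") (auto simp: mult_le_cancel_right)
  then have "ennreal S \<le> ennreal (M * enn2real (sqint G))" by (rule ennreal_leI)
  also have "\<dots> = ennreal M * sqint G" using M Gfin by (simp add: ennreal_mult)
  finally show ?thesis unfolding S_def a_def .
qed

lemma borel_measurable_Pair_compose: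
  fixes q :: "'a::euclidean_space \<Rightarrow> 'b::euclidean_space \<Rightarrow> real"
  assumes "(\<lambda>p. q (fst p) (snd p)) \<in> borel_measurable borel"
  shows "(\<lambda>x. q (fst x) (snd x)) \<in> borel_measurable (borel \<Otimes>\<^sub>M borel)" "(\<lambda>z. q y z) \<in> borel_measurable borel"
    "(\<lambda>y. q y z) \<in> borel_measurable borel"
proof -
  show a: "(\<lambda>x. q (fst x) (snd x)) \<in> borel_measurable (borel \<Otimes>\<^sub>M borel)"
    using assms by (simp add: borel_prod)
  show "(\<lambda>z. q y z) \<in> borel_measurable borel" "(\<lambda>y. q y z) \<in> borel_measurable borel"
    using measurable_compose[OF _ a, of "\<lambda>z. (y, z)" borel] measurable_compose[OF _ a, of "\<lambda>y. (y, z)" borel] by simp_all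
qed

section \<open>A single symbol: eigenfunctions, coefficients and energy\<close>

locale tf_symbol = tf_frame w phi for w :: "('d::finite) tf \<Rightarrow> real" and phi +
  fixes \<eta> :: "'d tf \<Rightarrow> real" and lam :: "nat \<Rightarrow> real" and e :: "nat \<Rightarrow> 'd fn" and u :: "'d fn \<Rightarrow> complex" and Bd :: real
  assumes diag: "diagonalization phi \<eta> lam e"
    and \<eta>_meas [measurable]: "\<eta> \<in> borel_measurable borel"
    and \<eta>_nonneg: "\<And>z. 0 \<le> \<eta> z" and \<eta>_bd: "\<And>z. \<eta> z \<le> Bd"
    and \<eta>_int: "wint (\<lambda>z. ennreal (\<eta> z)) < \<infinity>"
    and u: "u \<in> Minf w"
    and \<eta>_w2: "(\<integral>\<^sup>+z. (ennreal (\<eta> z) * ennreal (w z))^2 \<partial>lborel) < \<infinity>"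
begin

abbreviation "U \<equiv> dstft phi u"

lemma U_meas [measurable]: "U \<in> borel_measurable borel"
  using u by (rule dstft_measurable)

lemma U_growth: "\<exists>K\<ge>0. \<forall>z. ennreal (cmod (U z)) \<le> ennreal K * ennreal (w z)"
proof -
  obtain K where K: "ubound u K" using Minf_ubound[OF u] by blast
  have "ennreal (cmod (U z)) \<le> ennreal (K * enn2real (N1 phi)) * ennreal (w z)" for z
    using dstft_bound[OF u K, of z] phi_N1 K by (simp add: ubound_def ennreal_mult mult_ac)
  moreover have "0 \<le> K * enn2real (N1 phi)" using K by (simp add: ubound_def)
  ultimately show ?thesis by blast
qed

lemma \<eta>2_U: "(\<integral>\<^sup>+z. ennreal ((\<eta> z)^2 * (cmod (U z))^2) \<partial>lborel) < \<infinity>"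
proof -
  obtain K where K: "0 \<le> K" "\<And>z. ennreal (cmod (U z)) \<le> ennreal K * ennreal (w z)" using U_growth by blast
  have "(\<integral>\<^sup>+z. ennreal ((\<eta> z)^2 * (cmod (U z))^2) \<partial>lborel)
      \<le> (\<integral>\<^sup>+z. ennreal (K^2) * (ennreal (\<eta> z) * ennreal (w z))^2 \<partial>lborel)"
  proof (intro nn_integral_mono)
    fix z
    have "(ennreal (\<eta> z) * ennreal (cmod (U z)))^2 \<le> (ennreal (\<eta> z) * (ennreal K * ennreal (w z)))^2"
      by (intro power_mono mult_left_mono K) auto
    then show "ennreal ((\<eta> z)^2 * (cmod (U z))^2) \<le> ennreal (K^2) * (ennreal (\<eta> z) * ennreal (w z))^2"
      using \<eta>_nonneg[of z] K(1) by (simp add: ennreal_mult ennreal_power[symmetric] power_mult_distrib mult_ac)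
  qed
  also have "\<dots> = ennreal (K^2) * (\<integral>\<^sup>+z. (ennreal (\<eta> z) * ennreal (w z))^2 \<partial>lborel)"
    by (rule nn_integral_cmult) measurable
  also have "\<dots> < \<infinity>" using \<eta>_w2 by (simp add: ennreal_mult_less_top)
  finally show ?thesis .
qed

lemma e_L2: "e k \<in> L2"
  and e_orth: "ip (e k) (e j) = (if k = j then 1 else 0)"
  and lam_nonneg: "0 \<le> lam k"
  and diag_sums: "f \<in> L2 \<Longrightarrow> h \<in> L2 \<Longrightarrow> (\<lambda>k. of_real (lam k) * ip f (e k) * ip (e k) h) sums
            (LINT z|lborel. of_real (\<eta> z) * stft phi f z * cnj (stft phi h z))"
  using diag unfolding diagonalization_def by auto

lemma Bd_nonneg: "0 \<le> Bd" using \<eta>_nonneg[of 0] \<eta>_bd[of 0] by linarith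

abbreviation "E k \<equiv> stft phi (e k)"

lemma E_meas [measurable]: "E k \<in> borel_measurable borel"
  using e_L2 by measurable

lemma diag_e: "h \<in> L2 \<Longrightarrow> (LINT z|lborel. of_real (\<eta> z) * E k z * cnj (stft phi h z)) = of_real (lam k) * ip (e k) h"
proof -
  assume h: "h \<in> L2"
  have "(\<lambda>j. of_real (lam j) * ip (e k) (e j) * ip (e j) h) = (\<lambda>j. if j = k then of_real (lam k) * ip (e k) h else 0)"
    by (auto simp: e_orth fun_eq_iff)
  then have "(\<lambda>j. of_real (lam j) * ip (e k) (e j) * ip (e j) h) sums (of_real (lam k) * ip (e k) h)"
    using sums_single[of k "\<lambda>j. of_real (lam k) * ip (e k) h"] by simp
  then show ?thesis using diag_sums[OF e_L2 h] sums_unique2 by blast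
qed

lemma e_reps: "\<exists>e'. \<forall>k. rep (e k) (e' k)"
  using e_L2 unfolding L2_iff_rep by (rule choice[OF allI])

lemma e_norm: "L2norm (e k) = 1"
proof -
  have "complex_of_real ((L2norm (e k))^2) = 1" using ip_self[OF e_L2, of k] e_orth[of k k] by simp
  then have "(L2norm (e k))^2 = 1" by (metis of_real_1 of_real_eq_iff)
  then show ?thesis using L2norm_nonneg[of "e k"] by (simp add: power2_eq_1_iff)
qed

lemma E_sqint: "sqint (E k) = 1"
  by (simp add: sqint_stft e_L2 phi_L2 e_norm phi_norm)

lemma E_orth: "(LINT z|lborel. E j z * cnj (E k z)) = (if j = k then of_real 1 else 0)"
  using stft_moyal(2)[OF e_L2 e_L2 phi_L2] by (simp add: phi_norm e_orth)

text \<open>Coefficient of the operator's output along the k-th eigenfunction, written as an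
  integral so that it makes sense for transforms of functionals and for their truncations.\<close>

definition cf :: "('d tf \<Rightarrow> complex) \<Rightarrow> nat \<Rightarrow> complex" where
  "cf W k = (LINT z|lborel. of_real (\<eta> z) * W z * cnj (E k z))"

text \<open>The functional acts only on M1, and eigenfunctions are merely in L2. For a non-zero
  eigenvalue, lam k * e k is a superposition of shifted windows with coefficients eta * E k, so it
  lies in M1 and u passes under the integral. For eigenvalue 0 the energy of E k against eta
  vanishes, so eta * E k is 0 almost everywhere and both sides are 0.\<close>

lemma lam_u: "of_real (lam k) * u (e k) = cf U k"
proof (cases "lam k = 0")
  case False
  define h where "h = (\<lambda>t. complex_of_real (lam k) * e k t)"
  let ?m = "\<lambda>z. of_real (\<eta> z) * E k z"
  have h2: "h \<in> L2" unfolding h_def by (intro L2_scale e_L2)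
  have E1: "cmod (E k z) \<le> 1" for z
    using stft_bound[OF e_L2 phi_L2, of k z] by (simp add: e_norm phi_norm)
  have mfin: "wint (\<lambda>z. ennreal (cmod (?m z))) < \<infinity>"
  proof (rule le_less_trans[OF wint_mono \<eta>_int])
    fix z show "ennreal (cmod (?m z)) \<le> ennreal (\<eta> z)"
      using \<eta>_nonneg[of z] by (intro ennreal_leI) (auto simp: norm_mult intro: mult_left_le E1)
  qed
  have hV: "stft gauss h y = (LINT z|lborel. ?m z * V z y)" for y
  proof -
    have "stft gauss h y = of_real (lam k) * ip (e k) (tfshift y gauss)"
      unfolding h_def stft_def using ip_lin_left[OF e_L2 e_L2 L2_tfshift[OF L2_gauss], of "of_real (lam k)" k 0 k y] by simp
    then show ?thesis unfolding V_eq diag_e[OF L2_tfshift[OF L2_gauss], symmetric] .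
  qed
  have hM: "h \<in> M1 w" by (rule superposition_M1[OF _ mfin h2 hV]) measurable
  have "u h = (LINT z|lborel. cnj (?m z) * U z)"
    by (rule functional_superposition[OF u _ mfin hM hV]) measurable
  also have "\<dots> = cf U k" unfolding cf_def by (simp add: mult_ac)
  finally have uh: "u h = cf U k" .
  have "(\<lambda>t. complex_of_real (1 / lam k) * h t + 0 * h t) = e k"
    using False by (auto simp: h_def)
  then have "u (e k) = of_real (1 / lam k) * u h"
    using Minf_lin[OF u hM hM, of "of_real (1 / lam k)" 0] by simp
  then show ?thesis using False uh by simp
next
  case True
  have "of_real (lam k) * ip (e k) (e k) = (LINT z|lborel. of_real (\<eta> z) * E k z * cnj (E k z))"
    by (rule diag_e[OF e_L2, symmetric])
  also have "\<dots> = (LINT z|lborel. complex_of_real (\<eta> z * (cmod (E k z))^2))"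
    by (simp only: mult.assoc complex_norm_square[symmetric] of_real_mult)
  also have "\<dots> = of_real (LINT z|lborel. \<eta> z * (cmod (E k z))^2)" by (rule integral_complex_of_real)
  finally have i0: "(LINT z|lborel. \<eta> z * (cmod (E k z))^2) = 0" using True e_orth[of k k] by simp
  have "integrable lborel (\<lambda>z. Bd * (cmod (E k z))^2)"
    using E_sqint[of k] by (intro integrable_mult_right) (simp add: integrable_iff_bounded sqint_def)
  then have "integrable lborel (\<lambda>z. \<eta> z * (cmod (E k z))^2)"
    by (rule Bochner_Integration.integrable_bound)
      (use \<eta>_nonneg \<eta>_bd Bd_nonneg in \<open>auto simp: abs_mult intro!: mult_right_mono\<close>)
  then have "AE z in lborel. \<eta> z * (cmod (E k z))^2 = 0"
    using integral_nonneg_eq_0_iff_AE[of lborel "\<lambda>z. \<eta> z * (cmod (E k z))^2"] i0 \<eta>_nonneg by simp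
  then have "AE z in lborel. of_real (\<eta> z) * U z * cnj (E k z) = 0" by eventually_elim auto
  then have "cf U k = (LINT z|lborel. (0::complex) * U z)" unfolding cf_def by (intro integral_cong_AE) auto
  then show ?thesis using True by simp
qed

lemma sqrt_weight: "sqint (\<lambda>z. of_real (sqrt (\<eta> z)) * W z) = (\<integral>\<^sup>+z. ennreal (\<eta> z * (cmod (W z))^2) \<partial>lborel)"
  unfolding sqint_def using \<eta>_nonneg by (simp add: norm_mult power_mult_distrib)

lemma cf_sqrt: "cf W k = (LINT z|lborel. (of_real (sqrt (\<eta> z)) * W z) * cnj (of_real (sqrt (\<eta> z)) * E k z))"
  unfolding cf_def
proof (intro Bochner_Integration.integral_cong refl)
  fix z
  have "complex_of_real (\<eta> z) = of_real (sqrt (\<eta> z)) * of_real (sqrt (\<eta> z))"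
    using \<eta>_nonneg[of z] by (simp flip: of_real_mult)
  then show "of_real (\<eta> z) * W z * cnj (E k z) = (of_real (sqrt (\<eta> z)) * W z) * cnj (of_real (sqrt (\<eta> z)) * E k z)"
    by simp
qed

lemma E_weight_sqint: "sqint (\<lambda>z. of_real (sqrt (\<eta> z)) * E k z) < \<infinity>"
proof -
  have "sqint (\<lambda>z. of_real (sqrt (\<eta> z)) * E k z) \<le> (\<integral>\<^sup>+z. ennreal Bd * ennreal ((cmod (E k z))^2) \<partial>lborel)"
    unfolding sqrt_weight using \<eta>_bd \<eta>_nonneg Bd_nonneg
    by (intro nn_integral_mono) (auto simp: ennreal_mult[symmetric] intro!: ennreal_leI mult_right_mono)
  also have "\<dots> = ennreal Bd" using E_sqint[of k] unfolding sqint_def by (simp add: nn_integral_cmult)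
  finally show ?thesis by (rule le_less_trans) simp
qed

lemma E_weight_orth:
  "(LINT z|lborel. (of_real (sqrt (\<eta> z)) * E j z) * cnj (of_real (sqrt (\<eta> z)) * E k z)) = (if j = k then of_real (lam k) else 0)"
  unfolding cf_sqrt[symmetric] cf_def diag_e[OF e_L2] e_orth by simp

text \<open>Small eigenvalues are exploited here: they are the squared norms of the functions sqrt
  eta * E k. The price is a weight eta instead of its square.\<close>

lemma bessel_weighted:
  assumes [measurable]: "W \<in> borel_measurable borel" and fin: "(\<integral>\<^sup>+z. ennreal (\<eta> z * (cmod (W z))^2) \<partial>lborel) < \<infinity>"
    and F: "finite F" and \<epsilon>: "\<And>k. k \<in> F \<Longrightarrow> lam k \<le> \<epsilon>" "0 \<le> \<epsilon>"
  shows "ennreal (\<Sum>k\<in>F. (cmod (cf W k))^2) \<le> ennreal \<epsilon> * (\<integral>\<^sup>+z. ennreal (\<eta> z * (cmod (W z))^2) \<partial>lborel)"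
  unfolding cf_sqrt sqrt_weight[symmetric]
  by (rule bessel[OF F, where \<mu> = lam])
    (use fin \<epsilon> E_weight_sqint in \<open>auto simp: E_weight_orth sqrt_weight simp del: complex_cnj_mult\<close>)

text \<open>The complementary bound: eta is put entirely on W and the E k are orthonormal, so the
  weight is squared but no factor is gained.\<close>

lemma bessel_unweighted:
  assumes [measurable]: "W \<in> borel_measurable borel" and fin: "(\<integral>\<^sup>+z. ennreal ((\<eta> z)^2 * (cmod (W z))^2) \<partial>lborel) < \<infinity>"
    and F: "finite F"
  shows "ennreal (\<Sum>k\<in>F. (cmod (cf W k))^2) \<le> (\<integral>\<^sup>+z. ennreal ((\<eta> z)^2 * (cmod (W z))^2) \<partial>lborel)"
proof -
  have eq: "sqint (\<lambda>z. of_real (\<eta> z) * W z) = (\<integral>\<^sup>+z. ennreal ((\<eta> z)^2 * (cmod (W z))^2) \<partial>lborel)"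
    by (simp add: sqint_def norm_mult power_mult_distrib)
  have "ennreal (\<Sum>k\<in>F. (cmod (cf W k))^2) \<le> ennreal 1 * sqint (\<lambda>z. of_real (\<eta> z) * W z)"
    unfolding cf_def
    by (rule bessel[OF F, where \<mu> = "\<lambda>_. 1"])
      (use fin in \<open>auto simp: E_sqint E_orth eq\<close>)
  then show ?thesis by (simp add: eq)
qed

text \<open>A trace estimate. Each eigenvalue is the integral of eta |E k|^2, and Bessel for the
  shifted window, of norm 1, bounds the sum of the |E k z|^2 by 1; so any finite sum of eigenvalues
  is at most the integral of eta.\<close>

lemma large_finite:
  assumes \<epsilon>: "0 < \<epsilon>"
  shows "finite {k. \<epsilon> < lam k}"
proof (rule ccontr)
  assume inf: "infinite {k. \<epsilon> < lam k}"
  have "(\<integral>\<^sup>+z. ennreal (\<eta> z) \<partial>lborel) < \<infinity>"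
    using le_less_trans[OF nn_integral_le_wint \<eta>_int] .
  then obtain I where I: "(\<integral>\<^sup>+z. ennreal (\<eta> z) \<partial>lborel) = ennreal I" "0 \<le> I"
    by (cases "\<integral>\<^sup>+z. ennreal (\<eta> z) \<partial>lborel") auto
  obtain n :: nat where n: "I / \<epsilon> < real n" using reals_Archimedean2 by blast
  obtain F where F: "finite F" "card F = n" "F \<subseteq> {k. \<epsilon> < lam k}" using infinite_arbitrarily_large[OF inf, of n] by auto
  have Ebessel: "(\<Sum>k\<in>F. (cmod (E k z))^2) \<le> 1" for z
  proof -
    obtain p' where p: "rep (tfshift z phi) p'" using L2_repE[OF L2_tfshift[OF phi_L2]] by blast
    obtain e' where e': "\<And>k. rep (e k) (e' k)" using e_reps by blast
    have "ennreal (\<Sum>k\<in>F. (cmod (LINT t|lborel. p' t * cnj (e' k t)))^2) \<le> ennreal 1 * sqint p'"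
    proof (rule bessel[OF F(1), where \<mu> = "\<lambda>_. 1"])
      show "(LINT t|lborel. e' j t * cnj (e' k t)) = (if j = k then of_real 1 else 0)" for j k
        using e_orth[of j k] rep_ip[OF e'[of j] e'[of k]] by simp
    qed (use e' p in \<open>auto simp: rep_def\<close>)
    also have "sqint p' = 1" by (simp add: rep_L2norm_sq[OF p] L2norm_tfshift[OF phi_L2] phi_norm)
    finally have "(\<Sum>k\<in>F. (cmod (LINT t|lborel. p' t * cnj (e' k t)))^2) \<le> 1" by simp
    moreover have "cmod (LINT t|lborel. p' t * cnj (e' k t)) = cmod (E k z)" for k
      unfolding rep_ip[OF p e', symmetric] stft_def ip_cnj[OF e_L2 L2_tfshift[OF phi_L2]] by simp
    ultimately show ?thesis by simp
  qed
  have lamE: "ennreal (lam k) = (\<integral>\<^sup>+z. ennreal (\<eta> z * (cmod (E k z))^2) \<partial>lborel)" for k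
  proof -
    have "(\<lambda>z. of_real (sqrt (\<eta> z)) * E k z) \<in> borel_measurable borel" by measurable
    then have "autocor (\<lambda>z. of_real (sqrt (\<eta> z)) * E k z) 0 = of_real (enn2real (sqint (\<lambda>z. of_real (sqrt (\<eta> z)) * E k z)))"
      by (rule autocor_0) (rule E_weight_sqint)
    then have "lam k = enn2real (sqint (\<lambda>z. of_real (sqrt (\<eta> z)) * E k z))"
      using E_weight_orth[of k k] unfolding autocor_def by (simp only: diff_0_right simp_thms if_True of_real_eq_iff)
    then show ?thesis using E_weight_sqint[of k] unfolding sqrt_weight by simp
  qed
  have "ennreal (real n * \<epsilon>) \<le> ennreal (\<Sum>k\<in>F. lam k)"
    using sum_mono[of F "\<lambda>_. \<epsilon>" lam] F by (intro ennreal_leI) (auto intro: less_imp_le)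
  also have "\<dots> = (\<Sum>k\<in>F. \<integral>\<^sup>+z. ennreal (\<eta> z * (cmod (E k z))^2) \<partial>lborel)"
    by (simp add: sum_ennreal[symmetric] lam_nonneg lamE)
  also have "\<dots> = (\<integral>\<^sup>+z. (\<Sum>k\<in>F. ennreal (\<eta> z * (cmod (E k z))^2)) \<partial>lborel)"
    by (rule nn_integral_sum[symmetric]) measurable
  also have "\<dots> \<le> (\<integral>\<^sup>+z. ennreal (\<eta> z) \<partial>lborel)"
  proof (intro nn_integral_mono)
    fix z
    have "(\<Sum>k\<in>F. \<eta> z * (cmod (E k z))^2) \<le> \<eta> z"
      using mult_left_mono[OF Ebessel \<eta>_nonneg, of z] by (simp add: sum_distrib_left)
    then show "(\<Sum>k\<in>F. ennreal (\<eta> z * (cmod (E k z))^2)) \<le> ennreal (\<eta> z)"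
      using \<eta>_nonneg by (simp add: ennreal_leI)
  qed
  finally have "real n * \<epsilon> \<le> I" using I by simp
  then show False using n \<epsilon> by (simp add: divide_less_eq)
qed

text \<open>The thresholded sum is finite, and \<open>lam_u\<close> replaces the values of u by the
  coefficients of its transform, leaving an orthonormal sum.\<close>

lemma Heps_norm:
  assumes \<epsilon>: "0 < \<epsilon>"
  shows "(L2norm (Heps \<epsilon> lam e u))^2 = (\<Sum>k\<in>{k. \<epsilon> < lam k}. (cmod (cf U k))^2)"
proof -
  let ?F = "{k. \<epsilon> < lam k}"
  have F: "finite ?F" using \<epsilon> by (rule large_finite)
  obtain e' where e': "\<And>k. rep (e k) (e' k)" using e_reps by blast
  then have e'm [measurable]: "e' k \<in> borel_measurable borel" for k by (auto simp: rep_def)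
  have sq: "sqint (\<lambda>t. \<Sum>k\<in>?F. cf U k * e' k t) = ennreal (\<Sum>k\<in>?F. (cmod (cf U k))^2 * 1)"
  proof (rule sqint_orthogonal_sum[OF F, where \<mu> = "\<lambda>_. 1"])
    show "(LINT t|lborel. e' j t * cnj (e' k t)) = (if j = k then of_real 1 else 0)" for j k
      using e_orth[of j k] rep_ip[OF e'[of j] e'[of k]] by simp
  qed (use e' in \<open>auto simp: rep_def\<close>)
  have ae: "AE t in lborel. \<forall>k\<in>?F. e k t = e' k t"
    using e' F by (intro AE_finite_allI) (auto simp: rep_def)
  have "rep (Heps \<epsilon> lam e u) (\<lambda>t. \<Sum>k\<in>?F. cf U k * e' k t)"
    unfolding rep_def
  proof (intro conjI)
    show "AE t in lborel. Heps \<epsilon> lam e u t = (\<Sum>k\<in>?F. cf U k * e' k t)"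
      using ae unfolding Heps_def lam_u by eventually_elim auto
  qed (simp_all add: sq)
  from rep_L2norm_sq[OF this] have "ennreal ((L2norm (Heps \<epsilon> lam e u))^2) = ennreal (\<Sum>k\<in>?F. (cmod (cf U k))^2)"
    by (simp add: sq)
  then show ?thesis by (simp add: sum_nonneg)
qed

lemma Heps_le:
  assumes \<epsilon>: "0 < \<epsilon>"
  shows "ennreal ((L2norm (Heps \<epsilon> lam e u))^2) \<le> (\<integral>\<^sup>+z. ennreal ((\<eta> z)^2 * (cmod (U z))^2) \<partial>lborel)"
  unfolding Heps_norm[OF \<epsilon>] by (intro bessel_unweighted \<eta>2_U large_finite \<epsilon>) measurable


lemma ip_sum:
  fixes h :: "'d fn"
  assumes "finite I" "\<And>i. i \<in> I \<Longrightarrow> f i \<in> L2" "h \<in> L2"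
  shows "ip (\<lambda>t. \<Sum>i\<in>I. c i * f i t) h = (\<Sum>i\<in>I. c i * ip (f i) h)"
proof -
  have eq: "ip f h = stft h f 0" for f :: "'d fn"
    by (simp add: stft_def tfshift_def)
  show ?thesis unfolding eq using stft_sum[of I f h c 0] assms by simp
qed

lemma weighted_energy:
  assumes f: "f \<in> L2"
  shows "sqint (\<lambda>z. of_real (sqrt (\<eta> z)) * stft phi f z) < \<infinity>"
    and "(LINT z|lborel. of_real (\<eta> z) * stft phi f z * cnj (stft phi f z))
      = of_real (enn2real (sqint (\<lambda>z. of_real (sqrt (\<eta> z)) * stft phi f z)))"
proof -
  let ?W = "stft phi f"
  have [measurable]: "?W \<in> borel_measurable borel" using f by measurable
  have "sqint (\<lambda>z. of_real (sqrt (\<eta> z)) * ?W z) \<le> (\<integral>\<^sup>+z. ennreal Bd * ennreal ((cmod (?W z))^2) \<partial>lborel)"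
    unfolding sqrt_weight using \<eta>_bd \<eta>_nonneg Bd_nonneg
    by (intro nn_integral_mono) (auto simp: ennreal_mult[symmetric] intro!: ennreal_leI mult_right_mono)
  also have "\<dots> = ennreal Bd * sqint ?W" unfolding sqint_def by (simp add: nn_integral_cmult)
  also have "\<dots> < \<infinity>" by (simp add: sqint_stft[OF f phi_L2] ennreal_mult_less_top)
  finally show fin: "sqint (\<lambda>z. of_real (sqrt (\<eta> z)) * ?W z) < \<infinity>" .
  have "(LINT z|lborel. of_real (\<eta> z) * ?W z * cnj (?W z)) = autocor (\<lambda>z. of_real (sqrt (\<eta> z)) * ?W z) 0"
    unfolding autocor_def diff_0_right
  proof (intro Bochner_Integration.integral_cong refl)
    fix z
    have "complex_of_real (\<eta> z) = of_real (sqrt (\<eta> z)) * of_real (sqrt (\<eta> z))"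
      using \<eta>_nonneg[of z] by (simp flip: of_real_mult)
    then show "of_real (\<eta> z) * ?W z * cnj (?W z) = (of_real (sqrt (\<eta> z)) * ?W z) * cnj (of_real (sqrt (\<eta> z)) * ?W z)"
      by simp
  qed
  also have "\<dots> = of_real (enn2real (sqint (\<lambda>z. of_real (sqrt (\<eta> z)) * ?W z)))"
    by (rule autocor_0[OF _ fin]) measurable
  finally show "(LINT z|lborel. of_real (\<eta> z) * ?W z * cnj (?W z))
      = of_real (enn2real (sqint (\<lambda>z. of_real (sqrt (\<eta> z)) * ?W z)))" .
qed

lemma energy_sums:
  assumes f: "f \<in> L2"
  shows "(\<lambda>k. lam k * (cmod (ip f (e k)))^2) sums enn2real (sqint (\<lambda>z. of_real (sqrt (\<eta> z)) * stft phi f z))"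
proof -
  have "of_real (lam k) * ip f (e k) * ip (e k) f = complex_of_real (lam k * (cmod (ip f (e k)))^2)" for k
    unfolding ip_cnj[OF f e_L2, of k] of_real_mult complex_norm_square by (simp add: mult.assoc)
  then have "(\<lambda>k. complex_of_real (lam k * (cmod (ip f (e k)))^2)) sums
      of_real (enn2real (sqint (\<lambda>z. of_real (sqrt (\<eta> z)) * stft phi f z)))"
    using diag_sums[OF f f] unfolding weighted_energy(2)[OF f] by (simp only:)
  then show ?thesis by (simp only: sums_of_real_iff)
qed

lemma ker_measurable [measurable]: "(\<lambda>x. ker (fst x) (snd x)) \<in> borel_measurable (borel \<Otimes>\<^sub>M borel)"
proof -
  obtain p where r: "rep phi p" using phi_L2 by (rule L2_repE)
  then have [measurable]: "p \<in> borel_measurable borel" by (auto simp: rep_def)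
  show ?thesis
    unfolding ker_def rep_ip[OF rep_tfshift[OF r] rep_tfshift[OF r]] tfshift_cis by measurable
qed

lemma ker_measurable' [measurable]:
  "f \<in> borel_measurable M \<Longrightarrow> g \<in> borel_measurable M \<Longrightarrow> (\<lambda>x. ker (f x) (g x)) \<in> borel_measurable M"
  using measurable_compose[OF measurable_Pair ker_measurable] by simp

text \<open>The reproducing kernel applied to eta * W, that is, the transform of the operator's
  output; \<open>D_tendsto\<close> expands it along the eigenfunctions with coefficients
  \<open>cf W k\<close>.\<close>

definition D :: "('d tf \<Rightarrow> complex) \<Rightarrow> 'd tf \<Rightarrow> complex" where
  "D W z = (LINT y|lborel. ker z y * (of_real (\<eta> y) * W y))"

lemma D_meas [measurable]:
  assumes [measurable]: "W \<in> borel_measurable borel"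
  shows "D W \<in> borel_measurable borel"
  unfolding D_def[abs_def] by measurable

text \<open>The symbol only sees the span of the eigenfunctions: the part of a shifted window orthogonal
  to the first n of them carries weighted energy tending to zero.\<close>

lemma D_tendsto:
  assumes W [measurable]: "W \<in> borel_measurable borel"
    and Wfin: "(\<integral>\<^sup>+z. ennreal (\<eta> z * (cmod (W z))^2) \<partial>lborel) < \<infinity>"
  shows "(\<lambda>n. \<Sum>k<n. cf W k * E k z) \<longlonglongrightarrow> D W z"
proof -
  define f where "f = tfshift z phi"
  have f: "f \<in> L2" unfolding f_def by (intro L2_tfshift phi_L2)
  define s where "s n = (\<lambda>t. \<Sum>k<n. ip f (e k) * e k t)" for n
  have s: "s n \<in> L2" "stft phi (s n) y = (\<Sum>k<n. ip f (e k) * E k y)" for n y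
    unfolding s_def using stft_sum[of "{..<n}" e phi "\<lambda>k. ip f (e k)" y] e_L2 phi_L2 by auto
  define g where "g n = (\<lambda>t. 1 * f t + (-1) * s n t)" for n
  have g: "g n \<in> L2" for n unfolding g_def by (intro L2_lin f s)
  have Vg: "stft phi (g n) y = stft phi f y - (\<Sum>k<n. ip f (e k) * E k y)" for n y
    unfolding g_def stft_lin[OF f s(1) phi_L2] s(2) by simp
  have ipg: "ip (g n) (e j) = (if j < n then 0 else ip f (e j))" for n j
  proof -
    have "ip (s n) (e j) = (\<Sum>k<n. ip f (e k) * ip (e k) (e j))"
      unfolding s_def by (rule ip_sum) (auto simp: e_L2)
    also have "\<dots> = (if j < n then ip f (e j) else 0)"
      by (simp add: e_orth if_distrib[of "\<lambda>x. _ * x"] sum.delta cong: if_cong)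
    finally show ?thesis unfolding g_def ip_lin_left[OF f s(1) e_L2] by simp
  qed
  let ?q = "\<lambda>h y. complex_of_real (sqrt (\<eta> y)) * stft phi h y"
  let ?G = "\<lambda>y. complex_of_real (sqrt (\<eta> y)) * W y"
  have Gfin: "sqint ?G < \<infinity>" unfolding sqrt_weight using Wfin .
  define X where "X n = enn2real (sqint (?q (g n)))" for n
  let ?t = "\<lambda>k. lam k * (cmod (ip f (e k)))^2"
  \<comment> \<open>X n is the energy, weighted by eta, of the remainder after n eigenfunctions. It
    equals the tail of a convergent series, so it tends to 0 even if the eigenfunctions do not span
    L2.\<close>
  have Xlim: "X \<longlonglongrightarrow> 0"
  proof -
    let ?T = "enn2real (sqint (?q f))"
    have t: "?t sums ?T" by (rule energy_sums[OF f])
    have Xeq: "X = (\<lambda>n. ?T - (\<Sum>k<n. ?t k))"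
    proof (rule ext)
      fix n
      have "(\<lambda>k. ?t k - (if k \<in> {..<n} then ?t k else 0)) sums (?T - (\<Sum>k<n. ?t k))"
        by (intro sums_diff t sums_If_finite_set) auto
      moreover have "(\<lambda>k. ?t k - (if k \<in> {..<n} then ?t k else 0)) = (\<lambda>k. lam k * (cmod (ip (g n) (e k)))^2)"
        by (auto simp: ipg fun_eq_iff)
      ultimately have "(\<lambda>k. lam k * (cmod (ip (g n) (e k)))^2) sums (?T - (\<Sum>k<n. ?t k))" by (simp only:)
      from sums_unique2[OF energy_sums[OF g] this] show "X n = ?T - (\<Sum>k<n. ?t k)" unfolding X_def .
    qed
    have "(\<lambda>n. ?T - (\<Sum>k<n. ?t k)) \<longlonglongrightarrow> ?T - ?T"
      using t unfolding sums_def by (intro tendsto_diff tendsto_const)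
    then show ?thesis unfolding Xeq by simp
  qed
  have int: "integrable lborel (\<lambda>y. ?G y * cnj (?q h y))" if "h \<in> L2" for h
  proof (rule cauchy_schwarz_sqint(1)[OF _ _ Gfin])
    have [measurable]: "stft phi h \<in> borel_measurable borel" using that by measurable
    show "?G \<in> borel_measurable borel" "(\<lambda>y. cnj (?q h y)) \<in> borel_measurable borel" by measurable
    show "sqint (\<lambda>y. cnj (?q h y)) < \<infinity>" using weighted_energy(1)[OF that] by (simp only: sqint_cnj)
  qed
  have Df: "D W z = (LINT y|lborel. ?G y * cnj (?q f y))"
    unfolding D_def ker_eq(2) f_def
  proof (intro Bochner_Integration.integral_cong refl)
    fix y
    have "complex_of_real (\<eta> y) = of_real (sqrt (\<eta> y)) * of_real (sqrt (\<eta> y))"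
      using \<eta>_nonneg[of y] by (simp flip: of_real_mult)
    then show "cnj (stft phi (tfshift z phi) y) * (of_real (\<eta> y) * W y) = ?G y * cnj (?q (tfshift z phi) y)"
      by (simp add: mult_ac)
  qed
  have rn: "(LINT y|lborel. ?G y * cnj (?q (g n) y)) = D W z - (\<Sum>k<n. cf W k * E k z)" for n
  proof -
    have "(LINT y|lborel. ?G y * cnj (?q (g n) y)) = (LINT y|lborel. ?G y * cnj (?q f y) - (\<Sum>k<n. cnj (ip f (e k)) * (?G y * cnj (?q (e k) y))))"
      unfolding Vg by (simp add: right_diff_distrib sum_distrib_left mult_ac)
    also have "\<dots> = (LINT y|lborel. ?G y * cnj (?q f y)) - (LINT y|lborel. (\<Sum>k<n. cnj (ip f (e k)) * (?G y * cnj (?q (e k) y))))"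
      by (intro Bochner_Integration.integral_diff Bochner_Integration.integrable_sum integrable_mult_right int f e_L2)
    also have "(LINT y|lborel. (\<Sum>k<n. cnj (ip f (e k)) * (?G y * cnj (?q (e k) y))))
        = (\<Sum>k<n. LINT y|lborel. cnj (ip f (e k)) * (?G y * cnj (?q (e k) y)))"
      by (intro Bochner_Integration.integral_sum integrable_mult_right int e_L2)
    also have "\<dots> = (\<Sum>k<n. cf W k * E k z)"
    proof (intro sum.cong refl)
      fix k
      have "cnj (ip f (e k)) = E k z" unfolding stft_def f_def by (rule ip_cnj[symmetric]) (intro L2_tfshift phi_L2 e_L2)+
      then show "(LINT y|lborel. cnj (ip f (e k)) * (?G y * cnj (?q (e k) y))) = cf W k * E k z"
        unfolding cf_sqrt by (simp only: integral_mult_right_zero mult.commute)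
    qed
    finally show ?thesis unfolding Df .
  qed
  have bound: "(cmod (D W z - (\<Sum>k<n. cf W k * E k z)))^2 \<le> enn2real (sqint ?G) * X n" for n
  proof -
    have [measurable]: "stft phi (g n) \<in> borel_measurable borel" using g by measurable
    have "cmod (LINT y|lborel. ?G y * cnj (?q (g n) y)) ^ 2 \<le> enn2real (sqint ?G) * enn2real (sqint (\<lambda>y. cnj (?q (g n) y)))"
    proof (rule cauchy_schwarz_sqint(2)[OF _ _ Gfin])
      show "?G \<in> borel_measurable borel" "(\<lambda>y. cnj (?q (g n) y)) \<in> borel_measurable borel" by measurable
      show "sqint (\<lambda>y. cnj (?q (g n) y)) < \<infinity>" using weighted_energy(1)[OF g] by (simp only: sqint_cnj)
    qed
    then show ?thesis unfolding rn sqint_cnj X_def .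
  qed
  have lim: "(\<lambda>n. enn2real (sqint ?G) * X n) \<longlonglongrightarrow> 0"
    using tendsto_mult_left[OF Xlim, of "enn2real (sqint ?G)"] by simp
  have "(\<lambda>n. (cmod (D W z - (\<Sum>k<n. cf W k * E k z)))^2) \<longlonglongrightarrow> 0"
    by (rule tendsto_sandwich[OF _ _ tendsto_const lim]) (auto intro!: always_eventually bound)
  then have "(\<lambda>n. sqrt ((cmod (D W z - (\<Sum>k<n. cf W k * E k z)))^2)) \<longlonglongrightarrow> sqrt 0"
    by (rule tendsto_real_sqrt)
  then have "(\<lambda>n. cmod ((\<Sum>k<n. cf W k * E k z) - D W z)) \<longlonglongrightarrow> 0"
    by (simp add: norm_minus_commute)
  then show ?thesis by (simp only: tendsto_norm_zero_iff LIM_zero_iff)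
qed

text \<open>Fatou along the expansion: the n-th partial sum has as its energy the sum of the first n
  squared coefficients, by orthonormality.\<close>

lemma D_sqint_le:
  assumes W: "W \<in> borel_measurable borel"
    and Wfin: "(\<integral>\<^sup>+z. ennreal (\<eta> z * (cmod (W z))^2) \<partial>lborel) < \<infinity>"
    and H: "\<And>n. ennreal (\<Sum>k<n. (cmod (cf W k))^2) \<le> H"
  shows "sqint (D W) \<le> H"
proof -
  let ?s = "\<lambda>n z. ennreal ((cmod (\<Sum>k<n. cf W k * E k z))^2)"
  have "(\<lambda>n. ?s n z) \<longlonglongrightarrow> ennreal ((cmod (D W z))^2)" for z
    by (intro tendsto_ennrealI tendsto_power tendsto_norm D_tendsto W Wfin)
  then have "ennreal ((cmod (D W z))^2) = liminf (\<lambda>n. ?s n z)" for z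
    by (intro lim_imp_Liminf[symmetric]) auto
  then have "sqint (D W) = (\<integral>\<^sup>+z. liminf (\<lambda>n. ?s n z) \<partial>lborel)" by (simp add: sqint_def)
  also have "\<dots> \<le> liminf (\<lambda>n. \<integral>\<^sup>+z. ?s n z \<partial>lborel)"
    by (rule nn_integral_liminf) measurable
  also have "\<dots> \<le> limsup (\<lambda>n. \<integral>\<^sup>+z. ?s n z \<partial>lborel)"
    by (rule Liminf_le_Limsup) simp
  also have "\<dots> \<le> H"
  proof (rule Limsup_bounded, rule always_eventually, rule allI)
    fix n
    have "(\<integral>\<^sup>+z. ?s n z \<partial>lborel) = ennreal (\<Sum>k<n. (cmod (cf W k))^2 * 1)"
      unfolding sqint_def[symmetric]
      by (rule sqint_orthogonal_sum[where \<mu> = "\<lambda>_. 1"]) (auto simp: E_sqint E_orth)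
    then show "(\<integral>\<^sup>+z. ?s n z \<partial>lborel) \<le> H" using H[of n] by simp
  qed
  finally show ?thesis .
qed

text \<open>Coefficients with eigenvalue above \<epsilon> are kept. For the others W is cut where
  eta crosses \<tau> = sqrt \<epsilon>. Above that height the weighted Bessel bound applies and
  \<epsilon> * eta \<le> \<tau> * eta^2; below it the unweighted bound applies and eta equals its
  minimum with \<tau>. The factors 2 come from squaring the sum of the two parts.\<close>

lemma D_sqint_dominated:
  assumes \<epsilon>: "0 < \<epsilon>" and [measurable]: "W \<in> borel_measurable borel"
    and WU: "\<And>z. cmod (W z) \<le> cmod (U z)"
    and Wfin: "(\<integral>\<^sup>+z. ennreal (\<eta> z * (cmod (W z))^2) \<partial>lborel) < \<infinity>"
  shows "sqint (D W) \<le> ennreal (\<Sum>k\<in>{k. \<epsilon> < lam k}. (cmod (cf W k))^2)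
    + (ennreal (2 * sqrt \<epsilon>) * (\<integral>\<^sup>+z. ennreal ((\<eta> z)^2 * (cmod (U z))^2) \<partial>lborel)
    + 2 * (\<integral>\<^sup>+z. ennreal ((min (\<eta> z) (sqrt \<epsilon>))^2 * (cmod (U z))^2) \<partial>lborel))"
    (is "_ \<le> _ + (_ * ?I + 2 * ?J)")
proof (rule D_sqint_le[OF assms(2) Wfin])
  fix n
  define \<tau> where "\<tau> = sqrt \<epsilon>"
  have \<tau>: "0 < \<tau>" "\<tau> * \<tau> = \<epsilon>" using \<epsilon> by (auto simp: \<tau>_def)
  define W1 where "W1 z = (if \<tau> < \<eta> z then W z else 0)" for z
  define W2 where "W2 z = (if \<tau> < \<eta> z then 0 else W z)" for z
  have [measurable]: "W1 \<in> borel_measurable borel" "W2 \<in> borel_measurable borel"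
    unfolding W1_def[abs_def] W2_def[abs_def] by measurable
  have f1: "(\<integral>\<^sup>+z. ennreal (\<eta> z * (cmod (W1 z))^2) \<partial>lborel) < \<infinity>"
    by (rule le_less_trans[OF nn_integral_mono Wfin]) (auto simp: W1_def)
  have f2: "(\<integral>\<^sup>+z. ennreal (\<eta> z * (cmod (W2 z))^2) \<partial>lborel) < \<infinity>"
    by (rule le_less_trans[OF nn_integral_mono Wfin]) (auto simp: W2_def)
  have f22: "(\<integral>\<^sup>+z. ennreal ((\<eta> z)^2 * (cmod (W2 z))^2) \<partial>lborel) < \<infinity>"
    by (rule le_less_trans[OF nn_integral_mono \<eta>2_U]) (auto simp: W2_def intro!: ennreal_leI mult_left_mono power_mono WU)
  let ?F = "{k. k < n \<and> lam k \<le> \<epsilon>}"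
  let ?L = "{k. \<epsilon> < lam k}"
  have split: "cf W k = cf W1 k + cf W2 k" for k
  proof -
    have int: "integrable lborel (\<lambda>z. (of_real (sqrt (\<eta> z)) * W z) * cnj (of_real (sqrt (\<eta> z)) * E k z))"
      if "(\<integral>\<^sup>+z. ennreal (\<eta> z * (cmod (W z))^2) \<partial>lborel) < \<infinity>" and [measurable]: "W \<in> borel_measurable borel" for W
    proof (rule cauchy_schwarz_sqint(1))
      show "sqint (\<lambda>z. of_real (sqrt (\<eta> z)) * W z) < \<infinity>" unfolding sqrt_weight using that by simp
      show "sqint (\<lambda>z. cnj (of_real (sqrt (\<eta> z)) * E k z)) < \<infinity>" unfolding sqint_cnj by (rule E_weight_sqint)
    qed measurable
    have "W z = W1 z + W2 z" for z by (simp add: W1_def W2_def)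
    then show ?thesis unfolding cf_sqrt
      by (subst Bochner_Integration.integral_add[symmetric, OF int[OF f1] int[OF f2]]) (auto simp: algebra_simps)
  qed
  have "(\<Sum>k<n. (cmod (cf W k))^2) \<le> (\<Sum>k\<in>?L \<union> ?F. (cmod (cf W k))^2)"
    using large_finite[OF \<epsilon>] by (intro sum_mono2) auto
  also have "\<dots> = (\<Sum>k\<in>?L. (cmod (cf W k))^2) + (\<Sum>k\<in>?F. (cmod (cf W k))^2)"
    using large_finite[OF \<epsilon>] by (intro sum.union_disjoint) auto
  also have "(\<Sum>k\<in>?F. (cmod (cf W k))^2) \<le> (\<Sum>k\<in>?F. 2 * (cmod (cf W1 k))^2 + 2 * (cmod (cf W2 k))^2)"
  proof (intro sum_mono)
    fix k
    have "(cmod (cf W k))^2 \<le> (cmod (cf W1 k) + cmod (cf W2 k))^2"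
      unfolding split by (intro power_mono norm_triangle_ineq) auto
    also have "\<dots> \<le> 2 * (cmod (cf W1 k))^2 + 2 * (cmod (cf W2 k))^2"
      using sum_squares_ge_zero[of "cmod (cf W1 k) - cmod (cf W2 k)" 0] by (simp add: power2_eq_square algebra_simps)
    finally show "(cmod (cf W k))^2 \<le> 2 * (cmod (cf W1 k))^2 + 2 * (cmod (cf W2 k))^2" .
  qed
  also have "\<dots> = 2 * (\<Sum>k\<in>?F. (cmod (cf W1 k))^2) + 2 * (\<Sum>k\<in>?F. (cmod (cf W2 k))^2)"
    by (simp add: sum.distrib sum_distrib_left)
  finally have "ennreal (\<Sum>k<n. (cmod (cf W k))^2) \<le> ennreal ((\<Sum>k\<in>?L. (cmod (cf W k))^2)
      + (2 * (\<Sum>k\<in>?F. (cmod (cf W1 k))^2) + 2 * (\<Sum>k\<in>?F. (cmod (cf W2 k))^2)))"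
    by (intro ennreal_leI) simp
  also have "\<dots> = ennreal (\<Sum>k\<in>?L. (cmod (cf W k))^2)
      + (2 * ennreal (\<Sum>k\<in>?F. (cmod (cf W1 k))^2) + 2 * ennreal (\<Sum>k\<in>?F. (cmod (cf W2 k))^2))"
    by (simp add: sum_nonneg ennreal_mult)
  also have "\<dots> \<le> ennreal (\<Sum>k\<in>?L. (cmod (cf W k))^2) + (2 * (ennreal \<tau> * ?I) + 2 * ?J)"
  proof (intro add_mono mult_left_mono order_refl)
    have "ennreal (\<Sum>k\<in>?F. (cmod (cf W1 k))^2) \<le> ennreal \<epsilon> * (\<integral>\<^sup>+z. ennreal (\<eta> z * (cmod (W1 z))^2) \<partial>lborel)"
      using \<epsilon> by (intro bessel_weighted f1) auto
    also have "\<dots> = (\<integral>\<^sup>+z. ennreal \<epsilon> * ennreal (\<eta> z * (cmod (W1 z))^2) \<partial>lborel)"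
      by (rule nn_integral_cmult[symmetric]) measurable
    also have "\<dots> \<le> (\<integral>\<^sup>+z. ennreal \<tau> * ennreal ((\<eta> z)^2 * (cmod (U z))^2) \<partial>lborel)"
    proof (intro nn_integral_mono)
      fix z
      have "\<epsilon> * (\<eta> z * (cmod (W1 z))^2) \<le> \<tau> * ((\<eta> z)^2 * (cmod (U z))^2)"
      proof (cases "\<tau> < \<eta> z")
        case True
        have "\<tau> * (\<tau> * (\<eta> z * (cmod (W z))^2)) \<le> \<tau> * (\<eta> z * (\<eta> z * (cmod (U z))^2))"
          using True \<tau> \<eta>_nonneg[of z] by (intro mult_left_mono mult_mono power_mono WU) auto
        then show ?thesis using True \<tau> by (simp add: W1_def power2_eq_square mult.assoc[symmetric])
      qed (use \<tau> in \<open>simp add: W1_def\<close>)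
      then show "ennreal \<epsilon> * ennreal (\<eta> z * (cmod (W1 z))^2) \<le> ennreal \<tau> * ennreal ((\<eta> z)^2 * (cmod (U z))^2)"
        using \<epsilon> \<tau> \<eta>_nonneg[of z] by (simp add: ennreal_mult[symmetric] ennreal_leI)
    qed
    also have "\<dots> = ennreal \<tau> * ?I" by (rule nn_integral_cmult) measurable
    finally show "ennreal (\<Sum>k\<in>?F. (cmod (cf W1 k))^2) \<le> ennreal \<tau> * ?I" .
    have "ennreal (\<Sum>k\<in>?F. (cmod (cf W2 k))^2) \<le> (\<integral>\<^sup>+z. ennreal ((\<eta> z)^2 * (cmod (W2 z))^2) \<partial>lborel)"
      by (intro bessel_unweighted f22) auto
    also have "\<dots> \<le> ?J"
      by (intro nn_integral_mono ennreal_leI) (auto simp: W2_def \<tau>_def[symmetric] min_def intro!: mult_left_mono power_mono WU)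
    finally show "ennreal (\<Sum>k\<in>?F. (cmod (cf W2 k))^2) \<le> ?J" .
  qed auto
  also have "2 * (ennreal \<tau> * ?I) = ennreal (2 * sqrt \<epsilon>) * ?I"
    using \<tau> unfolding \<tau>_def[symmetric] by (simp add: ennreal_mult mult.assoc)
  finally show "ennreal (\<Sum>k<n. (cmod (cf W k))^2) \<le> ennreal (\<Sum>k\<in>?L. (cmod (cf W k))^2)
    + (ennreal (2 * sqrt \<epsilon>) * ?I + 2 * ?J)" .
qed


lemma ker_U_integrable: "integrable lborel (\<lambda>y. ker z y * (of_real (\<eta> y) * U y))"
proof -
  obtain K where K: "0 \<le> K" "\<And>z. ennreal (cmod (U z)) \<le> ennreal K * ennreal (w z)" using U_growth by blast
  have "(\<integral>\<^sup>+y. ennreal (norm (ker z y * (of_real (\<eta> y) * U y))) \<partial>lborel)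
      \<le> (\<integral>\<^sup>+y. ennreal (Bd * K * w z) * (b1 (z - y) * ennreal (w (z - y))) \<partial>lborel)"
  proof (intro nn_integral_mono)
    fix y
    have "ennreal (w y) \<le> ennreal (w z) * ennreal (w (z - y))"
      using ennreal_w_submult[of z "y - z"] even[of "y - z"] by simp
    then have "ennreal (cmod (U y)) \<le> ennreal K * (ennreal (w z) * ennreal (w (z - y)))"
      using K(2)[of y] by (metis mult_left_mono order_trans zero_le)
    then have "ennreal (cmod (ker z y)) * (ennreal (\<eta> y) * ennreal (cmod (U y)))
        \<le> b1 (z - y) * (ennreal Bd * (ennreal K * (ennreal (w z) * ennreal (w (z - y)))))"
      by (intro mult_mono ker_bound ennreal_leI \<eta>_bd) auto
    then show "ennreal (norm (ker z y * (of_real (\<eta> y) * U y))) \<le> ennreal (Bd * K * w z) * (b1 (z - y) * ennreal (w (z - y)))"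
      using \<eta>_nonneg[of y] Bd_nonneg K(1) less_imp_le[OF pos] by (simp add: norm_mult ennreal_mult mult_ac)
  qed
  also have "\<dots> = ennreal (Bd * K * w z) * wint b1"
    using nn_integral_lborel_shift(3)[of "\<lambda>z. b1 z * ennreal (w z)"] by (simp add: nn_integral_cmult wint_def)
  also have "\<dots> < \<infinity>" using wint_b1 by (simp add: ennreal_mult_less_top)
  finally show ?thesis by (simp add: integrable_iff_bounded)
qed

text \<open>The transform U may grow like w, so the integral of eta |U|^2 is not known to be finite.
  Truncations of U to balls satisfy that condition; the limit is taken by Fatou on the left and by
  dominated convergence in the finitely many kept coefficients on the right.\<close>

lemma D_sqint_bound:
  assumes \<epsilon>: "0 < \<epsilon>"
  shows "sqint (D U) \<le> ennreal ((L2norm (Heps \<epsilon> lam e u))^2)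
    + (ennreal (2 * sqrt \<epsilon>) * (\<integral>\<^sup>+z. ennreal ((\<eta> z)^2 * (cmod (U z))^2) \<partial>lborel)
    + 2 * (\<integral>\<^sup>+z. ennreal ((min (\<eta> z) (sqrt \<epsilon>))^2 * (cmod (U z))^2) \<partial>lborel))"
    (is "_ \<le> _ + ?\<beta>")
proof -
  define W where "W n z = indicator (cball 0 (real n)) z * U z" for n z
  have [measurable]: "W n \<in> borel_measurable borel" for n
    unfolding W_def[abs_def] by (intro borel_measurable_times borel_measurable_indicator U_meas) auto
  have WU: "cmod (W n z) \<le> cmod (U z)" for n z by (simp add: W_def indicator_def)
  have Wlim: "(\<lambda>n. W n z) \<longlonglongrightarrow> U z" for z
  proof -
    obtain n0 where n0: "norm z \<le> real n0" using real_arch_simple by blast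
    have "eventually (\<lambda>n. W n z = U z) sequentially"
      using eventually_ge_at_top[of n0] by eventually_elim (use n0 in \<open>auto simp: W_def\<close>)
    then show ?thesis by (rule tendsto_eventually)
  qed
  obtain K where K: "0 \<le> K" "\<And>z. ennreal (cmod (U z)) \<le> ennreal K * ennreal (w z)" using U_growth by blast
  obtain M where M: "1 \<le> M" "\<And>z. w z \<le> M * exp (1 * norm z)" using w_exp_bound[of 1] by auto
  have Wfin: "(\<integral>\<^sup>+z. ennreal (\<eta> z * (cmod (W n z))^2) \<partial>lborel) < \<infinity>" for n
  proof -
    let ?c = "Bd * (K * (M * exp (real n)))^2"
    have "(\<integral>\<^sup>+z. ennreal (\<eta> z * (cmod (W n z))^2) \<partial>lborel) \<le> (\<integral>\<^sup>+z. ennreal ?c * indicator (cball (0::'d tf) (real n)) z \<partial>lborel)"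
    proof (intro nn_integral_mono)
      fix z :: "'d tf"
      show "ennreal (\<eta> z * (cmod (W n z))^2) \<le> ennreal ?c * indicator (cball 0 (real n)) z"
      proof (cases "z \<in> cball 0 (real n)")
        case True
        have "cmod (U z) \<le> K * w z"
          using K(2)[of z] K(1) pos[of z] by (simp add: ennreal_mult[symmetric] ennreal_le_iff)
        also have "\<dots> \<le> K * (M * exp (1 * norm z))" by (intro mult_left_mono M K)
        also have "\<dots> \<le> K * (M * exp (real n))" using True K M by (intro mult_left_mono) auto
        finally have "\<eta> z * (cmod (U z))^2 \<le> ?c"
          using \<eta>_bd[of z] \<eta>_nonneg[of z] by (intro mult_mono power_mono) auto
        then show ?thesis using True by (simp add: W_def ennreal_leI)
      qed (simp add: W_def)
    qed
    also have "\<dots> = ennreal ?c * emeasure lborel (cball (0::'d tf) (real n))"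
      by (rule nn_integral_cmult_indicator) auto
    also have "\<dots> < \<infinity>" using emeasure_lborel_cball_finite[of "0::'d tf" "real n"] by (simp add: ennreal_mult_less_top)
    finally show ?thesis .
  qed
  let ?L = "{k. \<epsilon> < lam k}"
  let ?S = "\<lambda>W. ennreal (\<Sum>k\<in>?L. (cmod (cf W k))^2)"
  have Dlim: "(\<lambda>n. D (W n) z) \<longlonglongrightarrow> D U z" for z
    unfolding D_def
  proof (rule integral_dominated_convergence[where w = "\<lambda>y. cmod (ker z y * (of_real (\<eta> y) * U y))"])
    show "integrable lborel (\<lambda>y. cmod (ker z y * (of_real (\<eta> y) * U y)))"
      using integrable_norm[OF ker_U_integrable[of z]] by simp
    show "AE y in lborel. (\<lambda>n. ker z y * (of_real (\<eta> y) * W n y)) \<longlonglongrightarrow> ker z y * (of_real (\<eta> y) * U y)"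
      by (intro AE_I2 tendsto_mult_left Wlim)
    show "AE y in lborel. norm (ker z y * (of_real (\<eta> y) * W n y)) \<le> cmod (ker z y * (of_real (\<eta> y) * U y))" for n
      by (intro AE_I2) (auto simp: norm_mult intro!: mult_left_mono WU)
  qed measurable
  have clim: "(\<lambda>n. cf (W n) k) \<longlonglongrightarrow> cf U k" for k
    unfolding cf_def
  proof (rule integral_dominated_convergence[where w = "\<lambda>z. cmod (of_real (\<eta> z) * U z * cnj (E k z))"])
    have "sqint (\<lambda>z. of_real (\<eta> z) * U z) < \<infinity>" using \<eta>2_U by (simp add: sqint_def norm_mult power_mult_distrib)
    then have "integrable lborel (\<lambda>z. of_real (\<eta> z) * U z * cnj (E k z))"
      by (rule cauchy_schwarz_sqint(1)[rotated 2]) (auto simp: sqint_cnj E_sqint)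
    then show "integrable lborel (\<lambda>z. cmod (of_real (\<eta> z) * U z * cnj (E k z)))" by (rule integrable_norm)
    show "AE z in lborel. (\<lambda>n. of_real (\<eta> z) * W n z * cnj (E k z)) \<longlonglongrightarrow> of_real (\<eta> z) * U z * cnj (E k z)"
      by (intro AE_I2 tendsto_mult_left tendsto_mult_right Wlim)
    show "AE z in lborel. norm (of_real (\<eta> z) * W n z * cnj (E k z)) \<le> cmod (of_real (\<eta> z) * U z * cnj (E k z))" for n
      by (intro AE_I2) (auto simp: norm_mult intro!: mult_left_mono mult_right_mono WU)
  qed measurable
  have Slim: "(\<lambda>n. ?S (W n) + ?\<beta>) \<longlonglongrightarrow> ?S U + ?\<beta>"
    by (intro tendsto_add tendsto_const tendsto_ennrealI tendsto_sum tendsto_power tendsto_norm clim)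
  have "(\<lambda>n. ennreal ((cmod (D (W n) z))^2)) \<longlonglongrightarrow> ennreal ((cmod (D U z))^2)" for z
    by (intro tendsto_ennrealI tendsto_power tendsto_norm Dlim)
  then have "ennreal ((cmod (D U z))^2) = liminf (\<lambda>n. ennreal ((cmod (D (W n) z))^2))" for z
    by (intro lim_imp_Liminf[symmetric]) auto
  then have "sqint (D U) = (\<integral>\<^sup>+z. liminf (\<lambda>n. ennreal ((cmod (D (W n) z))^2)) \<partial>lborel)" by (simp add: sqint_def)
  also have "\<dots> \<le> liminf (\<lambda>n. sqint (D (W n)))"
    unfolding sqint_def by (rule nn_integral_liminf) measurable
  also have "\<dots> \<le> liminf (\<lambda>n. ?S (W n) + ?\<beta>)"
    by (intro Liminf_mono always_eventually allI D_sqint_dominated \<epsilon> WU Wfin) measurable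
  also have "\<dots> = ?S U + ?\<beta>"
    using Slim by (intro lim_imp_Liminf) auto
  finally show ?thesis unfolding Heps_norm[OF \<epsilon>] .
qed

abbreviation "aU z \<equiv> ennreal (cmod (U z))"

lemma D_le: "ennreal (cmod (D U z)) \<le> (\<integral>\<^sup>+y. b1 (z - y) * (ennreal (\<eta> y) * aU y) \<partial>lborel)"
proof -
  have "ennreal (cmod (D U z)) \<le> (\<integral>\<^sup>+y. ennreal (cmod (ker z y)) * (ennreal (\<eta> y) * aU y) \<partial>lborel)"
    unfolding D_def
    by (cases "integrable lborel (\<lambda>y. ker z y * (of_real (\<eta> y) * U y))")
      (auto simp: norm_mult ennreal_mult \<eta>_nonneg not_integrable_integral_eq dest!: integral_norm_bound_ennreal)
  also have "\<dots> \<le> (\<integral>\<^sup>+y. b1 (z - y) * (ennreal (\<eta> y) * aU y) \<partial>lborel)"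
    by (intro nn_integral_mono mult_right_mono ker_bound) auto
  finally show ?thesis .
qed

text \<open>Both sides integrate the same kernel, with the cut-off at one or at the other variable; the
  difference is a commutator.\<close>

lemma local_energy_le:
  assumes [measurable]: "Q \<in> borel_measurable borel" and Q0: "\<And>z. 0 \<le> Q z" and Qw: "(\<integral>\<^sup>+z. ennreal (Q z) * (ennreal (w z) * ennreal (w z)) \<partial>lborel) < \<infinity>"
  shows "(\<integral>\<^sup>+z. ennreal (\<eta> z * (Q z * (cmod (U z))^2)) \<partial>lborel)
    \<le> (\<integral>\<^sup>+z. ennreal (Q z) * (ennreal (cmod (D U z)) * aU z) \<partial>lborel)
    + (\<integral>\<^sup>+y. \<integral>\<^sup>+z. ennreal (\<eta> y) * (aU y * (aU z * (b1 (y - z) * ennreal \<bar>Q y - Q z\<bar>))) \<partial>lborel \<partial>lborel)"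
    (is "?T \<le> ?Y + ?R")
proof -
  let ?f = "\<lambda>y z. of_real (\<eta> y) * U y * ker z y * cnj (U z)"
  obtain K where K: "0 \<le> K" "\<And>z. aU z \<le> ennreal K * ennreal (w z)" using U_growth by blast
  have nf: "ennreal (cmod (?f y z)) \<le> ennreal (\<eta> y) * (aU y * (aU z * b1 (y - z)))" for y z
  proof -
    have "ennreal (cmod (?f y z)) = (ennreal (\<eta> y) * (aU y * aU z)) * ennreal (cmod (ker z y))"
      using \<eta>_nonneg[of y] by (simp add: norm_mult ennreal_mult mult_ac)
    also have "\<dots> \<le> (ennreal (\<eta> y) * (aU y * aU z)) * b1 (z - y)"
      by (intro mult_left_mono ker_bound) auto
    also have "b1 (z - y) = b1 (y - z)" using b1_even[of "y - z"] by simp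
    finally show ?thesis by (simp only: mult_ac)
  qed
  \<comment> \<open>The growth of U at z is charged to y and to the difference y - z, so that the
    z-integral becomes the weighted integral of \<open>b1\<close>.\<close>
  have growth: "aU z \<le> ennreal K * (ennreal (w y) * ennreal (w (y - z)))" for y z
  proof -
    have "ennreal (w z) \<le> ennreal (w y) * ennreal (w (y - z))"
      using ennreal_w_submult[of y "z - y"] even[of "z - y"] by simp
    then show ?thesis using K(2)[of z] by (metis mult_left_mono order_trans zero_le)
  qed
  have fint: "integrable (lborel \<Otimes>\<^sub>M lborel) (\<lambda>(y, z). of_real (q y z) * ?f y z)"
    if [measurable]: "(\<lambda>p. q (fst p) (snd p)) \<in> borel_measurable borel"
      and q: "(\<integral>\<^sup>+y. \<integral>\<^sup>+z. ennreal (q y z) * (aU y * (aU z * b1 (y - z))) \<partial>lborel \<partial>lborel) < \<infinity>"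
      and q0: "\<And>y z. 0 \<le> q y z" for q
  proof (rule integrable_pairI)
    have "(\<integral>\<^sup>+y. \<integral>\<^sup>+z. ennreal (norm (of_real (q y z) * ?f y z)) \<partial>lborel \<partial>lborel)
      \<le> (\<integral>\<^sup>+y. \<integral>\<^sup>+z. ennreal Bd * (ennreal (q y z) * (aU y * (aU z * b1 (y - z)))) \<partial>lborel \<partial>lborel)"
    proof (intro nn_integral_mono)
      fix y z
      have "ennreal (norm (of_real (q y z) * ?f y z)) = ennreal (q y z) * ennreal (cmod (?f y z))"
        using q0[of y z] unfolding norm_mult[of "of_real (q y z)"] norm_of_real by (subst ennreal_mult) auto
      also have "\<dots> \<le> ennreal (q y z) * (ennreal Bd * (aU y * (aU z * b1 (y - z))))"
        by (intro mult_left_mono order_trans[OF nf] mult_right_mono ennreal_leI \<eta>_bd) auto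
      finally show "ennreal (norm (of_real (q y z) * ?f y z)) \<le> ennreal Bd * (ennreal (q y z) * (aU y * (aU z * b1 (y - z))))"
        by (simp only: mult_ac)
    qed
    also have "\<dots> = ennreal Bd * (\<integral>\<^sup>+y. \<integral>\<^sup>+z. ennreal (q y z) * (aU y * (aU z * b1 (y - z))) \<partial>lborel \<partial>lborel)"
      using borel_measurable_Pair_compose[OF that(1)] by (simp add: nn_integral_cmult)
    also have "\<dots> < \<infinity>" using q by (simp add: ennreal_mult_less_top)
    finally show "(\<integral>\<^sup>+y. \<integral>\<^sup>+z. ennreal (norm (case (y, z) of (y, z) \<Rightarrow> of_real (q y z) * ?f y z)) \<partial>lborel \<partial>lborel) < \<infinity>"
      by simp
    show "(\<lambda>(y, z). of_real (q y z) * ?f y z) \<in> borel_measurable borel"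
      unfolding split_beta' by measurable
  qed
  have fin1: "(\<integral>\<^sup>+y. \<integral>\<^sup>+z. ennreal (Q y) * (aU y * (aU z * b1 (y - z))) \<partial>lborel \<partial>lborel) < \<infinity>"
  proof -
    have "(\<integral>\<^sup>+y. \<integral>\<^sup>+z. ennreal (Q y) * (aU y * (aU z * b1 (y - z))) \<partial>lborel \<partial>lborel)
      \<le> (\<integral>\<^sup>+y. \<integral>\<^sup>+z. (ennreal K * ennreal K * (ennreal (Q y) * (ennreal (w y) * ennreal (w y)))) * (b1 (y - z) * ennreal (w (y - z))) \<partial>lborel \<partial>lborel)"
    proof (intro nn_integral_mono)
      fix y z
      have "ennreal (Q y) * (aU y * (aU z * b1 (y - z))) \<le> ennreal (Q y) * ((ennreal K * ennreal (w y)) * ((ennreal K * (ennreal (w y) * ennreal (w (y - z)))) * b1 (y - z)))"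
        by (intro mult_left_mono mult_mono K growth) auto
      then show "ennreal (Q y) * (aU y * (aU z * b1 (y - z))) \<le> (ennreal K * ennreal K * (ennreal (Q y) * (ennreal (w y) * ennreal (w y)))) * (b1 (y - z) * ennreal (w (y - z)))"
        by (simp only: mult_ac)
    qed
    also have "\<dots> = (\<integral>\<^sup>+y. (ennreal K * ennreal K * (ennreal (Q y) * (ennreal (w y) * ennreal (w y)))) * wint b1 \<partial>lborel)"
      using nn_integral_lborel_shift(3)[of "\<lambda>z. b1 z * ennreal (w z)"]
      by (simp add: nn_integral_cmult wint_def)
    also have "\<dots> = (ennreal K * ennreal K * (\<integral>\<^sup>+z. ennreal (Q z) * (ennreal (w z) * ennreal (w z)) \<partial>lborel)) * wint b1"
      by (simp add: nn_integral_cmult nn_integral_multc)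
    also have "\<dots> < \<infinity>" using Qw wint_b1 by (simp add: ennreal_mult_less_top)
    finally show ?thesis .
  qed
  have fin2: "(\<integral>\<^sup>+y. \<integral>\<^sup>+z. ennreal (Q z) * (aU y * (aU z * b1 (y - z))) \<partial>lborel \<partial>lborel) < \<infinity>"
  proof -
    have "(\<integral>\<^sup>+y. \<integral>\<^sup>+z. ennreal (Q z) * (aU y * (aU z * b1 (y - z))) \<partial>lborel \<partial>lborel)
      = (\<integral>\<^sup>+z. \<integral>\<^sup>+y. ennreal (Q z) * (aU y * (aU z * b1 (y - z))) \<partial>lborel \<partial>lborel)"
      by (rule lborel_pair.Fubini') measurable
    also have "\<dots> = (\<integral>\<^sup>+z. \<integral>\<^sup>+y. ennreal (Q z) * (aU z * (aU y * b1 (z - y))) \<partial>lborel \<partial>lborel)"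
    proof (intro nn_integral_cong)
      fix z y
      have "b1 (y - z) = b1 (z - y)" using b1_even[of "z - y"] by simp
      then show "ennreal (Q z) * (aU y * (aU z * b1 (y - z))) = ennreal (Q z) * (aU z * (aU y * b1 (z - y)))"
        by (simp only: mult_ac)
    qed
    finally show ?thesis using fin1 by simp
  qed
  have i1: "integrable (lborel \<Otimes>\<^sub>M lborel) (\<lambda>(y, z). of_real (Q y) * ?f y z)"
    by (rule fint[of "\<lambda>y z. Q y"]) (measurable, rule fin1, rule Q0)
  have i2: "integrable (lborel \<Otimes>\<^sub>M lborel) (\<lambda>(y, z). of_real (Q z) * ?f y z)"
    by (rule fint[of "\<lambda>y z. Q z"]) (measurable, rule fin2, rule Q0)
  \<comment> \<open>\<open>?X\<close> has the cut-off at the variable of the symbol,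
    \<open>?Z\<close> at the other one. Integrating out z in \<open>?X\<close> reproduces U y and
    yields the local energy; integrating out y in \<open>?Z\<close> yields D U z.\<close>
  let ?X = "LINT p|(lborel \<Otimes>\<^sub>M lborel). (case p of (y, z) \<Rightarrow> of_real (Q y) * ?f y z)"
  let ?Z = "LINT p|(lborel \<Otimes>\<^sub>M lborel). (case p of (y, z) \<Rightarrow> of_real (Q z) * ?f y z)"
  have "?X = (LINT y|lborel. LINT z|lborel. of_real (Q y) * ?f y z)"
    using lborel_pair.integral_fst'[OF i1] by simp
  also have "\<dots> = (LINT y|lborel. complex_of_real (\<eta> y * (Q y * (cmod (U y))^2)))"
  proof (intro Bochner_Integration.integral_cong refl)
    fix y
    have "(LINT z|lborel. of_real (Q y) * ?f y z) = of_real (Q y) * of_real (\<eta> y) * U y * (LINT z|lborel. ker z y * cnj (U z))"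
      by (subst integral_mult_right_zero[symmetric]) (simp add: mult_ac)
    also have "(LINT z|lborel. ker z y * cnj (U z)) = cnj (LINT z|lborel. ker y z * U z)"
      unfolding Bochner_Integration.integral_cnj[symmetric] by (simp add: ker_cnj)
    also have "\<dots> = cnj (U y)" unfolding reproducing[OF u, of y] ..
    also have "of_real (Q y) * of_real (\<eta> y) * U y * cnj (U y) = complex_of_real (\<eta> y * (Q y * (cmod (U y))^2))"
      unfolding of_real_mult complex_norm_square by (simp add: mult_ac)
    finally show "(LINT z|lborel. of_real (Q y) * ?f y z) = complex_of_real (\<eta> y * (Q y * (cmod (U y))^2))" .
  qed
  also have "\<dots> = of_real (LINT y|lborel. \<eta> y * (Q y * (cmod (U y))^2))" by (rule integral_complex_of_real)
  finally have X: "?X = of_real (LINT y|lborel. \<eta> y * (Q y * (cmod (U y))^2))" .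
  have Tint: "integrable lborel (\<lambda>y. \<eta> y * (Q y * (cmod (U y))^2))"
  proof -
    have "(\<integral>\<^sup>+y. ennreal (norm (\<eta> y * (Q y * (cmod (U y))^2))) \<partial>lborel)
      \<le> (\<integral>\<^sup>+y. ennreal (Bd * (K * K)) * (ennreal (Q y) * (ennreal (w y) * ennreal (w y))) \<partial>lborel)"
    proof (intro nn_integral_mono)
      fix y
      have "ennreal (\<eta> y) * (ennreal (Q y) * (aU y * aU y)) \<le> ennreal Bd * (ennreal (Q y) * ((ennreal K * ennreal (w y)) * (ennreal K * ennreal (w y))))"
        by (intro mult_mono K ennreal_leI \<eta>_bd) auto
      then show "ennreal (norm (\<eta> y * (Q y * (cmod (U y))^2))) \<le> ennreal (Bd * (K * K)) * (ennreal (Q y) * (ennreal (w y) * ennreal (w y)))"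
        using \<eta>_nonneg[of y] Q0[of y] K(1) Bd_nonneg by (simp add: abs_mult ennreal_mult power2_eq_square mult_ac)
    qed
    also have "\<dots> = ennreal (Bd * (K * K)) * (\<integral>\<^sup>+z. ennreal (Q z) * (ennreal (w z) * ennreal (w z)) \<partial>lborel)"
      by (rule nn_integral_cmult) measurable
    also have "\<dots> < \<infinity>" using Qw by (simp add: ennreal_mult_less_top)
    finally show ?thesis by (simp add: integrable_iff_bounded)
  qed
  have T: "?T = ennreal (cmod ?X)"
    unfolding X using Q0 \<eta>_nonneg by (subst nn_integral_eq_integral[OF Tint]) auto
  have Z: "ennreal (cmod ?Z) \<le> ?Y"
  proof -
    have "?Z = (LINT z|lborel. LINT y|lborel. of_real (Q z) * ?f y z)"
      using lborel_pair.integral_snd[of "\<lambda>y z. of_real (Q z) * ?f y z"] i2 by (simp add: split_beta')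
    also have "\<dots> = (LINT z|lborel. of_real (Q z) * (D U z * cnj (U z)))"
      unfolding D_def by (simp add: mult_ac integral_mult_right_zero[symmetric] integral_mult_left_zero[symmetric] del: integral_mult_right_zero integral_mult_left_zero)
    finally have eqZ: "?Z = (LINT z|lborel. of_real (Q z) * (D U z * cnj (U z)))" .
    have "ennreal (cmod ?Z) \<le> (\<integral>\<^sup>+z. ennreal (norm (of_real (Q z) * (D U z * cnj (U z)))) \<partial>lborel)"
      unfolding eqZ by (cases "integrable lborel (\<lambda>z. of_real (Q z) * (D U z * cnj (U z)))")
        (rule integral_norm_bound_ennreal, assumption, simp only: not_integrable_integral_eq norm_zero ennreal_0 zero_le simp_thms)
    also have "\<dots> = ?Y"
      using Q0 by (intro nn_integral_cong) (simp add: norm_mult ennreal_mult abs_of_nonneg)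
    finally show ?thesis .
  qed
  have XZ: "ennreal (cmod (?X - ?Z)) \<le> ?R"
  proof -
    let ?d = "\<lambda>p. case p of (y, z) \<Rightarrow> of_real (Q y - Q z) * ?f y z"
    have deq: "(case p of (y, z) \<Rightarrow> of_real (Q y) * ?f y z) - (case p of (y, z) \<Rightarrow> of_real (Q z) * ?f y z) = ?d p" for p
      by (simp only: split_beta' of_real_diff left_diff_distrib)
    have dint: "integrable (lborel \<Otimes>\<^sub>M lborel) ?d"
      using Bochner_Integration.integrable_diff[OF i1 i2] unfolding deq .
    have "?X - ?Z = (LINT p|(lborel \<Otimes>\<^sub>M lborel). ?d p)"
      unfolding Bochner_Integration.integral_diff[OF i1 i2, symmetric] deq ..
    then have "ennreal (cmod (?X - ?Z)) \<le> (\<integral>\<^sup>+p. ennreal (norm (?d p)) \<partial>(lborel \<Otimes>\<^sub>M lborel))"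
      by (simp only: integral_norm_bound_ennreal[OF dint])
    also have "\<dots> = (\<integral>\<^sup>+y. \<integral>\<^sup>+z. ennreal (norm (?d (y, z))) \<partial>lborel \<partial>lborel)"
      by (rule lborel.nn_integral_fst[symmetric]) (simp add: split_beta', measurable)
    also have "\<dots> \<le> ?R"
    proof (intro nn_integral_mono)
      fix y z
      have "ennreal (norm (?d (y, z))) = ennreal \<bar>Q y - Q z\<bar> * ennreal (cmod (?f y z))"
        unfolding prod.case norm_mult[of "of_real (Q y - Q z)"] norm_of_real by (rule ennreal_mult) auto
      also have "\<dots> \<le> ennreal \<bar>Q y - Q z\<bar> * (ennreal (\<eta> y) * (aU y * (aU z * b1 (y - z))))"
        by (intro mult_left_mono nf) auto
      finally show "ennreal (norm (?d (y, z))) \<le> ennreal (\<eta> y) * (aU y * (aU z * (b1 (y - z) * ennreal \<bar>Q y - Q z\<bar>)))"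
        by (simp only: mult_ac)
    qed
    finally show ?thesis .
  qed
  have "ennreal (cmod ?X) \<le> ennreal (cmod ?Z + cmod (?X - ?Z))"
    by (intro ennreal_leI norm_triangle_sub)
  also have "\<dots> = ennreal (cmod ?Z) + ennreal (cmod (?X - ?Z))"
    by (rule ennreal_plus[OF norm_ge_zero norm_ge_zero])
  also have "\<dots> \<le> ?Y + ?R" by (intro add_mono Z XZ)
  finally show ?thesis unfolding T .
qed

end

section \<open>Local norms of the transform\<close>

context submult_weight
begin

text \<open>Moderateness, v x \<le> Cv * w (x - y) * v y, moves the weight v through the kernel at
  the cost of w, so the Schur test applies to K times w. Each of the two measures may be Lebesgue
  measure or counting measure on the index set.\<close>

lemma young:
  fixes M N :: "'a measure"
  assumes sf: "sigma_finite_measure M" "sigma_finite_measure N"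
    and id [measurable]: "(\<lambda>x. x) \<in> borel_measurable M" "(\<lambda>x. x) \<in> borel_measurable N"
    and K [measurable]: "K \<in> borel_measurable borel"
    and f [measurable]: "f \<in> borel_measurable N" and g [measurable]: "g \<in> borel_measurable M"
    and v [measurable]: "v \<in> borel_measurable borel" and vpos: "\<And>z. 0 < v z"
    and Cv: "0 < Cv" and vmod: "\<And>z z'. v (z + z') \<le> Cv * w z * v z'"
    and gK: "AE x in M. g x \<le> (\<integral>\<^sup>+y. K (x - y) * f y \<partial>N)"
    and K1: "\<And>x. (\<integral>\<^sup>+y. K (x - y) * ennreal (w (x - y)) \<partial>N) \<le> ennreal C"
    and K2: "\<And>y. (\<integral>\<^sup>+x. K (x - y) * ennreal (w (x - y)) \<partial>M) \<le> ennreal C"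
    and C: "0 < C" and p: "1 \<le> p"
  shows "lpn p M (\<lambda>x. g x * ennreal (v x)) \<le> ennreal (Cv * C) * lpn p N (\<lambda>x. f x * ennreal (v x))"
proof (rule schur_test[OF sf, where K = "\<lambda>x y. ennreal Cv * (K (x - y) * ennreal (w (x - y)))"])
  have [measurable]: "(\<lambda>x. h x) \<in> borel_measurable M" "(\<lambda>x. h x) \<in> borel_measurable N"
    if "h \<in> borel_measurable borel" for h :: "'a \<Rightarrow> real"
    using measurable_compose[OF id(1) that] measurable_compose[OF id(2) that] by auto
  have [measurable]: "(\<lambda>x. h x) \<in> borel_measurable M" "(\<lambda>x. h x) \<in> borel_measurable N"
    if "h \<in> borel_measurable borel" for h :: "'a \<Rightarrow> ennreal"
    using measurable_compose[OF id(1) that] measurable_compose[OF id(2) that] by auto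
  have [measurable]: "(\<lambda>x. fst x) \<in> borel_measurable (M \<Otimes>\<^sub>M N)" "(\<lambda>x. snd x) \<in> borel_measurable (M \<Otimes>\<^sub>M N)"
    using measurable_compose[OF measurable_fst id(1)] measurable_compose[OF measurable_snd id(2)] by auto
  have m1 [measurable]: "(\<lambda>y. K (x - y)) \<in> borel_measurable N" "(\<lambda>y. w (x - y)) \<in> borel_measurable N" for x
    by measurable
  have m2 [measurable]: "(\<lambda>x. K (x - y)) \<in> borel_measurable M" "(\<lambda>x. w (x - y)) \<in> borel_measurable M" for y
    by measurable
  show "(\<lambda>(x, y). ennreal Cv * (K (x - y) * ennreal (w (x - y)))) \<in> borel_measurable (M \<Otimes>\<^sub>M N)"
    unfolding split_beta' by measurable
  show "(\<lambda>x. f x * ennreal (v x)) \<in> borel_measurable N" "(\<lambda>x. g x * ennreal (v x)) \<in> borel_measurable M"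
    by measurable
  show "AE x in M. g x * ennreal (v x) \<le> (\<integral>\<^sup>+y. ennreal Cv * (K (x - y) * ennreal (w (x - y))) * (f y * ennreal (v y)) \<partial>N)"
    using gK
  proof eventually_elim
    case (elim x)
    have "g x * ennreal (v x) \<le> (\<integral>\<^sup>+y. K (x - y) * f y \<partial>N) * ennreal (v x)"
      by (intro mult_right_mono elim) auto
    also have "\<dots> = (\<integral>\<^sup>+y. K (x - y) * f y * ennreal (v x) \<partial>N)"
      by (rule nn_integral_multc[symmetric]) measurable
    also have "\<dots> \<le> (\<integral>\<^sup>+y. ennreal Cv * (K (x - y) * ennreal (w (x - y))) * (f y * ennreal (v y)) \<partial>N)"
    proof (intro nn_integral_mono)
      fix y
      have "v x \<le> Cv * w (x - y) * v y" using vmod[of "x - y" y] by simp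
      then have "ennreal (v x) \<le> ennreal (Cv * w (x - y) * v y)" by (rule ennreal_leI)
      also have "\<dots> = ennreal Cv * ennreal (w (x - y)) * ennreal (v y)"
        using Cv pos[of "x - y"] vpos[of y] by (simp add: ennreal_mult)
      finally have "ennreal (v x) \<le> ennreal Cv * ennreal (w (x - y)) * ennreal (v y)" .
      from mult_left_mono[OF this zero_le, of "K (x - y) * f y"]
      show "K (x - y) * f y * ennreal (v x) \<le> ennreal Cv * (K (x - y) * ennreal (w (x - y))) * (f y * ennreal (v y))"
        by (simp only: mult_ac)
    qed
    finally show ?case .
  qed
  have "ennreal Cv * ennreal C = ennreal (Cv * C)" using Cv C by (simp add: ennreal_mult)
  then show "(\<integral>\<^sup>+y. ennreal Cv * (K (x - y) * ennreal (w (x - y))) \<partial>N) \<le> ennreal (Cv * C)"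
    and "(\<integral>\<^sup>+x. ennreal Cv * (K (x - y) * ennreal (w (x - y))) \<partial>M) \<le> ennreal (Cv * C)" for x y
    using mult_left_mono[OF K1[of x] zero_le, of "ennreal Cv"] mult_left_mono[OF K2[of y] zero_le, of "ennreal Cv"]
    by (simp_all add: nn_integral_cmult)
  show "0 < Cv * C" using Cv C by simp
qed (rule p)

lemma lborel_row:
  assumes [measurable]: "K \<in> borel_measurable borel"
  shows "(\<integral>\<^sup>+y. K (x - y) * ennreal (w (x - y)) \<partial>lborel) = wint K"
    and "(\<integral>\<^sup>+x. K (x - y) * ennreal (w (x - y)) \<partial>lborel) = wint K"
  unfolding wint_def
  by (rule nn_integral_lborel_shift(3)[where f = "\<lambda>z. K z * ennreal (w z)"], measurable)
    (rule nn_integral_lborel_shift(1)[where f = "\<lambda>z. K z * ennreal (w z)"], measurable)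

end

text \<open>The local supremum G is integrable against w, but it controls g (z + y) only for almost
  every y, with an exceptional set depending on z. Tonelli turns this around: for almost every s, |g
  s| \<le> G (s - y) for almost every y in the unit ball. Averaging over y bounds |g s| by G
  convolved with an exponential, which is slowly varying; adding the reflection makes it
  even.\<close>

lemma wiener_dominated:
  fixes w :: "('d::finite) tf \<Rightarrow> real"
  assumes "submult_weight w" and g: "g \<in> wiener w"
  shows "\<exists>b. slow 1 1 b \<and> (\<forall>z. b (- z) = b z) \<and> submult_weight.wint w b < \<infinity> \<and> (AE z in lborel. ennreal \<bar>g z\<bar> \<le> b z)"
proof -
  interpret submult_weight w by fact
  define G where "G z = esssup (restrict_space lborel (cball 0 1)) (\<lambda>y. ennreal \<bar>g (z + y)\<bar>)" for z
  have [measurable]: "g \<in> borel_measurable borel" "G \<in> borel_measurable borel" and Gw: "wint G < \<infinity>"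
    using g unfolding wiener_def G_def[abs_def] wint_def by (auto simp: Let_def)
  have [measurable]: "cball (0::'d tf) 1 \<in> sets borel" "ball (0::'d tf) 1 \<in> sets borel" by auto
  have AEG: "AE y in lborel. y \<in> cball 0 1 \<longrightarrow> ennreal \<bar>g (z + y)\<bar> \<le> G z" for z
    using esssup_AE[of "\<lambda>y. ennreal \<bar>g (z + y)\<bar>" "restrict_space lborel (cball 0 1)"]
    unfolding G_def by (subst (asm) AE_restrict_space_iff) auto
  \<comment> \<open>Indicator of the exceptional pairs; its double integral is computed in both
    orders.\<close>
  define n :: "'d tf \<Rightarrow> 'd tf \<Rightarrow> ennreal" where
    "n z y = (if y \<in> cball 0 1 \<and> G z < ennreal \<bar>g (z + y)\<bar> then 1 else 0)" for z y
  have n_meas [measurable]: "(\<lambda>x. n (a x) (b x)) \<in> borel_measurable M"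
    if [measurable]: "a \<in> borel_measurable M" "b \<in> borel_measurable M" for a b and M :: "'m measure"
    unfolding n_def by measurable
  have n_meas2 [measurable]: "(\<lambda>x. n (a x) (b x)) \<in> borel_measurable M"
    if [measurable]: "a \<in> borel_measurable M" "b \<in> borel_measurable M" for a b and M :: "('d tf \<times> 'd tf) measure"
    unfolding n_def by measurable
  have n_meas3 [measurable]: "(\<lambda>x. n (a x) (b x)) \<in> borel_measurable M"
    if [measurable]: "a \<in> borel_measurable M" "b \<in> borel_measurable M" for a b and M :: "'d tf measure"
    unfolding n_def by measurable
  have n0: "(\<integral>\<^sup>+y. n z y \<partial>lborel) = 0" for z
    using AEG[of z] by (subst nn_integral_0_iff_AE) (measurable, auto simp: n_def not_less elim!: eventually_mono)
  have "(\<integral>\<^sup>+s. \<integral>\<^sup>+y. n (s - y) y \<partial>lborel \<partial>lborel) = (\<integral>\<^sup>+y. \<integral>\<^sup>+s. n (s - y) y \<partial>lborel \<partial>lborel)"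
    by (rule lborel_pair.Fubini') measurable
  also have "\<dots> = (\<integral>\<^sup>+y. \<integral>\<^sup>+z. n z y \<partial>lborel \<partial>lborel)"
    by (intro nn_integral_cong nn_integral_lborel_shift(1)[where f = "\<lambda>z. n z y" for y]) measurable
  also have "\<dots> = (\<integral>\<^sup>+z. \<integral>\<^sup>+y. n z y \<partial>lborel \<partial>lborel)"
    by (rule lborel_pair.Fubini') measurable
  also have "\<dots> = 0" unfolding n0 by simp
  finally have "AE s in lborel. (\<integral>\<^sup>+y. n (s - y) y \<partial>lborel) = 0"
    by (subst (asm) nn_integral_0_iff_AE) auto
  then have main: "AE s in lborel. AE y in lborel. n (s - y) y = 0"
    by (subst (asm) nn_integral_0_iff_AE) auto
  obtain V where V: "0 < V" "\<And>x::'d tf. emeasure lborel (ball x 1) = ennreal V"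
    using unit_ball_measure[where 'a = "'d tf"] by blast
  \<comment> \<open>Here 1 / V averages over the unit ball, and exp 1 compensates the decay of the
    exponential on it.\<close>
  define c where "c z = ennreal (exp 1 / V) * conv G (edecay 1) z" for z
  have slc: "slow 1 1 c" unfolding c_def[abs_def] by (intro slow_cmult slow_conv slow_edecay) auto
  have cm [measurable]: "c \<in> borel_measurable borel" using slc by (rule slowD)
  have wc: "wint c < \<infinity>"
  proof -
    have "wint c = ennreal (exp 1 / V) * wint (conv G (edecay 1))"
      unfolding c_def[abs_def] by (rule wint_cmult) measurable
    also have "\<dots> \<le> ennreal (exp 1 / V) * (wint G * wint (edecay 1))"
      by (intro mult_left_mono wint_conv) auto
    also have "\<dots> < \<infinity>" using Gw wint_edecay_finite[of 1] by (simp add: ennreal_mult_less_top)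
    finally show ?thesis .
  qed
  have ae: "AE s in lborel. ennreal \<bar>g s\<bar> \<le> c s"
    using main
  proof eventually_elim
    case (elim s)
    have "ennreal \<bar>g s\<bar> * ennreal V = (\<integral>\<^sup>+y. ennreal \<bar>g s\<bar> * indicator (ball (0::'d tf) 1) y \<partial>lborel)"
      by (simp add: nn_integral_cmult_indicator V)
    also have "\<dots> \<le> (\<integral>\<^sup>+y. ennreal (exp 1) * (G (s - y) * edecay 1 y) \<partial>lborel)"
    proof (rule nn_integral_mono_AE)
      show "AE y in lborel. ennreal \<bar>g s\<bar> * indicator (ball 0 1) y \<le> ennreal (exp 1) * (G (s - y) * edecay 1 y)"
        using elim
      proof eventually_elim
        case (elim y)
        show ?case
        proof (cases "y \<in> ball 0 1")
          case True
          then have "ennreal \<bar>g s\<bar> \<le> G (s - y)"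
            using elim by (auto simp: n_def not_less split: if_splits)
          moreover have "1 \<le> ennreal (exp 1) * edecay 1 y"
            using True unfolding edecay_def
            by (subst ennreal_mult[symmetric]) (auto simp: exp_add[symmetric] ennreal_1[symmetric] simp del: ennreal_1 intro!: ennreal_leI)
          ultimately have "ennreal \<bar>g s\<bar> * 1 \<le> G (s - y) * (ennreal (exp 1) * edecay 1 y)"
            by (intro mult_mono) auto
          then show ?thesis using True by (simp add: mult_ac)
        qed simp
      qed
    qed
    also have "\<dots> = ennreal (exp 1) * conv G (edecay 1) s"
      unfolding conv_flip[of G "edecay 1" s, simplified] by (rule nn_integral_cmult) measurable
    finally have "ennreal (1/V) * (ennreal \<bar>g s\<bar> * ennreal V) \<le> ennreal (1/V) * (ennreal (exp 1) * conv G (edecay 1) s)"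
      by (rule mult_left_mono) simp
    moreover have "ennreal (1/V) * (ennreal \<bar>g s\<bar> * ennreal V) = ennreal \<bar>g s\<bar>"
      using V(1) by (simp flip: ennreal_mult)
    moreover have "ennreal (1/V) * (ennreal (exp 1) * conv G (edecay 1) s) = c s"
      unfolding c_def using V(1) by (simp add: mult.assoc[symmetric] flip: ennreal_mult)
    ultimately show ?case by simp
  qed
  show ?thesis
  proof (intro exI[of _ "\<lambda>z. c z + c (- z)"] conjI allI)
    show "slow 1 1 (\<lambda>z. c z + c (- z))" by (intro slow_add slc slow_reflect[OF slc])
    show "wint (\<lambda>z. c z + c (- z)) < \<infinity>"
      using wc by (subst wint_add) (auto simp: wint_reflect)
    show "AE z in lborel. ennreal \<bar>g z\<bar> \<le> c z + c (- z)"
      using ae by eventually_elim (auto intro: add_increasing2)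
  qed (simp add: add.commute)
qed

lemma epow_half_sq: "(epow x (1/2))^2 = x"
  using epow_epow[of x "1/2" 2]
  by (cases x) (auto simp: epow_ennreal ennreal_power powr_half_sqrt)

lemma epow_half_le: "x \<le> y ^ 2 \<Longrightarrow> epow x (1/2) \<le> y"
  by (rule ennreal_power2_le_cancel) (simp add: epow_half_sq)

context tf_frame
begin

text \<open>The transform reproduces itself through a slowly varying kernel, so an L1 norm controls the
  L2 norm.\<close>

lemma local_L2_le:
  "\<exists>C>0. \<forall>k u x. slow D \<kappa> k \<longrightarrow> (\<forall>z. k (- z) = k z) \<longrightarrow> u \<in> Minf w \<longrightarrow>
    (\<integral>\<^sup>+z. (k (z - x) * ennreal (cmod (dstft phi u z)))^2 \<partial>lborel)
      \<le> (\<integral>\<^sup>+y. ennreal C * conv k b1 (x - y) * ennreal (cmod (dstft phi u y)) \<partial>lborel)^2"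
proof -
  obtain C where C: "0 < C" "\<And>b::'d tf \<Rightarrow> ennreal. slow (D * 1) (\<kappa> + 1) b \<Longrightarrow>
     (\<integral>\<^sup>+x. (b x)^2 \<partial>lborel) \<le> (ennreal C * (\<integral>\<^sup>+x. b x \<partial>lborel))^2"
    using slow_L2_le_L1[where 'a = "'d tf", of "D * 1" "\<kappa> + 1"] by blast
  show ?thesis
  proof (intro exI[of _ C] conjI allI impI C(1))
    fix k u x assume k: "slow D \<kappa> k" and ev: "\<forall>z::'d tf. k (- z) = k z" and u: "u \<in> Minf w"
    let ?a = "\<lambda>z. ennreal (cmod (dstft phi u z))"
    have [measurable]: "k \<in> borel_measurable borel" using k by (rule slowD)
    have [measurable]: "dstft phi u \<in> borel_measurable borel" using u by (rule dstft_measurable)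
    have "(\<integral>\<^sup>+z. (k (z - x) * ?a z)^2 \<partial>lborel) \<le> (\<integral>\<^sup>+z. (\<integral>\<^sup>+y. k (z - x) * b1 (z - y) * ?a y \<partial>lborel)^2 \<partial>lborel)"
    proof (intro nn_integral_mono power_mono)
      fix z
      have "k (z - x) * ?a z \<le> k (z - x) * (\<integral>\<^sup>+y. b1 (z - y) * ?a y \<partial>lborel)"
        by (intro mult_left_mono dstft_le_conv u) auto
      also have "\<dots> = (\<integral>\<^sup>+y. k (z - x) * (b1 (z - y) * ?a y) \<partial>lborel)"
        by (rule nn_integral_cmult[symmetric]) measurable
      finally show "k (z - x) * ?a z \<le> (\<integral>\<^sup>+y. k (z - x) * b1 (z - y) * ?a y \<partial>lborel)" by (simp only: mult.assoc)
    qed auto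
    also have "\<dots> \<le> (\<integral>\<^sup>+y. ennreal C * conv k b1 (x - y) * ?a y \<partial>lborel)^2"
    proof (rule minkowski_L2[OF lborel.sigma_finite_measure_axioms lborel.sigma_finite_measure_axioms])
      fix y
      have sl: "slow (D * 1) (\<kappa> + 1) (\<lambda>z. k (z - x) * b1 (z - y))"
        by (intro slow_mult slow_shift k slow_b1)
      have "(\<integral>\<^sup>+z. k (z - x) * b1 (z - y) \<partial>lborel) = (\<integral>\<^sup>+z. k (z - x) * b1 ((y - x) - (z - x)) \<partial>lborel)"
        by (intro nn_integral_cong) (metis b1_even minus_diff_eq diff_diff_eq2 diff_add_cancel)
      also have "\<dots> = conv k b1 (y - x)"
        unfolding conv_def by (rule nn_integral_lborel_shift(1)[where f = "\<lambda>z. k z * b1 ((y - x) - z)"]) measurable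
      also have "\<dots> = conv k b1 (x - y)"
        using conv_even[of k b1 "x - y"] ev b1_even by simp
      finally have eq: "(\<integral>\<^sup>+z. k (z - x) * b1 (z - y) \<partial>lborel) = conv k b1 (x - y)" .
      have "(\<integral>\<^sup>+z. (k (z - x) * b1 (z - y) * ?a y)^2 \<partial>lborel) = (\<integral>\<^sup>+z. (k (z - x) * b1 (z - y))^2 \<partial>lborel) * (?a y)^2"
        unfolding power_mult_distrib by (rule nn_integral_multc) measurable
      also have "\<dots> \<le> (ennreal C * (\<integral>\<^sup>+z. k (z - x) * b1 (z - y) \<partial>lborel))^2 * (?a y)^2"
        by (intro mult_right_mono C(2) sl) auto
      finally show "(\<integral>\<^sup>+z. (k (z - x) * b1 (z - y) * ?a y)^2 \<partial>lborel) \<le> (ennreal C * conv k b1 (x - y) * ?a y)^2"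
        unfolding eq power_mult_distrib .
    qed measurable
    finally show "(\<integral>\<^sup>+z. (k (z - x) * ?a z)^2 \<partial>lborel) \<le> (\<integral>\<^sup>+y. ennreal C * conv k b1 (x - y) * ?a y \<partial>lborel)^2" .
  qed
qed

definition Fsq :: "real \<Rightarrow> ('d fn \<Rightarrow> complex) \<Rightarrow> 'd tf \<Rightarrow> ennreal" where
  "Fsq L u x = (\<integral>\<^sup>+z. (edecay (1/L) (z - x) * ennreal (cmod (dstft phi u z)))^2 \<partial>lborel)"

definition F :: "real \<Rightarrow> ('d fn \<Rightarrow> complex) \<Rightarrow> 'd tf \<Rightarrow> ennreal" where
  "F L u x = epow (Fsq L u x) (1/2)"

lemma F_sq: "(F L u x)^2 = Fsq L u x"
  unfolding F_def by (rule epow_half_sq)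

lemma F_measurable [measurable]:
  assumes u: "u \<in> Minf w"
  shows "F L u \<in> borel_measurable borel"
proof -
  have [measurable]: "dstft phi u \<in> borel_measurable borel" using u by (rule dstft_measurable)
  show ?thesis unfolding F_def Fsq_def by measurable
qed

text \<open>With z = y - s the cut-off moves along with the translate, so the local norm of each
  translated copy is exactly F at x - s; Minkowski sums these.\<close>

lemma local_conv_le:
  assumes u: "u \<in> Minf w" and k [measurable]: "k \<in> borel_measurable borel"
  shows "(\<integral>\<^sup>+y. (edecay (1/L) (y - x) * (\<integral>\<^sup>+z. k (y - z) * ennreal (cmod (dstft phi u z)) \<partial>lborel))^2 \<partial>lborel)
    \<le> (\<integral>\<^sup>+y. k (x - y) * F L u y \<partial>lborel)^2"
proof -
  have [measurable]: "dstft phi u \<in> borel_measurable borel" using u by (rule dstft_measurable)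
  have Fm [measurable]: "F L u \<in> borel_measurable borel" using u by (rule F_measurable)
  let ?a = "\<lambda>z. ennreal (cmod (dstft phi u z))"
  have "(\<integral>\<^sup>+y. (edecay (1/L) (y - x) * (\<integral>\<^sup>+z. k (y - z) * ?a z \<partial>lborel))^2 \<partial>lborel)
    = (\<integral>\<^sup>+y. (\<integral>\<^sup>+s. edecay (1/L) (y - x) * (k s * ?a (y - s)) \<partial>lborel)^2 \<partial>lborel)"
    using nn_integral_lborel_shift(3)[of "\<lambda>s. k s * ?a (y - s)" y for y] by (simp add: nn_integral_cmult)
  also have "\<dots> \<le> (\<integral>\<^sup>+s. k s * F L u (x - s) \<partial>lborel)^2"
  proof (rule minkowski_L2[OF lborel.sigma_finite_measure_axioms lborel.sigma_finite_measure_axioms])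
    fix s
    have "(\<integral>\<^sup>+y. (edecay (1/L) (y - x) * (k s * ?a (y - s)))^2 \<partial>lborel)
      = (\<integral>\<^sup>+y. (k s)^2 * (edecay (1/L) ((y - s) - (x - s)) * ?a (y - s))^2 \<partial>lborel)"
      by (intro nn_integral_cong) (simp add: power_mult_distrib mult_ac)
    also have "\<dots> = (k s)^2 * (\<integral>\<^sup>+y. (edecay (1/L) ((y - s) - (x - s)) * ?a (y - s))^2 \<partial>lborel)"
      by (rule nn_integral_cmult) measurable
    also have "(\<integral>\<^sup>+y. (edecay (1/L) ((y - s) - (x - s)) * ?a (y - s))^2 \<partial>lborel) = Fsq L u (x - s)"
      unfolding Fsq_def by (rule nn_integral_lborel_shift(1)[where f = "\<lambda>y. (edecay (1/L) (y - (x - s)) * ?a y)^2"]) measurable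
    finally show "(\<integral>\<^sup>+y. (edecay (1/L) (y - x) * (k s * ?a (y - s)))^2 \<partial>lborel) \<le> (k s * F L u (x - s))^2"
      by (simp add: power_mult_distrib F_sq)
  qed measurable
  also have "(\<integral>\<^sup>+s. k s * F L u (x - s) \<partial>lborel) = (\<integral>\<^sup>+y. k (x - y) * F L u y \<partial>lborel)"
    using nn_integral_lborel_shift(3)[of "\<lambda>s. k s * F L u (x - s)" x] by simp
  finally show ?thesis .
qed

text \<open>Pointwise values are recovered from local L2 norms: the self-reproducing bound is
  averaged over unit balls, on which \<open>b1\<close> is nearly constant, and Cauchy-Schwarz is
  used on each ball.\<close>

lemma dstft_le_F:
  assumes L: "1 \<le> L"
  shows "\<exists>C>0. \<forall>u y. u \<in> Minf w \<longrightarrow> ennreal (cmod (dstft phi u y)) \<le> ennreal C * (\<integral>\<^sup>+s. b1 (y - s) * F L u s \<partial>lborel)"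
proof -
  obtain V where V: "0 < V" "\<And>x::'d tf. emeasure lborel (ball x 1) = ennreal V"
    using unit_ball_measure[where 'a = "'d tf"] by blast
  \<comment> \<open>1 / V from averaging, exp 1 from the variation of \<open>b1\<close> on a unit
    ball, sqrt V from Cauchy-Schwarz, and another exp 1 because the cut-off is at least exp (-1)
    there when L \<ge> 1.\<close>
  let ?C = "exp 1 / V * (sqrt V * exp 1)"
  show ?thesis
  proof (intro exI[of _ ?C] conjI allI impI)
    show "0 < ?C" using V by simp
    fix u y assume u: "u \<in> Minf w"
    have [measurable]: "dstft phi u \<in> borel_measurable borel" using u by (rule dstft_measurable)
    have Fm [measurable]: "F L u \<in> borel_measurable borel" using u by (rule F_measurable)
    let ?a = "\<lambda>z. ennreal (cmod (dstft phi u z))"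
    have [measurable]: "(\<lambda>p::'d tf \<times> 'd tf. indicator (ball (fst p) 1) (snd p) :: ennreal) \<in> borel_measurable (borel \<Otimes>\<^sub>M borel)" (is "?i \<in> _")
    proof -
      have "?i = (\<lambda>p. indicator (ball 0 1) (fst p - snd p))" by (rule ext) (simp add: indicator_def dist_norm norm_minus_commute)
      moreover have "(\<lambda>p::'d tf \<times> 'd tf. indicator (ball 0 1) (fst p - snd p) :: ennreal) \<in> borel_measurable (borel \<Otimes>\<^sub>M borel)"
        using measurable_compose[of "\<lambda>p::'d tf \<times> 'd tf. fst p - snd p" "borel \<Otimes>\<^sub>M borel" borel "indicator (ball 0 1) :: _ \<Rightarrow> ennreal" borel]
          measurable_indicator_ball[of 0 1] by simp
      ultimately show ?thesis by simp
    qed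
    have loc: "(\<integral>\<^sup>+z. indicator (ball s 1) z * ?a z \<partial>lborel) \<le> ennreal (sqrt V * exp 1) * F L u s" for s
    proof (rule ennreal_power2_le_cancel)
      have "(\<integral>\<^sup>+z. indicator (ball s 1) z * ?a z \<partial>lborel)^2 = (\<integral>\<^sup>+z. indicator (ball s 1) z * (indicator (ball s 1) z * ?a z) \<partial>lborel)^2"
        by (simp add: mult.assoc[symmetric] indicator_inter_arith[symmetric])
      also have "\<dots> \<le> (\<integral>\<^sup>+z. (indicator (ball s 1) z)^2 \<partial>lborel) * (\<integral>\<^sup>+z. (indicator (ball s 1) z * ?a z)^2 \<partial>lborel)"
        by (rule Cauchy_Schwarz_nn_integral) measurable
      also have "(\<integral>\<^sup>+z. (indicator (ball s 1) z)^2 \<partial>lborel) = ennreal V"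
        by (simp add: power2_eq_square indicator_inter_arith[symmetric] V)
      also have "(\<integral>\<^sup>+z. (indicator (ball s 1) z * ?a z)^2 \<partial>lborel) \<le> (\<integral>\<^sup>+z. ennreal (exp 1 ^ 2) * (edecay (1/L) (z - s) * ?a z)^2 \<partial>lborel)"
      proof (intro nn_integral_mono)
        fix z
        show "(indicator (ball s 1) z * ?a z)^2 \<le> ennreal (exp 1 ^ 2) * (edecay (1/L) (z - s) * ?a z)^2"
        proof (cases "z \<in> ball s 1")
          case True
          have "norm (z - s) / L \<le> 1"
            using True L by (simp add: dist_norm norm_minus_commute divide_le_eq)
          then have "1 \<le> exp 1 * exp (- (1/L * norm (z - s)))" by (simp add: exp_add[symmetric])
          then have "1 \<le> ennreal (exp 1) * edecay (1/L) (z - s)"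
            unfolding edecay_def by (subst ennreal_mult[symmetric]) (auto simp del: ennreal_1 simp: ennreal_1[symmetric] intro!: ennreal_leI)
          from mult_right_mono[OF this zero_le, of "?a z"]
          have "(?a z)^2 \<le> (ennreal (exp 1) * edecay (1/L) (z - s) * ?a z)^2" by (intro power_mono) auto
          then show ?thesis using True by (simp add: power_mult_distrib ennreal_power mult.assoc)
        qed simp
      qed
      also have "\<dots> = ennreal (exp 1 ^ 2) * Fsq L u s" unfolding Fsq_def by (rule nn_integral_cmult) measurable
      also have "ennreal V * (ennreal (exp 1 ^ 2) * Fsq L u s) = (ennreal (sqrt V * exp 1) * F L u s)^2"
        using V(1) by (simp add: power_mult_distrib F_sq ennreal_power mult.assoc[symmetric] ennreal_mult[symmetric])
      finally show "(\<integral>\<^sup>+z. indicator (ball s 1) z * ?a z \<partial>lborel)^2 \<le> (ennreal (sqrt V * exp 1) * F L u s)^2"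
        by (simp add: mult_left_mono)
    qed
    have "ennreal V * ?a y \<le> ennreal V * (\<integral>\<^sup>+z. b1 (y - z) * ?a z \<partial>lborel)"
      by (intro mult_left_mono dstft_le_conv u) auto
    also have "\<dots> = (\<integral>\<^sup>+z. \<integral>\<^sup>+s. b1 (y - z) * ?a z * indicator (ball s 1) z \<partial>lborel \<partial>lborel)"
    proof -
      have "(\<integral>\<^sup>+s. b1 (y - z) * ?a z * indicator (ball s 1) z \<partial>lborel) = ennreal V * (b1 (y - z) * ?a z)" for z
      proof -
        have "(\<integral>\<^sup>+s. b1 (y - z) * ?a z * indicator (ball s 1) z \<partial>lborel) = (\<integral>\<^sup>+s. b1 (y - z) * ?a z * indicator (ball z 1) s \<partial>lborel)"
          by (intro nn_integral_cong) (auto simp: indicator_def dist_commute)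
        also have "\<dots> = (b1 (y - z) * ?a z) * emeasure lborel (ball z 1)"
          by (rule nn_integral_cmult_indicator) auto
        finally show ?thesis by (simp only: V mult.commute)
      qed
      then show ?thesis by (simp add: nn_integral_cmult)
    qed
    also have "\<dots> = (\<integral>\<^sup>+s. \<integral>\<^sup>+z. b1 (y - z) * ?a z * indicator (ball s 1) z \<partial>lborel \<partial>lborel)"
      by (rule lborel_pair.Fubini') measurable
    also have "\<dots> \<le> (\<integral>\<^sup>+s. \<integral>\<^sup>+z. ennreal (exp 1) * b1 (y - s) * (indicator (ball s 1) z * ?a z) \<partial>lborel \<partial>lborel)"
    proof (intro nn_integral_mono)
      fix s z
      show "b1 (y - z) * ?a z * indicator (ball s 1) z \<le> ennreal (exp 1) * b1 (y - s) * (indicator (ball s 1) z * ?a z)"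
      proof (cases "z \<in> ball s 1")
        case True
        have "b1 (y - z) \<le> ennreal (1 * exp (1 * norm ((y - z) - (y - s)))) * b1 (y - s)" by (rule slowD(4)[OF slow_b1])
        also have "\<dots> \<le> ennreal (exp 1) * b1 (y - s)"
          using True by (intro mult_right_mono ennreal_leI) (auto simp: dist_norm)
        finally show ?thesis using True by (simp add: mult_right_mono)
      qed simp
    qed
    also have "\<dots> = (\<integral>\<^sup>+s. ennreal (exp 1) * b1 (y - s) * (\<integral>\<^sup>+z. indicator (ball s 1) z * ?a z \<partial>lborel) \<partial>lborel)"
      by (intro nn_integral_cong nn_integral_cmult) measurable
    also have "\<dots> \<le> (\<integral>\<^sup>+s. ennreal (exp 1) * b1 (y - s) * (ennreal (sqrt V * exp 1) * F L u s) \<partial>lborel)"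
      by (intro nn_integral_mono mult_left_mono loc) auto
    also have "\<dots> = (\<integral>\<^sup>+s. ennreal (exp 1 * (sqrt V * exp 1)) * (b1 (y - s) * F L u s) \<partial>lborel)"
      using V(1) by (intro nn_integral_cong) (simp add: ennreal_mult mult_ac)
    also have "\<dots> = ennreal (exp 1 * (sqrt V * exp 1)) * (\<integral>\<^sup>+s. b1 (y - s) * F L u s \<partial>lborel)"
      by (rule nn_integral_cmult) measurable
    finally have "ennreal (1/V) * (ennreal V * ?a y) \<le> ennreal (1/V) * (ennreal (exp 1 * (sqrt V * exp 1)) * (\<integral>\<^sup>+s. b1 (y - s) * F L u s \<partial>lborel))"
      by (rule mult_left_mono) simp
    moreover have "ennreal (1/V) * (ennreal V * ?a y) = ?a y"
      using V(1) by (simp flip: ennreal_mult mult.assoc)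
    moreover have "ennreal (1/V) * (ennreal (exp 1 * (sqrt V * exp 1)) * I) = ennreal ?C * I" for I
      using V(1) by (simp add: mult.assoc[symmetric] ennreal_mult[symmetric])
    ultimately show "?a y \<le> ennreal ?C * (\<integral>\<^sup>+s. b1 (y - s) * F L u s \<partial>lborel)" by simp
  qed
qed

end

section \<open>Families of symbols\<close>

lemma slow_mono:
  fixes b :: "'a::euclidean_space \<Rightarrow> ennreal"
  shows "slow D \<kappa> b \<Longrightarrow> D \<le> D' \<Longrightarrow> \<kappa> \<le> \<kappa>' \<Longrightarrow> slow D' \<kappa>' b"
  unfolding slow_def
proof safe
  fix x y :: 'a assume b: "\<forall>x y. b x \<le> ennreal (D * exp (\<kappa> * norm (x - y))) * b y" "1 \<le> D" "D \<le> D'" "\<kappa> \<le> \<kappa>'"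
  have "D * exp (\<kappa> * norm (x - y)) \<le> D' * exp (\<kappa>' * norm (x - y))"
    using b by (intro mult_mono) (auto intro: mult_right_mono)
  then show "b x \<le> ennreal (D' * exp (\<kappa>' * norm (x - y))) * b y"
    using b(1)[rule_format, of x y] by (meson ennreal_leI mult_right_mono order_trans zero_le)
qed auto

lemma cauchy_schwarz_le:
  assumes "f \<in> borel_measurable M" "g \<in> borel_measurable M"
    and "(\<integral>\<^sup>+z. (f z)^2 \<partial>M) \<le> p^2" "(\<integral>\<^sup>+z. (g z)^2 \<partial>M) \<le> q^2"
  shows "(\<integral>\<^sup>+z. f z * g z \<partial>M) \<le> p * (q :: ennreal)"
proof (rule ennreal_power2_le_cancel)
  have "(\<integral>\<^sup>+z. f z * g z \<partial>M)^2 \<le> (\<integral>\<^sup>+z. (f z)^2 \<partial>M) * (\<integral>\<^sup>+z. (g z)^2 \<partial>M)"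
    by (rule Cauchy_Schwarz_nn_integral) fact+
  also have "\<dots> \<le> p^2 * q^2" by (intro mult_mono assms) auto
  finally show "(\<integral>\<^sup>+z. f z * g z \<partial>M)^2 \<le> (p * q)^2" by (simp add: power_mult_distrib)
qed

text \<open>Factor the difference of squares of the cut-off values p and q. As exp (- s) has
  variation proportional to its own size, |p - q| is at most rho times p + q, and (p + q)^2 \<le> 2
  * (p^2 + q^2). The bound contains the squared cut-offs again, so the commutator can be measured by
  F.\<close>

lemma edecay_commutator:
  assumes L: "1 \<le> L"
  shows "ennreal \<bar>exp (- (norm (y - x) / L))^2 - exp (- (norm (z - x) / L))^2\<bar>
    \<le> 2 * rho L (y - z) * ((edecay (1/L) (y - x))^2 + (edecay (1/L) (z - x))^2)"
proof -
  let ?p = "\<lambda>y. exp (- (norm (y - x) / L))"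
  let ?r = "min 1 ((1 + norm (y - z)) / L)"
  have le: "exp (- s) - exp (- t) \<le> min 1 \<bar>s - t\<bar> * exp (- s)" if "0 \<le> s" "0 \<le> t" for s t :: real
  proof (cases "s \<le> t")
    case True
    have eq: "exp (- s) - exp (- t) = exp (- s) * (1 - exp (- (t - s)))" by (simp add: algebra_simps exp_add[symmetric])
    have "1 - exp (- (t - s)) \<le> min 1 \<bar>s - t\<bar>"
      using exp_ge_add_one_self[of "- (t - s)"] exp_gt_zero[of "- (t - s)"] True by linarith
    then have "exp (- s) * (1 - exp (- (t - s))) \<le> exp (- s) * min 1 \<bar>s - t\<bar>" by (rule mult_left_mono) simp
    then show ?thesis unfolding eq by (simp only: mult.commute)
  next
    case False
    then have "exp (- s) \<le> exp (- t)" by simp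
    then show ?thesis by (smt (verit) exp_gt_zero mult_nonneg_nonneg)
  qed
  have d: "\<bar>norm (y - x) / L - norm (z - x) / L\<bar> \<le> (1 + norm (y - z)) / L"
  proof -
    have "\<bar>norm (y - x) - norm (z - x)\<bar> \<le> 1 + norm (y - z)"
      using norm_triangle_ineq3[of "y - x" "z - x"] by simp
    then have "\<bar>norm (y - x) - norm (z - x)\<bar> / L \<le> (1 + norm (y - z)) / L"
      using L by (intro divide_right_mono) auto
    then show ?thesis using L by (simp add: diff_divide_distrib[symmetric])
  qed
  have r: "min 1 \<bar>norm (y - x) / L - norm (z - x) / L\<bar> \<le> ?r" using d by (auto simp: min_def)
  have r': "min 1 \<bar>norm (z - x) / L - norm (y - x) / L\<bar> \<le> ?r" using d by (auto simp: min_def)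
  have "?p y - ?p z \<le> ?r * ?p y"
    by (rule order_trans[OF le mult_right_mono[OF r]]) (use L in auto)
  moreover have "?p z - ?p y \<le> ?r * ?p z"
    by (rule order_trans[OF le mult_right_mono[OF r']]) (use L in auto)
  moreover have r0: "0 \<le> ?r" using L by auto
  moreover have "0 \<le> ?r * ?p y" "0 \<le> ?r * ?p z" using r0 by auto
  ultimately have "\<bar>?p y - ?p z\<bar> \<le> ?r * (?p y + ?p z)"
    unfolding distrib_left by linarith
  then have "\<bar>?p y - ?p z\<bar> * (?p y + ?p z) \<le> ?r * (?p y + ?p z) * (?p y + ?p z)"
    by (intro mult_right_mono) (auto intro: add_nonneg_nonneg)
  moreover have "\<bar>(?p y)^2 - (?p z)^2\<bar> = \<bar>?p y - ?p z\<bar> * (?p y + ?p z)"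
  proof -
    have "(?p y)^2 - (?p z)^2 = (?p y - ?p z) * (?p y + ?p z)" by (simp add: power2_eq_square algebra_simps)
    moreover have "0 \<le> ?p y + ?p z" by (simp add: add_nonneg_nonneg)
    ultimately show ?thesis by (simp only: abs_mult abs_of_nonneg)
  qed
  moreover have "(?p y + ?p z) * (?p y + ?p z) \<le> 2 * ((?p y)^2 + (?p z)^2)"
    using sum_squares_ge_zero[of "?p y - ?p z" 0] by (simp add: power2_eq_square algebra_simps)
  then have "?r * ((?p y + ?p z) * (?p y + ?p z)) \<le> ?r * (2 * ((?p y)^2 + (?p z)^2))"
    by (rule mult_left_mono[OF _ r0])
  ultimately have "\<bar>(?p y)^2 - (?p z)^2\<bar> \<le> 2 * ?r * ((?p y)^2 + (?p z)^2)"
    by (simp only: mult_ac)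
  then have "ennreal \<bar>(?p y)^2 - (?p z)^2\<bar> \<le> ennreal (2 * ?r * ((?p y)^2 + (?p z)^2))"
    by (rule ennreal_leI)
  also have "\<dots> = 2 * rho L (y - z) * ((edecay (1/L) (y - x))^2 + (edecay (1/L) (z - x))^2)"
    using r0 by (simp add: ennreal_mult rho_def edecay_def ennreal_power)
  finally show ?thesis .
qed

text \<open>Splits 1 into a part near the origin at scale L and a far part, by 1 - exp (- t) \<le>
  t.\<close>

lemma one_le_edecay_rho: "1 \<le> L \<Longrightarrow> 1 \<le> edecay (1/L) z + rho L z"
proof -
  assume L: "1 \<le> L"
  have "1 \<le> exp (- (1/L * norm z)) + norm z / L" using exp_ge_add_one_self[of "- (1/L * norm z)"] by simp
  also have "norm z / L \<le> (1 + norm z) / L" using L by (intro divide_right_mono) auto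
  finally have "1 \<le> exp (- (1/L * norm z)) + min 1 ((1 + norm z) / L)"
    by (auto simp: min_def)
  then have "ennreal 1 \<le> ennreal (exp (- (1/L * norm z)) + min 1 ((1 + norm z) / L))" by (rule ennreal_leI)
  then show ?thesis using L by (simp add: edecay_def rho_def)
qed

lemma rho_triangle: "1 \<le> L \<Longrightarrow> rho L (a + b) \<le> rho L a + rho L b"
proof -
  assume L: "1 \<le> L"
  have "(1 + norm (a + b)) / L \<le> (1 + norm a) / L + (1 + norm b) / L"
    using norm_triangle_ineq[of a b] L by (simp add: add_divide_distrib[symmetric] divide_right_mono)
  moreover have "0 \<le> (1 + norm a) / L" "0 \<le> (1 + norm b) / L" using L by auto
  ultimately have "min 1 ((1 + norm (a + b)) / L) \<le> min 1 ((1 + norm a) / L) + min 1 ((1 + norm b) / L)"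
    by (auto simp: min_def)
  then show ?thesis using L by (simp add: rho_def ennreal_plus[symmetric] ennreal_leI del: ennreal_plus)
qed

lemma edecay_triangle: "0 \<le> c \<Longrightarrow> edecay c (z - x) * edecay c (z - g) \<le> edecay c (x - g)"
proof -
  assume c: "0 \<le> c"
  have "norm (x - g) \<le> norm (z - x) + norm (z - g)"
    using norm_triangle_ineq4[of "z - g" "z - x"] by (simp add: add.commute)
  then have "c * norm (x - g) \<le> c * norm (z - x) + c * norm (z - g)"
    using c by (metis distrib_left mult_left_mono)
  then show ?thesis unfolding edecay_def
    by (subst ennreal_mult[symmetric]) (auto simp: exp_add[symmetric] intro!: ennreal_leI)
qed

section \<open>The family of symbols and its common envelope\<close>

locale tf_cover = tf_frame w phi for w :: "('d::finite) tf \<Rightarrow> real" and phi +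
  fixes \<Gamma> :: "'d tf set" and \<eta> :: "'d tf \<Rightarrow> 'd tf \<Rightarrow> real" and lam :: "'d tf \<Rightarrow> nat \<Rightarrow> real"
    and e :: "'d tf \<Rightarrow> nat \<Rightarrow> 'd fn" and N :: nat and b2 :: "'d tf \<Rightarrow> ennreal" and A B :: real
  assumes \<Gamma>_fin: "\<And>z. finite (\<Gamma> \<inter> ball z 1)" and \<Gamma>_card: "\<And>z. card (\<Gamma> \<inter> ball z 1) \<le> N"
    and \<eta>_meas: "\<And>g. g \<in> \<Gamma> \<Longrightarrow> \<eta> g \<in> borel_measurable borel"
    and \<eta>_bd: "\<And>g. g \<in> \<Gamma> \<Longrightarrow> \<exists>Bd. \<forall>z. \<bar>\<eta> g z\<bar> \<le> Bd"
    and \<eta>_nonneg: "\<And>g z. g \<in> \<Gamma> \<Longrightarrow> 0 \<le> \<eta> g z"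
    and AB: "0 < A" "A \<le> B"
    and sumA: "\<And>z. ennreal A \<le> (\<integral>\<^sup>+g. ennreal (\<eta> g z) \<partial>count_space \<Gamma>)"
    and sumB: "\<And>z. (\<integral>\<^sup>+g. ennreal (\<eta> g z) \<partial>count_space \<Gamma>) \<le> ennreal B"
    and diag: "\<And>g. g \<in> \<Gamma> \<Longrightarrow> diagonalization phi (\<eta> g) (lam g) (e g)"
    and slow_b2: "slow 1 1 b2" and b2_even: "\<And>z. b2 (- z) = b2 z" and wint_b2: "wint b2 < \<infinity>"
    and \<eta>_le: "\<And>g. g \<in> \<Gamma> \<Longrightarrow> AE z in lborel. ennreal (\<eta> g z) \<le> b2 (z - g)"
begin

lemma b2_measurable [measurable]: "b2 \<in> borel_measurable borel"
  using slow_b2 by (rule slowD)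

lemma \<Gamma>_countable: "countable \<Gamma>"
  using \<Gamma>_fin by (rule relatively_separated_countable)

lemma sigma_finite_\<Gamma>: "sigma_finite_measure (count_space \<Gamma>)"
  using \<Gamma>_countable by (rule sigma_finite_measure_count_space_countable)

text \<open>Countability of the index set makes a family of Borel functions jointly measurable, so
  Tonelli applies.\<close>

lemma swap_count:
  assumes "\<And>g. g \<in> \<Gamma> \<Longrightarrow> f g \<in> borel_measurable borel"
  shows "(\<integral>\<^sup>+g. (\<integral>\<^sup>+z. f g z \<partial>(lborel :: 'd tf measure)) \<partial>count_space \<Gamma>) = (\<integral>\<^sup>+z. (\<integral>\<^sup>+g. f g z \<partial>count_space \<Gamma>) \<partial>lborel)"
proof -
  interpret G: sigma_finite_measure "count_space \<Gamma>" by (rule sigma_finite_\<Gamma>)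
  interpret P: pair_sigma_finite "count_space \<Gamma>" "lborel :: 'd tf measure" ..
  have "(\<lambda>(g, z). f g z) \<in> borel_measurable (count_space \<Gamma> \<Otimes>\<^sub>M lborel)"
    by (rule measurable_pair_measure_countable1[OF \<Gamma>_countable]) (use assms in auto)
  then show ?thesis by (rule P.Fubini'[symmetric])
qed

text \<open>The integrability conditions on a single symbol come from the shifted envelope
  \<open>b2\<close>. Square integrability of eta * w holds because \<open>b2\<close> * w is slowly
  varying and integrable, hence square integrable.\<close>

lemma tf_symbol_at:
  assumes g: "g \<in> \<Gamma>" and u: "u \<in> Minf w"
  shows "\<exists>Bd. tf_symbol w phi (\<eta> g) (lam g) (e g) u Bd"
proof -
  obtain Bd where Bd: "\<And>z. \<bar>\<eta> g z\<bar> \<le> Bd" using \<eta>_bd[OF g] by blast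
  have [measurable]: "\<eta> g \<in> borel_measurable borel" using g by (rule \<eta>_meas)
  have "wint (\<lambda>z. ennreal (\<eta> g z)) \<le> wint (\<lambda>z. b2 (z - g))"
    unfolding wint_def using \<eta>_le[OF g]
    by (intro nn_integral_mono_AE) (auto elim!: eventually_mono intro: mult_right_mono)
  also have "\<dots> \<le> ennreal (w g) * wint b2" by (rule wint_shift_le) measurable
  also have "\<dots> < \<infinity>" using wint_b2 by (simp add: ennreal_mult_less_top)
  finally have int: "wint (\<lambda>z. ennreal (\<eta> g z)) < \<infinity>" .
  obtain Dw where Dw: "slow Dw 1 (\<lambda>z. ennreal (w z))" using slow_w by blast
  have sl: "slow (1 * Dw) (1 + 1) (\<lambda>z. b2 z * ennreal (w z))" by (rule slow_mult[OF slow_b2 Dw])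
  obtain C where C: "\<And>b::'d tf \<Rightarrow> ennreal. slow (1 * Dw) (1 + 1) b \<Longrightarrow> (\<integral>\<^sup>+x. (b x)^2 \<partial>lborel) \<le> (ennreal C * (\<integral>\<^sup>+x. b x \<partial>lborel))^2"
    using slow_L2_le_L1[where 'a = "'d tf", of "1 * Dw" "1 + 1"] by blast
  have b2w: "(\<integral>\<^sup>+z. (b2 z * ennreal (w z))^2 \<partial>lborel) < \<infinity>"
  proof (rule le_less_trans[OF C[OF sl]])
    show "(ennreal C * (\<integral>\<^sup>+x. b2 x * ennreal (w x) \<partial>lborel))^2 < \<infinity>"
      using wint_b2 unfolding wint_def by (simp add: power_less_top_ennreal ennreal_mult_less_top)
  qed
  have "(\<integral>\<^sup>+z. (ennreal (\<eta> g z) * ennreal (w z))^2 \<partial>lborel)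
      \<le> (\<integral>\<^sup>+z. (ennreal (w g))^2 * (b2 (z - g) * ennreal (w (z - g)))^2 \<partial>lborel)"
  proof (rule nn_integral_mono_AE)
    show "AE z in lborel. (ennreal (\<eta> g z) * ennreal (w z))^2 \<le> (ennreal (w g))^2 * (b2 (z - g) * ennreal (w (z - g)))^2"
      using \<eta>_le[OF g]
    proof eventually_elim
      case (elim z)
      have "ennreal (\<eta> g z) * ennreal (w z) \<le> b2 (z - g) * (ennreal (w g) * ennreal (w (z - g)))"
        using elim ennreal_w_submult[of g "z - g"] by (intro mult_mono) auto
      then have "(ennreal (\<eta> g z) * ennreal (w z))^2 \<le> (b2 (z - g) * (ennreal (w g) * ennreal (w (z - g))))^2"
        by (intro power_mono) auto
      then show ?case by (simp only: power_mult_distrib mult_ac)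
    qed
  qed
  also have "\<dots> = (ennreal (w g))^2 * (\<integral>\<^sup>+z. (b2 (z - g) * ennreal (w (z - g)))^2 \<partial>lborel)"
    by (rule nn_integral_cmult) measurable
  also have "(\<integral>\<^sup>+z. (b2 (z - g) * ennreal (w (z - g)))^2 \<partial>lborel) = (\<integral>\<^sup>+z. (b2 z * ennreal (w z))^2 \<partial>lborel)"
    by (rule nn_integral_lborel_shift(1)[where f = "\<lambda>z. (b2 z * ennreal (w z))^2"]) measurable
  also have "(ennreal (w g))^2 * \<dots> < \<infinity>" using b2w by (simp add: ennreal_mult_less_top power_less_top_ennreal)
  finally have w2: "(\<integral>\<^sup>+z. (ennreal (\<eta> g z) * ennreal (w z))^2 \<partial>lborel) < \<infinity>" .
  have "tf_symbol w phi (\<eta> g) (lam g) (e g) u Bd"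
    by unfold_locales
      (use int w2 u diag[OF g] \<eta>_nonneg[OF g] Bd abs_le_D1 in \<open>auto\<close>)
  then show ?thesis ..
qed

definition aU :: "('d fn \<Rightarrow> complex) \<Rightarrow> 'd tf \<Rightarrow> ennreal" where
  "aU u z = ennreal (cmod (dstft phi u z))"

lemma aU_measurable: "u \<in> Minf w \<Longrightarrow> aU u \<in> borel_measurable borel"
  unfolding aU_def[abs_def] using dstft_measurable[of u] by measurable

text \<open>DD u g is the transform of H u for the symbol at g; the operator itself is never applied to a
  functional.\<close>

definition DD :: "('d fn \<Rightarrow> complex) \<Rightarrow> 'd tf \<Rightarrow> 'd tf \<Rightarrow> complex" where
  "DD u g z = (LINT y|lborel. ker z y * (of_real (\<eta> g y) * dstft phi u y))"

definition aH :: "real \<Rightarrow> ('d fn \<Rightarrow> complex) \<Rightarrow> 'd tf \<Rightarrow> ennreal" where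
  "aH \<epsilon> u g = ennreal (L2norm (Heps \<epsilon> (lam g) (e g) u))"

text \<open>Norm of the full, unthresholded output, taken on the transform side and allowed to be
  infinite.\<close>

definition nH :: "('d fn \<Rightarrow> complex) \<Rightarrow> 'd tf \<Rightarrow> ennreal" where
  "nH u g = epow (sqint (DD u g)) (1/2)"

lemma symbol_energy_le:
  assumes g: "g \<in> \<Gamma>" and u: "u \<in> Minf w" and "0 \<le> t"
  shows "(\<integral>\<^sup>+z. ennreal ((\<eta> g z)^2 * (cmod (dstft phi u z))^2) \<partial>lborel) \<le> (\<integral>\<^sup>+z. (b2 (z - g) * aU u z)^2 \<partial>lborel)"
    and "(\<integral>\<^sup>+z. ennreal ((min (\<eta> g z) t)^2 * (cmod (dstft phi u z))^2) \<partial>lborel)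
      \<le> (\<integral>\<^sup>+z. (min (b2 (z - g)) (ennreal t) * aU u z)^2 \<partial>lborel)"
proof -
  have *: "ennreal (h^2 * (cmod (dstft phi u z))^2) = (ennreal h * aU u z)^2" if "0 \<le> h" for h z
    using that by (simp add: aU_def power_mult_distrib ennreal_mult ennreal_power)
  show "(\<integral>\<^sup>+z. ennreal ((\<eta> g z)^2 * (cmod (dstft phi u z))^2) \<partial>lborel) \<le> (\<integral>\<^sup>+z. (b2 (z - g) * aU u z)^2 \<partial>lborel)"
    using \<eta>_le[OF g] by (intro nn_integral_mono_AE)
      (auto elim!: eventually_mono intro!: power_mono mult_right_mono simp: * \<eta>_nonneg[OF g])
  have "AE z in lborel. ennreal ((min (\<eta> g z) t)^2 * (cmod (dstft phi u z))^2) \<le> (min (b2 (z - g)) (ennreal t) * aU u z)^2"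
    using \<eta>_le[OF g]
  proof eventually_elim
    case (elim z)
    have "ennreal (min (\<eta> g z) t) \<le> min (b2 (z - g)) (ennreal t)"
      by (rule min.boundedI) (rule order_trans[OF ennreal_leI elim], simp, simp add: ennreal_leI)
    then have "(ennreal (min (\<eta> g z) t) * aU u z)^2 \<le> (min (b2 (z - g)) (ennreal t) * aU u z)^2"
      by (intro power_mono mult_right_mono) auto
    then show ?case using \<eta>_nonneg[OF g] assms(3) by (subst *) auto
  qed
  then show "(\<integral>\<^sup>+z. ennreal ((min (\<eta> g z) t)^2 * (cmod (dstft phi u z))^2) \<partial>lborel)
      \<le> (\<integral>\<^sup>+z. (min (b2 (z - g)) (ennreal t) * aU u z)^2 \<partial>lborel)"
    by (rule nn_integral_mono_AE)
qed

lemma aH_sq_le: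
  assumes g: "g \<in> \<Gamma>" and u: "u \<in> Minf w" and \<epsilon>: "0 < \<epsilon>"
  shows "(aH \<epsilon> u g)^2 \<le> (\<integral>\<^sup>+z. (b2 (z - g) * aU u z)^2 \<partial>lborel)"
proof -
  obtain Bd where "tf_symbol w phi (\<eta> g) (lam g) (e g) u Bd" using tf_symbol_at[OF g u] by blast
  then interpret S: tf_symbol w phi "\<eta> g" "lam g" "e g" u Bd .
  show ?thesis using order_trans[OF S.Heps_le[OF \<epsilon>] symbol_energy_le(1)[OF g u order_refl]]
    by (simp add: aH_def ennreal_power)
qed

lemma nH_sq_le:
  assumes g: "g \<in> \<Gamma>" and u: "u \<in> Minf w" and \<epsilon>: "0 < \<epsilon>"
  shows "(nH u g)^2 \<le> (aH \<epsilon> u g)^2 + (ennreal (2 * sqrt \<epsilon>) * (\<integral>\<^sup>+z. (b2 (z - g) * aU u z)^2 \<partial>lborel)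
    + 2 * (\<integral>\<^sup>+z. (min (b2 (z - g)) (ennreal (sqrt \<epsilon>)) * aU u z)^2 \<partial>lborel))"
proof -
  obtain Bd where "tf_symbol w phi (\<eta> g) (lam g) (e g) u Bd" using tf_symbol_at[OF g u] by blast
  then interpret S: tf_symbol w phi "\<eta> g" "lam g" "e g" u Bd .
  have "DD u g = S.D (dstft phi u)" by (simp add: fun_eq_iff DD_def S.D_def)
  then have "(nH u g)^2 = sqint (S.D (dstft phi u))" by (simp add: nH_def epow_half_sq)
  also note S.D_sqint_bound[OF \<epsilon>]
  also have "ennreal ((L2norm (Heps \<epsilon> (lam g) (e g) u))^2) = (aH \<epsilon> u g)^2" by (simp add: aH_def ennreal_power)
  finally show ?thesis
    by (rule order_trans) (use \<epsilon> in \<open>intro add_mono mult_left_mono symbol_energy_le(1)[OF g u order_refl] symbol_energy_le(2)[OF g u] order_refl; simp\<close>)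
qed

lemma DD_le:
  assumes g: "g \<in> \<Gamma>" and u: "u \<in> Minf w"
  shows "ennreal (cmod (DD u g z)) \<le> (\<integral>\<^sup>+y. b1 (z - y) * (ennreal (\<eta> g y) * aU u y) \<partial>lborel)"
proof -
  obtain Bd where "tf_symbol w phi (\<eta> g) (lam g) (e g) u Bd" using tf_symbol_at[OF g u] by blast
  then interpret S: tf_symbol w phi "\<eta> g" "lam g" "e g" u Bd .
  show ?thesis using S.D_le[of z] by (simp add: DD_def S.D_def aU_def)
qed

lemma DD_measurable:
  assumes g: "g \<in> \<Gamma>" and u: "u \<in> Minf w"
  shows "DD u g \<in> borel_measurable borel"
proof -
  obtain Bd where "tf_symbol w phi (\<eta> g) (lam g) (e g) u Bd" using tf_symbol_at[OF g u] by blast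
  then interpret S: tf_symbol w phi "\<eta> g" "lam g" "e g" u Bd .
  have "DD u g = S.D (dstft phi u)" by (simp add: fun_eq_iff DD_def S.D_def)
  then show ?thesis using S.D_meas[OF S.U_meas] by simp
qed

lemma local_energy_le:
  fixes x :: "'d tf"
  assumes g: "g \<in> \<Gamma>" and u: "u \<in> Minf w" and L: "1 \<le> L"
  defines "Q \<equiv> \<lambda>z. exp (- (norm (z - x) / L))^2"
  shows "(\<integral>\<^sup>+z. ennreal (\<eta> g z) * (edecay (1/L) (z - x) * aU u z)^2 \<partial>lborel)
    \<le> (\<integral>\<^sup>+z. (edecay (1/L) (z - x))^2 * (ennreal (cmod (DD u g z)) * aU u z) \<partial>lborel)
    + (\<integral>\<^sup>+y. \<integral>\<^sup>+z. ennreal (\<eta> g y) * (aU u y * (aU u z * (b1 (y - z) * ennreal \<bar>Q y - Q z\<bar>))) \<partial>lborel \<partial>lborel)"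
proof -
  obtain Bd where "tf_symbol w phi (\<eta> g) (lam g) (e g) u Bd" using tf_symbol_at[OF g u] by blast
  then interpret S: tf_symbol w phi "\<eta> g" "lam g" "e g" u Bd .
  have Qe: "ennreal (Q z) = (edecay (1/L) (z - x))^2" for z
    by (simp add: Q_def edecay_def ennreal_power)
  have [measurable]: "Q \<in> borel_measurable borel" unfolding Q_def by measurable
  have Qw: "(\<integral>\<^sup>+z. ennreal (Q z) * (ennreal (w z) * ennreal (w z)) \<partial>lborel) < \<infinity>"
  proof -
    \<comment> \<open>One factor of the squared cut-off absorbs one factor w; the other factor is
      integrable against the remaining one.\<close>
    obtain M where M: "1 \<le> M" "\<And>z. w z \<le> M * exp (1/L * norm z)" using w_exp_bound[of "1/L"] L by auto
    have "(\<integral>\<^sup>+z. ennreal (Q z) * (ennreal (w z) * ennreal (w z)) \<partial>lborel)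
      \<le> (\<integral>\<^sup>+z. ennreal (w x * w x * M) * (edecay (1/L) (z - x) * ennreal (w (z - x))) \<partial>lborel)"
    proof (intro nn_integral_mono)
      fix z
      have wz: "w z \<le> w x * w (z - x)" using submult[of x "z - x"] by simp
      have "w z * w z \<le> (w x * w (z - x)) * (w x * w (z - x))"
        using wz pos less_imp_le[OF pos] by (intro mult_mono) auto
      also have "\<dots> \<le> (w x * (M * exp (1/L * norm (z - x)))) * (w x * w (z - x))"
        using M pos less_imp_le[OF pos] by (intro mult_right_mono mult_left_mono) auto
      finally have "Q z * (w z * w z) \<le> Q z * ((w x * (M * exp (1/L * norm (z - x)))) * (w x * w (z - x)))"
        by (intro mult_left_mono) (auto simp: Q_def)
      also have "\<dots> = w x * w x * M * (exp (- (1/L * norm (z - x))) * w (z - x))"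
        unfolding Q_def by (simp add: power2_eq_square mult_ac exp_minus_inverse exp_minus field_simps)
      finally show "ennreal (Q z) * (ennreal (w z) * ennreal (w z)) \<le> ennreal (w x * w x * M) * (edecay (1/L) (z - x) * ennreal (w (z - x)))"
        using M less_imp_le[OF pos] by (simp add: edecay_def ennreal_mult[symmetric] ennreal_leI Q_def)
    qed
    also have "\<dots> = ennreal (w x * w x * M) * (\<integral>\<^sup>+z. edecay (1/L) (z - x) * ennreal (w (z - x)) \<partial>lborel)"
      by (rule nn_integral_cmult) measurable
    also have "(\<integral>\<^sup>+z. edecay (1/L) (z - x) * ennreal (w (z - x)) \<partial>lborel) = wint (edecay (1/L))"
      by (rule lborel_row(2)) measurable
    also have "ennreal (w x * w x * M) * wint (edecay (1/L)) < \<infinity>"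
      using wint_edecay_finite[of "1/L"] L by (simp add: ennreal_mult_less_top)
    finally show ?thesis .
  qed
  have "(\<integral>\<^sup>+z. ennreal (\<eta> g z) * (edecay (1/L) (z - x) * aU u z)^2 \<partial>lborel) = (\<integral>\<^sup>+z. ennreal (\<eta> g z * (Q z * (cmod (dstft phi u z))^2)) \<partial>lborel)"
    using \<eta>_nonneg[OF g] by (intro nn_integral_cong) (simp add: aU_def ennreal_mult power_mult_distrib ennreal_power Qe[symmetric] Q_def)
  also have "\<dots> \<le> (\<integral>\<^sup>+z. ennreal (Q z) * (ennreal (cmod (S.D (dstft phi u) z)) * ennreal (cmod (dstft phi u z))) \<partial>lborel)
    + (\<integral>\<^sup>+y. \<integral>\<^sup>+z. ennreal (\<eta> g y) * (ennreal (cmod (dstft phi u y)) * (ennreal (cmod (dstft phi u z)) * (b1 (y - z) * ennreal \<bar>Q y - Q z\<bar>))) \<partial>lborel \<partial>lborel)"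
    by (rule S.local_energy_le[OF _ _ Qw]) (measurable, simp add: Q_def)
  also have "S.D (dstft phi u) = DD u g" by (simp add: fun_eq_iff DD_def S.D_def)
  finally show ?thesis unfolding Qe aU_def .
qed

end

lemma ennreal_power2_superadd: "x\<^sup>2 + y\<^sup>2 \<le> (x + y)\<^sup>2" for x y :: ennreal
proof -
  have "(x + y)\<^sup>2 = x\<^sup>2 + y\<^sup>2 + (x * y + y * x)" by (simp add: power2_eq_square distrib_left distrib_right add_ac)
  then show ?thesis by (simp add: add_increasing2)
qed

section \<open>Thresholding error and the localized lower bound\<close>

context tf_cover
begin

lemma aH_le: "\<exists>C>0. \<forall>\<epsilon> u g. 0 < \<epsilon> \<longrightarrow> u \<in> Minf w \<longrightarrow> g \<in> \<Gamma> \<longrightarrow>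
  aH \<epsilon> u g \<le> (\<integral>\<^sup>+y. ennreal C * conv b2 b1 (g - y) * aU u y \<partial>lborel)"
proof -
  obtain C where "0 < C" and C: "\<And>k u x. slow 1 1 k \<Longrightarrow> (\<And>z. k (- z) = k z) \<Longrightarrow> u \<in> Minf w \<Longrightarrow>
    (\<integral>\<^sup>+z. (k (z - x) * ennreal (cmod (dstft phi u z)))^2 \<partial>lborel)
      \<le> (\<integral>\<^sup>+y. ennreal C * conv k b1 (x - y) * ennreal (cmod (dstft phi u y)) \<partial>lborel)^2"
    using local_L2_le[of 1 1] by blast
  show ?thesis
  proof (intro exI[of _ C] conjI allI impI \<open>0 < C\<close>)
    fix \<epsilon> :: real and u g assume \<epsilon>: "0 < \<epsilon>" and u: "u \<in> Minf w" and g: "g \<in> \<Gamma>"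
    show "aH \<epsilon> u g \<le> (\<integral>\<^sup>+y. ennreal C * conv b2 b1 (g - y) * aU u y \<partial>lborel)"
      by (rule ennreal_power2_le_cancel)
        (rule order_trans[OF aH_sq_le[OF g u \<epsilon>] C[OF slow_b2 b2_even u, folded aU_def]])
  qed
qed

text \<open>Kernel for the part of the operator that is lost by thresholding; the two summands come from
  splitting the symbol at height sqrt epsilon.\<close>

definition Kres :: "real \<Rightarrow> real \<Rightarrow> 'd tf \<Rightarrow> ennreal" where
  "Kres C \<epsilon> z = ennreal (sqrt (2 * sqrt \<epsilon>)) * (ennreal C * conv b2 b1 z)
     + 2 * (ennreal C * conv (\<lambda>z. min (b2 z) (ennreal (sqrt \<epsilon>))) b1 z)"

lemma slow_Kres: "slow 1 1 (Kres C \<epsilon>)"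
  unfolding Kres_def[abs_def] by (intro slow_add slow_cmult slow_conv slow_b1) measurable

lemma Kres_even: "Kres C \<epsilon> (- z) = Kres C \<epsilon> z"
  unfolding Kres_def by (simp add: conv_even b2_even b1_even)

text \<open>Square roots are taken through x^2 + y^2 \<le> (x + y)^2, which leaves the thresholded
  norm with coefficient 1 and makes the error linear in |V u|.\<close>

lemma nH_le: "\<exists>C>0. \<forall>\<epsilon> u g. 0 < \<epsilon> \<longrightarrow> u \<in> Minf w \<longrightarrow> g \<in> \<Gamma> \<longrightarrow>
  nH u g \<le> aH \<epsilon> u g + (\<integral>\<^sup>+y. Kres C \<epsilon> (g - y) * aU u y \<partial>lborel)"
proof -
  obtain C where "0 < C" and C: "\<And>k u x. slow 1 1 k \<Longrightarrow> (\<And>z. k (- z) = k z) \<Longrightarrow> u \<in> Minf w \<Longrightarrow>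
    (\<integral>\<^sup>+z. (k (z - x) * aU u z)^2 \<partial>lborel) \<le> (\<integral>\<^sup>+y. ennreal C * conv k b1 (x - y) * aU u y \<partial>lborel)^2"
    using local_L2_le[of 1 1] unfolding aU_def by blast
  show ?thesis
  proof (intro exI[of _ C] conjI allI impI \<open>0 < C\<close>)
    fix \<epsilon> :: real and u g assume \<epsilon>: "0 < \<epsilon>" and u: "u \<in> Minf w" and g: "g \<in> \<Gamma>"
    have [measurable]: "aU u \<in> borel_measurable borel" using u by (rule aU_measurable)
    define m where "m z = min (b2 z) (ennreal (sqrt \<epsilon>))" for z
    have m: "slow 1 1 m" unfolding m_def[abs_def] by (rule slow_min[OF slow_b2])
    have [measurable]: "m \<in> borel_measurable borel" using m by (rule slowD)
    have me: "m (- z) = m z" for z by (simp add: m_def b2_even)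
    let ?s = "ennreal (sqrt (2 * sqrt \<epsilon>))"
    let ?E = "\<integral>\<^sup>+y. ennreal C * conv b2 b1 (g - y) * aU u y \<partial>lborel"
    let ?M = "\<integral>\<^sup>+y. ennreal C * conv m b1 (g - y) * aU u y \<partial>lborel"
    have s2: "ennreal (2 * sqrt \<epsilon>) = ?s^2" using \<epsilon> by (simp add: ennreal_power)
    have "(nH u g)^2 \<le> (aH \<epsilon> u g)^2 + (?s^2 * (\<integral>\<^sup>+z. (b2 (z - g) * aU u z)^2 \<partial>lborel) + 2 * (\<integral>\<^sup>+z. (m (z - g) * aU u z)^2 \<partial>lborel))"
      using nH_sq_le[OF g u \<epsilon>] unfolding s2 m_def .
    \<comment> \<open>The factor 2 is enlarged to 2^2 so that every summand is a square.\<close>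
    also have "\<dots> \<le> (aH \<epsilon> u g)^2 + (?s^2 * ?E^2 + 2^2 * ?M^2)"
      by (intro add_mono mult_mono C slow_b2 b2_even m me u) (auto simp: power2_eq_square)
    also have "\<dots> \<le> (aH \<epsilon> u g + (?s * ?E + 2 * ?M))^2"
      unfolding power_mult_distrib[symmetric]
      by (rule order_trans[OF add_left_mono[OF ennreal_power2_superadd] ennreal_power2_superadd])
    finally have "nH u g \<le> aH \<epsilon> u g + (?s * ?E + 2 * ?M)" by (rule ennreal_power2_le_cancel)
    also have "?s * ?E = (\<integral>\<^sup>+y. ?s * (ennreal C * conv b2 b1 (g - y) * aU u y) \<partial>lborel)"
      by (rule nn_integral_cmult[symmetric]) measurable
    also have "2 * ?M = (\<integral>\<^sup>+y. 2 * (ennreal C * conv m b1 (g - y) * aU u y) \<partial>lborel)"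
      by (rule nn_integral_cmult[symmetric]) measurable
    also have "(\<integral>\<^sup>+y. ?s * (ennreal C * conv b2 b1 (g - y) * aU u y) \<partial>lborel) + (\<integral>\<^sup>+y. 2 * (ennreal C * conv m b1 (g - y) * aU u y) \<partial>lborel)
       = (\<integral>\<^sup>+y. ?s * (ennreal C * conv b2 b1 (g - y) * aU u y) + 2 * (ennreal C * conv m b1 (g - y) * aU u y) \<partial>lborel)"
      by (rule nn_integral_add[symmetric]) measurable
    also have "\<dots> = (\<integral>\<^sup>+y. Kres C \<epsilon> (g - y) * aU u y \<partial>lborel)"
      unfolding Kres_def m_def[abs_def] by (simp only: distrib_right mult.assoc)
    finally show "nH u g \<le> aH \<epsilon> u g + (\<integral>\<^sup>+y. Kres C \<epsilon> (g - y) * aU u y \<partial>lborel)" .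
  qed
qed

text \<open>The first part of the kernel is small through its factor, the second through truncation
  of the envelope.\<close>

lemma Kres_small:
  assumes C: "0 < C" and \<delta>: "0 < \<delta>"
  shows "\<exists>\<epsilon>0>0. \<forall>\<epsilon>. 0 < \<epsilon> \<and> \<epsilon> \<le> \<epsilon>0 \<longrightarrow> wint (Kres C \<epsilon>) \<le> ennreal \<delta>"
proof -
  obtain x2 where x2: "0 \<le> x2" "wint b2 = ennreal x2" using wint_b2 by (cases "wint b2") auto
  obtain x1 where x1: "0 \<le> x1" "wint b1 = ennreal x1" using wint_b1 by (cases "wint b1") auto
  \<comment> \<open>d and s give each part of the kernel at most \<delta> / 2; the added 1 keeps the
    denominators positive.\<close>
  define d where "d = \<delta> / (4 * (C * (x1 + 1)))"
  define s where "s = \<delta> / (2 * (C * (x2 * x1 + 1)))"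
  have x21: "0 \<le> x2 * x1" using x1 x2 by simp
  then have pos: "0 < d" "0 < s" using C \<delta> x1 unfolding d_def s_def by (auto intro!: divide_pos_pos mult_pos_pos)
  obtain \<tau> where \<tau>: "0 < \<tau>" "wint (\<lambda>x. min (b2 x) (ennreal \<tau>)) \<le> ennreal d"
    using wint_min_small[OF b2_measurable wint_b2 pos(1)] by blast
  show ?thesis
  \<comment> \<open>The first bound gives sqrt \<epsilon> \<le> \<tau>, the second sqrt (2 * sqrt
    \<epsilon>) \<le> s.\<close>
  proof (intro exI[of _ "min (\<tau>^2) ((s^2/2)^2)"] conjI allI impI)
    show "0 < min (\<tau>^2) ((s^2/2)^2)" using \<tau> pos by simp
    fix \<epsilon> assume \<epsilon>: "0 < \<epsilon> \<and> \<epsilon> \<le> min (\<tau>^2) ((s^2/2)^2)"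
    have r: "sqrt \<epsilon> \<le> \<tau>" using \<epsilon> \<tau> by (auto intro: real_le_lsqrt)
    have "sqrt \<epsilon> \<le> s^2/2" by (rule real_le_lsqrt) (use \<epsilon> in auto)
    then have t: "sqrt (2 * sqrt \<epsilon>) \<le> s" using pos by (auto intro: real_le_lsqrt)
    let ?m = "\<lambda>z. min (b2 z) (ennreal (sqrt \<epsilon>))"
    have "wint (Kres C \<epsilon>) = wint (\<lambda>z. ennreal (sqrt (2 * sqrt \<epsilon>)) * (ennreal C * conv b2 b1 z)) + wint (\<lambda>z. 2 * (ennreal C * conv ?m b1 z))"
      unfolding Kres_def[abs_def] by (rule wint_add) measurable
    also have "wint (\<lambda>z. ennreal (sqrt (2 * sqrt \<epsilon>)) * (ennreal C * conv b2 b1 z)) = ennreal (sqrt (2 * sqrt \<epsilon>)) * (ennreal C * wint (conv b2 b1))"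
      by (subst wint_cmult, measurable, subst wint_cmult) measurable
    also have "wint (\<lambda>z. 2 * (ennreal C * conv ?m b1 z)) = 2 * (ennreal C * wint (conv ?m b1))"
      by (subst wint_cmult, measurable, subst wint_cmult) measurable
    also have "ennreal (sqrt (2 * sqrt \<epsilon>)) * (ennreal C * wint (conv b2 b1)) \<le> ennreal s * (ennreal C * (wint b2 * wint b1))"
      by (intro mult_mono ennreal_leI t wint_conv) auto
    also have "2 * (ennreal C * wint (conv ?m b1)) \<le> 2 * (ennreal C * (ennreal d * wint b1))"
    proof (intro mult_left_mono)
      have "wint ?m \<le> wint (\<lambda>x. min (b2 x) (ennreal \<tau>))"
        by (intro wint_mono min.mono ennreal_leI r order_refl)
      also note \<tau>(2)
      finally have "wint ?m \<le> ennreal d" .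
      then show "wint (conv ?m b1) \<le> ennreal d * wint b1"
        by (intro order_trans[OF wint_conv] mult_right_mono) auto
    qed auto
    also have "ennreal s * (ennreal C * (wint b2 * wint b1)) + 2 * (ennreal C * (ennreal d * wint b1)) = ennreal (s * (C * (x2 * x1)) + 2 * (C * (d * x1)))"
      using pos C x1 x2 by (subst ennreal_plus) (simp_all add: ennreal_mult)
    also have "\<dots> \<le> ennreal \<delta>"
    proof (rule ennreal_leI)
      have "s * (C * (x2 * x1)) \<le> s * (C * (x2 * x1 + 1))" using pos C by (intro mult_left_mono) auto
      also have "\<dots> = \<delta> / 2" unfolding s_def using C x21 by (simp add: field_simps add_nonneg_eq_0_iff)
      finally have 1: "s * (C * (x2 * x1)) \<le> \<delta> / 2" .
      have "2 * (C * (d * x1)) \<le> 2 * (C * (d * (x1 + 1)))" using pos C by (intro mult_left_mono) auto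
      also have "\<dots> = \<delta> / 2" unfolding d_def using C x1 by (simp add: field_simps add_nonneg_eq_0_iff)
      finally show "s * (C * (x2 * x1)) + 2 * (C * (d * x1)) \<le> \<delta>" using 1 by simp
    qed
    finally show "wint (Kres C \<epsilon>) \<le> ennreal \<delta>" by (simp add: add_mono)
  qed
qed

text \<open>The constant serves all L \<ge> 1 at once, because those cut-offs share the slow
  variation constants 1 and 1.\<close>

lemma F_le: "\<exists>C>0. \<forall>L u x. 1 \<le> L \<longrightarrow> u \<in> Minf w \<longrightarrow>
  F L u x \<le> (\<integral>\<^sup>+y. ennreal C * conv (edecay (1/L)) b1 (x - y) * aU u y \<partial>lborel)"
proof -
  obtain C where "0 < C" and C: "\<And>k u x. slow 1 1 k \<Longrightarrow> (\<And>z. k (- z) = k z) \<Longrightarrow> u \<in> Minf w \<Longrightarrow>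
    (\<integral>\<^sup>+z. (k (z - x) * ennreal (cmod (dstft phi u z)))^2 \<partial>lborel)
      \<le> (\<integral>\<^sup>+y. ennreal C * conv k b1 (x - y) * ennreal (cmod (dstft phi u y)) \<partial>lborel)^2"
    using local_L2_le[of 1 1] by blast
  show ?thesis
  proof (intro exI[of _ C] conjI allI impI \<open>0 < C\<close>)
    fix L u and x :: "'d tf" assume L: "(1::real) \<le> L" and u: "u \<in> Minf w"
    have "slow 1 1 (edecay (1/L) :: 'd tf \<Rightarrow> ennreal)"
      by (rule slow_mono[OF slow_edecay]) (use L in auto)
    from C[OF this edecay_minus u, of x] show "F L u x \<le> (\<integral>\<^sup>+y. ennreal C * conv (edecay (1/L)) b1 (x - y) * aU u y \<partial>lborel)"
      unfolding F_def Fsq_def aU_def by (rule epow_half_le)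
  qed
qed

text \<open>Finiteness allows one factor F L u x to be cancelled later. It follows from the growth
  of V u, at most like w, against a kernel integrable with w.\<close>

lemma F_finite:
  assumes L: "1 \<le> L" and u: "u \<in> Minf w"
  shows "F L u x < \<infinity>"
proof -
  obtain C where C: "F L u x \<le> (\<integral>\<^sup>+y. ennreal C * conv (edecay (1/L)) b1 (x - y) * aU u y \<partial>lborel)"
    using F_le L u by blast
  obtain K where K: "ubound u K" using Minf_ubound[OF u] by blast
  let ?k = "conv (edecay (1/L)) b1"
  note C
  also have "(\<integral>\<^sup>+y. ennreal C * ?k (x - y) * aU u y \<partial>lborel)
    \<le> (\<integral>\<^sup>+y. ennreal C * ennreal K * N1 phi * ennreal (w x) * (?k (x - y) * ennreal (w (x - y))) \<partial>lborel)"
  proof (intro nn_integral_mono)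
    fix y
    have wy: "ennreal (w y) \<le> ennreal (w x) * ennreal (w (x - y))"
      using ennreal_w_submult[of x "y - x"] even[of "x - y"] by simp
    have "aU u y \<le> ennreal K * (ennreal (w y) * N1 phi)" unfolding aU_def by (rule dstft_bound[OF u K])
    also have "\<dots> \<le> ennreal K * ((ennreal (w x) * ennreal (w (x - y))) * N1 phi)"
      by (intro mult_left_mono mult_right_mono wy) auto
    finally have "aU u y \<le> ennreal K * ((ennreal (w x) * ennreal (w (x - y))) * N1 phi)" .
    from mult_left_mono[OF this zero_le, of "ennreal C * ?k (x - y)"]
    show "ennreal C * ?k (x - y) * aU u y \<le> ennreal C * ennreal K * N1 phi * ennreal (w x) * (?k (x - y) * ennreal (w (x - y)))"
      by (simp only: mult_ac)
  qed
  also have "\<dots> = ennreal C * ennreal K * N1 phi * ennreal (w x) * (\<integral>\<^sup>+y. ?k (x - y) * ennreal (w (x - y)) \<partial>lborel)"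
    by (rule nn_integral_cmult) measurable
  also have "(\<integral>\<^sup>+y. ?k (x - y) * ennreal (w (x - y)) \<partial>lborel) = wint ?k"
    by (rule lborel_row(1)) measurable
  also have "wint ?k \<le> wint (edecay (1/L)) * wint b1" by (rule wint_conv) measurable
  also have "ennreal C * ennreal K * N1 phi * ennreal (w x) * \<dots> < \<infinity>"
    using wint_edecay_finite[of "1/L"] wint_b1 phi_N1 L by (simp add: ennreal_mult_less_top)
  finally show ?thesis by (simp add: mult_left_mono)
qed

text \<open>One cut-off goes to each factor before Cauchy-Schwarz, so the first factor contributes
  exactly F L u x and the second is the local norm of a convolution.\<close>

lemma local_pairing_le:
  assumes u: "u \<in> Minf w" and k [measurable]: "k \<in> borel_measurable borel"
  shows "(\<integral>\<^sup>+y. (edecay (1/L) (y - x))^2 * (aU u y * (\<integral>\<^sup>+z. k (y - z) * aU u z \<partial>lborel)) \<partial>lborel)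
    \<le> F L u x * (\<integral>\<^sup>+y. k (x - y) * F L u y \<partial>lborel)"
proof -
  have [measurable]: "aU u \<in> borel_measurable borel" using u by (rule aU_measurable)
  have "(\<integral>\<^sup>+y. (edecay (1/L) (y - x))^2 * (aU u y * (\<integral>\<^sup>+z. k (y - z) * aU u z \<partial>lborel)) \<partial>lborel)
    = (\<integral>\<^sup>+y. (edecay (1/L) (y - x) * aU u y) * (edecay (1/L) (y - x) * (\<integral>\<^sup>+z. k (y - z) * aU u z \<partial>lborel)) \<partial>lborel)"
    by (simp add: power2_eq_square mult_ac)
  also have "\<dots> \<le> F L u x * (\<integral>\<^sup>+y. k (x - y) * F L u y \<partial>lborel)"
  proof (rule cauchy_schwarz_le)
    show "(\<integral>\<^sup>+z. (edecay (1/L) (z - x) * aU u z)^2 \<partial>lborel) \<le> (F L u x)^2"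
      unfolding F_sq Fsq_def aU_def ..
    show "(\<integral>\<^sup>+y. (edecay (1/L) (y - x) * (\<integral>\<^sup>+z. k (y - z) * aU u z \<partial>lborel))^2 \<partial>lborel) \<le> (\<integral>\<^sup>+y. k (x - y) * F L u y \<partial>lborel)^2"
      using local_conv_le[OF u k, of L x] unfolding aU_def .
  qed measurable
  finally show ?thesis .
qed

text \<open>The sum over the symbols is taken first and is at most B. The commutator bound has
  constant 2 and two halves exchanged by y and z, which have equal integrals; this gives 4 *
  B.\<close>

lemma commutator_sum_le:
  fixes x :: "'d tf"
  assumes u: "u \<in> Minf w" and L: "1 \<le> L"
  defines "Q \<equiv> \<lambda>z. exp (- (norm (z - x) / L))^2"
  shows "(\<integral>\<^sup>+g. (\<integral>\<^sup>+y. \<integral>\<^sup>+z. ennreal (\<eta> g y) * (aU u y * (aU u z * (b1 (y - z) * ennreal \<bar>Q y - Q z\<bar>))) \<partial>lborel \<partial>lborel) \<partial>count_space \<Gamma>)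
    \<le> ennreal (4 * B) * (F L u x * (\<integral>\<^sup>+y. rho L (x - y) * b1 (x - y) * F L u y \<partial>lborel))"
proof -
  let ?a = "aU u" and ?e = "\<lambda>z. edecay (1/L) (z - x)"
  have [measurable]: "?a \<in> borel_measurable borel" using u by (rule aU_measurable)
  have [measurable]: "Q \<in> borel_measurable borel" unfolding Q_def by measurable
  define h where "h = (\<lambda>y z. ?a y * (?a z * (b1 (y - z) * ennreal \<bar>Q y - Q z\<bar>)))"
  define P where "P = (\<lambda>y z. (?e y)^2 * (?a y * (rho L (y - z) * b1 (y - z) * ?a z)))"
  have hm: "(\<lambda>(y, z). h y z) \<in> borel_measurable (borel \<Otimes>\<^sub>M borel)" unfolding h_def split_beta' by measurable
  have hm1 [measurable]: "h y \<in> borel_measurable borel" for y unfolding h_def by measurable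
  have hm2 [measurable]: "(\<lambda>y. \<integral>\<^sup>+z. h y z \<partial>lborel) \<in> borel_measurable borel" unfolding h_def by measurable
  have Pm1 [measurable]: "P y \<in> borel_measurable borel" for y unfolding P_def by measurable
  have Pm1' [measurable]: "(\<lambda>z. P z y) \<in> borel_measurable borel" for y unfolding P_def by measurable
  have Pm2 [measurable]: "(\<lambda>y. \<integral>\<^sup>+z. P y z \<partial>lborel) \<in> borel_measurable borel" unfolding P_def by measurable
  have Pm2' [measurable]: "(\<lambda>y. \<integral>\<^sup>+z. P z y \<partial>lborel) \<in> borel_measurable borel" unfolding P_def by measurable
  have "(\<integral>\<^sup>+g. (\<integral>\<^sup>+y. \<integral>\<^sup>+z. ennreal (\<eta> g y) * h y z \<partial>lborel \<partial>lborel) \<partial>count_space \<Gamma>)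
    = (\<integral>\<^sup>+g. (\<integral>\<^sup>+y. ennreal (\<eta> g y) * (\<integral>\<^sup>+z. h y z \<partial>lborel) \<partial>lborel) \<partial>count_space \<Gamma>)"
    by (simp add: nn_integral_cmult)
  also have "\<dots> = (\<integral>\<^sup>+y. (\<integral>\<^sup>+g. ennreal (\<eta> g y) * (\<integral>\<^sup>+z. h y z \<partial>lborel) \<partial>count_space \<Gamma>) \<partial>lborel)"
    by (rule swap_count) (use \<eta>_meas in measurable)
  also have "\<dots> = (\<integral>\<^sup>+y. (\<integral>\<^sup>+g. ennreal (\<eta> g y) \<partial>count_space \<Gamma>) * (\<integral>\<^sup>+z. h y z \<partial>lborel) \<partial>lborel)"
    by (simp add: nn_integral_multc)
  also have "\<dots> \<le> (\<integral>\<^sup>+y. ennreal B * (\<integral>\<^sup>+z. h y z \<partial>lborel) \<partial>lborel)"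
    by (intro nn_integral_mono mult_right_mono sumB) auto
  also have "\<dots> = ennreal B * (\<integral>\<^sup>+y. \<integral>\<^sup>+z. h y z \<partial>lborel \<partial>lborel)" by (rule nn_integral_cmult) measurable
  also have "(\<integral>\<^sup>+y. \<integral>\<^sup>+z. h y z \<partial>lborel \<partial>lborel) \<le> (\<integral>\<^sup>+y. \<integral>\<^sup>+z. 2 * P y z + 2 * P z y \<partial>lborel \<partial>lborel)"
  proof (intro nn_integral_mono)
    fix y z
    have s: "rho L (z - y) = rho L (y - z)" "b1 (z - y) = b1 (y - z)"
      using rho_minus[of L "y - z"] b1_even[of "y - z"] by simp_all
    have "ennreal \<bar>Q y - Q z\<bar> \<le> 2 * rho L (y - z) * ((?e y)^2 + (?e z)^2)"
      unfolding Q_def by (rule edecay_commutator[OF L])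
    from mult_left_mono[OF this zero_le, of "?a y * ?a z * b1 (y - z)"]
    show "h y z \<le> 2 * P y z + 2 * P z y"
      unfolding h_def P_def s by (simp only: distrib_left mult_ac)
  qed
  also have "\<dots> = (\<integral>\<^sup>+y. 2 * (\<integral>\<^sup>+z. P y z \<partial>lborel) + 2 * (\<integral>\<^sup>+z. P z y \<partial>lborel) \<partial>lborel)"
    by (simp add: nn_integral_add nn_integral_cmult)
  also have "\<dots> = 2 * (\<integral>\<^sup>+y. \<integral>\<^sup>+z. P y z \<partial>lborel \<partial>lborel) + 2 * (\<integral>\<^sup>+y. \<integral>\<^sup>+z. P z y \<partial>lborel \<partial>lborel)"
    by (simp add: nn_integral_add nn_integral_cmult)
  also have "(\<integral>\<^sup>+y. \<integral>\<^sup>+z. P z y \<partial>lborel \<partial>lborel) = (\<integral>\<^sup>+y. \<integral>\<^sup>+z. P y z \<partial>lborel \<partial>lborel)"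
    unfolding P_def by (rule lborel_pair.Fubini') measurable
  also have "2 * I + 2 * I = 4 * I" for I :: ennreal by (simp add: distrib_right[symmetric])
  also have "(\<integral>\<^sup>+y. \<integral>\<^sup>+z. P y z \<partial>lborel \<partial>lborel)
      = (\<integral>\<^sup>+y. (?e y)^2 * (?a y * (\<integral>\<^sup>+z. rho L (y - z) * b1 (y - z) * ?a z \<partial>lborel)) \<partial>lborel)"
    unfolding P_def by (simp add: nn_integral_cmult)
  also have "\<dots> \<le> F L u x * (\<integral>\<^sup>+y. rho L (x - y) * b1 (x - y) * F L u y \<partial>lborel)"
    by (rule local_pairing_le[OF u, where k = "\<lambda>z. rho L z * b1 z"]) measurable
  also have "ennreal B * (4 * I) = ennreal (4 * B) * I" for I
    using AB by (simp add: ennreal_mult mult_ac)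
  finally show ?thesis unfolding h_def by (simp add: mult_left_mono)
qed

text \<open>The output of the symbol at g is measured away from g. Since rho (z - g) \<le> rho (z -
  y) + rho (y - g), either the kernel has moved far, where the symbols sum to at most B, or the
  symbol is evaluated far from its centre, where the tails of \<open>b2\<close> are summed by
  sampling, uniformly in y.\<close>

lemma far_sum_le: "\<exists>C>0. \<forall>L u x. 1 \<le> L \<longrightarrow> u \<in> Minf w \<longrightarrow>
  (\<integral>\<^sup>+g. (\<integral>\<^sup>+z. (edecay (1/L) (z - x))^2 * (rho L (z - g) * ennreal (cmod (DD u g z)) * aU u z) \<partial>lborel) \<partial>count_space \<Gamma>)
    \<le> F L u x * (\<integral>\<^sup>+y. (ennreal B * (rho L (x - y) * b1 (x - y)) + ennreal C * (\<integral>\<^sup>+z. rho L z * b2 z \<partial>lborel) * b1 (x - y)) * F L u y \<partial>lborel)"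
proof -
  obtain C where "0 < C" and C: "\<And>b::'d tf \<Rightarrow> ennreal. slow (1 * 1) (1 + 1) b \<Longrightarrow>
      (\<integral>\<^sup>+g. b g \<partial>count_space \<Gamma>) \<le> ennreal C * (\<integral>\<^sup>+x. b x \<partial>lborel)"
    using slow_sum_le_integral[OF \<Gamma>_fin \<Gamma>_card, of "1 * 1" "1 + 1"] by blast
  show ?thesis
  proof (intro exI[of _ C] conjI allI impI \<open>0 < C\<close>)
    fix L u and x :: "'d tf" assume L: "(1::real) \<le> L" and u: "u \<in> Minf w"
    let ?a = "aU u" and ?e = "\<lambda>z. edecay (1/L) (z - x)"
    let ?\<tau> = "ennreal C * (\<integral>\<^sup>+z. rho L z * b2 z \<partial>lborel)"
    let ?k = "\<lambda>z. ennreal B * (rho L z * b1 z) + ?\<tau> * b1 z"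
    have [measurable]: "?a \<in> borel_measurable borel" using u by (rule aU_measurable)
    have DDm: "g \<in> \<Gamma> \<Longrightarrow> DD u g \<in> borel_measurable borel" for g using u by (intro DD_measurable)
    have tau: "(\<integral>\<^sup>+g. rho L (y - g) * b2 (y - g) \<partial>count_space \<Gamma>) \<le> ?\<tau>" for y
    proof -
      have "slow (1 * 1) (1 + 1) (\<lambda>z::'d tf. rho L z * b2 z)"
        using L by (intro slow_mult slow_rho slow_b2) simp
      from C[OF slow_shift[OF this, of y]]
      have "(\<integral>\<^sup>+g. rho L (g - y) * b2 (g - y) \<partial>count_space \<Gamma>) \<le> ennreal C * (\<integral>\<^sup>+z. rho L (z - y) * b2 (z - y) \<partial>lborel)" .
      also have "(\<integral>\<^sup>+z. rho L (z - y) * b2 (z - y) \<partial>lborel) = (\<integral>\<^sup>+z. rho L z * b2 z \<partial>lborel)"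
        by (rule nn_integral_lborel_shift(1)[where f = "\<lambda>z. rho L z * b2 z"]) measurable
      also have "(\<lambda>g. rho L (g - y) * b2 (g - y)) = (\<lambda>g. rho L (y - g) * b2 (y - g))"
      proof
        fix g show "rho L (g - y) * b2 (g - y) = rho L (y - g) * b2 (y - g)"
          using rho_minus[of L "y - g"] b2_even[of "y - g"] by simp
      qed
      finally show ?thesis .
    qed
    have ae: "AE y in lborel. \<forall>g\<in>\<Gamma>. ennreal (\<eta> g y) \<le> b2 (y - g)"
      using \<Gamma>_countable \<eta>_le by (simp add: AE_ball_countable)
    have inner: "(\<integral>\<^sup>+g. rho L (z - g) * ennreal (cmod (DD u g z)) \<partial>count_space \<Gamma>) \<le> (\<integral>\<^sup>+y. ?k (z - y) * ?a y \<partial>lborel)" for z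
    proof -
      have "(\<integral>\<^sup>+g. rho L (z - g) * ennreal (cmod (DD u g z)) \<partial>count_space \<Gamma>)
        \<le> (\<integral>\<^sup>+g. (\<integral>\<^sup>+y. rho L (z - g) * (b1 (z - y) * (ennreal (\<eta> g y) * ?a y)) \<partial>lborel) \<partial>count_space \<Gamma>)"
      proof (intro nn_integral_mono)
        fix g assume "g \<in> space (count_space \<Gamma>)"
        then have g: "g \<in> \<Gamma>" by simp
        have [measurable]: "\<eta> g \<in> borel_measurable borel" using g by (rule \<eta>_meas)
        have "rho L (z - g) * ennreal (cmod (DD u g z)) \<le> rho L (z - g) * (\<integral>\<^sup>+y. b1 (z - y) * (ennreal (\<eta> g y) * ?a y) \<partial>lborel)"
          by (intro mult_left_mono DD_le g u) auto
        also have "\<dots> = (\<integral>\<^sup>+y. rho L (z - g) * (b1 (z - y) * (ennreal (\<eta> g y) * ?a y)) \<partial>lborel)"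
          by (rule nn_integral_cmult[symmetric]) measurable
        finally show "rho L (z - g) * ennreal (cmod (DD u g z)) \<le> \<dots>" .
      qed
      also have "\<dots> = (\<integral>\<^sup>+y. (\<integral>\<^sup>+g. rho L (z - g) * (b1 (z - y) * (ennreal (\<eta> g y) * ?a y)) \<partial>count_space \<Gamma>) \<partial>lborel)"
      proof (rule swap_count)
        fix g assume "g \<in> \<Gamma>"
        then have [measurable]: "\<eta> g \<in> borel_measurable borel" by (rule \<eta>_meas)
        show "(\<lambda>y. rho L (z - g) * (b1 (z - y) * (ennreal (\<eta> g y) * ?a y))) \<in> borel_measurable borel" by measurable
      qed
      also have "\<dots> \<le> (\<integral>\<^sup>+y. ?k (z - y) * ?a y \<partial>lborel)"
      proof (rule nn_integral_mono_AE)
        show "AE y in lborel. (\<integral>\<^sup>+g. rho L (z - g) * (b1 (z - y) * (ennreal (\<eta> g y) * ?a y)) \<partial>count_space \<Gamma>) \<le> ?k (z - y) * ?a y"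
          using ae
        proof eventually_elim
          case (elim y)
          have "(\<integral>\<^sup>+g. rho L (z - g) * ennreal (\<eta> g y) \<partial>count_space \<Gamma>)
            \<le> (\<integral>\<^sup>+g. rho L (z - y) * ennreal (\<eta> g y) + rho L (y - g) * b2 (y - g) \<partial>count_space \<Gamma>)"
          proof (intro nn_integral_mono)
            fix g assume "g \<in> space (count_space \<Gamma>)"
            then have "ennreal (\<eta> g y) \<le> b2 (y - g)" using elim by simp
            moreover have "rho L (z - g) \<le> rho L (z - y) + rho L (y - g)"
              using rho_triangle[OF L, of "z - y" "y - g"] by simp
            ultimately have "rho L (z - g) * ennreal (\<eta> g y) \<le> (rho L (z - y) + rho L (y - g)) * ennreal (\<eta> g y)"
                and "rho L (y - g) * ennreal (\<eta> g y) \<le> rho L (y - g) * b2 (y - g)"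
              by (auto intro: mult_right_mono mult_left_mono)
            then show "rho L (z - g) * ennreal (\<eta> g y) \<le> rho L (z - y) * ennreal (\<eta> g y) + rho L (y - g) * b2 (y - g)"
              unfolding distrib_right by (meson add_left_mono order_trans)
          qed
          also have "\<dots> = rho L (z - y) * (\<integral>\<^sup>+g. ennreal (\<eta> g y) \<partial>count_space \<Gamma>) + (\<integral>\<^sup>+g. rho L (y - g) * b2 (y - g) \<partial>count_space \<Gamma>)"
            by (simp add: nn_integral_add nn_integral_cmult)
          also have "\<dots> \<le> rho L (z - y) * ennreal B + ?\<tau>"
            by (intro add_mono mult_left_mono sumB tau) auto
          finally have *: "(\<integral>\<^sup>+g. rho L (z - g) * ennreal (\<eta> g y) \<partial>count_space \<Gamma>) \<le> rho L (z - y) * ennreal B + ?\<tau>" .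
          have "(\<integral>\<^sup>+g. rho L (z - g) * (b1 (z - y) * (ennreal (\<eta> g y) * ?a y)) \<partial>count_space \<Gamma>)
            = (\<integral>\<^sup>+g. b1 (z - y) * ?a y * (rho L (z - g) * ennreal (\<eta> g y)) \<partial>count_space \<Gamma>)"
            by (simp only: mult_ac)
          also have "\<dots> = b1 (z - y) * ?a y * (\<integral>\<^sup>+g. rho L (z - g) * ennreal (\<eta> g y) \<partial>count_space \<Gamma>)"
            by (rule nn_integral_cmult) simp
          also have "\<dots> \<le> b1 (z - y) * ?a y * (rho L (z - y) * ennreal B + ?\<tau>)"
            by (intro mult_left_mono *) auto
          also have "\<dots> = ?k (z - y) * ?a y" by (simp only: distrib_left distrib_right mult_ac)
          finally show ?case .
        qed
      qed
      finally show ?thesis .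
    qed
    have "(\<integral>\<^sup>+g. (\<integral>\<^sup>+z. (?e z)^2 * (rho L (z - g) * ennreal (cmod (DD u g z)) * ?a z) \<partial>lborel) \<partial>count_space \<Gamma>)
      = (\<integral>\<^sup>+z. (\<integral>\<^sup>+g. (?e z)^2 * (rho L (z - g) * ennreal (cmod (DD u g z)) * ?a z) \<partial>count_space \<Gamma>) \<partial>lborel)"
    proof (rule swap_count)
      fix g assume "g \<in> \<Gamma>"
      then have [measurable]: "DD u g \<in> borel_measurable borel" by (rule DDm)
      show "(\<lambda>z. (?e z)^2 * (rho L (z - g) * ennreal (cmod (DD u g z)) * ?a z)) \<in> borel_measurable borel" by measurable
    qed
    also have "\<dots> = (\<integral>\<^sup>+z. (?e z)^2 * (?a z * (\<integral>\<^sup>+g. rho L (z - g) * ennreal (cmod (DD u g z)) \<partial>count_space \<Gamma>)) \<partial>lborel)"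
      by (simp add: nn_integral_cmult nn_integral_multc mult.commute)
    also have "\<dots> \<le> (\<integral>\<^sup>+z. (?e z)^2 * (?a z * (\<integral>\<^sup>+y. ?k (z - y) * ?a y \<partial>lborel)) \<partial>lborel)"
      by (intro nn_integral_mono mult_left_mono inner) auto
    also have "\<dots> \<le> F L u x * (\<integral>\<^sup>+y. ?k (x - y) * F L u y \<partial>lborel)"
      by (rule local_pairing_le[OF u]) measurable
    finally show "(\<integral>\<^sup>+g. (\<integral>\<^sup>+z. (?e z)^2 * (rho L (z - g) * ennreal (cmod (DD u g z)) * ?a z) \<partial>lborel) \<partial>count_space \<Gamma>)
      \<le> F L u x * (\<integral>\<^sup>+y. ?k (x - y) * F L u y \<partial>lborel)" .
  qed
qed

text \<open>One of the two cut-offs at x is traded: near g it combines with the decay around g into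
  decay in x - g, and the remaining cut-off produces F L u x by Cauchy-Schwarz. The far part keeps
  the factor rho.\<close>

lemma near_far_split:
  assumes g: "g \<in> \<Gamma>" and u: "u \<in> Minf w" and L: "1 \<le> L"
  shows "(\<integral>\<^sup>+z. (edecay (1/L) (z - x))^2 * (ennreal (cmod (DD u g z)) * aU u z) \<partial>lborel)
    \<le> F L u x * (edecay (1/L) (x - g) * nH u g)
      + (\<integral>\<^sup>+z. (edecay (1/L) (z - x))^2 * (rho L (z - g) * ennreal (cmod (DD u g z)) * aU u z) \<partial>lborel)"
proof -
  let ?a = "aU u" and ?e = "\<lambda>z. edecay (1/L) (z - x)" and ?D = "\<lambda>z. ennreal (cmod (DD u g z))"
  have [measurable]: "?a \<in> borel_measurable borel" using u by (rule aU_measurable)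
  have [measurable]: "DD u g \<in> borel_measurable borel" using g u by (rule DD_measurable)
  have "(\<integral>\<^sup>+z. (?e z)^2 * (?D z * ?a z) \<partial>lborel)
    \<le> (\<integral>\<^sup>+z. edecay (1/L) (x - g) * ((?e z * ?a z) * ?D z) + (?e z)^2 * (rho L (z - g) * ?D z * ?a z) \<partial>lborel)"
  proof (intro nn_integral_mono)
    fix z
    have "?e z * 1 \<le> ?e z * (edecay (1/L) (z - g) + rho L (z - g))"
      by (intro mult_left_mono one_le_edecay_rho L) auto
    also have "\<dots> \<le> edecay (1/L) (x - g) + ?e z * rho L (z - g)"
      unfolding distrib_left using L by (intro add_right_mono edecay_triangle) auto
    finally have "?e z \<le> edecay (1/L) (x - g) + ?e z * rho L (z - g)" by simp
    from mult_left_mono[OF this zero_le, of "?e z * (?D z * ?a z)"]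
    show "(?e z)^2 * (?D z * ?a z) \<le> edecay (1/L) (x - g) * ((?e z * ?a z) * ?D z) + (?e z)^2 * (rho L (z - g) * ?D z * ?a z)"
      by (simp only: power2_eq_square distrib_left mult_ac)
  qed
  also have "\<dots> = edecay (1/L) (x - g) * (\<integral>\<^sup>+z. (?e z * ?a z) * ?D z \<partial>lborel)
      + (\<integral>\<^sup>+z. (?e z)^2 * (rho L (z - g) * ?D z * ?a z) \<partial>lborel)"
    by (simp add: nn_integral_add nn_integral_cmult)
  also have "(\<integral>\<^sup>+z. (?e z * ?a z) * ?D z \<partial>lborel) \<le> F L u x * nH u g"
  proof (rule cauchy_schwarz_le)
    show "(\<integral>\<^sup>+z. (?e z * ?a z)^2 \<partial>lborel) \<le> (F L u x)^2" unfolding F_sq Fsq_def aU_def ..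
    show "(\<integral>\<^sup>+z. (?D z)^2 \<partial>lborel) \<le> (nH u g)^2"
      unfolding nH_def epow_half_sq sqint_def by (simp add: ennreal_power)
  qed measurable
  finally show ?thesis by (simp add: mult_left_mono add_right_mono mult.left_commute)
qed

text \<open>The coefficient 5 * B collects B from the far part and 4 * B from the commutator; the
  second summand comes from the tails of the symbols.\<close>

definition Kcom :: "real \<Rightarrow> real \<Rightarrow> 'd tf \<Rightarrow> ennreal" where
  "Kcom C L z = ennreal (5 * B) * (rho L z * b1 z) + ennreal C * (\<integral>\<^sup>+z. rho L z * b2 z \<partial>lborel) * b1 z"

lemma Kcom_measurable [measurable]: "Kcom C L \<in> borel_measurable borel"
  unfolding Kcom_def[abs_def] by measurable

text \<open>Inserting the lower bound A on the sum of the symbols into F^2 gives A * F^2 on the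
  left, and every term on the right carries a factor F L u x. This factor is finite and, unless the
  claim is trivial, non-zero, so it cancels.\<close>

lemma localized_lower_bound: "\<exists>C>0. \<forall>L u x. 1 \<le> L \<longrightarrow> u \<in> Minf w \<longrightarrow>
  ennreal A * F L u x \<le> (\<integral>\<^sup>+g. edecay (1/L) (x - g) * nH u g \<partial>count_space \<Gamma>) + (\<integral>\<^sup>+y. Kcom C L (x - y) * F L u y \<partial>lborel)"
proof -
  obtain C where "0 < C" and far: "\<And>L u x. 1 \<le> L \<Longrightarrow> u \<in> Minf w \<Longrightarrow>
    (\<integral>\<^sup>+g. (\<integral>\<^sup>+z. (edecay (1/L) (z - x))^2 * (rho L (z - g) * ennreal (cmod (DD u g z)) * aU u z) \<partial>lborel) \<partial>count_space \<Gamma>)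
      \<le> F L u x * (\<integral>\<^sup>+y. (ennreal B * (rho L (x - y) * b1 (x - y)) + ennreal C * (\<integral>\<^sup>+z. rho L z * b2 z \<partial>lborel) * b1 (x - y)) * F L u y \<partial>lborel)"
    using far_sum_le by blast
  show ?thesis
  proof (intro exI[of _ C] conjI allI impI \<open>0 < C\<close>)
    fix L u and x :: "'d tf" assume L: "(1::real) \<le> L" and u: "u \<in> Minf w"
    let ?a = "aU u" and ?e = "\<lambda>z. edecay (1/L) (z - x)"
    let ?Q = "\<lambda>z. exp (- (norm (z - x) / L))^2"
    let ?\<tau> = "ennreal C * (\<integral>\<^sup>+z. rho L z * b2 z \<partial>lborel)"
    let ?k = "\<lambda>z. ennreal B * (rho L z * b1 z) + ?\<tau> * b1 z"
    have [measurable]: "?a \<in> borel_measurable borel" using u by (rule aU_measurable)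
    have [measurable]: "F L u \<in> borel_measurable borel" using u by (rule F_measurable)
    let ?R = "\<lambda>g. \<integral>\<^sup>+y. \<integral>\<^sup>+z. ennreal (\<eta> g y) * (?a y * (?a z * (b1 (y - z) * ennreal \<bar>?Q y - ?Q z\<bar>))) \<partial>lborel \<partial>lborel"
    let ?Y = "\<lambda>g. \<integral>\<^sup>+z. (?e z)^2 * (rho L (z - g) * ennreal (cmod (DD u g z)) * ?a z) \<partial>lborel"
    let ?N = "\<integral>\<^sup>+g. edecay (1/L) (x - g) * nH u g \<partial>count_space \<Gamma>"
    let ?I = "\<integral>\<^sup>+y. ?k (x - y) * F L u y \<partial>lborel"
    let ?J = "\<integral>\<^sup>+y. rho L (x - y) * b1 (x - y) * F L u y \<partial>lborel"
    have "ennreal A * (F L u x)^2 = (\<integral>\<^sup>+z. ennreal A * (?e z * ?a z)^2 \<partial>lborel)"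
      unfolding F_sq Fsq_def aU_def[symmetric] by (rule nn_integral_cmult[symmetric]) measurable
    also have "\<dots> \<le> (\<integral>\<^sup>+z. (\<integral>\<^sup>+g. ennreal (\<eta> g z) \<partial>count_space \<Gamma>) * (?e z * ?a z)^2 \<partial>lborel)"
      by (intro nn_integral_mono mult_right_mono sumA) auto
    also have "\<dots> = (\<integral>\<^sup>+z. (\<integral>\<^sup>+g. ennreal (\<eta> g z) * (?e z * ?a z)^2 \<partial>count_space \<Gamma>) \<partial>lborel)"
      by (simp add: nn_integral_multc)
    also have "\<dots> = (\<integral>\<^sup>+g. (\<integral>\<^sup>+z. ennreal (\<eta> g z) * (?e z * ?a z)^2 \<partial>lborel) \<partial>count_space \<Gamma>)"
    proof (rule swap_count[symmetric])
      fix g assume "g \<in> \<Gamma>"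
      then have [measurable]: "\<eta> g \<in> borel_measurable borel" by (rule \<eta>_meas)
      show "(\<lambda>z. ennreal (\<eta> g z) * (?e z * ?a z)^2) \<in> borel_measurable borel" by measurable
    qed
    also have "\<dots> \<le> (\<integral>\<^sup>+g. (F L u x * (edecay (1/L) (x - g) * nH u g) + ?Y g) + ?R g \<partial>count_space \<Gamma>)"
    proof (intro nn_integral_mono)
      fix g assume "g \<in> space (count_space \<Gamma>)"
      then have g: "g \<in> \<Gamma>" by simp
      show "(\<integral>\<^sup>+z. ennreal (\<eta> g z) * (?e z * ?a z)^2 \<partial>lborel) \<le> (F L u x * (edecay (1/L) (x - g) * nH u g) + ?Y g) + ?R g"
        by (rule order_trans[OF local_energy_le[OF g u L] add_right_mono[OF near_far_split[OF g u L]]])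
    qed
    also have "\<dots> = (F L u x * ?N + (\<integral>\<^sup>+g. ?Y g \<partial>count_space \<Gamma>)) + (\<integral>\<^sup>+g. ?R g \<partial>count_space \<Gamma>)"
      by (simp add: nn_integral_add nn_integral_cmult)
    also have "\<dots> \<le> (F L u x * ?N + F L u x * ?I) + ennreal (4 * B) * (F L u x * ?J)"
      by (intro add_mono order_refl far[OF L u] commutator_sum_le[OF u L])
    also have "\<dots> = F L u x * (?N + (?I + ennreal (4 * B) * ?J))"
      by (simp only: distrib_left mult_ac add_ac)
    also have "?I + ennreal (4 * B) * ?J = ?I + (\<integral>\<^sup>+y. ennreal (4 * B) * (rho L (x - y) * b1 (x - y) * F L u y) \<partial>lborel)"
      by (subst nn_integral_cmult) auto
    also have "\<dots> = (\<integral>\<^sup>+y. ?k (x - y) * F L u y + ennreal (4 * B) * (rho L (x - y) * b1 (x - y) * F L u y) \<partial>lborel)"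
      by (rule nn_integral_add[symmetric]) measurable
    also have "\<dots> = (\<integral>\<^sup>+y. Kcom C L (x - y) * F L u y \<partial>lborel)"
    proof (intro nn_integral_cong)
      fix y
      have "ennreal (5 * B) = ennreal B + ennreal (4 * B)"
        using AB by (subst ennreal_plus[symmetric]) auto
      then show "?k (x - y) * F L u y + ennreal (4 * B) * (rho L (x - y) * b1 (x - y) * F L u y) = Kcom C L (x - y) * F L u y"
        unfolding Kcom_def by (simp only: distrib_left distrib_right mult_ac add_ac)
    qed
    finally have *: "F L u x * (ennreal A * F L u x) \<le> F L u x * (?N + (\<integral>\<^sup>+y. Kcom C L (x - y) * F L u y \<partial>lborel))"
      by (simp only: power2_eq_square mult_ac)
    show "ennreal A * F L u x \<le> ?N + (\<integral>\<^sup>+y. Kcom C L (x - y) * F L u y \<partial>lborel)"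
    proof (cases "F L u x = 0")
      case False
      then show ?thesis using * F_finite[OF L u, of x] by (subst (asm) ennreal_mult_le_mult_iff) auto
    qed simp
  qed
qed

lemma Kcom_small:
  assumes C: "0 < C" and \<delta>: "0 < \<delta>"
  shows "\<exists>L\<ge>1. wint (Kcom C L) \<le> ennreal \<delta>"
proof -
  obtain x1 where x1: "0 \<le> x1" "wint b1 = ennreal x1" using wint_b1 by (cases "wint b1") auto
  define d where "d = \<delta> / (5 * B + C * (x1 + 1))"
  have "0 < x1 + 1" using x1 by simp
  then have p: "0 < 5 * B + C * (x1 + 1)" using AB mult_pos_pos[OF C] by fastforce
  then have d: "0 < d" using \<delta> unfolding d_def by simp
  obtain N1 where N1: "\<And>n. n \<ge> N1 \<Longrightarrow> wint (\<lambda>x. rho (real (Suc n)) x * b1 x) \<le> ennreal d"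
    using wint_rho_small[OF b1_measurable wint_b1 d] by blast
  obtain N2 where N2: "\<And>n. n \<ge> N2 \<Longrightarrow> wint (\<lambda>x. rho (real (Suc n)) x * b2 x) \<le> ennreal d"
    using wint_rho_small[OF b2_measurable wint_b2 d] by blast
  \<comment> \<open>Smallness was obtained along the integers by dominated convergence; the larger
    index serves both envelopes.\<close>
  define L where "L = real (Suc (max N1 N2))"
  have 1: "wint (\<lambda>x. rho L x * b1 x) \<le> ennreal d" unfolding L_def by (rule N1) simp
  have 2: "wint (\<lambda>x. rho L x * b2 x) \<le> ennreal d" unfolding L_def by (rule N2) simp
  have "wint (Kcom C L) = ennreal (5 * B) * wint (\<lambda>x. rho L x * b1 x) + ennreal C * (\<integral>\<^sup>+z. rho L z * b2 z \<partial>lborel) * wint b1"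
    unfolding Kcom_def[abs_def] by (subst wint_add, measurable, subst wint_cmult, measurable, subst wint_cmult) measurable
  also have "\<dots> \<le> ennreal (5 * B) * ennreal d + ennreal C * ennreal d * wint b1"
    by (intro add_mono mult_mono 1 order_trans[OF nn_integral_le_wint 2]) auto
  also have "\<dots> = ennreal (5 * B * d + C * d * x1)"
    unfolding x1(2) using AB C d x1(1) by (subst ennreal_plus) (simp_all add: ennreal_mult)
  also have "\<dots> \<le> ennreal \<delta>"
  proof (rule ennreal_leI)
    have "5 * B * d + C * d * x1 \<le> (5 * B + C * (x1 + 1)) * d" using C d by (simp add: algebra_simps)
    also have "\<dots> = \<delta>" unfolding d_def using p by simp
    finally show "5 * B * d + C * d * x1 \<le> \<delta>" .
  qed
  finally show ?thesis by (intro exI[of _ L]) (simp add: L_def)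
qed

end

section \<open>Norm equivalence\<close>

text \<open>In extended arithmetic the absorbed term may be moved to the left only when x is
  finite.\<close>

lemma ennreal_absorb:
  fixes x :: ennreal
  assumes "x < \<infinity>" "x \<le> a + y" "y \<le> ennreal (1/2) * x"
  shows "x \<le> 2 * a"
proof (cases a)
  case (real s)
  obtain r where r: "0 \<le> r" "x = ennreal r" using assms(1) by (cases x) auto
  have "x \<le> ennreal s + ennreal (1/2) * ennreal r"
    using assms(2,3) unfolding real r by (meson add_left_mono order_trans)
  also have "ennreal (1/2) * ennreal r = ennreal (1/2 * r)" using r by (intro ennreal_mult[symmetric]) auto
  also have "ennreal s + ennreal (1/2 * r) = ennreal (s + 1/2 * r)" using r real by (intro ennreal_plus[symmetric]) auto
  finally have "ennreal r \<le> ennreal (s + 1/2 * r)" unfolding r(2) .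
  then have "r \<le> s + 1/2 * r" using r real by (subst (asm) ennreal_le_iff) auto
  then have "r \<le> 2 * s" by simp
  then have "ennreal r \<le> ennreal (2 * s)" by (rule ennreal_leI)
  then show ?thesis using real r by (simp add: ennreal_mult)
qed (simp add: ennreal_mult_top)

lemma ennreal_le_positive: "x < \<infinity> \<Longrightarrow> \<exists>c>0. x \<le> ennreal c"
proof (cases x)
  case (real r)
  then show ?thesis by (intro exI[of _ "r + 1"]) (auto intro: ennreal_leI)
qed simp

context tf_cover
begin

lemma young_lborel:
  fixes f g :: "'d tf \<Rightarrow> ennreal"
  assumes v: "moderated w Cv v" "0 < Cv" and p: "1 \<le> p"
    and K [measurable]: "K \<in> borel_measurable borel" and c: "wint K \<le> ennreal c" "0 < c"
    and "f \<in> borel_measurable borel" "g \<in> borel_measurable borel"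
    and gK: "\<And>x. g x \<le> (\<integral>\<^sup>+y. K (x - y) * f y \<partial>lborel)"
  shows "lpn p lborel (\<lambda>x. g x * ennreal (v x)) \<le> ennreal (Cv * c) * lpn p lborel (\<lambda>x. f x * ennreal (v x))"
  using v assms(7-)
  by (intro young[where K = K] lborel.sigma_finite_measure_axioms K p c)
    (auto simp: moderated_def lborel_row c)

text \<open>One constant for all row and column masses between the plane and the index set. It is
  uniform over the kernels, so it can be fixed before L and \<epsilon> are chosen.\<close>

definition young_const :: "real \<Rightarrow> bool" where
  "young_const M \<longleftrightarrow> 0 < M \<and> (\<forall>K c x. slow 1 1 K \<longrightarrow> (\<forall>z. K (- z) = K z) \<longrightarrow> wint K \<le> ennreal c \<longrightarrow> 0 < c \<longrightarrow>
    (\<integral>\<^sup>+y. K (x - y) * ennreal (w (x - y)) \<partial>lborel) \<le> ennreal (M * c) \<and>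
    (\<integral>\<^sup>+y. K (y - x) * ennreal (w (y - x)) \<partial>lborel) \<le> ennreal (M * c) \<and>
    (\<integral>\<^sup>+g. K (g - x) * ennreal (w (g - x)) \<partial>count_space \<Gamma>) \<le> ennreal (M * c) \<and>
    (\<integral>\<^sup>+g. K (x - g) * ennreal (w (x - g)) \<partial>count_space \<Gamma>) \<le> ennreal (M * c))"

lemma ex_young_const: "\<exists>M. young_const M"
proof -
  obtain Dw where Dw: "slow Dw 1 (\<lambda>z. ennreal (w z))" using slow_w by blast
  obtain C where "0 < C" and C: "\<And>b::'d tf \<Rightarrow> ennreal. slow (1 * Dw) (1 + 1) b \<Longrightarrow>
      (\<integral>\<^sup>+g. b g \<partial>count_space \<Gamma>) \<le> ennreal C * (\<integral>\<^sup>+x. b x \<partial>lborel)"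
    using slow_sum_le_integral[OF \<Gamma>_fin \<Gamma>_card, of "1 * Dw" "1 + 1"] by blast
  \<comment> \<open>1 serves the integrals over the plane and C the sums over the index set.\<close>
  define M where "M = max 1 C"
  have M: "0 < M" "1 \<le> M" "C \<le> M" by (auto simp: M_def)
  show ?thesis
    unfolding young_const_def
  proof (intro exI[of _ M] conjI[OF M(1)] allI impI)
    fix K :: "'d tf \<Rightarrow> ennreal" and c x
    assume sl: "slow 1 1 K" and ev: "\<forall>z. K (- z) = K z" and c: "wint K \<le> ennreal c" "0 < c"
    have K [measurable]: "K \<in> borel_measurable borel" using sl by (rule slowD)
    have cM: "ennreal c \<le> ennreal (M * c)" using M c(2) by (intro ennreal_leI) (simp add: mult_le_cancel_right1)
    have l1: "(\<integral>\<^sup>+y. K (x - y) * ennreal (w (x - y)) \<partial>lborel) \<le> ennreal (M * c)"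
      and l2: "(\<integral>\<^sup>+y. K (y - x) * ennreal (w (y - x)) \<partial>lborel) \<le> ennreal (M * c)" for x
      using order_trans[OF c(1) cM] by (simp_all add: lborel_row)
    have g1: "(\<integral>\<^sup>+g. K (g - x) * ennreal (w (g - x)) \<partial>count_space \<Gamma>) \<le> ennreal (M * c)" for x
    proof -
      have "(\<integral>\<^sup>+g. K (g - x) * ennreal (w (g - x)) \<partial>count_space \<Gamma>) \<le> ennreal C * (\<integral>\<^sup>+y. K (y - x) * ennreal (w (y - x)) \<partial>lborel)"
        by (rule C[OF slow_shift[OF slow_mult[OF sl Dw]]])
      also have "(\<integral>\<^sup>+y. K (y - x) * ennreal (w (y - x)) \<partial>lborel) = wint K" by (rule lborel_row(2)) measurable
      also have "ennreal C * wint K \<le> ennreal M * ennreal c" by (intro mult_mono ennreal_leI M c) auto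
      finally show ?thesis using M c by (simp add: ennreal_mult)
    qed
    have g2: "(\<integral>\<^sup>+g. K (x - g) * ennreal (w (x - g)) \<partial>count_space \<Gamma>) \<le> ennreal (M * c)" for x
    proof -
      have "K (g - x) * ennreal (w (g - x)) = K (x - g) * ennreal (w (x - g))" for g
        using ev[rule_format, of "x - g"] even[of "x - g"] by simp
      then show ?thesis using g1[of x] by simp
    qed
    show "(\<integral>\<^sup>+y. K (x - y) * ennreal (w (x - y)) \<partial>lborel) \<le> ennreal (M * c) \<and>
      (\<integral>\<^sup>+y. K (y - x) * ennreal (w (y - x)) \<partial>lborel) \<le> ennreal (M * c) \<and>
      (\<integral>\<^sup>+g. K (g - x) * ennreal (w (g - x)) \<partial>count_space \<Gamma>) \<le> ennreal (M * c) \<and>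
      (\<integral>\<^sup>+g. K (x - g) * ennreal (w (x - g)) \<partial>count_space \<Gamma>) \<le> ennreal (M * c)"
      by (intro conjI l1 l2 g1 g2)
  qed
qed

lemma
  assumes M: "young_const M" and sl: "slow 1 1 K" and ev: "\<And>z. K (- z) = K z" and c: "wint K \<le> ennreal c" "0 < c"
    and v: "moderated w Cv v" "0 < Cv" and p: "1 \<le> p" and f: "f \<in> borel_measurable borel"
  shows young_to_\<Gamma>: "(\<And>\<gamma>. \<gamma> \<in> \<Gamma> \<Longrightarrow> g \<gamma> \<le> (\<integral>\<^sup>+y. K (\<gamma> - y) * f y \<partial>lborel)) \<Longrightarrow>
      lpn p (count_space \<Gamma>) (\<lambda>x. g x * ennreal (v x)) \<le> ennreal (Cv * (M * c)) * lpn p lborel (\<lambda>x. f x * ennreal (v x))"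
    and young_from_\<Gamma>: "(\<And>x. f x \<le> (\<integral>\<^sup>+\<gamma>. K (x - \<gamma>) * g \<gamma> \<partial>count_space \<Gamma>)) \<Longrightarrow>
      lpn p lborel (\<lambda>x. f x * ennreal (v x)) \<le> ennreal (Cv * (M * c)) * lpn p (count_space \<Gamma>) (\<lambda>x. g x * ennreal (v x))"
proof -
  have idG: "(\<lambda>x. x) \<in> borel_measurable (count_space \<Gamma>)" by simp
  have Mc: "0 < M * c" using M c by (simp add: young_const_def)
  note vv = v(1)[unfolded moderated_def]
  have rw: "(\<integral>\<^sup>+y. K (x - y) * ennreal (w (x - y)) \<partial>lborel) \<le> ennreal (M * c)"
      "(\<integral>\<^sup>+y. K (y - x) * ennreal (w (y - x)) \<partial>lborel) \<le> ennreal (M * c)"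
      "(\<integral>\<^sup>+g. K (g - x) * ennreal (w (g - x)) \<partial>count_space \<Gamma>) \<le> ennreal (M * c)"
      "(\<integral>\<^sup>+g. K (x - g) * ennreal (w (x - g)) \<partial>count_space \<Gamma>) \<le> ennreal (M * c)" for x
    using M sl ev c unfolding young_const_def by blast+
  show "lpn p (count_space \<Gamma>) (\<lambda>x. g x * ennreal (v x)) \<le> ennreal (Cv * (M * c)) * lpn p lborel (\<lambda>x. f x * ennreal (v x))"
    if "\<And>\<gamma>. \<gamma> \<in> \<Gamma> \<Longrightarrow> g \<gamma> \<le> (\<integral>\<^sup>+y. K (\<gamma> - y) * f y \<partial>lborel)"
    by (rule young[where K = K, OF sigma_finite_\<Gamma> lborel.sigma_finite_measure_axioms idG _ slowD(1)[OF sl] _ _ _ _ v(2) _ _ rw(1) rw(3) Mc p])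
      (use vv that f in \<open>auto simp: AE_count_space\<close>)
  show "lpn p lborel (\<lambda>x. f x * ennreal (v x)) \<le> ennreal (Cv * (M * c)) * lpn p (count_space \<Gamma>) (\<lambda>x. g x * ennreal (v x))"
    if "\<And>x. f x \<le> (\<integral>\<^sup>+\<gamma>. K (x - \<gamma>) * g \<gamma> \<partial>count_space \<Gamma>)"
    by (rule young[where K = K, OF lborel.sigma_finite_measure_axioms sigma_finite_\<Gamma> _ idG slowD(1)[OF sl] _ _ _ _ v(2) _ _ rw(4) rw(2) Mc p])
      (use vv that f in auto)
qed

lemma wint_cmult_conv_finite:
  assumes [measurable]: "k \<in> borel_measurable borel" and "wint k < \<infinity>"
  shows "wint (\<lambda>z. ennreal C * conv k b1 z) < \<infinity>"
proof -
  have "wint (\<lambda>z. ennreal C * conv k b1 z) = ennreal C * wint (conv k b1)" by (rule wint_cmult) measurable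
  also have "\<dots> \<le> ennreal C * (wint k * wint b1)" by (intro mult_left_mono wint_conv) auto
  also have "\<dots> < \<infinity>" using assms(2) wint_b1 by (simp add: ennreal_mult_less_top)
  finally show ?thesis .
qed

text \<open>Order of the choices: A and Cv determine \<delta> and with it L; L determines the
  constants S and R; R determines the admissible thresholding error and so \<epsilon>0. None of them
  depends on p, v or u.\<close>

lemma norm_equivalence:
  assumes Cv: "0 < Cv"
  shows "\<exists>R C \<epsilon>0. 0 < R \<and> 0 < C \<and> 0 < \<epsilon>0 \<and> (\<forall>v p \<epsilon> u. moderated w Cv v \<longrightarrow> 1 \<le> p \<longrightarrow> 0 < \<epsilon> \<longrightarrow> \<epsilon> \<le> \<epsilon>0 \<longrightarrow>
    u \<in> Minf w \<longrightarrow> lpn p lborel (\<lambda>z. aU u z * ennreal (v z)) < \<infinity> \<longrightarrow>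
    lpn p lborel (\<lambda>z. aU u z * ennreal (v z)) \<le> ennreal R * lpn p (count_space \<Gamma>) (\<lambda>g. aH \<epsilon> u g * ennreal (v g)) \<and>
    lpn p (count_space \<Gamma>) (\<lambda>g. aH \<epsilon> u g * ennreal (v g)) \<le> ennreal C * lpn p lborel (\<lambda>z. aU u z * ennreal (v z)))"
proof -
  obtain M where Mc: "young_const M" using ex_young_const by blast
  then have M: "0 < M" by (simp add: young_const_def)
  note young1 = young_to_\<Gamma>[OF Mc] and young2 = young_from_\<Gamma>[OF Mc]
  obtain C2 where C2: "\<And>\<epsilon> u g. 0 < \<epsilon> \<Longrightarrow> u \<in> Minf w \<Longrightarrow> g \<in> \<Gamma> \<Longrightarrow>
    aH \<epsilon> u g \<le> (\<integral>\<^sup>+y. ennreal C2 * conv b2 b1 (g - y) * aU u y \<partial>lborel)" using aH_le by blast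
  obtain C3 where "0 < C3" and C3: "\<And>\<epsilon> u g. 0 < \<epsilon> \<Longrightarrow> u \<in> Minf w \<Longrightarrow> g \<in> \<Gamma> \<Longrightarrow>
    nH u g \<le> aH \<epsilon> u g + (\<integral>\<^sup>+y. Kres C3 \<epsilon> (g - y) * aU u y \<partial>lborel)" using nH_le by blast
  obtain C5 where C5: "\<And>L u x. 1 \<le> L \<Longrightarrow> u \<in> Minf w \<Longrightarrow>
    F L u x \<le> (\<integral>\<^sup>+y. ennreal C5 * conv (edecay (1/L)) b1 (x - y) * aU u y \<partial>lborel)" using F_le by blast
  obtain C7 where "0 < C7" and C7: "\<And>L u x. 1 \<le> L \<Longrightarrow> u \<in> Minf w \<Longrightarrow>
    ennreal A * F L u x \<le> (\<integral>\<^sup>+g. edecay (1/L) (x - g) * nH u g \<partial>count_space \<Gamma>) + (\<integral>\<^sup>+y. Kcom C7 L (x - y) * F L u y \<partial>lborel)"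
    using localized_lower_bound by blast
  \<comment> \<open>Makes the coefficient 4 / A * Cv * \<delta> of the commutator term equal to 1 /
    2.\<close>
  define \<delta> where "\<delta> = A / (8 * Cv)"
  have \<delta>: "0 < \<delta>" using AB Cv by (simp add: \<delta>_def)
  obtain L where L: "1 \<le> L" and Ksmall: "wint (Kcom C7 L) \<le> ennreal \<delta>"
    using Kcom_small[OF \<open>0 < C7\<close> \<delta>] by blast
  obtain C6 where C6: "\<And>u y. u \<in> Minf w \<Longrightarrow> aU u y \<le> ennreal C6 * (\<integral>\<^sup>+s. b1 (y - s) * F L u s \<partial>lborel)"
    using dstft_le_F[OF L] unfolding aU_def by blast
  have finc: "wint (edecay (1/L)) < \<infinity>" using L by (intro wint_edecay_finite) simp
  obtain c2 where c2: "0 < c2" "wint (\<lambda>z. ennreal C2 * conv b2 b1 z) \<le> ennreal c2"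
    using ennreal_le_positive[OF wint_cmult_conv_finite[OF b2_measurable wint_b2]] by blast
  obtain c5 where c5: "0 < c5" "wint (\<lambda>z. ennreal C5 * conv (edecay (1/L)) b1 z) \<le> ennreal c5"
    using ennreal_le_positive[OF wint_cmult_conv_finite[OF measurable_edecay finc]] by blast
  obtain ce where ce: "0 < ce" "wint (edecay (1/L)) \<le> ennreal ce" using ennreal_le_positive[OF finc] by blast
  have "wint (\<lambda>z. ennreal C6 * b1 z) < \<infinity>" using wint_b1 by (subst wint_cmult) (auto simp: ennreal_mult_less_top)
  then obtain c6 where c6: "0 < c6" "wint (\<lambda>z. ennreal C6 * b1 z) \<le> ennreal c6" using ennreal_le_positive by blast
  \<comment> \<open>The 2 is from the absorption, the 4 from the quasi-triangle inequality, 1 / A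
    from the lower bound on the symbols, and the rest from Young's inequality.\<close>
  define S where "S = 2 * (4/A * (Cv * (M * ce)))"
  define R where "R = Cv * c6 * S"
  have S: "0 < S" using AB Cv M ce by (simp add: S_def)
  have R: "0 < R" using S Cv c6 by (simp add: R_def)
  \<comment> \<open>Makes the coefficient 4 * R * Cv * M * d3 of the thresholding error equal to 1 /
    2; the factor 8 * R of the lower bound is then 2 * 4 * R.\<close>
  define d3 where "d3 = 1 / (8 * R * Cv * M)"
  have d3: "0 < d3" using R Cv M by (simp add: d3_def)
  obtain \<epsilon>0 where \<epsilon>0: "0 < \<epsilon>0" and Kr: "\<And>\<epsilon>. 0 < \<epsilon> \<Longrightarrow> \<epsilon> \<le> \<epsilon>0 \<Longrightarrow> wint (Kres C3 \<epsilon>) \<le> ennreal d3"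
    using Kres_small[OF \<open>0 < C3\<close> d3] by blast
  have sle: "slow 1 1 (edecay (1/L) :: 'd tf \<Rightarrow> ennreal)"
    by (rule slow_mono[OF slow_edecay]) (use L in auto)
  show ?thesis
  proof (rule exI[of _ "8 * R"], rule exI[of _ "Cv * (M * c2)"], rule exI[of _ \<epsilon>0], intro conjI[OF _ conjI[OF _ conjI[OF \<epsilon>0]]] allI impI)
    show "0 < 8 * R" "0 < Cv * (M * c2)" using R Cv M c2 by auto
    fix v p \<epsilon> u assume v: "moderated w Cv v" and p: "(1::ennreal) \<le> p" and \<epsilon>: "0 < \<epsilon>" "\<epsilon> \<le> \<epsilon>0" and u: "u \<in> Minf w"
      and fin: "lpn p lborel (\<lambda>z. aU u z * ennreal (v z)) < \<infinity>"
    have vm [measurable]: "v \<in> borel_measurable borel" using v by (simp add: moderated_def)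
    have [measurable]: "aU u \<in> borel_measurable borel" using u by (rule aU_measurable)
    have Fm [measurable]: "F L u \<in> borel_measurable borel" using u by (rule F_measurable)
    define Mn where "Mn = lpn p lborel (\<lambda>z. aU u z * ennreal (v z))"
    define Fn where "Fn = lpn p lborel (\<lambda>z. F L u z * ennreal (v z))"
    define An where "An = lpn p (count_space \<Gamma>) (\<lambda>g. aH \<epsilon> u g * ennreal (v g))"
    define Hn where "Hn = lpn p (count_space \<Gamma>) (\<lambda>g. nH u g * ennreal (v g))"
    have upper: "An \<le> ennreal (Cv * (M * c2)) * Mn"
      unfolding An_def Mn_def
      by (rule young1[OF _ _ c2(2,1) v Cv p _ C2[OF \<epsilon>(1) u]])
        (auto intro!: slow_cmult slow_conv slow_b1 simp: conv_even b2_even b1_even)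
    \<comment> \<open>A priori finiteness of \<open>Fn\<close>, which permits the first
      absorption.\<close>
    have "Fn \<le> ennreal (Cv * c5) * Mn"
      unfolding Fn_def Mn_def by (rule young_lborel[OF v Cv p _ c5(2,1) _ _ C5[OF L u]]) auto
    also have "\<dots> < \<infinity>" using fin by (simp add: Mn_def ennreal_mult_less_top)
    finally have Ffin: "Fn < \<infinity>" .
    define G1 where "G1 x = (\<integral>\<^sup>+g. edecay (1/L) (x - g) * nH u g \<partial>count_space \<Gamma>)" for x
    define G2 where "G2 x = (\<integral>\<^sup>+y. Kcom C7 L (x - y) * F L u y \<partial>lborel)" for x
    have G1m [measurable]: "G1 \<in> borel_measurable borel"
    proof -
      interpret G: sigma_finite_measure "count_space \<Gamma>" by (rule sigma_finite_\<Gamma>)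
      have "(\<lambda>(g, x). edecay (1/L) (x - g) * nH u g) \<in> borel_measurable (count_space \<Gamma> \<Otimes>\<^sub>M (borel :: 'd tf measure))"
        by (rule measurable_pair_measure_countable1[OF \<Gamma>_countable]) (simp only: prod.case, measurable)
      then have "(\<lambda>(x, g). edecay (1/L) (x - g) * nH u g) \<in> borel_measurable ((borel :: 'd tf measure) \<Otimes>\<^sub>M count_space \<Gamma>)"
        by (subst measurable_pair_swap_iff) (simp add: split_beta')
      then show ?thesis unfolding G1_def[abs_def] by (rule G.borel_measurable_nn_integral)
    qed
    have G2m [measurable]: "G2 \<in> borel_measurable borel" unfolding G2_def[abs_def] by measurable
    have "Fn \<le> ennreal (1/A) * lpn p lborel (\<lambda>x. G1 x * ennreal (v x) + G2 x * ennreal (v x))"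
    proof -
      have "F L u x * ennreal (v x) \<le> ennreal (1/A) * (G1 x * ennreal (v x) + G2 x * ennreal (v x))" for x
      proof -
        have "F L u x = ennreal (1/A) * (ennreal A * F L u x)"
          using AB by (simp add: mult.assoc[symmetric] ennreal_mult[symmetric])
        also have "\<dots> \<le> ennreal (1/A) * (G1 x + G2 x)"
          unfolding G1_def G2_def by (intro mult_left_mono C7 L u) auto
        finally have "F L u x * ennreal (v x) \<le> ennreal (1/A) * (G1 x + G2 x) * ennreal (v x)" by (rule mult_right_mono) simp
        then show ?thesis by (simp only: distrib_right mult.assoc)
      qed
      then have "Fn \<le> lpn p lborel (\<lambda>x. ennreal (1/A) * (G1 x * ennreal (v x) + G2 x * ennreal (v x)))"
        unfolding Fn_def by (intro lpn_mono) auto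
      also have "\<dots> \<le> ennreal (1/A) * lpn p lborel (\<lambda>x. G1 x * ennreal (v x) + G2 x * ennreal (v x))"
        by (intro lpn_cmult_le p) measurable
      finally show ?thesis .
    qed
    also have "\<dots> \<le> ennreal (1/A) * (4 * (lpn p lborel (\<lambda>x. G1 x * ennreal (v x)) + lpn p lborel (\<lambda>x. G2 x * ennreal (v x))))"
      by (intro mult_left_mono lpn_add_le p) auto
    also have "\<dots> \<le> ennreal (1/A) * (4 * (ennreal (Cv * (M * ce)) * Hn + ennreal (Cv * \<delta>) * Fn))"
    proof (intro mult_left_mono add_mono)
      show "lpn p lborel (\<lambda>x. G1 x * ennreal (v x)) \<le> ennreal (Cv * (M * ce)) * Hn"
        unfolding Hn_def by (rule young2[OF sle _ ce(2,1) v Cv p G1m]) (auto simp: G1_def)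
      show "lpn p lborel (\<lambda>x. G2 x * ennreal (v x)) \<le> ennreal (Cv * \<delta>) * Fn"
        unfolding Fn_def by (rule young_lborel[OF v Cv p _ Ksmall \<delta> Fm G2m]) (auto simp: G2_def)
    qed auto
    also have "\<dots> = ennreal (4/A * (Cv * (M * ce))) * Hn + ennreal (4/A * (Cv * \<delta>)) * Fn"
    proof -
      have "ennreal (1/A) * (4 * (ennreal a * h)) = ennreal (4/A * a) * h" if "0 \<le> a" for a h
      proof -
        have "ennreal (4/A * a) = ennreal (1/A) * (ennreal 4 * ennreal a)"
          using AB that by (subst ennreal_mult[symmetric], simp, simp, subst ennreal_mult[symmetric]) auto
        then show ?thesis by (simp add: mult.assoc)
      qed
      then show ?thesis using Cv M ce \<delta> by (simp add: distrib_left)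
    qed
    also have "4/A * (Cv * \<delta>) = 1/2" using Cv AB by (simp add: \<delta>_def)
    finally have "Fn \<le> 2 * (ennreal (4/A * (Cv * (M * ce))) * Hn)"
      by (rule ennreal_absorb[OF Ffin _ order_refl])
    also have "\<dots> = ennreal S * Hn"
      unfolding S_def using AB Cv M ce by (subst ennreal_mult[of 2 "4/A * (Cv * (M * ce))"]) (auto simp: mult.assoc)
    finally have FH: "Fn \<le> ennreal S * Hn" .
    have "Mn \<le> ennreal (Cv * c6) * Fn"
      unfolding Fn_def Mn_def
    proof (rule young_lborel[OF v Cv p _ c6(2,1)])
      fix x show "aU u x \<le> (\<integral>\<^sup>+y. ennreal C6 * b1 (x - y) * F L u y \<partial>lborel)"
        using C6[OF u, of x] by (simp add: nn_integral_cmult mult.assoc)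
    qed auto
    also have "\<dots> \<le> ennreal (Cv * c6) * (ennreal S * Hn)" by (intro mult_left_mono FH) auto
    also have "\<dots> = ennreal R * Hn"
      using S Cv c6 by (simp add: R_def ennreal_mult mult.assoc)
    finally have MH: "Mn \<le> ennreal R * Hn" .
    define G3 where "G3 g = (\<integral>\<^sup>+y. Kres C3 \<epsilon> (g - y) * aU u y \<partial>lborel)" for g
    have "Hn \<le> lpn p (count_space \<Gamma>) (\<lambda>g. aH \<epsilon> u g * ennreal (v g) + G3 g * ennreal (v g))"
      unfolding Hn_def
    proof (rule lpn_mono)
      fix g assume "g \<in> space (count_space \<Gamma>)"
      then have "nH u g \<le> aH \<epsilon> u g + G3 g" unfolding G3_def by (intro C3 \<epsilon> u) auto
      then show "nH u g * ennreal (v g) \<le> aH \<epsilon> u g * ennreal (v g) + G3 g * ennreal (v g)"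
        unfolding distrib_right[symmetric] by (rule mult_right_mono) simp
    qed simp
    also have "\<dots> \<le> 4 * (An + lpn p (count_space \<Gamma>) (\<lambda>g. G3 g * ennreal (v g)))"
      unfolding An_def by (intro lpn_add_le p) auto
    also have "lpn p (count_space \<Gamma>) (\<lambda>g. G3 g * ennreal (v g)) \<le> ennreal (Cv * (M * d3)) * Mn"
      unfolding Mn_def by (rule young1[OF slow_Kres Kres_even Kr[OF \<epsilon>] d3 v Cv p]) (auto simp: G3_def)
    finally have "ennreal R * Hn \<le> ennreal R * (4 * (An + ennreal (Cv * (M * d3)) * Mn))"
      by (simp add: mult_left_mono add_left_mono)
    also have "\<dots> = ennreal (4 * R) * An + ennreal (4 * R * (Cv * (M * d3))) * Mn"
      using R Cv M d3 by (simp add: distrib_left ennreal_mult mult_ac)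
    also have "4 * R * (Cv * (M * d3)) = 1/2" using R Cv M by (simp add: d3_def)
    \<comment> \<open>The second absorption removes the thresholding error; \<open>Mn\<close> is
      finite because u has finite norm.\<close>
    finally have "Mn \<le> ennreal (4 * R) * An + ennreal (1/2) * Mn" using MH by (rule order_trans[rotated])
    then have "Mn \<le> 2 * (ennreal (4 * R) * An)"
      by (rule ennreal_absorb[OF fin[folded Mn_def] _ order_refl])
    also have "\<dots> = ennreal (8 * R) * An"
      using R unfolding mult.assoc[symmetric] by (simp add: ennreal_mult mult.assoc[symmetric])
    finally have lower: "Mn \<le> ennreal (8 * R) * An" .
    show "lpn p lborel (\<lambda>z. aU u z * ennreal (v z)) \<le> ennreal (8 * R) * lpn p (count_space \<Gamma>) (\<lambda>g. aH \<epsilon> u g * ennreal (v g)) \<and>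
      lpn p (count_space \<Gamma>) (\<lambda>g. aH \<epsilon> u g * ennreal (v g)) \<le> ennreal (Cv * (M * c2)) * lpn p lborel (\<lambda>z. aU u z * ennreal (v z))"
      using lower upper unfolding Mn_def An_def ..
  qed
qed

end

section \<open>Identification with the norms of the statement\<close>

lemma Mpv_norm_eq_lpn:
  assumes p: "1 \<le> p" and v: "\<And>z. 0 < v z"
  shows "Mpv_norm phi p v u = lpn p lborel (\<lambda>z. ennreal (cmod (dstft phi u z)) * ennreal (v z))"
  using less_imp_le[OF v]
  by (simp add: Mpv_norm_def Lpv_norm_def lpn_def epow_def Let_def ennreal_mult[symmetric] del: ennreal_mult_eq_top_iff)

text \<open>For infinite p the supremum agrees with the essential supremum because counting measure
  has no non-empty null set.\<close>

lemma lpv_norm_eq_lpn: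
  assumes p: "1 \<le> p" and v: "\<And>z. 0 < v z" and a: "\<And>g. 0 \<le> a g" and \<Gamma>: "countable \<Gamma>"
  shows "lpv_norm p \<Gamma> v a = lpn p (count_space \<Gamma>) (\<lambda>g. ennreal (a g) * ennreal (v g))"
proof (cases "p = \<infinity>")
  case True
  have "(SUP g\<in>\<Gamma>. ennreal (a g * v g)) = esssup (count_space \<Gamma>) (\<lambda>g. ennreal (a g * v g))"
  proof (rule antisym)
    have "AE g in count_space \<Gamma>. ennreal (a g * v g) \<le> esssup (count_space \<Gamma>) (\<lambda>g. ennreal (a g * v g))"
      by (rule esssup_AE)
    then show "(SUP g\<in>\<Gamma>. ennreal (a g * v g)) \<le> esssup (count_space \<Gamma>) (\<lambda>g. ennreal (a g * v g))"
      by (intro SUP_least) (simp add: AE_count_space)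
    show "esssup (count_space \<Gamma>) (\<lambda>g. ennreal (a g * v g)) \<le> (SUP g\<in>\<Gamma>. ennreal (a g * v g))"
      by (intro esssup_I) (auto simp: AE_count_space intro: SUP_upper)
  qed
  then show ?thesis using True less_imp_le[OF v] a by (simp add: lpv_norm_def lpn_def ennreal_mult)
next
  case False
  have "epow (ennreal (a g) * ennreal (v g)) r = ennreal ((a g * v g) powr r)" for g r
    using less_imp_le[OF v] a by (simp add: ennreal_mult[symmetric] epow_ennreal)
  then show ?thesis using False
    by (simp add: lpv_norm_def lpn_def Let_def infsum_eq_nn_integral_count_space[OF \<Gamma>]) (simp add: epow_def)
qed

theorem theorem5p3:
  fixes w :: "('d::finite) tf \<Rightarrow> real" and phi :: "('d::finite) fn"
    and \<Gamma> :: "('d::finite) tf set" and \<eta> :: "('d::finite) tf \<Rightarrow> ('d::finite) tf \<Rightarrow> real"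
    and lam :: "('d::finite) tf \<Rightarrow> nat \<Rightarrow> real" and e :: "('d::finite) tf \<Rightarrow> nat \<Rightarrow> ('d::finite) fn"
  assumes "admissible_weight w"
    and "phi \<in> M1 w" and "L2norm phi = 1"
    and "well_spread w \<Gamma> \<eta>"
    and "\<forall>\<gamma>\<in>\<Gamma>. \<eta> \<gamma> \<in> borel_measurable lborel \<and> integrable lborel (\<eta> \<gamma>)
           \<and> (\<exists>B. \<forall>z. \<bar>\<eta> \<gamma> z\<bar> \<le> B) \<and> (\<forall>z. 0 \<le> \<eta> \<gamma> z)"
    and "\<exists>A B. 0 < A \<and> A \<le> B \<and>
           (\<forall>z. ennreal A \<le> (\<Sum>\<^sub>\<infinity> \<gamma>\<in>\<Gamma>. ennreal (\<eta> \<gamma> z)) \<and> (\<Sum>\<^sub>\<infinity> \<gamma>\<in>\<Gamma>. ennreal (\<eta> \<gamma> z)) \<le> ennreal B)"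
    and "\<forall>\<gamma>\<in>\<Gamma>. diagonalization phi (\<eta> \<gamma>) (lam \<gamma>) (e \<gamma>)"
  shows "\<forall>Cv. \<exists>c C \<epsilon>0. 0 < c \<and> c \<le> C \<and> 0 < \<epsilon>0 \<and>
           (\<forall>v. moderated w Cv v \<longrightarrow>
             (\<forall>\<epsilon>. 0 < \<epsilon> \<and> \<epsilon> \<le> \<epsilon>0 \<longrightarrow>
               (\<forall>p. 1 \<le> p \<longrightarrow>
                 (\<forall>u \<in> Mpv w phi p v.
                    ennreal c * Mpv_norm phi p v u
                      \<le> lpv_norm p \<Gamma> v (\<lambda>\<gamma>. L2norm (Heps \<epsilon> (lam \<gamma>) (e \<gamma>) u))
                  \<and> lpv_norm p \<Gamma> v (\<lambda>\<gamma>. L2norm (Heps \<epsilon> (lam \<gamma>) (e \<gamma>) u))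
                      \<le> ennreal C * Mpv_norm phi p v u))))"
proof -
  interpret submult_weight w
    using assms(1) unfolding admissible_weight_def submult_weight_def by blast
  interpret tf_frame w phi by unfold_locales (fact assms)+
  obtain N where N: "\<And>z. finite (\<Gamma> \<inter> ball z 1)" "\<And>z. card (\<Gamma> \<inter> ball z 1) \<le> N"
    using assms(4) unfolding well_spread_def by blast
  obtain G where G: "G \<in> wiener w" "\<And>\<gamma> z. \<gamma> \<in> \<Gamma> \<Longrightarrow> \<bar>\<eta> \<gamma> z\<bar> \<le> G (z - \<gamma>)"
    using assms(4) unfolding well_spread_def by blast
  obtain b2 where b2: "slow 1 1 b2" "\<And>z. b2 (- z) = b2 z" "wint b2 < \<infinity>" "AE z in lborel. ennreal \<bar>G z\<bar> \<le> b2 z"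
    using wiener_dominated[OF submult_weight_axioms G(1)] by blast
  have \<Gamma>: "countable \<Gamma>" using N(1) by (rule relatively_separated_countable)
  obtain A B where AB: "0 < A" "A \<le> B"
      "\<And>z. ennreal A \<le> (\<integral>\<^sup>+\<gamma>. ennreal (\<eta> \<gamma> z) \<partial>count_space \<Gamma>)" "\<And>z. (\<integral>\<^sup>+\<gamma>. ennreal (\<eta> \<gamma> z) \<partial>count_space \<Gamma>) \<le> ennreal B"
    using assms(6) unfolding infsum_eq_nn_integral_count_space[OF \<Gamma>] by blast
  have le: "AE z in lborel. ennreal (\<eta> g z) \<le> b2 (z - g)" if g: "g \<in> \<Gamma>" for g
    using AE_lborel_shift[OF b2(4), of g]
  proof eventually_elim
    case (elim z)
    have "\<eta> g z \<le> \<bar>G (z - g)\<bar>" using G(2)[OF g, of z] by linarith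
    then show ?case using elim by (meson ennreal_leI order_trans)
  qed
  have \<eta>: "\<And>g. g \<in> \<Gamma> \<Longrightarrow> \<eta> g \<in> borel_measurable borel" "\<And>g. g \<in> \<Gamma> \<Longrightarrow> \<exists>Bd. \<forall>z. \<bar>\<eta> g z\<bar> \<le> Bd"
      "\<And>g z. g \<in> \<Gamma> \<Longrightarrow> 0 \<le> \<eta> g z" "\<And>g. g \<in> \<Gamma> \<Longrightarrow> diagonalization phi (\<eta> g) (lam g) (e g)"
    using assms(5,7) unfolding measurable_lborel2 by blast+
  interpret tf_cover w phi \<Gamma> \<eta> lam e N b2 A B
    by unfold_locales (fact N \<eta> AB b2 le)+
  show ?thesis
  proof
    fix Cv :: real
    show "\<exists>c C \<epsilon>0. 0 < c \<and> c \<le> C \<and> 0 < \<epsilon>0 \<and>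
           (\<forall>v. moderated w Cv v \<longrightarrow>
             (\<forall>\<epsilon>. 0 < \<epsilon> \<and> \<epsilon> \<le> \<epsilon>0 \<longrightarrow>
               (\<forall>p. 1 \<le> p \<longrightarrow>
                 (\<forall>u \<in> Mpv w phi p v.
                    ennreal c * Mpv_norm phi p v u
                      \<le> lpv_norm p \<Gamma> v (\<lambda>\<gamma>. L2norm (Heps \<epsilon> (lam \<gamma>) (e \<gamma>) u))
                  \<and> lpv_norm p \<Gamma> v (\<lambda>\<gamma>. L2norm (Heps \<epsilon> (lam \<gamma>) (e \<gamma>) u))
                      \<le> ennreal C * Mpv_norm phi p v u))))"
    proof (cases "0 < Cv")
      \<comment> \<open>No weight is moderated with a non-positive constant, since v 0 > 0, so any
        constants will do.\<close>
      case False
      have "\<not> moderated w Cv v" for v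
      proof
        assume v: "moderated w Cv v"
        then have "v 0 \<le> Cv * w 0 * v 0" "0 < v 0" unfolding moderated_def by (metis add_0, blast)
        moreover have "Cv * (w 0 * v 0) \<le> 0" using False pos[of 0] \<open>0 < v 0\<close> by (simp add: mult_nonpos_nonneg)
        ultimately show False unfolding mult.assoc by linarith
      qed
      then show ?thesis by (intro exI[of _ 1]) auto
    next
      case True
      obtain R C \<epsilon>0 where pos: "0 < R" "0 < C" "0 < \<epsilon>0"
        and ne: "\<And>v p \<epsilon> u. moderated w Cv v \<Longrightarrow> 1 \<le> p \<Longrightarrow> 0 < \<epsilon> \<Longrightarrow> \<epsilon> \<le> \<epsilon>0 \<Longrightarrow> u \<in> Minf w \<Longrightarrow>
            lpn p lborel (\<lambda>z. aU u z * ennreal (v z)) < \<infinity> \<Longrightarrow>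
            lpn p lborel (\<lambda>z. aU u z * ennreal (v z)) \<le> ennreal R * lpn p (count_space \<Gamma>) (\<lambda>g. aH \<epsilon> u g * ennreal (v g)) \<and>
            lpn p (count_space \<Gamma>) (\<lambda>g. aH \<epsilon> u g * ennreal (v g)) \<le> ennreal C * lpn p lborel (\<lambda>z. aU u z * ennreal (v z))"
        using norm_equivalence[OF True] by blast
      show ?thesis
      \<comment> \<open>1 / R is the constant that inverts the lower bound; the minimum ensures c
        \<le> C.\<close>
      proof (rule exI[of _ "min (1/R) C"], rule exI[of _ C], rule exI[of _ \<epsilon>0], intro conjI[OF _ conjI[OF _ conjI]] allI impI ballI)
        fix v \<epsilon> p u assume v: "moderated w Cv v" and \<epsilon>: "0 < \<epsilon> \<and> \<epsilon> \<le> \<epsilon>0" and p: "1 \<le> p" and u: "u \<in> Mpv w phi p v"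
        have vp: "0 < v z" for z using v unfolding moderated_def by blast
        have M: "Mpv_norm phi p v u = lpn p lborel (\<lambda>z. aU u z * ennreal (v z))"
          unfolding aU_def by (rule Mpv_norm_eq_lpn[OF p vp])
        have A: "lpv_norm p \<Gamma> v (\<lambda>\<gamma>. L2norm (Heps \<epsilon> (lam \<gamma>) (e \<gamma>) u)) = lpn p (count_space \<Gamma>) (\<lambda>g. aH \<epsilon> u g * ennreal (v g))"
          unfolding aH_def by (rule lpv_norm_eq_lpn[OF p vp _ \<Gamma>]) (simp add: L2norm_def)
        have "u \<in> Minf w" "lpn p lborel (\<lambda>z. aU u z * ennreal (v z)) < \<infinity>"
          using u unfolding Mpv_def M[symmetric] by auto
        from ne[OF v p _ _ this, of \<epsilon>] \<epsilon>
        have lo: "Mpv_norm phi p v u \<le> ennreal R * lpv_norm p \<Gamma> v (\<lambda>\<gamma>. L2norm (Heps \<epsilon> (lam \<gamma>) (e \<gamma>) u))"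
          and up: "lpv_norm p \<Gamma> v (\<lambda>\<gamma>. L2norm (Heps \<epsilon> (lam \<gamma>) (e \<gamma>) u)) \<le> ennreal C * Mpv_norm phi p v u"
          unfolding M A by auto
        have "ennreal (min (1/R) C) * Mpv_norm phi p v u \<le> ennreal (1/R) * Mpv_norm phi p v u"
          by (intro mult_right_mono ennreal_leI) auto
        also have "\<dots> \<le> ennreal (1/R) * (ennreal R * lpv_norm p \<Gamma> v (\<lambda>\<gamma>. L2norm (Heps \<epsilon> (lam \<gamma>) (e \<gamma>) u)))"
          by (intro mult_left_mono lo) auto
        also have "\<dots> = lpv_norm p \<Gamma> v (\<lambda>\<gamma>. L2norm (Heps \<epsilon> (lam \<gamma>) (e \<gamma>) u))"
          using pos by (simp add: mult.assoc[symmetric] ennreal_mult[symmetric])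
        finally show "ennreal (min (1/R) C) * Mpv_norm phi p v u \<le> lpv_norm p \<Gamma> v (\<lambda>\<gamma>. L2norm (Heps \<epsilon> (lam \<gamma>) (e \<gamma>) u))
          \<and> lpv_norm p \<Gamma> v (\<lambda>\<gamma>. L2norm (Heps \<epsilon> (lam \<gamma>) (e \<gamma>) u)) \<le> ennreal C * Mpv_norm phi p v u"
          using up by blast
      qed (use pos in auto)
    qed
  qed
qed

end
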